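(* Let $p,p'\ge2$ be coprime integers and $k+2=\frac{p'}p$. Assume that $\ell\in\mathbb Z$, $1\le s\le p'-1$, $2\le r\le p-1$ and $\lambda=\lambda_{r,s}^-=-\frac12\left(s+1-(k+2)(r+1)\right)$. Then: (1) $\widetilde{\mathcal M_{r,s}^{\ell,-}(\lambda)}$ is a logarithmic $V_k(sl(2))$-module of $\widetilde L_{sug}(0)$-nilpotent rank two. (2) The logarithmic module $\widetilde{\mathcal M_{r,s}^{\ell,-}(\lambda)}$ appears in the following non-split extension of weight $V_k(sl(2))$-modules: $$0\rightarrow L^{Vir}(d_{p,p'},h_{p,p'}^{r-1,s})\otimes\Pi_{(\ell+1)}(-\tfrac k2+\lambda)\rightarrow\widetilde{\mathcal M_{r,s}^{\ell,-}(\lambda)}\rightarrow L^{Vir}(d_{p,p'},h_{p,p'}^{r,s})\otimes\Pi_{(\ell)}(\lambda)\rightarrow0 .$$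
   Context: $d_{p,p'}=1-\frac{6(p-p')^2}{pp'}$, $h_{p,p'}^{r,s}=\frac{(sp-rp')^2-(p-p')^2}{4pp'}$ for $1\le r\le p-1$, $1\le s\le p'-1$; $L^{Vir}(d_{p,p'},h)$ is the irreducible highest weight Virasoro module; $v_{r,s}$ is the highest weight vector of $L^{Vir}(d_{p,p'},h_{p,p'}^{r,s})$; $\omega_{p,p'}$ is the conformal vector of $L^{Vir}(d_{p,p'},0)$. Let $\langle c,c\rangle=\langle d,d\rangle=0$, $\langle c,d\rangle=2$; $M(1)$ is the Heisenberg vertex algebra generated by $c(z),d(z)$ with $[a(m),b(n)]=m\langle a,b\rangle\delta_{m+n,0}$; $\Pi(0)=M(1)\otimes\mathbb C[\mathbb Zc]$; $\mu=\frac d2+\frac k4c$, $\nu=\frac d2-\frac k4c$; $\Pi_{(r)}(\lambda)=\Pi(0)e^{r\mu+\lambda c}$ with the usual lattice vertex operators. The simple affine vertex algebra $V_k(sl(2))$ is mapped into $L^{Vir}(d_{p,p'},0)\otimes\Pi(0)$ by $e\mapsto e^c$, $h\mapsto2\mu(-1)\mathbf 1$, $f\mapsto[(k+2)\omega_{p,p'}-\nu(-1)^2-(k+1)\nu(-2)]e^{-c}$, and identified with its image. A module is weight if $L_{sug}(0)$ and $h(0)$ act semisimply ($L_{sug}$ the Sugawara Virasoro field). Extended vertex algebra: $\mathcal M_{2,1}=L^{Vir}(d_{p,p'},h_{p,p'}^{2,1})\otimes\Pi_{(1)}(-\frac k2)$ (note $\Pi_{(1)}(-\frac k2)=\Pi(0)e^\nu$),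 and $\mathcal V=(L^{Vir}(d_{p,p'},0)\otimes\Pi(0))\oplus\mathcal M_{2,1}$ with $Y_{\mathcal V}(v_1+w_1,z)(v_2+w_2)=Y(v_1,z)v_2+Y(v_1,z)w_2+e^{zL(-1)}Y(v_2,-z)w_1$ for $v_i$ in the first summand, $w_i\in\mathcal M_{2,1}$. Let $s=v_{2,1}\otimes e^\nu\in\mathcal M_{2,1}$, and $S=s_0=\mathrm{Res}_zY(s,z)$; $S$ commutes with $\widehat{sl(2)}$ and $V_k(sl(2))\subset\ker_{\mathcal V}S$. $\mathcal M_{r,s}^{\ell,-}(\lambda)=\big(L^{Vir}(d_{p,p'},h_{p,p'}^{r,s})\otimes\Pi_{(\ell)}(\lambda)\big)\oplus\big(L^{Vir}(d_{p,p'},h_{p,p'}^{r-1,s})\otimes\Pi_{(\ell+1)}(-\frac k2+\lambda)\big)$ is a $\mathcal V$-module: the vertex algebra $L^{Vir}(d_{p,p'},0)\otimes\Pi(0)$ acts diagonally; $w\in\mathcal M_{2,1}$ acts by zero on the second summand and maps the first summand to the second by $\mathcal Y(w,z)$, where $\mathcal Y=\mathcal Y_1\otimes\mathcal Y_2$, $\mathcal Y_1$ is a non-trivial Virasoro intertwining operator of type $\binom{L^{Vir}(d_{p,p'},h^{r-1,s}_{p,p'})}{L^{Vir}(d_{p,p'},h^{2,1}_{p,p'})\ \ L^{Vir}(d_{p,p'},h^{r,s}_{p,p'})}$ and $\mathcal Y_2$ is the non-trivial lattice intertwining operator of type $\binom{\Pi_{(\ell+1)}(-\frac k2+\lambda)}{\Pi_{(1)}(-\frac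 k2)\ \ \Pi_{(\ell)}(\lambda)}$ (the product has integral powers of $z$). For a $\mathcal V$-module $(\mathcal M,Y_{\mathcal M})$, $\widetilde{\mathcal M}$ is the $V_k(sl(2))$-module with the same underlying space and vertex operator $\widetilde Y(a,z)=Y_{\mathcal M}(\Delta(s,z)a,z)$, $a\in V_k(sl(2))$, where $\Delta(s,z)=z^{s_0}\exp\big(\sum_{n\ge1}\frac{s_n}{-n}(-z)^{-n}\big)$; $\widetilde L_{sug}(0)$ is the resulting action of the zero mode of the Sugawara field. A module is logarithmic if it is the direct sum of generalized eigenspaces of (Sugawara) $L(0)$; it has nilpotent rank $m$ if $(L(0)-L_{ss}(0))^m=0$ and $(L(0)-L_{ss}(0))^{m-1}\ne0$, where $L_{ss}(0)$ is the semisimple part of $L(0)$. *)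

theory Defs
  imports Complex_Main "HOL-Library.Multiset" "HOL-Library.Poly_Mapping" "HOL-Library.Product_Plus"
begin

section \<open>Complex vector spaces\<close>

class complex_vector = ab_group_add +
  fixes scaleC :: "complex \<Rightarrow> 'a \<Rightarrow> 'a" (infixr "*\<^sub>C" 75)
  assumes scaleC_add_right: "c *\<^sub>C (x + y) = c *\<^sub>C x + c *\<^sub>C y"
    and scaleC_add_left: "(c + d) *\<^sub>C x = c *\<^sub>C x + d *\<^sub>C x"
    and scaleC_scaleC: "c *\<^sub>C d *\<^sub>C x = (c * d) *\<^sub>C x"
    and scaleC_one: "1 *\<^sub>C x = x"

global_interpretation cvec: vector_space "scaleC :: complex \<Rightarrow> 'a \<Rightarrow> 'a::complex_vector"
  by unfold_locales (simp_all add: scaleC_add_right scaleC_add_left scaleC_scaleC scaleC_one)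

abbreviation clinear :: "('a::complex_vector \<Rightarrow> 'b::complex_vector) \<Rightarrow> bool" where
  "clinear \<equiv> Vector_Spaces.linear scaleC scaleC"

instantiation complex :: complex_vector
begin
definition scaleC_complex :: "complex \<Rightarrow> complex \<Rightarrow> complex" where
  "scaleC_complex c x = c * x"
instance by standard (simp_all add: scaleC_complex_def algebra_simps)
end

instantiation prod :: (complex_vector, complex_vector) complex_vector
begin
definition scaleC_prod :: "complex \<Rightarrow> 'a \<times> 'b \<Rightarrow> 'a \<times> 'b" where
  "scaleC_prod c x = (c *\<^sub>C fst x, c *\<^sub>C snd x)"
instance
  by standard
    (simp_all add: scaleC_prod_def prod_eq_iff scaleC_add_right scaleC_add_left scaleC_scaleC scaleC_one)
end

instantiation poly_mapping :: (type, complex_vector) complex_vector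
begin
definition scaleC_poly_mapping :: "complex \<Rightarrow> ('a \<Rightarrow>\<^sub>0 'b) \<Rightarrow> ('a \<Rightarrow>\<^sub>0 'b)" where
  "scaleC_poly_mapping c f = Poly_Mapping.map (\<lambda>x. c *\<^sub>C x) f"
instance
proof
  have lk: "Poly_Mapping.lookup (c *\<^sub>C f) b = c *\<^sub>C Poly_Mapping.lookup f b"
    for c and f :: "'a \<Rightarrow>\<^sub>0 'b" and b
    by (simp add: scaleC_poly_mapping_def map.rep_eq when_def)
  fix c d :: complex and x y :: "'a \<Rightarrow>\<^sub>0 'b"
  show "c *\<^sub>C (x + y) = c *\<^sub>C x + c *\<^sub>C y"
    by (rule poly_mapping_eqI) (simp add: lk lookup_add scaleC_add_right)
  show "(c + d) *\<^sub>C x = c *\<^sub>C x + d *\<^sub>C x"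
    by (rule poly_mapping_eqI) (simp add: lk lookup_add scaleC_add_left)
  show "c *\<^sub>C d *\<^sub>C x = (c * d) *\<^sub>C x"
    by (rule poly_mapping_eqI) (simp add: lk scaleC_scaleC)
  show "1 *\<^sub>C x = x"
    by (rule poly_mapping_eqI) (simp add: lk scaleC_one)
qed
end


section \<open>Vertex algebras, modules, intertwining operators\<close>

text \<open>
  A vertex operator is given by its modes: \<open>I a n x\<close> is \<open>a\<^bsub>(n)\<^esub> x\<close> in
  \<open>I(a,z) x = \<Sum>\<^sub>n a\<^bsub>(n)\<^esub> x z\<^bsup>-n-1\<^esup>\<close>. The index \<open>n\<close> is an integer for algebras and modules and
  a complex number for intertwining operators. Infinite sums of modes have finitely many nonzero
  terms and are written with \<open>Sum_any\<close>.
\<close>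

type_synonym ('a, 'i, 'x, 'y) vop = "'a \<Rightarrow> 'i \<Rightarrow> 'x \<Rightarrow> 'y"

definition vertex_operator ::
  "'a::complex_vector set \<Rightarrow> ('a, 'i::ring_1, 'x::complex_vector, 'y::complex_vector) vop \<Rightarrow> bool" where
  "vertex_operator A I \<longleftrightarrow>
     (\<forall>a\<in>A. \<forall>n. clinear (I a n)) \<and>
     (\<forall>a\<in>A. \<forall>b\<in>A. \<forall>n x. I (a + b) n x = I a n x + I b n x) \<and>
     (\<forall>a\<in>A. \<forall>c n x. I (c *\<^sub>C a) n x = c *\<^sub>C I a n x) \<and>
     (\<forall>a\<in>A. \<forall>x q. \<exists>N::nat. \<forall>n\<ge>N. I a (q + of_nat n) x = 0)"

text \<open>
  The Jacobi identity in components (Borcherds identity), for \<open>a\<close> in the algebra and \<open>w\<close> in the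
  source of \<open>I\<close>; \<open>Y1\<close>, \<open>Y2\<close>, \<open>Y3\<close> are the actions of the algebra on the three modules in
  \<open>I : W1 \<otimes> W2 \<rightarrow> W3{z}\<close>.
\<close>

definition jacobi ::
  "'a set \<Rightarrow> 'w set \<Rightarrow> ('a, int, 'w, 'w) vop \<Rightarrow> ('a, int, 'x, 'x) vop \<Rightarrow> ('a, int, 'y, 'y) vop
     \<Rightarrow> ('w, 'i::ring_1, 'x, 'y::complex_vector) vop \<Rightarrow> bool" where
  "jacobi A W Y1 Y2 Y3 I \<longleftrightarrow>
     (\<forall>a\<in>A. \<forall>w\<in>W. \<forall>x p l q.
        Sum_any (\<lambda>i::nat. ((of_int p :: complex) gchoose i) *\<^sub>C
            I (Y1 a (l + int i) w) (of_int p + q - of_nat i) x) =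
        Sum_any (\<lambda>i::nat. ((-1) ^ i * ((of_int l :: complex) gchoose i)) *\<^sub>C
            (Y3 a (p + l - int i) (I w (q + of_nat i) x)
             - ((-1) powi l) *\<^sub>C I w (of_int l + q - of_nat i) (Y2 a (p + int i) x))))"

definition vertex_algebra :: "('v::complex_vector, int, 'v, 'v) vop \<Rightarrow> 'v \<Rightarrow> bool" where
  "vertex_algebra Y vac \<longleftrightarrow>
     vertex_operator UNIV Y \<and>
     (\<forall>n a. Y vac n a = (if n = -1 then a else 0)) \<and>
     (\<forall>a. Y a (-1) vac = a \<and> (\<forall>n\<ge>0. Y a n vac = 0)) \<and>
     jacobi UNIV UNIV Y Y Y Y"

text \<open>Modules for the vertex subalgebra \<open>A\<close> of the vertex algebra \<open>(Y, vac)\<close>.\<close>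

definition va_module ::
  "'v::complex_vector set \<Rightarrow> ('v, int, 'v, 'v) vop \<Rightarrow> 'v \<Rightarrow> ('v, int, 'w::complex_vector, 'w) vop \<Rightarrow> bool"
  where
  "va_module A Y vac YW \<longleftrightarrow>
     vertex_operator A YW \<and>
     (\<forall>n x. YW vac n x = (if n = -1 then x else 0)) \<and>
     jacobi A A Y YW YW YW"

text \<open>Intertwining operators of type \<open>(W3; W1 W2)\<close>; \<open>om\<close> is the conformal vector.\<close>

definition intertwining_operator ::
  "'v \<Rightarrow> ('v, int, 'w, 'w) vop \<Rightarrow> ('v, int, 'x, 'x) vop \<Rightarrow> ('v, int, 'y, 'y) vop
     \<Rightarrow> ('w::complex_vector, complex, 'x::complex_vector, 'y::complex_vector) vop \<Rightarrow> bool" where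
  "intertwining_operator om Y1 Y2 Y3 I \<longleftrightarrow>
     vertex_operator UNIV I \<and>
     jacobi UNIV UNIV Y1 Y2 Y3 I \<and>
     (\<forall>w q x. I (Y1 om 0 w) q x = (- q) *\<^sub>C I w (q - 1) x)"

definition nontrivial_vop :: "('a, 'i, 'x, 'y::zero) vop \<Rightarrow> bool" where
  "nontrivial_vop I \<longleftrightarrow> (\<exists>w q x. I w q x \<noteq> 0)"

inductive_set vertex_subalgebra ::
  "('v::complex_vector, int, 'v, 'v) vop \<Rightarrow> 'v \<Rightarrow> 'v set \<Rightarrow> 'v set" for Y vac G where
  vac: "vac \<in> vertex_subalgebra Y vac G"
| gen: "a \<in> G \<Longrightarrow> a \<in> vertex_subalgebra Y vac G"
| add: "a \<in> vertex_subalgebra Y vac G \<Longrightarrow> b \<in> vertex_subalgebra Y vac G \<Longrightarrow>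
    a + b \<in> vertex_subalgebra Y vac G"
| scale: "a \<in> vertex_subalgebra Y vac G \<Longrightarrow> c *\<^sub>C a \<in> vertex_subalgebra Y vac G"
| mode: "a \<in> vertex_subalgebra Y vac G \<Longrightarrow> b \<in> vertex_subalgebra Y vac G \<Longrightarrow>
    Y a n b \<in> vertex_subalgebra Y vac G"

definition va_hom ::
  "'v set \<Rightarrow> ('v, int, 'x::complex_vector, 'x) vop \<Rightarrow> ('v, int, 'y::complex_vector, 'y) vop
     \<Rightarrow> ('x \<Rightarrow> 'y) \<Rightarrow> bool" where
  "va_hom A Y1 Y2 f \<longleftrightarrow> clinear f \<and> (\<forall>a\<in>A. \<forall>n x. f (Y1 a n x) = Y2 a n (f x))"

definition short_exact ::
  "'v set \<Rightarrow> ('v, int, 'x::complex_vector, 'x) vop \<Rightarrow> ('v, int, 'y::complex_vector, 'y) vop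
     \<Rightarrow> ('v, int, 'z::complex_vector, 'z) vop \<Rightarrow> ('x \<Rightarrow> 'y) \<Rightarrow> ('y \<Rightarrow> 'z) \<Rightarrow> bool" where
  "short_exact A Y1 Y2 Y3 i q \<longleftrightarrow>
     va_hom A Y1 Y2 i \<and> va_hom A Y2 Y3 q \<and> inj i \<and> range i = {y. q y = 0} \<and> surj q"

definition splits ::
  "'v set \<Rightarrow> ('v, int, 'y::complex_vector, 'y) vop
     \<Rightarrow> ('v, int, 'z::complex_vector, 'z) vop \<Rightarrow> ('y \<Rightarrow> 'z) \<Rightarrow> bool" where
  "splits A Y2 Y3 q \<longleftrightarrow> (\<exists>g. va_hom A Y3 Y2 g \<and> (\<forall>z. q (g z) = z))"


section \<open>Semisimplicity and nilpotent rank\<close>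

definition semisimple :: "('v::complex_vector \<Rightarrow> 'v) \<Rightarrow> bool" where
  "semisimple T \<longleftrightarrow> cvec.span {v. \<exists>c. T v = c *\<^sub>C v} = UNIV"

definition gen_eigenspace :: "('v::complex_vector \<Rightarrow> 'v) \<Rightarrow> complex \<Rightarrow> 'v set" where
  "gen_eigenspace T c = {v. \<exists>n::nat. ((\<lambda>x. T x - c *\<^sub>C x) ^^ n) v = 0}"

definition gen_eigen_decomp ::
  "('v::complex_vector \<Rightarrow> 'v) \<Rightarrow> 'v \<Rightarrow> (complex \<Rightarrow>\<^sub>0 'v) \<Rightarrow> bool" where
  "gen_eigen_decomp T v f \<longleftrightarrow>
     (\<forall>c. Poly_Mapping.lookup f c \<in> gen_eigenspace T c) \<and>
     v = (\<Sum>c\<in>Poly_Mapping.keys f. Poly_Mapping.lookup f c)"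

definition logarithmic :: "('v::complex_vector \<Rightarrow> 'v) \<Rightarrow> bool" where
  "logarithmic T \<longleftrightarrow> (\<forall>v. \<exists>!f. gen_eigen_decomp T v f)"

definition semisimple_part :: "('v::complex_vector \<Rightarrow> 'v) \<Rightarrow> 'v \<Rightarrow> 'v" where
  "semisimple_part T v =
     (let f = (THE f. gen_eigen_decomp T v f)
      in \<Sum>c\<in>Poly_Mapping.keys f. c *\<^sub>C Poly_Mapping.lookup f c)"

definition has_nilpotent_rank :: "('v::complex_vector \<Rightarrow> 'v) \<Rightarrow> nat \<Rightarrow> bool" where
  "has_nilpotent_rank T m \<longleftrightarrow> m \<ge> 1 \<and>
     (\<forall>v. ((\<lambda>x. T x - semisimple_part T x) ^^ m) v = 0) \<and>
     (\<exists>v. ((\<lambda>x. T x - semisimple_part T x) ^^ (m - 1)) v \<noteq> 0)"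


section \<open>Formal exponentials and powers of z\<close>

text \<open>The coefficient of \<open>z\<^bsup>N\<^esup>\<close> in \<open>exp (\<Sum>\<^bsub>m\<ge>1\<^esub> X m z\<^bsup>m\<^esup>) v\<close>.\<close>

definition exp_coeff :: "(nat \<Rightarrow> 'v \<Rightarrow> 'v::complex_vector) \<Rightarrow> nat \<Rightarrow> 'v \<Rightarrow> 'v" where
  "exp_coeff X N v =
     (\<Sum>ns\<in>{ns. 0 \<notin> set ns \<and> sum_list ns = N}. (1 / fact (length ns)) *\<^sub>C foldr X ns v)"

text \<open>
  The coefficient of \<open>z\<^bsup>m\<^esup>\<close> in \<open>z\<^bsup>T\<^esup> u\<close>: if \<open>u\<close> is a sum of eigenvectors of \<open>T\<close> with integral
  eigenvalues, this is the component of eigenvalue \<open>m\<close>.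
\<close>

definition z_power_coeff :: "('v::complex_vector \<Rightarrow> 'v) \<Rightarrow> int \<Rightarrow> 'v \<Rightarrow> 'v" where
  "z_power_coeff T m u =
     (THE w. \<exists>f :: int \<Rightarrow>\<^sub>0 'v.
        (\<forall>i. T (Poly_Mapping.lookup f i) = of_int i *\<^sub>C Poly_Mapping.lookup f i) \<and>
        u = (\<Sum>i\<in>Poly_Mapping.keys f. Poly_Mapping.lookup f i) \<and>
        w = Poly_Mapping.lookup f m)"


section \<open>The Virasoro side\<close>

definition virasoro_c :: "nat \<Rightarrow> nat \<Rightarrow> complex" where
  "virasoro_c p p' = 1 - 6 * (of_nat p - of_nat p')\<^sup>2 / (of_nat p * of_nat p')"

definition virasoro_h :: "nat \<Rightarrow> nat \<Rightarrow> nat \<Rightarrow> nat \<Rightarrow> complex" where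
  "virasoro_h p p' r s =
     ((of_nat s * of_nat p - of_nat r * of_nat p')\<^sup>2 - (of_nat p - of_nat p')\<^sup>2)
       / (4 * of_nat p * of_nat p')"

definition virasoro_rep :: "complex \<Rightarrow> (int \<Rightarrow> 'v::complex_vector \<Rightarrow> 'v) \<Rightarrow> bool" where
  "virasoro_rep c L \<longleftrightarrow>
     (\<forall>n. clinear (L n)) \<and>
     (\<forall>m n v. L m (L n v) - L n (L m v) =
        of_int (m - n) *\<^sub>C L (m + n) v +
        (if m + n = 0 then (of_int (m ^ 3 - m) / 12 * c) *\<^sub>C v else 0))"

text \<open>
  This determines \<open>L\<^sup>V\<^sup>i\<^sup>r(c,h)\<close> up to isomorphism; generation by \<open>v\<close> is implied by irreducibility.
\<close>

definition irreducible_highest_weight ::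
  "complex \<Rightarrow> complex \<Rightarrow> (int \<Rightarrow> 'v::complex_vector \<Rightarrow> 'v) \<Rightarrow> 'v \<Rightarrow> bool" where
  "irreducible_highest_weight c h L v \<longleftrightarrow>
     virasoro_rep c L \<and>
     v \<noteq> 0 \<and> L 0 v = h *\<^sub>C v \<and> (\<forall>n>0. L n v = 0) \<and>
     (\<forall>U. cvec.subspace U \<and> (\<forall>n. \<forall>u\<in>U. L n u \<in> U) \<longrightarrow> U = {0} \<or> U = UNIV)"

text \<open>
  \<open>L\<^sup>V\<^sup>i\<^sup>r(c,0)\<close> with conformal vector \<open>om\<close>; the middle condition is \<open>L(-1) = T\<close> for the
  translation operator \<open>T\<close>.
\<close>

definition simple_virasoro_va ::
  "complex \<Rightarrow> ('a::complex_vector, int, 'a, 'a) vop \<Rightarrow> 'a \<Rightarrow> 'a \<Rightarrow> bool" where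
  "simple_virasoro_va c Y vac om \<longleftrightarrow>
     vertex_algebra Y vac \<and>
     (\<forall>a. Y om 0 a = Y a (-2) vac) \<and>
     irreducible_highest_weight c 0 (\<lambda>n. Y om (n + 1)) vac"

definition irreducible_virasoro_module ::
  "('a::complex_vector, int, 'a, 'a) vop \<Rightarrow> 'a \<Rightarrow> 'a \<Rightarrow> complex \<Rightarrow> complex
     \<Rightarrow> ('a, int, 'w::complex_vector, 'w) vop \<Rightarrow> 'w \<Rightarrow> bool" where
  "irreducible_virasoro_module Y vac om c h YW v \<longleftrightarrow>
     va_module UNIV Y vac YW \<and>
     irreducible_highest_weight c h (\<lambda>n. YW om (n + 1)) v"


section \<open>The lattice side\<close>

text \<open>The pair \<open>(x, y)\<close> stands for \<open>x c + y d\<close>.\<close>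

type_synonym heis = "complex \<times> complex"

definition form :: "heis \<Rightarrow> heis \<Rightarrow> complex" where
  "form a b = 2 * (fst a * snd b + snd a * fst b)"

definition c_vec :: heis where "c_vec = (1, 0)"
definition d_vec :: heis where "d_vec = (0, 1)"
definition mu_vec :: "complex \<Rightarrow> heis" where "mu_vec k = (k / 4, 1 / 2)"
definition nu_vec :: "complex \<Rightarrow> heis" where "nu_vec k = (- k / 4, 1 / 2)"

text \<open>
  All the spaces \<open>\<Pi>\<^bsub>(r)\<^esub>(\<lambda>) = M(1) \<otimes> \<complex>[\<int>c] e\<^bsup>r\<mu>+\<lambda>c\<^esup>\<close> are modelled on one vector space; only the
  action depends on \<open>(r, \<lambda>)\<close>. The basis element \<open>(A, B, j)\<close> stands for
  \<open>(\<Prod>\<^bsub>m\<in>A\<^esub> c(-m-1)) (\<Prod>\<^bsub>m\<in>B\<^esub> d(-m-1)) e\<^bsup>r\<mu>+(\<lambda>+j)c\<^esup>\<close>; note the shift of the indices by one.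
\<close>

type_synonym pi_basis = "nat multiset \<times> nat multiset \<times> int"
type_synonym pi = "pi_basis \<Rightarrow>\<^sub>0 complex"

definition pi_exp :: "int \<Rightarrow> pi" where
  "pi_exp j = Poly_Mapping.single ({#}, {#}, j) 1"

definition lin_ext :: "(pi_basis \<Rightarrow> pi) \<Rightarrow> pi \<Rightarrow> pi" where
  "lin_ext F x = (\<Sum>b\<in>Poly_Mapping.keys x. Poly_Mapping.lookup x b *\<^sub>C F b)"

text \<open>The operator \<open>a(n)\<close> on \<open>\<Pi>\<^bsub>(r)\<^esub>(\<lambda>)\<close>.\<close>

definition heis_op :: "complex \<Rightarrow> int \<Rightarrow> complex \<Rightarrow> heis \<Rightarrow> int \<Rightarrow> pi \<Rightarrow> pi" where
  "heis_op k r lam a n = lin_ext (\<lambda>(A, B, j).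
     if n < 0 then
       (let m = nat (- n - 1) in
        Poly_Mapping.single (add_mset m A, B, j) (fst a) +
        Poly_Mapping.single (A, add_mset m B, j) (snd a))
     else if n = 0 then
       Poly_Mapping.single (A, B, j)
         (form a (of_int r *\<^sub>C mu_vec k + (lam + of_int j) *\<^sub>C c_vec))
     else
       (let m = nat (n - 1) in
        Poly_Mapping.single (A - {#m#}, B, j) (of_int n * form a c_vec * of_nat (count A m)) +
        Poly_Mapping.single (A, B - {#m#}, j) (of_int n * form a d_vec * of_nat (count B m))))"

text \<open>
  The modes of \<open>Y(e\<^bsup>ic\<^esup>,z) = exp(\<Sum>\<^bsub>m\<ge>1\<^esub> ic(-m) z\<^bsup>m\<^esup>/m) exp(-\<Sum>\<^bsub>m\<ge>1\<^esub> ic(m) z\<^bsup>-m\<^esup>/m) e\<^bsup>ic\<^esup> z\<^bsup>ic(0)\<^esup>\<close> on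
  \<open>\<Pi>\<^bsub>(r)\<^esub>(\<lambda>)\<close>, where \<open>c(0)\<close> acts as \<open>\<langle>c, r\<mu> + (\<lambda>+j)c\<rangle> = r\<close>. No cocycle is needed since \<open>\<langle>c,c\<rangle> = 0\<close>.
\<close>

definition exp_vop :: "complex \<Rightarrow> int \<Rightarrow> complex \<Rightarrow> int \<Rightarrow> int \<Rightarrow> pi \<Rightarrow> pi" where
  "exp_vop k r lam i n x = Sum_any (\<lambda>(a::nat, b::nat).
     if int a - int b + i * r = - n - 1 then
       exp_coeff (\<lambda>m. heis_op k r lam ((of_int i / of_nat m) *\<^sub>C c_vec) (- int m)) a
         (exp_coeff (\<lambda>m. heis_op k r lam ((- of_int i / of_nat m) *\<^sub>C c_vec) (int m)) b
           (lin_ext (\<lambda>(A, B, j). Poly_Mapping.single (A, B, j + i) 1) x))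
     else 0)"

text \<open>The modes of the normally ordered product \<open>:(\<partial>\<^bsup>m\<^esup>H(z)/m!) U(z):\<close> with \<open>H(z) = \<Sum>\<^sub>n H n z\<^bsup>-n-1\<^esup>\<close>.\<close>

definition normal_product ::
  "(int \<Rightarrow> pi \<Rightarrow> pi) \<Rightarrow> nat \<Rightarrow> (int \<Rightarrow> pi \<Rightarrow> pi) \<Rightarrow> int \<Rightarrow> pi \<Rightarrow> pi" where
  "normal_product H m U n x = Sum_any (\<lambda>j::nat. of_nat ((m + j) choose j) *\<^sub>C
     (H (- int m - 1 - int j) (U (n + int j) x)
      + ((-1) ^ m) *\<^sub>C U (n - int m - 1 - int j) (H (int j) x)))"

definition pi_vop_basis :: "complex \<Rightarrow> int \<Rightarrow> complex \<Rightarrow> pi_basis \<Rightarrow> int \<Rightarrow> pi \<Rightarrow> pi" where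
  "pi_vop_basis k r lam = (\<lambda>(A, B, i).
     foldr (normal_product (heis_op k r lam c_vec)) (sorted_list_of_multiset A)
       (foldr (normal_product (heis_op k r lam d_vec)) (sorted_list_of_multiset B)
         (exp_vop k r lam i)))"

text \<open>
  The action of the vertex algebra \<open>\<Pi>(0)\<close> on \<open>\<Pi>\<^bsub>(r)\<^esub>(\<lambda>)\<close>; the vertex algebra \<open>\<Pi>(0)\<close> itself is the
  case \<open>r = 0\<close>, \<open>\<lambda> = 0\<close>.
\<close>

definition pi_vop :: "complex \<Rightarrow> int \<Rightarrow> complex \<Rightarrow> (pi, int, pi, pi) vop" where
  "pi_vop k r lam u n x =
     (\<Sum>b\<in>Poly_Mapping.keys u. Poly_Mapping.lookup u b *\<^sub>C pi_vop_basis k r lam b n x)"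

definition pi_heis :: "complex \<Rightarrow> heis \<Rightarrow> int \<Rightarrow> pi \<Rightarrow> pi" where
  "pi_heis k = heis_op k 0 0"

text \<open>
  The conformal vector \<open>\<omega>\<^bsub>\<Pi>\<^esub> = c(-1)d(-1)1/2 - \<nu>(-2)1\<close>; its translation operator \<open>L(-1)\<close> does not
  depend on the linear term.
\<close>

definition pi_omega :: "complex \<Rightarrow> pi" where
  "pi_omega k = (1 / 2) *\<^sub>C pi_heis k c_vec (-1) (pi_heis k d_vec (-1) (pi_exp 0))
     - pi_heis k (nu_vec k) (-2) (pi_exp 0)"


section \<open>Tensor products with the lattice side\<close>

text \<open>\<open>L \<otimes> \<Pi>\<^bsub>(r)\<^esub>(\<lambda>)\<close> is modelled as the finitely supported functions from the basis of \<open>\<Pi>\<^bsub>(r)\<^esub>(\<lambda>)\<close> to \<open>L\<close>.\<close>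

type_synonym 'w tpi = "pi_basis \<Rightarrow>\<^sub>0 'w"

definition tensor :: "'w::complex_vector \<Rightarrow> pi \<Rightarrow> 'w tpi" where
  "tensor w x = Poly_Mapping.map (\<lambda>t. t *\<^sub>C w) x"

text \<open>\<open>(I1 \<otimes> I2)(w \<otimes> x, z) = I1(w,z) \<otimes> I2(x,z)\<close>\<close>

definition tensor_vop ::
  "('a::complex_vector, 'i::ring_1, 'x::complex_vector, 'y::complex_vector) vop \<Rightarrow> (pi, 'i, pi, pi) vop
     \<Rightarrow> ('a tpi, 'i, 'x tpi, 'y tpi) vop" where
  "tensor_vop I1 I2 u n v =
     (\<Sum>b\<in>Poly_Mapping.keys u. \<Sum>b'\<in>Poly_Mapping.keys v.
        Sum_any (\<lambda>i. tensor (I1 (Poly_Mapping.lookup u b) i (Poly_Mapping.lookup v b'))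
          (I2 (Poly_Mapping.single b 1) (n - 1 - i) (Poly_Mapping.single b' 1))))"

text \<open>
  The action of \<open>L\<^sup>V\<^sup>i\<^sup>r(d,0) \<otimes> \<Pi>(0)\<close> on \<open>L \<otimes> \<Pi>\<^bsub>(r)\<^esub>(\<lambda>)\<close>, where \<open>YW\<close> is the action of
  \<open>L\<^sup>V\<^sup>i\<^sup>r(d,0)\<close> on \<open>L\<close>.
\<close>

definition tpi_vop ::
  "complex \<Rightarrow> ('a::complex_vector, int, 'w::complex_vector, 'w) vop \<Rightarrow> int \<Rightarrow> complex
     \<Rightarrow> ('a tpi, int, 'w tpi, 'w tpi) vop" where
  "tpi_vop k YW r lam = tensor_vop YW (pi_vop k r lam)"

definition tpi_vac :: "'a::complex_vector \<Rightarrow> 'a tpi" where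
  "tpi_vac vac = tensor vac (pi_exp 0)"

definition tpi_omega :: "complex \<Rightarrow> 'a::complex_vector \<Rightarrow> 'a \<Rightarrow> 'a tpi" where
  "tpi_omega k vac om = tensor om (pi_exp 0) + tensor vac (pi_omega k)"


section \<open>The affine vertex algebra inside the tensor product\<close>

definition sl2_e :: "'a::complex_vector \<Rightarrow> 'a tpi" where
  "sl2_e vac = tensor vac (pi_exp 1)"

definition sl2_h :: "complex \<Rightarrow> 'a::complex_vector \<Rightarrow> 'a tpi" where
  "sl2_h k vac = tensor vac (2 *\<^sub>C pi_heis k (mu_vec k) (-1) (pi_exp 0))"

definition sl2_f :: "complex \<Rightarrow> 'a::complex_vector \<Rightarrow> 'a \<Rightarrow> 'a tpi" where
  "sl2_f k vac om =
     (k + 2) *\<^sub>C tensor om (pi_exp (-1))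
     - tensor vac
         (pi_heis k (nu_vec k) (-1) (pi_heis k (nu_vec k) (-1) (pi_exp (-1)))
          + (k + 1) *\<^sub>C pi_heis k (nu_vec k) (-2) (pi_exp (-1)))"

text \<open>\<open>V\<^sub>k(sl(2))\<close>, identified with its image in \<open>L\<^sup>V\<^sup>i\<^sup>r(d,0) \<otimes> \<Pi>(0)\<close>.\<close>

definition affine_sl2 ::
  "complex \<Rightarrow> ('a::complex_vector, int, 'a, 'a) vop \<Rightarrow> 'a \<Rightarrow> 'a \<Rightarrow> 'a tpi set" where
  "affine_sl2 k Y vac om =
     vertex_subalgebra (tpi_vop k Y 0 0) (tpi_vac vac) {sl2_e vac, sl2_h k vac, sl2_f k vac om}"

definition sugawara ::
  "complex \<Rightarrow> ('a::complex_vector, int, 'a, 'a) vop \<Rightarrow> 'a \<Rightarrow> 'a \<Rightarrow> 'a tpi" where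
  "sugawara k Y vac om =
     (let YV = tpi_vop k Y 0 0; e = sl2_e vac; h = sl2_h k vac; f = sl2_f k vac om
      in (1 / (2 * (k + 2))) *\<^sub>C (YV e (-1) f + YV f (-1) e + (1 / 2) *\<^sub>C YV h (-1) h))"

definition affine_module ::
  "complex \<Rightarrow> ('a::complex_vector, int, 'a, 'a) vop \<Rightarrow> 'a \<Rightarrow> 'a
     \<Rightarrow> ('a tpi, int, 'w::complex_vector, 'w) vop \<Rightarrow> bool" where
  "affine_module k Y vac om YW \<longleftrightarrow>
     va_module (affine_sl2 k Y vac om) (tpi_vop k Y 0 0) (tpi_vac vac) YW"

definition sugawara_L0 ::
  "complex \<Rightarrow> ('a::complex_vector, int, 'a, 'a) vop \<Rightarrow> 'a \<Rightarrow> 'a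
     \<Rightarrow> ('a tpi, int, 'w, 'w) vop \<Rightarrow> 'w \<Rightarrow> 'w" where
  "sugawara_L0 k Y vac om YW = YW (sugawara k Y vac om) 1"

definition weight_module ::
  "complex \<Rightarrow> ('a::complex_vector, int, 'a, 'a) vop \<Rightarrow> 'a \<Rightarrow> 'a
     \<Rightarrow> ('a tpi, int, 'w::complex_vector, 'w) vop \<Rightarrow> bool" where
  "weight_module k Y vac om YW \<longleftrightarrow>
     affine_module k Y vac om YW \<and>
     semisimple (sugawara_L0 k Y vac om YW) \<and> semisimple (YW (sl2_h k vac) 0)"


section \<open>The extended vertex algebra and its modules\<close>

text \<open>
  The extended vertex algebra is the product of \<open>L\<^sup>V\<^sup>i\<^sup>r(d,0) \<otimes> \<Pi>(0)\<close> and
  \<open>L\<^sup>V\<^sup>i\<^sup>r(d,h\<^bsup>2,1\<^esup>) \<otimes> \<Pi>\<^bsub>(1)\<^esub>(-k/2)\<close>. The last sum is the \<open>n\<close>-th mode of \<open>e\<^bsup>zL(-1)\<^esup> Y(v2,-z) w1\<close>.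
\<close>

definition ext_vop ::
  "complex \<Rightarrow> ('a::complex_vector, int, 'a, 'a) vop \<Rightarrow> 'a \<Rightarrow> 'a
     \<Rightarrow> ('a, int, 'b::complex_vector, 'b) vop
     \<Rightarrow> ('a tpi \<times> 'b tpi, int, 'a tpi \<times> 'b tpi, 'a tpi \<times> 'b tpi) vop" where
  "ext_vop k Y vac om Y21 = (\<lambda>(v1, w1) n (v2, w2).
     let YV = tpi_vop k Y 0 0; YM = tpi_vop k Y21 1 (- k / 2); L_1 = YM (tpi_omega k vac om) 0
     in (YV v1 n v2,
         YM v1 n w2
         + Sum_any (\<lambda>j::nat. ((-1) powi (n + int j + 1) / fact j) *\<^sub>C (L_1 ^^ j) (YM v2 (n + int j) w1))))"

text \<open>\<open>s = v\<^bsub>2,1\<^esub> \<otimes> e\<^bsup>\<nu>\<^esup>\<close>, where \<open>e\<^bsup>\<nu>\<^esup> = e\<^bsup>\<mu> - (k/2) c\<^esup>\<close>.\<close>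

definition ext_s :: "'b::complex_vector \<Rightarrow> 'a::complex_vector tpi \<times> 'b tpi" where
  "ext_s v21 = (0, tensor v21 (pi_exp 0))"

text \<open>
  The \<open>(L\<^sup>V\<^sup>i\<^sup>r(d,0) \<otimes> \<Pi>(0)) \<oplus> M\<^bsub>2,1\<^esub>\<close>-module \<open>M\<^bsub>r,s\<^esub>\<^bsup>l,-\<^esup>(\<lambda>)\<close>; \<open>Yrs\<close> and \<open>Yr1s\<close> are the actions of
  \<open>L\<^sup>V\<^sup>i\<^sup>r(d,0)\<close> on \<open>L\<^sup>V\<^sup>i\<^sup>r(d,h\<^bsup>r,s\<^esup>)\<close> and \<open>L\<^sup>V\<^sup>i\<^sup>r(d,h\<^bsup>r-1,s\<^esup>)\<close>. Only integral modes of \<open>I1 \<otimes> I2\<close> occur.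
\<close>

definition M_vop ::
  "complex \<Rightarrow> ('a::complex_vector, int, 'c::complex_vector, 'c) vop
     \<Rightarrow> ('a, int, 'd::complex_vector, 'd) vop
     \<Rightarrow> ('b::complex_vector, complex, 'c, 'd) vop \<Rightarrow> (pi, complex, pi, pi) vop \<Rightarrow> int \<Rightarrow> complex
     \<Rightarrow> ('a tpi \<times> 'b tpi, int, 'c tpi \<times> 'd tpi, 'c tpi \<times> 'd tpi) vop" where
  "M_vop k Yrs Yr1s I1 I2 l lam = (\<lambda>(v, w) n (x, y).
     (tpi_vop k Yrs l lam v n x,
      tpi_vop k Yr1s (l + 1) (- k / 2 + lam) v n y + tensor_vop I1 I2 w (of_int n) x))"

text \<open>
  The coefficient of \<open>z\<^bsup>m-N\<^esup>\<close> in \<open>\<Delta>(s,z) a = z\<^bsup>s\<^sub>0\<^esup> exp(\<Sum>\<^bsub>n\<ge>1\<^esub> s\<^sub>n/(-n) (-z)\<^bsup>-n\<^esup>) a\<close> that comes from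
  \<open>z\<^bsup>m\<^esup>\<close> in the first factor and \<open>z\<^bsup>-N\<^esup>\<close> in the second.
\<close>

definition Delta_coeff ::
  "('v::complex_vector, int, 'v, 'v) vop \<Rightarrow> 'v \<Rightarrow> nat \<Rightarrow> int \<Rightarrow> 'v \<Rightarrow> 'v" where
  "Delta_coeff Y s N m a =
     z_power_coeff (Y s 0) m
       (exp_coeff (\<lambda>n x. ((-1) ^ n / (- of_nat n)) *\<^sub>C Y s (int n) x) N a)"

text \<open>\<open>Y\<^sub>M(\<Delta>(s,z) a, z)\<close>\<close>

definition tilde_vop ::
  "('v::complex_vector, int, 'v, 'v) vop \<Rightarrow> 'v \<Rightarrow> ('v, int, 'w::complex_vector, 'w) vop
     \<Rightarrow> ('v, int, 'w, 'w) vop" where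
  "tilde_vop Y s YM a n x =
     Sum_any (\<lambda>(N::nat, m::int). YM (Delta_coeff Y s N m a) (n + m - int N) x)"

definition M_tilde_vop ::
  "complex \<Rightarrow> ('a::complex_vector, int, 'a, 'a) vop \<Rightarrow> 'a \<Rightarrow> 'a
     \<Rightarrow> ('a, int, 'b::complex_vector, 'b) vop \<Rightarrow> 'b
     \<Rightarrow> ('a, int, 'c::complex_vector, 'c) vop \<Rightarrow> ('a, int, 'd::complex_vector, 'd) vop
     \<Rightarrow> ('b, complex, 'c, 'd) vop \<Rightarrow> (pi, complex, pi, pi) vop \<Rightarrow> int \<Rightarrow> complex
     \<Rightarrow> ('a tpi, int, 'c tpi \<times> 'd tpi, 'c tpi \<times> 'd tpi) vop" where
  "M_tilde_vop k Y vac om Y21 v21 Yrs Yr1s I1 I2 l lam a =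
     tilde_vop (ext_vop k Y vac om Y21) (ext_s v21) (M_vop k Yrs Yr1s I1 I2 l lam) (a, 0)"

end

theory Submission
 imports Defs "HOL-Computational_Algebra.Formal_Power_Series"
begin

text \<open>
 The Jacobi identity is handled one Borcherds identity \<open>(p, l, q)\<close> at a time. Its defect satisfies
 \<open>E (p + 1) l q = E p (l + 1) q + E p l (q + 1)\<close>, so it vanishes once it vanishes on the axes, or for all
 large \<open>l\<close> and for all large \<open>p\<close>. The first criterion reduces it to products and commutators of fields and
 makes \<open>\<Pi>\<^bsub>(r)\<^esub>(\<lambda>)\<close> a \<open>\<Pi>(0)\<close>-module; the second one passes it to tensor products.

 Since \<open>s\<^sub>m s\<^sub>n = 0\<close> on the extended algebra, \<open>\<Delta>(s,z) a = a + \<Sum>\<^sub>N c\<^sub>N s\<^sub>N a z\<^sup>-\<^sup>N\<close>, where \<open>c\<^sub>N\<close> is the derivative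
 of \<open>t choose N\<close> at \<open>t = 0\<close>. The second summand acts as the formal commutator of \<open>a(z)\<close> with the residue of
 \<open>s(z) log z\<close>, which is a derivation as soon as \<open>s\<^sub>0 a = 0\<close>. For \<open>a = f\<close> this last condition is the null vector
 equation \<open>L(-1)\<^sup>2 v\<^bsub>2,1\<^esub> = (k+2) L(-2) v\<^bsub>2,1\<^esub>\<close>.

 The Sugawara vector is \<open>\<omega> + \<omega>\<^bsub>\<Pi>\<^esub>\<close>, hence the deformed \<open>L(0)\<close> is the sum of the semisimple undeformed one and of
 \<open>S\<close>, which commutes with it and has square zero. Everything reduces to \<open>S \<noteq> 0\<close>; a splitting would make the deformed
 \<open>L(0)\<close> semisimple. The last nonzero mode of \<open>I1(v\<^bsub>2,1\<^esub>,z) v\<^bsub>r,s\<^esub>\<close> is singular, hence proportional to \<open>v\<^bsub>r-1,s\<^esub>\<close>,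
 and comparing weights it has index \<open>\<lambda> - 1\<close>; in the same way the last nonzero mode of \<open>I2(e\<^sup>\<nu>,z)\<close> on \<open>e\<^bsup>l\<mu>+(\<lambda>-1)c\<^esup>\<close> has
 index \<open>-\<lambda>\<close>. So \<open>S (v\<^bsub>r,s\<^esub> \<otimes> e\<^bsup>l\<mu>+(\<lambda>-1)c\<^esup>)\<close> is the tensor product of these two leading terms.
\<close>

text \<open>The lattice modules are explicit operators on polynomials, so their Jacobi identity has
  to come out of binomial and multiset combinatorics. The Virasoro modules are given abstractly and
  are used through their axioms and irreducibility. Intertwining operators have complex mode
  indices. Each is restricted to one coset of the integers, and the offsets of the two tensor
  factors are opposite, so that their product has integral modes. The Virasoro factor has leading
  index h(2,1) + h(r,s) - h(r-1,s) - 1, and the hypothesis on \<open>lam\<close> says that this is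
  \<open>lam - 1\<close>. The zero mode of a tensor product collects pairs of indices with sum -1;
  \<open>lam - 1\<close> and \<open>- lam\<close> form such a pair, which is why the zero mode is
  nonzero. The modes s_N a are handled inside the module M_{2,1}: skew-symmetry writes them as
  L(-1)-descendants of the vectors a_n s. The deformation then becomes a statement about one module,
  one intertwining operator and one vector, without reference to the extended algebra.\<close>

notation scaleC (infixr "*s" 75)

abbreviation (input) "single \<equiv> Poly_Mapping.single"
abbreviation (input) "lookup \<equiv> Poly_Mapping.lookup"
abbreviation (input) "keys \<equiv> Poly_Mapping.keys"

lemmas scaleC_diff_right = cvec.scale_right_diff_distrib and scaleC_diff_left = cvec.scale_left_diff_distrib
 and scaleC_sum_right = cvec.scale_sum_right and scaleC_sum_left = cvec.scale_sum_left
 and scaleC_0 = cvec.scale_zero_right and scaleC_minus_left = cvec.scale_minus_left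

section \<open>Finitely supported sums\<close>

text \<open>\<open>Sum_any\<close> is 0 on an infinite support, so linearity and exchange of sums
  need this condition. For fields it comes from truncation.\<close>

abbreviation fs :: "('i \<Rightarrow> 'v::zero) \<Rightarrow> bool" where "fs f \<equiv> finite {i. f i \<noteq> 0}"

lemma clinear_iff: "clinear f \<longleftrightarrow> (\<forall>x y. f (x + y) = f x + f y) \<and> (\<forall>c x. f (c *s x) = c *s f x)"
 by (auto simp: Vector_Spaces.linear_iff cvec.vector_space_axioms)

lemma clinearI:
 "(\<And>x y. f (x + y) = f x + f y) \<Longrightarrow> (\<And>c x. f (c *s x) = c *s f x) \<Longrightarrow> clinear f"
 by (simp add: clinear_iff)

context
 fixes f :: "'a::complex_vector \<Rightarrow> 'b::complex_vector"
 assumes f: "clinear f"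
begin
lemma clinear_add: "f (x + y) = f x + f y" using f by (simp add: clinear_iff)
lemma clinear_scale: "f (c *s x) = c *s f x" using f by (simp add: clinear_iff)
lemma clinear_0: "f 0 = 0" using clinear_add[of 0 0] by simp
lemma clinear_minus: "f (- x) = - f x"
 using clinear_add[of x "- x"] by (simp add: clinear_0 add_eq_0_iff)
lemma clinear_diff: "f (x - y) = f x - f y"
 using clinear_add[of x "- y"] by (simp add: clinear_minus)
lemma clinear_sum: "f (sum g A) = (\<Sum>i\<in>A. f (g i))"
 by (induction A rule: infinite_finite_induct) (simp_all add: clinear_0 clinear_add)
lemma clinear_Sum_any: "fs g \<Longrightarrow> f (Sum_any g) = Sum_any (\<lambda>i. f (g i))"
 by (subst Sum_any.expand_set, subst Sum_any.expand_superset[where A = "{i. g i \<noteq> 0}"])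
  (auto simp: clinear_sum clinear_0)
end

lemma clinear_id: "clinear (\<lambda>x. x)" by (simp add: clinear_iff)
lemma clinear_zero: "clinear (\<lambda>x. 0)" by (simp add: clinear_iff)
lemma clinear_compose: "clinear f \<Longrightarrow> clinear g \<Longrightarrow> clinear (\<lambda>x. f (g x))" by (simp add: clinear_iff)
lemma clinear_plus: "clinear f \<Longrightarrow> clinear g \<Longrightarrow> clinear (\<lambda>x. f x + g x)"
 by (simp add: clinear_iff scaleC_add_right)
lemma clinear_minusI: "clinear f \<Longrightarrow> clinear g \<Longrightarrow> clinear (\<lambda>x. f x - g x)"
 by (simp add: clinear_iff scaleC_diff_right)
lemma clinear_scaleI: "clinear f \<Longrightarrow> clinear (\<lambda>x. c *s f x)"
 by (simp add: clinear_iff scaleC_add_right mult.commute)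
lemma clinear_sumI: "(\<And>i. i \<in> A \<Longrightarrow> clinear (f i)) \<Longrightarrow> clinear (\<lambda>x. \<Sum>i\<in>A. f i x)"
 by (induction A rule: infinite_finite_induct) (auto intro: clinear_zero clinear_plus)

lemma fs_nat: "(\<And>i. i \<ge> K \<Longrightarrow> f i = 0) \<Longrightarrow> fs f" for K :: nat
 by (rule finite_subset[of _ "{..<K}"]) (auto simp: not_less[symmetric])

lemma fs_int: "(\<And>i. i < a \<Longrightarrow> f i = 0) \<Longrightarrow> (\<And>i. i > b \<Longrightarrow> f i = 0) \<Longrightarrow> fs f" for a b :: int
 by (rule finite_subset[of _ "{a..b}"]) (auto simp: not_less[symmetric])

lemma fs_nat_obtain: fixes f :: "nat \<Rightarrow> 'v::zero"
 assumes "fs f" obtains K where "\<And>i. i \<ge> K \<Longrightarrow> f i = 0"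
 proof -
 from assms obtain K where "\<forall>i\<in>{i. f i \<noteq> 0}. i < K" by (auto simp: finite_nat_set_iff_bounded)
 then show thesis by (intro that[of K]) force
qed

lemma fs_sub: "fs f \<Longrightarrow> (\<And>i. f i = 0 \<Longrightarrow> g i = 0) \<Longrightarrow> fs g"
 by (rule finite_subset[of _ "{i. f i \<noteq> 0}"]) auto

lemma fs_add: "fs f \<Longrightarrow> fs g \<Longrightarrow> fs (\<lambda>i. f i + g i)" for f :: "'i \<Rightarrow> 'v::comm_monoid_add"
 by (rule finite_subset[of _ "{i. f i \<noteq> 0} \<union> {i. g i \<noteq> 0}"]) auto

lemma fs_diff: "fs f \<Longrightarrow> fs g \<Longrightarrow> fs (\<lambda>i. f i - g i)" for f :: "'i \<Rightarrow> 'v::ab_group_add"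
 by (rule finite_subset[of _ "{i. f i \<noteq> 0} \<union> {i. g i \<noteq> 0}"]) auto

lemma fs_scale: "fs f \<Longrightarrow> fs (\<lambda>i. c i *s f i)" for f :: "'i \<Rightarrow> 'v::complex_vector"
 by (erule fs_sub) simp

lemma fs_inj: "fs f \<Longrightarrow> inj h \<Longrightarrow> fs (\<lambda>i. f (h i))"
 using finite_vimageI[of "{i. f i \<noteq> 0}" h] by (simp add: vimage_def)

lemma SA_nat: "(\<And>i. i \<ge> K \<Longrightarrow> f i = 0) \<Longrightarrow> Sum_any f = (\<Sum>i<K. f i)" for K :: nat
 by (rule Sum_any.expand_superset) (auto simp: not_less[symmetric])

lemma SA_diff: "fs f \<Longrightarrow> fs g \<Longrightarrow> Sum_any (\<lambda>i. f i - g i) = Sum_any f - Sum_any g"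
 for f :: "'i \<Rightarrow> 'v::ab_group_add"
proof -
 assume fg: "fs f" "fs g"
 have "Sum_any (\<lambda>i. (f i - g i) + g i) = Sum_any (\<lambda>i. f i - g i) + Sum_any g"
  by (rule Sum_any.distrib) (rule fs_diff[OF fg], rule fg)
 then show ?thesis by simp
qed

lemmas SA_add = Sum_any.distrib

lemma SA_scale: "Sum_any (\<lambda>i. c *s f i) = c *s Sum_any f" for f :: "'i \<Rightarrow> 'v::complex_vector"
 by (cases "c = 0") (simp_all add: Sum_any.expand_set scaleC_sum_right)

lemma SA_minus: "Sum_any (\<lambda>i. - f i) = - Sum_any f" for f :: "'i \<Rightarrow> 'v::ab_group_add"
 by (simp add: Sum_any.expand_set sum_negf)

lemma SA_shift: "Sum_any (\<lambda>i::int. f (i + c)) = Sum_any f"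
 by (rule Sum_any.reindex_cong[symmetric, of "\<lambda>i. i + c"])
  (auto simp: bij_def inj_def surj_def intro: exI[of _ "_ - c"])

lemma SA_neg: "Sum_any (\<lambda>i::int. f (c - i)) = Sum_any f"
 by (rule Sum_any.reindex_cong[symmetric, of "\<lambda>i. c - i"])
  (auto simp: bij_def inj_def surj_def intro: exI[of _ "c - _"])

lemma SA_Suc: "fs f \<Longrightarrow> Sum_any f = f 0 + Sum_any (\<lambda>i. f (Suc i))" for f :: "nat \<Rightarrow> 'v::comm_monoid_add"
proof -
 assume "fs f"
 then obtain K where K: "\<And>i. i \<ge> K \<Longrightarrow> f i = 0" by (rule fs_nat_obtain) blast
 have "Sum_any f = (\<Sum>i<Suc K. f i)" by (rule SA_nat) (use K in auto)
 also have "\<dots> = f 0 + (\<Sum>i<K. f (Suc i))" by (simp only: sum.lessThan_Suc_shift)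
 also have "(\<Sum>i<K. f (Suc i)) = Sum_any (\<lambda>i. f (Suc i))" by (rule SA_nat[symmetric]) (use K in auto)
 finally show ?thesis .
qed

lemma SA_single: "(\<And>i. i \<noteq> a \<Longrightarrow> f i = 0) \<Longrightarrow> Sum_any f = f a"
 by (subst Sum_any.expand_superset[of "{a}"]) auto

lemma SA_zero: "(\<And>i. f i = 0) \<Longrightarrow> Sum_any f = 0" by simp

lemma SA_finite_sum_swap: "finite A \<Longrightarrow> (\<And>a. a \<in> A \<Longrightarrow> fs (f a)) \<Longrightarrow>
 Sum_any (\<lambda>i. \<Sum>a\<in>A. f a i) = (\<Sum>a\<in>A. Sum_any (f a))" for f :: "'a \<Rightarrow> 'i \<Rightarrow> 'v::comm_monoid_add"
proof (induction A rule: finite_induct)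
 case (insert x F)
 have "fs (\<lambda>i. \<Sum>a\<in>F. f a i)"
  by (rule finite_subset[of _ "\<Union>a\<in>F. {i. f a i \<noteq> 0}"]) (use insert in \<open>auto dest: sum.not_neutral_contains_not_neutral\<close>)
 then show ?case using insert by (simp add: SA_add)
qed simp

lemma SA_swap:
 assumes "finite {(i, j). f i j \<noteq> 0}"
 shows "Sum_any (\<lambda>i. Sum_any (f i)) = Sum_any (\<lambda>j. Sum_any (\<lambda>i. f i j))"
proof (rule Sum_any.swap[where C = "fst ` {(i, j). f i j \<noteq> 0} \<times> snd ` {(i, j). f i j \<noteq> 0}"])
 show "finite (fst ` {(i, j). f i j \<noteq> 0} \<times> snd ` {(i, j). f i j \<noteq> 0})" using assms by blast
qed (force)

text \<open>In iterated mode expansions the two indices add up inside one mode, so truncation cuts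
  off a triangle. Summing along its diagonals prepares Vandermonde's identity.\<close>

lemma sum_triangle:
 fixes f :: "nat \<Rightarrow> nat \<Rightarrow> 'v::comm_monoid_add"
 assumes "\<And>i k. i + k \<ge> K \<Longrightarrow> f i k = 0"
 shows "(\<Sum>i<K. \<Sum>k<K. f i k) = (\<Sum>u<K. \<Sum>i\<le>u. f i (u - i))"
proof -
 have "(\<Sum>i<K. \<Sum>k<K. f i k) = (\<Sum>(i,k)\<in>{..<K}\<times>{..<K}. f i k)"
  by (simp add: sum.cartesian_product)
 also have "\<dots> = (\<Sum>(i,k)\<in>{(i,k). i + k < K}. f i k)"
  by (rule sum.mono_neutral_right) (use assms in \<open>auto, meson not_less\<close>)
 also have "\<dots> = (\<Sum>u<K. \<Sum>i\<le>u. f i (u - i))"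
  by (rule sum.triangle_reindex)
 finally show ?thesis .
qed

section \<open>Binomial coefficients\<close>

abbreviation bin :: "int \<Rightarrow> nat \<Rightarrow> complex" where "bin p i \<equiv> (of_int p :: complex) gchoose i"
abbreviation abin :: "int \<Rightarrow> nat \<Rightarrow> complex" where "abin l i \<equiv> (-1) ^ i * bin l i"
abbreviation sg :: "int \<Rightarrow> complex" where "sg l \<equiv> (-1) powi l"

lemma bin_Suc_Suc: "bin (p + 1) (Suc i) = bin p (Suc i) + bin p i"
 using gbinomial_Suc_Suc[of "of_int p :: complex" i] by (simp add: add.commute)

lemma bin_0_left: "bin 0 i = (if i = 0 then 1 else 0)"
 by (simp add: gbinomial_0_left)

lemma bin_Vandermonde: "(\<Sum>i\<le>u. bin a i * bin b (u - i)) = bin (a + b) u"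
 using gbinomial_Vandermonde[of "of_int a :: complex" "of_int b" u] by (simp add: atLeast0AtMost)

lemma bin_trinomial: "bin n (j + k) * of_nat ((j + k) choose j) = bin n j * bin (n - int j) k"
 using gbinomial_trinomial_revision[of j "j + k" "of_int n :: complex"]
 by (simp add: binomial_gbinomial)

lemma bin_negate: "bin a k = (-1) ^ k * bin (int k - a - 1) k"
 using gbinomial_negated_upper[of "of_int a :: complex" k] by simp

lemma bin_nat: "bin (int n) i = of_nat (n choose i)"
 by (simp add: binomial_gbinomial)

lemma bin_nat_0: "i > n \<Longrightarrow> bin (int n) i = 0"
 unfolding bin_nat by simp

lemma sg_mult: "sg (a + b) = sg a * sg b" by (simp add: power_int_add)
lemma sg_Suc: "sg (a + 1) = - sg a" "sg (1 + a) = - sg a" by (simp_all add: power_int_add)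
lemma sg_nat: "sg (int n) = (-1) ^ n" by (simp add: power_int_def)
lemma sg_sq: "sg a * sg a = 1" by (simp add: power_int_mult_distrib[symmetric])
lemma sg_minus: "sg (- a) = sg a" by (simp add: power_int_minus_left power_int_minus)
lemma sg_diff: "sg (a - b) = sg a * sg b" using sg_mult[of a "-b"] by (simp add: sg_minus)

section \<open>Fields and the Borcherds identity\<close>

text \<open>A family \<open>A n\<close> stands for the series A(z) = sum of A(n) z^(-n-1). Source
  and target may differ, as the fields of an intertwining operator require.\<close>

type_synonym ('x, 'y) fld = "int \<Rightarrow> 'x \<Rightarrow> 'y"

definition is_fld :: "('x::complex_vector, 'y::complex_vector) fld \<Rightarrow> bool" where
 "is_fld A \<longleftrightarrow> (\<forall>n. clinear (A n)) \<and> (\<forall>x. \<exists>N::int. \<forall>n\<ge>N. A n x = 0)"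

text \<open>Right-hand side of the Borcherds identity with indices \<open>p\<close>,
  \<open>l\<close>, \<open>q\<close>. As \<open>B\<close> maps one module to another, its partner
  occurs twice: \<open>A\<close> on the source and \<open>A'\<close> on the target.\<close>

definition brs :: "('y::complex_vector, 'y) fld \<Rightarrow> ('x::complex_vector, 'x) fld \<Rightarrow> ('x, 'y) fld \<Rightarrow>
  int \<Rightarrow> int \<Rightarrow> int \<Rightarrow> 'x \<Rightarrow> 'y" where
 "brs A' A B p l q x = Sum_any (\<lambda>i::nat. abin l i *s
   (A' (p + l - int i) (B (q + int i) x) - sg l *s B (l + q - int i) (A (p + int i) x)))"

text \<open>Left-hand side of the same identity, where \<open>F l\<close> plays the part of the
  field of the vector a_l b.\<close>

definition bls :: "(int \<Rightarrow> ('x, 'y::complex_vector) fld) \<Rightarrow> int \<Rightarrow> int \<Rightarrow> int \<Rightarrow> 'x \<Rightarrow> 'y" where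
 "bls F p l q x = Sum_any (\<lambda>i::nat. bin p i *s F (l + int i) (p + q - int i) x)"

text \<open>At \<open>p = 0\<close> the left-hand side has a single term, so the identity prescribes
  this field as the l-th product of \<open>A\<close> and \<open>B\<close>.\<close>

definition prd :: "('y::complex_vector, 'y) fld \<Rightarrow> ('x::complex_vector, 'x) fld \<Rightarrow> int \<Rightarrow> ('x, 'y) fld \<Rightarrow>
  ('x, 'y) fld" where
 "prd A' A l B = brs A' A B 0 l"

lemma is_fld_linear: "is_fld A \<Longrightarrow> clinear (A n)" by (simp add: is_fld_def)

lemmas fld_0 = clinear_0[OF is_fld_linear] and fld_add = clinear_add[OF is_fld_linear] and fld_scale = clinear_scale[OF is_fld_linear] and fld_sum = clinear_sum[OF is_fld_linear] and fld_diff = clinear_diff[OF is_fld_linear] and fld_minus = clinear_minus[OF is_fld_linear] and fld_Sum_any = clinear_Sum_any[OF is_fld_linear]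

lemma is_fld_bound: "is_fld A \<Longrightarrow> \<exists>K::nat. \<forall>i\<ge>K. A (q + int i) x = 0"
proof -
 assume "is_fld A"
 then obtain N where N: "\<forall>n\<ge>N. A n x = 0" unfolding is_fld_def by blast
 have "A (q + int i) x = 0" if "i \<ge> nat (N - q)" for i using N that by auto
 then show ?thesis by blast
qed

lemma is_fldI: "(\<And>n. clinear (A n)) \<Longrightarrow> (\<And>x. \<exists>N::int. \<forall>n\<ge>N. A n x = 0) \<Longrightarrow> is_fld A"
 by (simp add: is_fld_def)

lemma is_fld_zero: "is_fld (\<lambda>_ _. 0)" by (auto intro!: is_fldI clinear_zero)

lemma is_fld_add: "is_fld A \<Longrightarrow> is_fld B \<Longrightarrow> is_fld (\<lambda>n x. A n x + B n x)"
proof (rule is_fldI)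
 assume A: "is_fld A" and B: "is_fld B"
 show "clinear (\<lambda>x. A n x + B n x)" for n using A B by (intro clinear_plus is_fld_linear)
 fix x
 obtain N M where "\<forall>n\<ge>N. A n x = 0" "\<forall>n\<ge>M. B n x = 0" using A B unfolding is_fld_def by metis
 then have "\<forall>n\<ge>max N M. A n x + B n x = 0" by simp
 then show "\<exists>N. \<forall>n\<ge>N. A n x + B n x = 0" by blast
qed

lemma is_fld_scale: "is_fld A \<Longrightarrow> is_fld (\<lambda>n x. c n *s A n x)"
proof (rule is_fldI)
 assume A: "is_fld A"
 show "clinear (\<lambda>x. c n *s A n x)" for n using A by (intro clinear_scaleI is_fld_linear)
 fix x
 obtain N where "\<forall>n\<ge>N. A n x = 0" using A unfolding is_fld_def by metis
 then show "\<exists>N. \<forall>n\<ge>N. c n *s A n x = 0" by auto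
qed

lemma is_fld_shift: "is_fld A \<Longrightarrow> is_fld (\<lambda>n. A (n + c))"
proof (rule is_fldI)
 assume A: "is_fld A"
 show "clinear (A (n + c))" for n using A by (rule is_fld_linear)
 fix x
 obtain N where "\<forall>n\<ge>N. A n x = 0" using A unfolding is_fld_def by metis
 then have "\<forall>n\<ge>N - c. A (n + c) x = 0" by simp
 then show "\<exists>N. \<forall>n\<ge>N. A (n + c) x = 0" by blast
qed

lemma fld_fs_lin: "is_fld B \<Longrightarrow> (\<And>i. clinear (F i)) \<Longrightarrow> fs (\<lambda>i::nat. F i (B (q + int i) x))"
proof -
 assume "is_fld B" and F: "\<And>i. clinear (F i)"
 then obtain K where "\<forall>i\<ge>K. B (q + int i) x = 0" using is_fld_bound by blast
 then show ?thesis by (intro fs_nat[of K]) (auto simp: clinear_0[OF F])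
qed

lemma brs_split:
 assumes "is_fld A'" "is_fld A" "is_fld B"
 shows "brs A' A B p l q x =
  Sum_any (\<lambda>i::nat. abin l i *s A' (p + l - int i) (B (q + int i) x))
  - sg l *s Sum_any (\<lambda>i::nat. abin l i *s B (l + q - int i) (A (p + int i) x))"
 unfolding brs_def SA_scale[symmetric]
 by (subst SA_diff[symmetric])
  (auto simp: algebra_simps scaleC_diff_right assms is_fld_linear
   intro!: fs_scale fld_fs_lin)

lemma pascal:
 fixes f :: "nat \<Rightarrow> 'v::complex_vector"
 assumes "fs f"
 shows "Sum_any (\<lambda>i. bin (p + 1) i *s f i) =
  Sum_any (\<lambda>i. bin p i *s f i) + Sum_any (\<lambda>i. bin p i *s f (Suc i))"
proof -
 have s: "fs (\<lambda>i. f (Suc i))" by (rule fs_inj[OF assms]) simp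
 have "Sum_any (\<lambda>i. bin (p + 1) i *s f i) = f 0 + Sum_any (\<lambda>i. bin (p + 1) (Suc i) *s f (Suc i))"
  using SA_Suc[of "\<lambda>i. bin (p + 1) i *s f i"] by (simp add: fs_scale assms scaleC_one)
 also have "\<dots> = f 0 + (Sum_any (\<lambda>i. bin p (Suc i) *s f (Suc i)) + Sum_any (\<lambda>i. bin p i *s f (Suc i)))"
  by (subst SA_add[symmetric]) (auto simp: bin_Suc_Suc[simplified] scaleC_add_left intro!: fs_scale s)
 also have "\<dots> = Sum_any (\<lambda>i. bin p i *s f i) + Sum_any (\<lambda>i. bin p i *s f (Suc i))"
  using SA_Suc[of "\<lambda>i. bin p i *s f i"] by (simp add: fs_scale assms scaleC_one)
 finally show ?thesis .
qed

lemma pascal_alt: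
 fixes f :: "nat \<Rightarrow> 'v::complex_vector"
 assumes "fs f"
 shows "Sum_any (\<lambda>i. abin (p + 1) i *s f i) =
  Sum_any (\<lambda>i. abin p i *s f i) - Sum_any (\<lambda>i. abin p i *s f (Suc i))"
 using pascal[of "\<lambda>i. (-1) ^ i *s f i" p] fs_scale[OF assms, of "\<lambda>i. (-1) ^ i"]
 by (simp add: scaleC_scaleC SA_minus mult.commute)

text \<open>Pascal's rule for the binomials in \<open>l\<close> writes both sums for
  \<open>l + 1\<close> as differences of sums for \<open>l\<close>; one sum of each difference is
  then cancelled by the term with \<open>q + 1\<close>.\<close>

lemma brs_rec:
 assumes "is_fld A'" "is_fld A" "is_fld B"
 shows "brs A' A B (p + 1) l q x = brs A' A B p (l + 1) q x + brs A' A B p l (q + 1) x"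
proof -
 let ?a = "\<lambda>F. Sum_any (\<lambda>i::nat. abin l i *s F i)"
 let ?f = "\<lambda>i::nat. A' (p + 1 + l - int i) (B (q + int i) x)"
 let ?g = "\<lambda>i::nat. B (l + 1 + q - int i) (A (p + int i) x)"
 have f: "fs ?f" and g: "fs ?g" using assms by (auto intro!: fld_fs_lin is_fld_linear)
 have 1: "brs A' A B (p + 1) l q x = ?a ?f - sg l *s ?a (\<lambda>i. ?g (Suc i))"
  by (simp add: brs_split[OF assms] algebra_simps)
 have 2: "brs A' A B p (l + 1) q x = (?a ?f - ?a (\<lambda>i. ?f (Suc i))) + sg l *s (?a ?g - ?a (\<lambda>i. ?g (Suc i)))"
  unfolding pascal_alt[OF f, symmetric] pascal_alt[OF g, symmetric]
  by (simp add: brs_split[OF assms] algebra_simps sg_Suc)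
 have 3: "brs A' A B p l (q + 1) x = ?a (\<lambda>i. ?f (Suc i)) - sg l *s ?a ?g"
  by (simp add: brs_split[OF assms] algebra_simps)
 show ?thesis unfolding 1 2 3 by (simp add: scaleC_diff_right)
qed

lemma bls_rec:
 assumes "\<And>l. l \<ge> N \<Longrightarrow> F l = (\<lambda>_ _. 0)"
 shows "bls F (p + 1) l q x = bls F p (l + 1) q x + bls F p l (q + 1) x"
proof -
 have "fs (\<lambda>i::nat. F (l + int i) (p + 1 + q - int i) x)"
  by (rule fs_nat[of "nat (N - l)"]) (use assms in auto)
 from pascal[OF this, of p] show ?thesis
  unfolding bls_def by (simp add: algebra_simps)
qed

text \<open>The defect of the Borcherds identity satisfies the recursion of \<open>z1 = (z1 - z2) + z2\<close>.\<close>

lemma defect_zero_axes: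
 fixes E :: "int \<Rightarrow> int \<Rightarrow> int \<Rightarrow> 'v::ab_group_add"
 assumes rec: "\<And>p l q. E (p + 1) l q = E p (l + 1) q + E p l (q + 1)"
  and 0: "\<And>l q. E 0 l q = 0" "\<And>p q. E p 0 q = 0"
 shows "E p l q = 0"
proof -
 have P: "E (int n) l q = 0" for n l q
 proof (induction n arbitrary: l q)
  case (Suc n) then show ?case using rec[of "int n" l q] by (simp add: add.commute)
 qed (simp add: 0)
 have L: "E p (int n) q = 0" for n p q
 proof (induction n arbitrary: p q)
  case (Suc n) then show ?case using rec[of p "int n" q] by (simp add: add.commute)
 qed (simp add: 0)
 \<comment> \<open>With both indices negative the recursion is solved for its last term,
   \<open>E p l q = E (p + 1) l (q - 1) - E p (l + 1) (q - 1)\<close>, and both terms lie closer to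
   the axes.\<close>
 have N: "E (- int m) (- int n) q = 0" for m n q
 proof (induction "m + n" arbitrary: m n q rule: less_induct)
  case less
  show ?case
  proof (cases "m = 0 \<or> n = 0")
   case True then show ?thesis using 0 by auto
  next
   case False
   then obtain m' n' where mn: "m = Suc m'" "n = Suc n'" by (metis not0_implies_Suc)
   have "E (- int m') (- int n) (q - 1) = 0" "E (- int m) (- int n') (q - 1) = 0"
    by (rule less; simp add: mn)+
   then show ?thesis using rec[of "- int m" "- int n" "q - 1"] by (simp add: mn)
  qed
 qed
 show ?thesis
 proof (cases "p \<ge> 0 \<or> l \<ge> 0")
  case True then show ?thesis using P[of "nat p"] L[of _ "nat l"] by auto
 next
  case False then show ?thesis using N[of "nat (- p)" "nat (- l)"] by simp
 qed
qed

text \<open>Vanishing for large \<open>l\<close> is locality and for large \<open>p\<close> weak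
  associativity; both multiply directly over commuting fields, hence this criterion for tensor
  products. The recursion is solved for \<open>E p l q\<close> and descends in \<open>l\<close>, and
  for fixed \<open>l\<close> in \<open>p\<close>.\<close>

lemma defect_zero_large:
 fixes E :: "int \<Rightarrow> int \<Rightarrow> int \<Rightarrow> 'v::ab_group_add"
 assumes rec: "\<And>p l q. E (p + 1) l q = E p (l + 1) q + E p l (q + 1)"
  and l: "\<And>p l q. l \<ge> N \<Longrightarrow> E p l q = 0" and p: "\<And>p l q. p \<ge> P \<Longrightarrow> E p l q = 0"
 shows "E p l q = 0"
proof -
 have "E p l q = 0" if "l \<ge> N - int n" for n p l q
  using that
 proof (induction n arbitrary: p l q)
  case (Suc n)
  have "E p l q = 0" if "p \<ge> P - int m" for m p q
   using that
  proof (induction m arbitrary: p q)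
   case (Suc m)
   have "E (p + 1) l (q - 1) = 0" by (rule Suc.IH) (use Suc.prems in simp)
   moreover have "E p (l + 1) (q - 1) = 0" by (rule \<open>\<And>q p l. N - int n \<le> l \<Longrightarrow> E p l q = 0\<close>) (use \<open>N - int (Suc n) \<le> l\<close> in simp)
   ultimately show ?case using rec[of p l "q - 1"] by simp
  qed (simp add: p)
  from this[of "nat (P - p)" p q] show ?case by simp
 qed (simp add: l)
 from this[of "nat (N - l)" l p q] show ?thesis by simp
qed

text \<open>The bound on \<open>l\<close> is locality. It keeps the sum of products on the left-hand
  side finite.\<close>

definition bor :: "('y::complex_vector, 'y) fld \<Rightarrow> ('x::complex_vector, 'x) fld \<Rightarrow> ('x, 'y) fld \<Rightarrow> bool" where
 "bor A' A B \<longleftrightarrow> (\<exists>N. \<forall>l\<ge>N. prd A' A l B = (\<lambda>_ _. 0)) \<and>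
   (\<forall>p l q x. bls (\<lambda>l. prd A' A l B) p l q x = brs A' A B p l q x)"

lemma bls_0: "bls F 0 l q x = F l q x"
 unfolding bls_def by (subst SA_single[of 0]) (auto simp: gbinomial_0_left scaleC_one)

lemma brs_0: "brs A' A B p 0 q x = A' p (B q x) - B q (A p x)"
 unfolding brs_def by (subst SA_single[of 0]) (auto simp: gbinomial_0_left scaleC_one)

text \<open>On the axis \<open>p = 0\<close> the identity is the definition of \<open>prd\<close>,
  on the axis \<open>l = 0\<close> it is the commutator formula \<open>c\<close>; the recursion
  spreads it to all indices.\<close>

lemma borI:
 assumes "is_fld A'" "is_fld A" "is_fld B"
  and N: "\<And>l. l \<ge> N \<Longrightarrow> prd A' A l B = (\<lambda>_ _. 0)"
  and c: "\<And>m n x. A' m (B n x) - B n (A m x) =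
    Sum_any (\<lambda>i::nat. bin m i *s prd A' A (int i) B (m + n - int i) x)"
 shows "bor A' A B"
proof -
 have "bls (\<lambda>l. prd A' A l B) p l q x - brs A' A B p l q x = 0" for p l q x
 proof (rule defect_zero_axes[of "\<lambda>p l q. bls (\<lambda>l. prd A' A l B) p l q x - brs A' A B p l q x"])
  fix p l q
  show "bls (\<lambda>l. prd A' A l B) (p + 1) l q x - brs A' A B (p + 1) l q x =
    bls (\<lambda>l. prd A' A l B) p (l + 1) q x - brs A' A B p (l + 1) q x +
    (bls (\<lambda>l. prd A' A l B) p l (q + 1) x - brs A' A B p l (q + 1) x)"
   using brs_rec[OF assms(1-3), of p l q x] bls_rec[of N "\<lambda>l. prd A' A l B" p l q x] N by simp
  show "bls (\<lambda>l. prd A' A l B) 0 l q x - brs A' A B 0 l q x = 0" by (simp add: bls_0 prd_def)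
  show "bls (\<lambda>l. prd A' A l B) p 0 q x - brs A' A B p 0 q x = 0"
   using c[of p q x] by (simp add: brs_0 bls_def)
 qed
 then show ?thesis unfolding bor_def using N by auto
qed

lemma bor_comm: "bor A' A B \<Longrightarrow> A' m (B n x) - B n (A m x) =
    Sum_any (\<lambda>i::nat. bin m i *s prd A' A (int i) B (m + n - int i) x)"
proof -
 assume "bor A' A B"
 then have "bls (\<lambda>l. prd A' A l B) m 0 n x = brs A' A B m 0 n x" unfolding bor_def by blast
 then show ?thesis unfolding brs_0 bls_def by simp
qed

lemma bor_bound: "bor A' A B \<Longrightarrow> \<exists>N::nat. \<forall>l\<ge>int N. prd A' A l B = (\<lambda>_ _. 0)"
proof -
 assume "bor A' A B"
 then obtain N where "\<forall>l\<ge>N. prd A' A l B = (\<lambda>_ _. 0)" unfolding bor_def by blast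
 then have "\<forall>l\<ge>int (nat N). prd A' A l B = (\<lambda>_ _. 0)" by auto
 then show ?thesis ..
qed

lemma prd_fld:
 assumes A': "is_fld A'" and A: "is_fld A" and B: "is_fld B"
 shows "is_fld (prd A' A l B)"
proof (rule is_fldI)
 fix n
 show "clinear (prd A' A l B n)"
 proof (rule clinearI)
  fix x y c
  let ?a = "\<lambda>F. Sum_any (\<lambda>i::nat. abin l i *s F i)"
  have "?a (\<lambda>i. A' (l - int i) (B (n + int i) (x + y))) = ?a (\<lambda>i. A' (l - int i) (B (n + int i) x)) + ?a (\<lambda>i. A' (l - int i) (B (n + int i) y))"
   by (rule trans[OF _ SA_add])
    (auto intro!: fs_scale fld_fs_lin simp: A' A B is_fld_linear clinear_add[OF is_fld_linear] scaleC_add_right)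
  moreover have "?a (\<lambda>i. B (l + n - int i) (A (int i) (x + y))) = ?a (\<lambda>i. B (l + n - int i) (A (int i) x)) + ?a (\<lambda>i. B (l + n - int i) (A (int i) y))"
   by (rule trans[OF _ SA_add])
    (simp add: clinear_add[OF is_fld_linear] A B scaleC_add_right,
    (intro fs_scale fld_fs_lin[where q = 0, simplified] is_fld_linear A B)+)
  ultimately show "prd A' A l B n (x + y) = prd A' A l B n x + prd A' A l B n y"
   unfolding prd_def brs_split[OF assms] by (simp add: scaleC_add_right)
  show "prd A' A l B n (c *s x) = c *s prd A' A l B n x"
   unfolding prd_def brs_def SA_scale[symmetric]
   by (simp add: clinear_scale[OF is_fld_linear] A A' B scaleC_diff_right scaleC_scaleC mult_ac)
 qed
next
 fix x
 obtain M where M: "\<forall>n\<ge>M. B n x = 0" using B unfolding is_fld_def by blast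
 obtain K :: nat where K: "\<forall>i\<ge>K. A (int i) x = 0" using is_fld_bound[OF A, of 0 x] by auto
 have "\<exists>N. \<forall>n\<ge>N. B n (A (int i) x) = 0" for i using B unfolding is_fld_def by blast
 then obtain N where N: "\<And>i n. n \<ge> N i \<Longrightarrow> B n (A (int i) x) = 0" by metis
 define M' where "M' = Max (insert M ((\<lambda>i. N i - l + int i) ` {..<K}))"
 have M': "M' \<ge> M" "\<And>i. i < K \<Longrightarrow> M' \<ge> N i - l + int i" by (auto simp: M'_def)
 have "prd A' A l B n x = 0" if n: "n \<ge> M'" for n
  unfolding prd_def brs_def
 proof (rule SA_zero)
  fix i :: nat
  have "B (n + int i) x = 0" using M M'(1) n by auto
  moreover have "B (l + n - int i) (A (int i) x) = 0"
  proof (cases "i < K")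
   case True then show ?thesis using M'(2)[OF True] n by (intro N) auto
  next
   case False then show ?thesis using K by (simp add: fld_0[OF B])
  qed
  ultimately show "((- 1) ^ i * bin l i) *s (A' (0 + l - int i) (B (n + int i) x) - sg l *s B (l + n - int i) (A (0 + int i) x)) = 0"
   by (simp add: fld_0[OF A'])
 qed
 then show "\<exists>N. \<forall>n\<ge>N. prd A' A l B n x = 0" by blast
qed

section \<open>Products of fields\<close>

abbreviation pr :: "('x::complex_vector, 'x) fld \<Rightarrow> int \<Rightarrow> ('x, 'x) fld \<Rightarrow> ('x, 'x) fld" where
 "pr A l B \<equiv> prd A A l B"
abbreviation bo :: "('x::complex_vector, 'x) fld \<Rightarrow> ('x, 'x) fld \<Rightarrow> bool" where
 "bo A B \<equiv> bor A A B"

lemma sum_triangle':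
 fixes f :: "nat \<Rightarrow> nat \<Rightarrow> 'v::comm_monoid_add"
 assumes "\<And>i k. i + k \<ge> K \<Longrightarrow> f i k = 0" "K \<le> M" "K \<le> N"
 shows "(\<Sum>i<M. \<Sum>k<N. f i k) = (\<Sum>u<K. \<Sum>i\<le>u. f i (u - i))"
proof -
 have "(\<Sum>i<M. \<Sum>k<N. f i k) = (\<Sum>i<M. \<Sum>k<K. f i k)"
  by (intro sum.cong refl sum.mono_neutral_right) (use assms in auto)
 also have "\<dots> = (\<Sum>i<K. \<Sum>k<K. f i k)"
  by (intro sum.mono_neutral_right) (use assms in \<open>auto intro!: sum.neutral\<close>)
 finally show ?thesis using sum_triangle[of K f] assms(1) by simp
qed

lemma sum_rotate: "(\<Sum>i\<in>A. \<Sum>k\<in>B. \<Sum>j\<in>C. f i k j) = (\<Sum>j\<in>C. \<Sum>i\<in>A. \<Sum>k\<in>B. f i k j)"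
 by (rule trans[OF sum.cong[OF refl sum.swap] sum.swap])

lemma is_fld_choice: "is_fld C \<Longrightarrow> \<exists>N. \<forall>k. \<forall>i\<ge>N k. C (g k + int i) (y k) = 0"
 by (rule choice) (blast intro: is_fld_bound)

text \<open>The truncation order of a field depends on the vector. For finitely many nonzero vectors
  a common order exists, whatever the offsets \<open>g k\<close>; double mode sums are cut off this
  way.\<close>

lemma is_fld_uniform:
 fixes y :: "nat \<Rightarrow> 'x::complex_vector"
 assumes C: "is_fld C" and y: "\<And>k. k \<ge> K0 \<Longrightarrow> y k = 0"
 shows "\<exists>K. \<forall>i\<ge>K. \<forall>k. C (g k + int i) (y k) = 0"
proof -
 obtain N where N: "\<And>k i. i \<ge> N k \<Longrightarrow> C (g k + int i) (y k) = 0"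
  using is_fld_choice[OF C, of g y] by metis
 have "C (g k + int i) (y k) = 0" if "i \<ge> Max (insert 0 (N ` {..<K0}))" for i k
 proof (cases "k < K0")
  case True
  have "N k \<le> Max (insert 0 (N ` {..<K0}))" by (rule Max_ge) (use True in auto)
  then show ?thesis using N that by (meson le_trans)
 next
  case False then show ?thesis using y by (simp add: fld_0[OF C])
 qed
 then show ?thesis by blast
qed

lemma bin_comp: "bin n i * bin (n - int i) j = bin n j * bin (n - int j) i"
 using bin_trinomial[of n i j] bin_trinomial[of n j i] binomial_symmetric[of i "i + j"]
 by (simp add: add.commute)

lemma bin_comp_nat: "bin n (i + j) * bin (int (i + j)) j = bin n j * bin (n - int j) i"
 using bin_trinomial[of n j i] by (simp only: bin_nat add.commute)

lemma prd_bounded: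
 assumes "\<And>i. i \<ge> K \<Longrightarrow> B (q + int i) x = 0" "\<And>i. i \<ge> K \<Longrightarrow> B (l + q - int i) (A (int i) x) = 0"
  "is_fld A'"
 shows "prd A' A l B q x = (\<Sum>i<K. abin l i *s
   (A' (l - int i) (B (q + int i) x) - sg l *s B (l + q - int i) (A (int i) x)))"
 unfolding prd_def brs_def
 by (subst SA_nat[of K]) (use assms in \<open>auto simp: clinear_0[OF is_fld_linear]\<close>)

lemma bor_comm_sum:
 assumes "bor A' A B" "\<forall>l\<ge>int N. prd A' A l B = (\<lambda>_ _. 0)"
 shows "A' m (B n x) - B n (A m x) =
    (\<Sum>i<N. bin m i *s prd A' A (int i) B (m + n - int i) x)"
 by (subst bor_comm[OF assms(1)], rule SA_nat) (use assms in auto)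

text \<open>The operators A_(n) and B_(l) on the space of fields obey the same commutator formula as
  modes do. In the difference the terms with a mode of \<open>C\<close> between a mode of
  \<open>A\<close> and a mode of \<open>B\<close> cancel; the remaining mode commutators are
  expanded in the products of \<open>A\<close> and \<open>B\<close> and resummed by
  Vandermonde.\<close>

lemma prd_comm:
 assumes A: "is_fld A" and B: "is_fld B" and C: "is_fld C" and AB: "bo A B"
  and N: "\<forall>l\<ge>int N. pr A l B = (\<lambda>_ _. 0)"
 shows "pr A n (pr B l C) q x - pr B l (pr A n C) q x =
   (\<Sum>j<N. bin n j *s pr (pr A (int j) B) (n + l - int j) C q x)"
proof -
 define D where "D j = pr A (int j) B" for j
 have D: "is_fld (D j)" for j unfolding D_def by (intro prd_fld A B)
 note lin = fld_0[OF A] fld_0[OF B]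
   fld_0[OF C] fld_0[OF D]
 obtain K1 where K1: "\<And>u. u \<ge> K1 \<Longrightarrow> C (q + int u) x = 0" using is_fld_bound[OF C] by metis
 obtain K2 where K2: "\<And>u. u \<ge> K2 \<Longrightarrow> A (int u) x = 0" using is_fld_bound[OF A, of 0] by auto
 obtain K3 where K3: "\<And>u. u \<ge> K3 \<Longrightarrow> B (int u) x = 0" using is_fld_bound[OF B, of 0] by auto
 obtain K4 where K4: "\<And>i k. i \<ge> K4 \<Longrightarrow> C (l + q - int k + int i) (B (int k) x) = 0"
  using is_fld_uniform[OF C, of K3 "\<lambda>k. B (int k) x" "\<lambda>k. l + q - int k"] K3 by metis
 obtain K5 where K5: "\<And>i k. i \<ge> K5 \<Longrightarrow> C (n + q - int k + int i) (A (int k) x) = 0"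
  using is_fld_uniform[OF C, of K2 "\<lambda>k. A (int k) x" "\<lambda>k. n + q - int k"] K2 by metis
 obtain K6 where K6: "\<And>i k. i \<ge> K6 \<Longrightarrow> B (int i) (A (int k) x) = 0"
  using is_fld_uniform[OF B, of K2 "\<lambda>k. A (int k) x" "\<lambda>k. 0"] K2 by auto
 obtain K7 where K7: "\<And>i k. i \<ge> K7 \<Longrightarrow> A (int i) (B (int k) x) = 0"
  using is_fld_uniform[OF A, of K3 "\<lambda>k. B (int k) x" "\<lambda>k. 0"] K3 by auto
 obtain M where M: "\<And>j u. u \<ge> M j \<Longrightarrow> D j (int u) x = 0"
 proof -
  have "\<exists>M. \<forall>j. \<forall>u\<ge>M j. D j (0 + int u) x = 0"
   by (rule choice) (use is_fld_bound[OF D] in blast)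
  then show thesis using that by auto
 qed
 define K8 where "K8 = Max (insert 0 (M ` {..<N}))"
 have K8: "D j (int u) x = 0" if "u \<ge> K8" for j u
 proof (cases "j < N")
  case True
  have "M j \<le> K8" unfolding K8_def by (rule Max_ge) (use True in auto)
  then show ?thesis using M that by (meson le_trans)
 next
  case False then show ?thesis using N by (simp add: D_def)
 qed
 \<comment> \<open>\<open>L\<close> bounds every index at which a mode can be nonzero. The square of
   side \<open>K = L + N\<close> leaves room for the later shift of one index by
   \<open>j < N\<close>.\<close>
 define L where "L = K1 + K2 + K3 + K4 + K5 + K6 + K7 + K8"
 define K where "K = L + N"
 have L: "C (q + int u) x = 0" "A (int u) x = 0" "B (int u) x = 0" "C (l + q - int k + int u) (B (int k) x) = 0"
  "C (n + q - int k + int u) (A (int k) x) = 0" "B (int u) (A (int k) x) = 0"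
  "A (int u) (B (int k) x) = 0" "D j (int u) x = 0" if "u \<ge> L" for u k j
  using that unfolding L_def by (auto intro: K1 K2 K3 K4 K5 K6 K7 K8)
 have L': "C (q + int i + int k) x = 0" if "i + k \<ge> L" for i k using L(1)[OF that] by (simp add: add.assoc)
 have L4: "C (l + (q + int u) - int k) (B (int k) x) = 0" if "u \<ge> L" for u k
  using L(4)[OF that, of k] by (simp add: algebra_simps)
 have L5: "C (n + (q + int u) - int k) (A (int k) x) = 0" if "u \<ge> L" for u k
  using L(5)[OF that, of k] by (simp add: algebra_simps)
 let ?a = "\<lambda>i. (-1) ^ i * bin n i" and ?b = "\<lambda>k. (-1) ^ k * bin l k"
 have BC1: "pr B l C (q + int i) x = (\<Sum>k<K. ?b k *s
   (B (l - int k) (C (q + int i + int k) x) - sg l *s C (l + (q + int i) - int k) (B (int k) x)))" for i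
  by (rule prd_bounded) (use L in \<open>auto simp: K_def B L' lin\<close>)
 have BC2: "pr B l C (n + q - int i) (A (int i) x) = (\<Sum>k<K. ?b k *s
   (B (l - int k) (C (n + q - int i + int k) (A (int i) x)) - sg l *s C (l + (n + q - int i) - int k) (B (int k) (A (int i) x))))" for i
  by (rule prd_bounded) (use L in \<open>auto simp: K_def B L' lin\<close>)
 have AC1: "pr A n C (q + int k) x = (\<Sum>i<K. ?a i *s
   (A (n - int i) (C (q + int k + int i) x) - sg n *s C (n + (q + int k) - int i) (A (int i) x)))" for k
  by (rule prd_bounded) (use L in \<open>auto simp: K_def A L' lin\<close>)
 have AC2: "pr A n C (l + q - int k) (B (int k) x) = (\<Sum>i<K. ?a i *s
   (A (n - int i) (C (l + q - int k + int i) (B (int k) x)) - sg n *s C (n + (l + q - int k) - int i) (A (int i) (B (int k) x))))" for k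
  by (rule prd_bounded) (use L in \<open>auto simp: K_def A L' lin\<close>)
 have X: "pr A n (pr B l C) q x = (\<Sum>i<K. ?a i *s
   (A (n - int i) (pr B l C (q + int i) x) - sg n *s pr B l C (n + q - int i) (A (int i) x)))"
 proof (rule prd_bounded)
  fix i assume i: "K \<le> i"
  then show "pr B l C (q + int i) x = 0" unfolding BC1 using L' L4 by (intro sum.neutral) (auto simp: K_def lin)
  show "pr B l C (n + q - int i) (A (int i) x) = 0"
   using L(2)[of i] i fld_0[OF prd_fld[OF B B C]] by (simp add: K_def)
 qed (rule A)
 have Y: "pr B l (pr A n C) q x = (\<Sum>k<K. ?b k *s
   (B (l - int k) (pr A n C (q + int k) x) - sg l *s pr A n C (l + q - int k) (B (int k) x)))"
 proof (rule prd_bounded)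
  fix i assume i: "K \<le> i"
  then show "pr A n C (q + int i) x = 0" unfolding AC1 using L' L5 by (intro sum.neutral) (auto simp: K_def lin)
  show "pr A n C (l + q - int i) (B (int i) x) = 0"
   using L(3)[of i] i fld_0[OF prd_fld[OF A A C]] by (simp add: K_def)
 qed (rule B)
 note simps = clinear_sum[OF is_fld_linear] clinear_scale[OF is_fld_linear] clinear_diff[OF is_fld_linear] A B C
   scaleC_diff_right scaleC_scaleC scaleC_sum_right sum_subtractf[symmetric]
 let ?S = "\<lambda>j u. D j (n + l - int j - int u) (C (q + int u) x)" and ?T = "\<lambda>j u. C (n + l - int j + q - int u) (D j (int u) x)"
 let ?e = "\<lambda>j u. (-1) ^ u * bin (n + l - int j) u" and ?t = "\<lambda>j u i. bin (n - int j) i * bin l (u - i)"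
 let ?p = "\<lambda>j i k. (?a i * ?b k * bin (n - int i) j) *s D j (n + l - int i - int k - int j) (C (q + int i + int k) x)"
 let ?f = "\<lambda>j i k. (?a i * ?b k * (sg n * sg l * bin (int i) j)) *s C (l + n + q - int i - int k) (D j (int i + int k - int j) x)"
 have "pr A n (pr B l C) q x = (\<Sum>i<K. \<Sum>k<K. (?a i * ?b k) *s
   (A (n - int i) (B (l - int k) (C (q + int i + int k) x))
    - sg l *s A (n - int i) (C (l + q + int i - int k) (B (int k) x))
    - sg n *s B (l - int k) (C (n + q - int i + int k) (A (int i) x))
    + (sg n * sg l) *s C (l + n + q - int i - int k) (B (int k) (A (int i) x))))"
  unfolding X BC1 BC2 by (intro sum.cong refl) (simp add: simps scaleC_add_right algebra_simps)
 moreover have "pr B l (pr A n C) q x = (\<Sum>i<K. \<Sum>k<K. (?a i * ?b k) *s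
   (B (l - int k) (A (n - int i) (C (q + int i + int k) x))
    - sg l *s A (n - int i) (C (l + q + int i - int k) (B (int k) x))
    - sg n *s B (l - int k) (C (n + q - int i + int k) (A (int i) x))
    + (sg n * sg l) *s C (l + n + q - int i - int k) (A (int i) (B (int k) x))))"
  unfolding Y AC1 AC2
  by (subst sum.swap) (intro sum.cong refl, simp add: simps scaleC_add_right algebra_simps)
 ultimately have "pr A n (pr B l C) q x - pr B l (pr A n C) q x = (\<Sum>i<K. \<Sum>k<K. (?a i * ?b k) *s
   ((A (n - int i) (B (l - int k) (C (q + int i + int k) x)) - B (l - int k) (A (n - int i) (C (q + int i + int k) x)))
   - (sg n * sg l) *s C (l + n + q - int i - int k) (A (int i) (B (int k) x) - B (int k) (A (int i) x))))"
  unfolding sum_subtractf[symmetric]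
  by (simp only: sum_subtractf[symmetric] scaleC_diff_right[symmetric])
   (intro sum.cong refl arg_cong[where f = "(*s) _"],
    simp add: fld_diff[OF C] scaleC_diff_right)
 \<comment> \<open>Only commutators of modes of \<open>A\<close> and \<open>B\<close> are left,
   acting either after or before the mode of \<open>C\<close>.\<close>
 also have "\<dots> = (\<Sum>i<K. \<Sum>k<K. \<Sum>j<N. (?a i * ?b k) *s
   (bin (n - int i) j *s D j (n + l - int i - int k - int j) (C (q + int i + int k) x)
   - (sg n * sg l * bin (int i) j) *s C (l + n + q - int i - int k) (D j (int i + int k - int j) x)))"
  by (intro sum.cong refl)
   (simp add: bor_comm_sum[OF AB N] simps D_def algebra_simps)
 also have "\<dots> = (\<Sum>i<K. \<Sum>k<K. \<Sum>j<N. ?p j i k)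
   - (\<Sum>i<K. \<Sum>k<K. \<Sum>j<N. ?f j i k)" (is "_ = ?P - ?Q")
  by (simp add: sum_subtractf[symmetric] scaleC_diff_right scaleC_scaleC)
 also have "?P = (\<Sum>j<N. \<Sum>i<K. \<Sum>k<K. ?p j i k)"
  by (rule sum_rotate)
 also have "\<dots> = (\<Sum>j<N. bin n j *s (\<Sum>u<L. ?e j u *s
    ?S j u))"
 proof (intro sum.cong refl)
  fix j
  have "(\<Sum>i<K. \<Sum>k<K. ?p j i k) =
    (\<Sum>u<L. \<Sum>i\<le>u. ?p j i (u - i))"
   by (rule sum_triangle') (auto simp: L' lin K_def)
  \<comment> \<open>\<open>bin_comp\<close> extracts \<open>bin n j\<close>. On a diagonal the
    vector no longer depends on \<open>i\<close>, so the sum over \<open>i\<close> is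
    Vandermonde's.\<close>
  also have "\<dots> = (\<Sum>u<L. \<Sum>i\<le>u. ((-1) ^ u * bin n j * ?t j u i) *s
    ?S j u)"
  proof (intro sum.cong refl)
   fix u i :: nat assume "i \<in> {..u}"
   then have i: "i \<le> u" by simp
   have pw: "(-1 :: complex) ^ i * (-1) ^ (u - i) = (-1) ^ u" using i by (simp add: power_add[symmetric])
   have "?a i * ?b (u - i) * bin (n - int i) j = ((-1) ^ i * (-1) ^ (u - i)) * (bin n i * bin (n - int i) j) * bin l (u - i)"
    by (simp only: mult_ac)
   then have "?a i * ?b (u - i) * bin (n - int i) j = (-1) ^ u * bin n j * ?t j u i"
    unfolding pw bin_comp[of n i j] by (simp only: mult_ac)
   then show "?p j i (u - i) =
    ((-1) ^ u * bin n j * ?t j u i) *s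
     ?S j u"
    using i by (simp add: of_nat_diff algebra_simps)
  qed
  also have "\<dots> = (\<Sum>u<L. ((-1) ^ u * bin n j * bin (n + l - int j) u) *s
    ?S j u)"
  proof (intro sum.cong refl)
   fix u
   have "(\<Sum>i\<le>u. ?t j u i) = bin (n + l - int j) u"
    using bin_Vandermonde[of "n - int j" l u] by (simp add: algebra_simps)
   then show "(\<Sum>i\<le>u. ((-1) ^ u * bin n j * ?t j u i) *s
     ?S j u) = ((-1) ^ u * bin n j * bin (n + l - int j) u) *s
     ?S j u"
    by (simp only: scaleC_sum_left[symmetric] sum_distrib_left[symmetric])
  qed
  finally show "(\<Sum>i<K. \<Sum>k<K. ?p j i k) =
   bin n j *s (\<Sum>u<L. ?e j u *s
    ?S j u)"
   by (simp add: scaleC_sum_right scaleC_scaleC mult_ac)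
 qed
 also have "?Q = (\<Sum>j<N. \<Sum>i<K. \<Sum>k<K. ?f j i k)"
  by (rule sum_rotate)
 also have "\<dots> = (\<Sum>j<N. bin n j *s (\<Sum>u<L. ?e j u *s
   (sg (n + l - int j) *s ?T j u)))"
 proof (intro sum.cong refl)
  fix j assume "j \<in> {..<N}"
  then have j: "j < N" by simp
  \<comment> \<open>\<open>bin (int i) j\<close> vanishes for \<open>i < j\<close>. After the shift
    by \<open>j\<close> the range still has length at least \<open>L\<close>, as the triangle
    requires.\<close>
  have "(\<Sum>i<K. \<Sum>k<K. ?f j i k) = (\<Sum>i\<in>{j..<K}. \<Sum>k<K. ?f j i k)"
   by (intro sum.mono_neutral_right) (auto simp: bin_nat_0[simplified])
  also have "\<dots> = (\<Sum>i<K-j. \<Sum>k<K. ?f j (i + j) k)"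
   by (rule sum.reindex_bij_witness[of _ "\<lambda>i. i + j" "\<lambda>i. i - j"]) auto
  also have "\<dots> = (\<Sum>u<L. \<Sum>i\<le>u. ?f j (i + j) (u - i))"
  proof (rule sum_triangle')
   fix i k assume "L \<le> i + k"
   from L(8)[OF this, of j] show "?f j (i + j) k = 0" by (simp add: lin)
  qed (use j in \<open>auto simp: K_def\<close>)
  also have "\<dots> = (\<Sum>u<L. \<Sum>i\<le>u. ((-1) ^ u * bin n j * sg (n + l - int j) * ?t j u i) *s
     ?T j u)"
  proof (intro sum.cong refl)
   fix u i :: nat assume "i \<in> {..u}"
   then have i: "i \<le> u" by simp
   have s: "sg (n + l - int j) = sg n * sg l * (-1) ^ j" by (simp add: sg_mult sg_diff sg_nat)
   have pw: "(-1 :: complex) ^ i * (-1) ^ (u - i) = (-1) ^ u" using i by (simp add: power_add[symmetric])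
   have "?a (i + j) * ?b (u - i) * (sg n * sg l * bin (int (i + j)) j) =
     ((-1) ^ i * (-1) ^ (u - i)) * (bin n (i + j) * bin (int (i + j)) j) * (sg n * sg l * (-1) ^ j) * bin l (u - i)"
    by (simp only: mult_ac power_add)
   then have "?a (i + j) * ?b (u - i) * (sg n * sg l * bin (int (i + j)) j) =
     (-1) ^ u * bin n j * sg (n + l - int j) * ?t j u i"
    unfolding pw bin_comp_nat s by (simp only: mult_ac)
   then show "?f j (i + j) (u - i) = ((-1) ^ u * bin n j * sg (n + l - int j) * ?t j u i) *s
     ?T j u"
    using i by (simp add: of_nat_diff algebra_simps)
  qed
  also have "\<dots> = (\<Sum>u<L. ((-1) ^ u * bin n j * sg (n + l - int j) * bin (n + l - int j) u) *s
     ?T j u)"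
  proof (intro sum.cong refl)
   fix u
   have "(\<Sum>i\<le>u. ?t j u i) = bin (n + l - int j) u"
    using bin_Vandermonde[of "n - int j" l u] by (simp add: algebra_simps)
   then show "(\<Sum>i\<le>u. ((-1) ^ u * bin n j * sg (n + l - int j) * ?t j u i) *s
     ?T j u) = ((-1) ^ u * bin n j * sg (n + l - int j) * bin (n + l - int j) u) *s
     ?T j u"
    by (simp only: scaleC_sum_left[symmetric] sum_distrib_left[symmetric])
  qed
  finally show "(\<Sum>i<K. \<Sum>k<K. ?f j i k) = bin n j *s (\<Sum>u<L. ?e j u *s
   (sg (n + l - int j) *s ?T j u))"
   by (simp add: scaleC_sum_right scaleC_scaleC mult_ac)
 qed
 also have "(\<Sum>j<N. bin n j *s (\<Sum>u<L. ?e j u *s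
    ?S j u)) -
   (\<Sum>j<N. bin n j *s (\<Sum>u<L. ?e j u *s
   (sg (n + l - int j) *s ?T j u))) =
   (\<Sum>j<N. bin n j *s pr (D j) (n + l - int j) C q x)"
 proof -
  have "pr (D j) (n + l - int j) C q x = (\<Sum>u<L. ?e j u *s
   (?S j u - sg (n + l - int j) *s ?T j u))" for j
   by (rule prd_bounded) (auto simp: L D lin)
  then show ?thesis
   by (simp only: sum_subtractf scaleC_diff_right)
 qed
 finally show ?thesis by (simp add: D_def)
qed

lemma is_fld_uniform_fam:
 assumes C: "\<And>j. is_fld (D j)" and N: "\<And>j. j \<ge> (N::nat) \<Longrightarrow> D j = (\<lambda>_ _. 0)"
 shows "\<exists>K. \<forall>j. \<forall>u\<ge>K. D j (g j + int u) x = 0"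
proof -
 have "\<exists>M. \<forall>j. \<forall>u\<ge>M j. D j (g j + int u) x = 0"
  by (rule choice) (use is_fld_bound[OF C] in blast)
 then obtain M where M: "\<And>j u. u \<ge> M j \<Longrightarrow> D j (g j + int u) x = 0" by blast
 have "D j (g j + int u) x = 0" if "u \<ge> Max (insert 0 (M ` {..<N}))" for j u
 proof (cases "j < N")
  case True
  have "M j \<le> Max (insert 0 (M ` {..<N}))" by (rule Max_ge) (use True in auto)
  then show ?thesis using M that by (meson le_trans)
 qed (simp add: N)
 then show ?thesis by blast
qed

lemma prd_zero_right: "is_fld A' \<Longrightarrow> prd A' A l (\<lambda>_ _. 0) = (\<lambda>_ _. 0)"
 unfolding prd_def brs_def fun_eq_iff by (simp add: clinear_0[OF is_fld_linear])

text \<open>A form of Dong's lemma. Moving \<open>A m\<close> past \<open>pr G n B\<close> produces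
  commutators with \<open>B\<close>, which give the products of \<open>G\<close> with the fields
  \<open>E j\<close>, and commutators with \<open>G\<close>, whose contributions are Borcherds sums
  of \<open>D i\<close> and \<open>B\<close> with indices \<open>(m, n - i)\<close>. This is why the
  full identity, and not only the commutator formula, is assumed for \<open>D i\<close> and
  \<open>B\<close>.\<close>

lemma bor_right:
 assumes G: "is_fld G" and A: "is_fld A" and B: "is_fld B"
  and GA: "bo G A" and AB: "bo A B" and GAB: "\<And>i. bo (pr G (int i) A) B"
 shows "bo A (pr G n B)"
proof -
 define D where "D i = pr G (int i) A" for i
 define E where "E j = pr A (int j) B" for j
 obtain N where N: "\<forall>l\<ge>int N. pr G l A = (\<lambda>_ _. 0)" using bor_bound[OF GA] by blast
 obtain NE where NE: "\<forall>l\<ge>int NE. pr A l B = (\<lambda>_ _. 0)" using bor_bound[OF AB] by blast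
 have D: "is_fld (D j)" and E: "is_fld (E j)" for j unfolding D_def E_def by (intro prd_fld A B G)+
 have D0: "D i = (\<lambda>_ _. 0)" if "i \<ge> N" for i using N that by (simp add: D_def)
 have E0: "E i = (\<lambda>_ _. 0)" if "i \<ge> NE" for i using NE that by (simp add: E_def)
 note F = prd_comm[OF G A B GA N, folded D_def]
 have DB: "bo (D i) B" for i unfolding D_def by (rule GAB)
  have "\<exists>M. \<forall>l\<ge>M. pr (D j) l B = (\<lambda>_ _. 0)" for j using DB[of j] unfolding bor_def by blast
  then obtain M where M: "\<And>j l. l \<ge> M j \<Longrightarrow> pr (D j) l B = (\<lambda>_ _. 0)" by metis
  define L where "L = Max (insert (int NE) ((\<lambda>j. M j + int j - n) ` {..<N}))"
  have L: "int NE \<le> L" "j < N \<Longrightarrow> M j + int j - n \<le> L" for j by (auto simp: L_def)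
 show ?thesis
 proof (rule borI[OF A A prd_fld[OF G G B], of L])
  show "pr A l (pr G n B) = (\<lambda>_ _. 0)" if l: "l \<ge> L" for l
  proof (intro ext)
   fix q x
   have "pr A l B = (\<lambda>_ _. 0)" using NE L(1) l by auto
   then have "- pr A l (pr G n B) q x = (\<Sum>j<N. bin n j *s pr (D j) (n + l - int j) B q x)"
    using F[of n l q x] by (simp add: prd_zero_right G)
   also have "\<dots> = 0"
   proof (rule sum.neutral, intro ballI)
    fix j assume "j \<in> {..<N}"
    then have "pr (D j) (n + l - int j) B = (\<lambda>_ _. 0)" using L(2)[of j] l by (intro M) auto
    then show "bin n j *s pr (D j) (n + l - int j) B q x = 0" by simp
   qed
   finally show "pr A l (pr G n B) q x = 0" by simp
  qed
  fix m q x
  obtain K1 where K1: "\<And>u. u \<ge> K1 \<Longrightarrow> B (q + int u) x = 0" using is_fld_bound[OF B] by metis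
  obtain K2 where K2: "\<And>u. u \<ge> K2 \<Longrightarrow> G (int u) x = 0" using is_fld_bound[OF G, of 0] by auto
  obtain K3 where K3: "\<And>u. u \<ge> K3 \<Longrightarrow> B (q + int u) (A m x) = 0" using is_fld_bound[OF B] by metis
  obtain K4 where K4: "\<And>u. u \<ge> K4 \<Longrightarrow> G (int u) (A m x) = 0" using is_fld_bound[OF G, of 0] by auto
  obtain K5 where K5: "\<And>j u. u \<ge> K5 \<Longrightarrow> D j (m + int u) x = 0"
   using is_fld_uniform_fam[of D N "\<lambda>_. m", OF D D0] by metis
  obtain K6 where K6: "\<And>j u. u \<ge> K6 \<Longrightarrow> E j (m + q - int j + int u) x = 0"
   using is_fld_uniform_fam[of E NE "\<lambda>j. m + q - int j", OF E E0] by metis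
  define L where "L = K1 + K2 + K3 + K4 + K5 + K6"
  define K where "K = L + N"
  have L: "B (q + int u) x = 0" "G (int u) x = 0" "B (q + int u) (A m x) = 0" "G (int u) (A m x) = 0"
   "D j (m + int u) x = 0" "E j (m + q - int j + int u) x = 0" if "u \<ge> L" for u j
   using that unfolding L_def by (auto intro: K1 K2 K3 K4 K5 K6)
  note lin = fld_0[OF A] fld_0[OF B] fld_0[OF G]
   fld_0[OF D] fld_0[OF E]
  let ?g = "\<lambda>k. (-1) ^ k * bin n k"
  have 1: "pr G n B q y = (\<Sum>k<K. ?g k *s (G (n - int k) (B (q + int k) y) - sg n *s B (n + q - int k) (G (int k) y)))"
   if "y = x \<or> y = A m x" for y
   by (rule prd_bounded) (use that L in \<open>auto simp: K_def lin G\<close>)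
  note simps = clinear_sum[OF is_fld_linear] clinear_scale[OF is_fld_linear] clinear_diff[OF is_fld_linear]
   clinear_minus[OF is_fld_linear] A B G
   scaleC_diff_right scaleC_scaleC scaleC_sum_right
  have AG: "A m (G t y) - G t (A m y) = - (\<Sum>i<N. bin t i *s D i (t + m - int i) y)" for t y
   using bor_comm_sum[OF GA N, of t m y] unfolding D_def by (simp add: algebra_simps)
  have ABc: "A m (B t y) - B t (A m y) = (\<Sum>j<NE. bin m j *s E j (m + t - int j) y)" for t y
   using bor_comm_sum[OF AB NE, of m t y] unfolding E_def by simp
  let ?u = "\<lambda>i k. (?g k * bin (n - int k) i) *s D i (n - int k + m - int i) (B (q + int k) x)"
   and ?v = "\<lambda>i k. (?g k * (sg n * bin (int k) i)) *s B (n + q - int k) (D i (int k + m - int i) x)"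
   and ?w = "\<lambda>j k. ?g k *s (G (n - int k) (E j (m + q - int j + int k) x) - sg n *s E j (n + (m + q - int j) - int k) (G (int k) x))"
   and ?r = "\<lambda>i u. abin (n - int i) u *s D i (m + (n - int i) - int u) (B (q + int u) x)"
   and ?s = "\<lambda>i u. abin (n - int i) u *s (sg (n - int i) *s B (n - int i + q - int u) (D i (m + int u) x))"
  let ?y = "\<lambda>k. \<Sum>i<N. bin (int k) i *s B (n + q - int k) (D i (int k + m - int i) x)" and ?z = "\<lambda>k. \<Sum>i<N. bin (n - int k) i *s D i (n - int k + m - int i) (B (q + int k) x)"
  have "A m (pr G n B q x) - pr G n B q (A m x) = (\<Sum>k<K. ?g k *s (
    ((A m (G (n - int k) (B (q + int k) x)) - G (n - int k) (A m (B (q + int k) x)))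
     - sg n *s B (n + q - int k) (A m (G (int k) x) - G (int k) (A m x)))
    + (G (n - int k) (A m (B (q + int k) x) - B (q + int k) (A m x))
     - sg n *s (A m (B (n + q - int k) (G (int k) x)) - B (n + q - int k) (A m (G (int k) x))))))"
   unfolding 1[of x, simplified] 1[of "A m x", simplified]
   by (simp add: fld_sum[OF A] fld_scale[OF A])
    (simp add: sum_subtractf[symmetric] scaleC_diff_right[symmetric] del: scaleC_diff_right,
    intro sum.cong refl arg_cong[where f = "(*s) _"],
    simp add: simps)
  also have "\<dots> = (\<Sum>k<K. ?g k *s (
    (sg n *s ?y k
     - ?z k)
    + ((\<Sum>j<NE. bin m j *s G (n - int k) (E j (m + (q + int k) - int j) x))
     - sg n *s (\<Sum>j<NE. bin m j *s E j (m + (n + q - int k) - int j) (G (int k) x)))))"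
   unfolding AG ABc
   by (simp add: clinear_sum[OF is_fld_linear] clinear_scale[OF is_fld_linear] clinear_minus[OF is_fld_linear] G B)
  also have "\<dots> = (\<Sum>j<NE. bin m j *s (\<Sum>k<K. ?w j k))
    - (\<Sum>i<N. (\<Sum>k<K. ?u i k)
      - (\<Sum>k<K. ?v i k))"
  proof -
   have a: "(\<Sum>j<NE. bin m j *s (\<Sum>k<K. ?w j k))
    = (\<Sum>k<K. ?g k *s ((\<Sum>j<NE. bin m j *s G (n - int k) (E j (m + (q + int k) - int j) x))
     - sg n *s (\<Sum>j<NE. bin m j *s E j (m + (n + q - int k) - int j) (G (int k) x))))"
    unfolding scaleC_sum_right sum_subtractf[symmetric]
    by (subst sum.swap) (intro sum.cong refl, simp add: scaleC_scaleC scaleC_diff_right algebra_simps)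
   have b: "(\<Sum>i<N. (\<Sum>k<K. ?u i k)
      - (\<Sum>k<K. ?v i k))
     = - (\<Sum>k<K. ?g k *s (sg n *s ?y k
     - ?z k))"
    unfolding scaleC_sum_right sum_subtractf[symmetric] sum_negf[symmetric]
    by (subst sum.swap) (intro sum.cong refl, simp add: scaleC_scaleC scaleC_diff_right)
   show ?thesis unfolding a b by (simp only: scaleC_add_right sum.distrib) simp
  qed
  also have "(\<Sum>j<NE. bin m j *s (\<Sum>k<K. ?w j k))
    = (\<Sum>j<NE. bin m j *s pr G n (E j) (m + q - int j) x)"
   by (intro sum.cong refl arg_cong[where f = "(*s) _"], rule prd_bounded[symmetric])
    (use L in \<open>auto simp: K_def lin G\<close>)
  \<comment> \<open>The two double sums stemming from the commutators of \<open>G\<close> and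
    \<open>A\<close> are the two halves of a Borcherds sum of \<open>D i\<close> with
    \<open>B\<close>; its other side consists of products of fields again.\<close>
  also have "(\<Sum>i<N. (\<Sum>k<K. ?u i k)
      - (\<Sum>k<K. ?v i k))
    = (\<Sum>i<N. bin n i *s brs (D i) (D i) B m (n - int i) q x)"
  proof (intro sum.cong refl)
   fix i assume "i \<in> {..<N}"
   then have i: "i < N" by simp
   have br: "brs (D i) (D i) B m (n - int i) q x =
     (\<Sum>u<K. ?r i u)
    - (\<Sum>u<K-i. ?s i u)"
    unfolding brs_split[OF D D B]
    by (subst SA_nat[of K], use L in \<open>auto simp: K_def lin\<close>)
     (subst SA_nat[of "K-i"], use L i in \<open>auto simp: K_def lin scaleC_sum_right scaleC_scaleC mult_ac\<close>)
   have "(\<Sum>k<K. ?u i k) =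
     bin n i *s (\<Sum>u<K. ?r i u)"
    unfolding scaleC_sum_right scaleC_scaleC
   proof (intro sum.cong refl)
    fix k :: nat
    have "?g k * bin (n - int k) i = (-1) ^ k * (bin n k * bin (n - int k) i)" by (simp only: mult_ac)
    also have "\<dots> = bin n i * abin (n - int i) k"
     unfolding bin_comp[of n k i] by (simp only: mult_ac)
    finally show "?u i k =
     (bin n i * abin (n - int i) k) *s D i (m + (n - int i) - int k) (B (q + int k) x)"
     by (simp add: algebra_simps)
   qed
   moreover have "(\<Sum>k<K. ?v i k) =
     bin n i *s (\<Sum>u<K-i. ?s i u)"
   proof -
    let ?f = "\<lambda>k. ?v i k"
    have "(\<Sum>k<K. ?f k) = (\<Sum>k\<in>{i..<K}. ?f k)"
     by (intro sum.mono_neutral_right) (auto simp: bin_nat_0[simplified])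
    also have "\<dots> = (\<Sum>u<K-i. ?f (u + i))"
     by (rule sum.reindex_bij_witness[of _ "\<lambda>u. u + i" "\<lambda>u. u - i"]) auto
    also have "\<dots> = bin n i *s (\<Sum>u<K-i. ?s i u)"
     unfolding scaleC_sum_right scaleC_scaleC
    proof (intro sum.cong refl)
     fix u :: nat
     have s: "sg (n - int i) = sg n * (-1) ^ i" by (simp add: sg_diff sg_nat)
     have "?g (u + i) * (sg n * bin (int (u + i)) i) = (-1) ^ u * (bin n (u + i) * bin (int (u + i)) i) * (sg n * (-1) ^ i)"
      by (simp only: power_add mult_ac)
     also have "\<dots> = bin n i * ((-1) ^ u * bin (n - int i) u * sg (n - int i))"
      unfolding bin_comp_nat s by (simp only: mult_ac)
     finally show "?f (u + i) = (bin n i * ((-1) ^ u * bin (n - int i) u * sg (n - int i))) *s B (n - int i + q - int u) (D i (m + int u) x)"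
      by (simp add: algebra_simps)
    qed
    finally show ?thesis .
   qed
   ultimately show "(\<Sum>k<K. ?u i k)
      - (\<Sum>k<K. ?v i k) =
     bin n i *s brs (D i) (D i) B m (n - int i) q x"
    unfolding br by (simp only: scaleC_diff_right)
  qed
  also have "\<dots> = (\<Sum>i<N. bin n i *s bls (\<lambda>l. pr (D i) l B) m (n - int i) q x)"
   using DB unfolding bor_def by simp
  finally have main: "A m (pr G n B q x) - pr G n B q (A m x) =
   (\<Sum>j<NE. bin m j *s pr G n (E j) (m + q - int j) x) - (\<Sum>i<N. bin n i *s bls (\<lambda>l. pr (D i) l B) m (n - int i) q x)" .
  have "\<exists>Z. \<forall>j. \<forall>k\<ge>Z j. pr (D j) (n - int j + int k) B = (\<lambda>_ _. 0)"
  proof (rule choice, rule allI)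
   fix j
   obtain M where M: "\<And>l. l \<ge> int M \<Longrightarrow> pr (D j) l B = (\<lambda>_ _. 0)" using bor_bound[OF DB[of j]] by blast
   show "\<exists>Z. \<forall>k\<ge>Z. pr (D j) (n - int j + int k) B = (\<lambda>_ _. 0)"
    by (rule exI[of _ "M + j + nat \<bar>n\<bar>"]) (auto intro!: M)
  qed
  then obtain Z where Z: "\<And>j k. k \<ge> Z j \<Longrightarrow> pr (D j) (n - int j + int k) B = (\<lambda>_ _. 0)" by blast
  define R where "R = Max (insert NE (Z ` {..<N}))"
  have R: "NE \<le> R" "j < N \<Longrightarrow> Z j \<le> R" for j by (auto simp: R_def)
  have "(\<Sum>j<NE. bin m j *s pr G n (E j) (m + q - int j) x) = (\<Sum>j<R. bin m j *s pr G n (E j) (m + q - int j) x)"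
   by (rule sum.mono_neutral_left) (use R E0 in \<open>auto simp: prd_zero_right G\<close>)
  moreover have "(\<Sum>i<N. bin n i *s bls (\<lambda>l. pr (D i) l B) m (n - int i) q x) =
    (\<Sum>j<R. bin m j *s (\<Sum>i<N. bin n i *s pr (D i) (n - int i + int j) B (m + q - int j) x))"
  proof -
   have "bls (\<lambda>l. pr (D i) l B) m (n - int i) q x = (\<Sum>j<R. bin m j *s pr (D i) (n - int i + int j) B (m + q - int j) x)" if "i < N" for i
    unfolding bls_def by (rule SA_nat) (use R(2)[OF that] Z in auto)
   then show ?thesis unfolding scaleC_sum_right
    by (subst sum.swap) (simp add: scaleC_sum_right scaleC_scaleC mult_ac)
  qed
  ultimately have "A m (pr G n B q x) - pr G n B q (A m x) = (\<Sum>j<R. bin m j *s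
   (pr G n (E j) (m + q - int j) x - (\<Sum>i<N. bin n i *s pr (D i) (n - int i + int j) B (m + q - int j) x)))"
   unfolding main by (simp only: sum_subtractf scaleC_diff_right)
  \<comment> \<open>By \<open>prd_comm\<close> the bracket is the j-th product of \<open>A\<close>
    with \<open>pr G n B\<close>, so the commutator formula for this pair is reached.\<close>
  also have "\<dots> = (\<Sum>j<R. bin m j *s pr A (int j) (pr G n B) (m + q - int j) x)"
   by (intro sum.cong refl arg_cong[where f = "(*s) _"])
    (use F[of n "int _"] in \<open>simp add: E_def algebra_simps\<close>)
  also have "\<dots> = Sum_any (\<lambda>j. bin m j *s pr A (int j) (pr G n B) (m + q - int j) x)"
  proof (rule SA_nat[symmetric])
   fix j assume j: "R \<le> j"
   have "pr A (int j) B = (\<lambda>_ _. 0)" using E0[of j] R(1) j by (simp add: E_def)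
   then have "- pr A (int j) (pr G n B) (m + q - int j) x = (\<Sum>i<N. bin n i *s pr (D i) (n + int j - int i) B (m + q - int j) x)"
    using F[of n "int j" "m + q - int j" x] by (simp add: prd_zero_right G)
   also have "\<dots> = 0"
   proof (rule sum.neutral, intro ballI)
    fix i assume "i \<in> {..<N}"
    then have "pr (D i) (n - int i + int j) B = (\<lambda>_ _. 0)" using R(2)[of i] j by (intro Z) auto
    then show "bin n i *s pr (D i) (n + int j - int i) B (m + q - int j) x = 0" by (simp add: algebra_simps)
   qed
   finally show "bin m j *s pr A (int j) (pr G n B) (m + q - int j) x = 0" by simp
  qed
  finally show "A m (pr G n B q x) - pr G n B q (A m x) = Sum_any (\<lambda>j. bin m j *s pr A (int j) (pr G n B) (m + q - int j) x)" .
 qed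
qed

section \<open>Reconstruction of modules from generators\<close>

definition jac :: "('a, int, 'm, 'm) vop \<Rightarrow> ('a, int, 'x::complex_vector, 'x) vop \<Rightarrow>
  ('a, int, 'y::complex_vector, 'y) vop \<Rightarrow> ('m, int, 'x, 'y) vop \<Rightarrow> 'a \<Rightarrow> 'm \<Rightarrow> bool" where
 "jac Y1 Y2 Y3 I a w \<longleftrightarrow>
   (\<forall>p l q x. bls (\<lambda>l. I (Y1 a l w)) p l q x = brs (Y3 a) (Y2 a) (I w) p l q x)"

lemma jacobi_iff_jac:
 fixes I :: "('m, int, 'x::complex_vector, 'y::complex_vector) vop"
 shows "jacobi A W Y1 Y2 Y3 I \<longleftrightarrow> (\<forall>a\<in>A. \<forall>w\<in>W. jac Y1 Y2 Y3 I a w)"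
 unfolding jacobi_def jac_def bls_def brs_def by (auto simp: add_ac)

definition is_vop :: "('m::complex_vector, int, 'x::complex_vector, 'y::complex_vector) vop \<Rightarrow> bool" where
 "is_vop I \<longleftrightarrow> (\<forall>a. is_fld (I a)) \<and> (\<forall>n x. clinear (\<lambda>a. I a n x))"

lemma is_vop_fld: "is_vop I \<Longrightarrow> is_fld (I a)" by (simp add: is_vop_def)
lemma is_vop_linear: "is_vop I \<Longrightarrow> clinear (I a n)" by (simp add: is_vop_def is_fld_def)
lemma is_vop_linear1: "is_vop I \<Longrightarrow> clinear (\<lambda>a. I a n x)" by (simp add: is_vop_def)

lemmas vop_0 = clinear_0[OF is_vop_linear] and vop_add = clinear_add[OF is_vop_linear] and vop_scale = clinear_scale[OF is_vop_linear] and vop_sum = clinear_sum[OF is_vop_linear] and vop_diff = clinear_diff[OF is_vop_linear]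

lemmas vop1_0 = clinear_0[OF is_vop_linear1] and vop1_add = clinear_add[OF is_vop_linear1] and vop1_scale = clinear_scale[OF is_vop_linear1] and vop1_sum = clinear_sum[OF is_vop_linear1] and vop1_diff = clinear_diff[OF is_vop_linear1] and vop1_minus = clinear_minus[OF is_vop_linear1] and vop1_Sum_any = clinear_Sum_any[OF is_vop_linear1]

lemma is_vop_0: "is_vop I \<Longrightarrow> I 0 = (\<lambda>_ _. 0)"
 by (auto simp: fun_eq_iff clinear_0[OF is_vop_linear1])

lemma vertex_operator_UNIV: "vertex_operator UNIV I \<longleftrightarrow> is_vop I"
proof
 assume I: "vertex_operator UNIV I"
 have "\<exists>N::int. \<forall>n\<ge>N. I a n x = 0" for a x
 proof -
  obtain N :: nat where N: "\<forall>n\<ge>N. I a (0 + of_nat n) x = 0" using I unfolding vertex_operator_def by blast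
  have "I a n x = 0" if "n \<ge> int N" for n using N[rule_format, of "nat n"] that by (simp add: nat_le_iff le_nat_iff)
  then show ?thesis by blast
 qed
 moreover have "clinear (\<lambda>a. I a n x)" for n x using I unfolding vertex_operator_def clinear_iff by simp
 ultimately show "is_vop I" using I unfolding is_vop_def is_fld_def vertex_operator_def by auto
next
 assume I: "is_vop I"
 have "\<exists>N::nat. \<forall>n\<ge>N. I a (q + of_nat n) x = 0" for a q x
  using is_fld_bound[OF is_vop_fld[OF I]] by auto
 then show "vertex_operator UNIV I"
  unfolding vertex_operator_def using is_vop_linear[OF I]
  by (auto simp: vop1_add[OF I] vop1_scale[OF I])
qed

lemma is_vop_subset: "is_vop I \<Longrightarrow> vertex_operator A I"
 using vertex_operator_UNIV[of I] unfolding vertex_operator_def by blast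

lemma jac_prd:
 assumes "jac Y1 Y2 Y3 I a w"
 shows "I (Y1 a l w) = prd (Y3 a) (Y2 a) l (I w)"
 using assms bls_0[of "\<lambda>l. I (Y1 a l w)" l] unfolding jac_def prd_def fun_eq_iff by metis

lemma jac_comm:
 assumes "jac Y1 Y2 Y3 I a w"
 shows "Y3 a m (I w n x) - I w n (Y2 a m x) = Sum_any (\<lambda>i::nat. bin m i *s I (Y1 a (int i) w) (m + n - int i) x)"
proof -
 have "bls (\<lambda>l. I (Y1 a l w)) m 0 n x = brs (Y3 a) (Y2 a) (I w) m 0 n x" using assms unfolding jac_def by blast
 then show ?thesis unfolding brs_0 bls_def by simp
qed

lemma fld_bound0: "is_fld A \<Longrightarrow> \<exists>N::nat. \<forall>l\<ge>int N. A l x = 0"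
proof -
 assume "is_fld A"
 then obtain K where K: "\<forall>i\<ge>K. A (0 + int i) x = 0" using is_fld_bound by blast
 have "A l x = 0" if "l \<ge> int K" for l using K[rule_format, of "nat l"] that by (simp add: le_nat_iff)
 then show ?thesis by blast
qed

lemma jac_bor:
 assumes "is_fld (Y1 a)" "is_vop I" "jac Y1 Y2 Y3 I a w"
 shows "bor (Y3 a) (Y2 a) (I w)"
proof -
 obtain N where "\<forall>l\<ge>int N. Y1 a l w = 0" using fld_bound0[OF assms(1)] by blast
 then have "\<forall>l\<ge>int N. prd (Y3 a) (Y2 a) l (I w) = (\<lambda>_ _. 0)"
  using is_vop_0[OF assms(2)] by (simp add: jac_prd[OF assms(3), symmetric])
 then show ?thesis using assms(3) unfolding bor_def jac_def jac_prd[OF assms(3)] by blast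
qed

lemma bor_jac:
 assumes "\<And>l. I (Y1 a l w) = prd (Y3 a) (Y2 a) l (I w)" "bor (Y3 a) (Y2 a) (I w)"
 shows "jac Y1 Y2 Y3 I a w"
 using assms unfolding jac_def bor_def by simp

lemma jac_lin:
 assumes Y1: "is_vop Y1" and Y2: "is_vop Y2" and Y3: "is_vop Y3" and I: "is_vop I"
 shows jac_add_left: "jac Y1 Y2 Y3 I a w \<Longrightarrow> jac Y1 Y2 Y3 I b w \<Longrightarrow> jac Y1 Y2 Y3 I (a + b) w"
  and jac_scale_left: "jac Y1 Y2 Y3 I a w \<Longrightarrow> jac Y1 Y2 Y3 I (c *s a) w"
  and jac_add_right: "jac Y1 Y2 Y3 I a w \<Longrightarrow> jac Y1 Y2 Y3 I a v \<Longrightarrow> jac Y1 Y2 Y3 I a (w + v)"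
  and jac_scale_right: "jac Y1 Y2 Y3 I a w \<Longrightarrow> jac Y1 Y2 Y3 I a (c *s w)"
proof -
 note s = vop_add[OF Y1] vop_add[OF Y2] vop_add[OF Y3]
  vop_add[OF I] vop1_add[OF Y1] vop1_add[OF Y2]
  vop1_add[OF Y3] vop1_add[OF I]
 note c = vop_scale[OF Y1] vop_scale[OF Y2] vop_scale[OF Y3]
  vop_scale[OF I] vop1_scale[OF Y1] vop1_scale[OF Y2]
  vop1_scale[OF Y3] vop1_scale[OF I]
 have fl: "fs (\<lambda>i. bin p i *s I (Y1 a (l + int i) w) (n i) x)" for p a l w n x
 proof -
  obtain K where "\<forall>i\<ge>K. Y1 a (l + int i) w = 0" using is_fld_bound[OF is_vop_fld[OF Y1]] by blast
  then show ?thesis by (intro fs_nat[of K]) (simp add: is_vop_0[OF I])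
 qed
 have fr1: "fs (\<lambda>i. abin l i *s Y3 a (p + l - int i) (I w (q + int i) x))" for a w p l q x
  by (intro fs_scale fld_fs_lin is_vop_fld I is_vop_linear Y3)
 have fr2: "fs (\<lambda>i. abin l i *s I w (l + q - int i) (Y2 a (p + int i) x))" for a w p l q x
  by (intro fs_scale fld_fs_lin is_vop_fld I is_vop_linear Y2)
 note br = brs_split[OF is_vop_fld[OF Y3] is_vop_fld[OF Y2] is_vop_fld[OF I]]
 have L1: "bls (\<lambda>l. I (Y1 (a + b) l w)) p l q x = bls (\<lambda>l. I (Y1 a l w)) p l q x + bls (\<lambda>l. I (Y1 b l w)) p l q x" for a b w p l q x
  unfolding bls_def s scaleC_add_right by (intro SA_add fl)
 have L2: "bls (\<lambda>l. I (Y1 a l (w + v))) p l q x = bls (\<lambda>l. I (Y1 a l w)) p l q x + bls (\<lambda>l. I (Y1 a l v)) p l q x" for a v w p l q x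
  unfolding bls_def s scaleC_add_right by (intro SA_add fl)
 have L3: "bls (\<lambda>l. I (Y1 (c *s a) l w)) p l q x = c *s bls (\<lambda>l. I (Y1 a l w)) p l q x" for a c w p l q x
  unfolding bls_def c SA_scale[symmetric] by (simp add: scaleC_scaleC mult.commute)
 have L4: "bls (\<lambda>l. I (Y1 a l (c *s w))) p l q x = c *s bls (\<lambda>l. I (Y1 a l w)) p l q x" for a c w p l q x
  unfolding bls_def c SA_scale[symmetric] by (simp add: scaleC_scaleC mult.commute)
 have R1: "brs (Y3 (a + b)) (Y2 (a + b)) (I w) p l q x = brs (Y3 a) (Y2 a) (I w) p l q x + brs (Y3 b) (Y2 b) (I w) p l q x" for a b w p l q x
  unfolding br s scaleC_add_right SA_add[OF fr1 fr1] SA_add[OF fr2 fr2] by (simp add: scaleC_add_right)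
 have R2: "brs (Y3 a) (Y2 a) (I (w + v)) p l q x = brs (Y3 a) (Y2 a) (I w) p l q x + brs (Y3 a) (Y2 a) (I v) p l q x" for a v w p l q x
  unfolding br s scaleC_add_right SA_add[OF fr1 fr1] SA_add[OF fr2 fr2] by (simp add: scaleC_add_right)
 have R3: "brs (Y3 (c *s a)) (Y2 (c *s a)) (I w) p l q x = c *s brs (Y3 a) (Y2 a) (I w) p l q x" for a c w p l q x
  unfolding brs_def c SA_scale[symmetric] by (simp add: scaleC_scaleC scaleC_diff_right mult_ac)
 have R4: "brs (Y3 a) (Y2 a) (I (c *s w)) p l q x = c *s brs (Y3 a) (Y2 a) (I w) p l q x" for a c w p l q x
  unfolding brs_def c SA_scale[symmetric] by (simp add: scaleC_scaleC scaleC_diff_right mult_ac)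
 show "jac Y1 Y2 Y3 I a w \<Longrightarrow> jac Y1 Y2 Y3 I b w \<Longrightarrow> jac Y1 Y2 Y3 I (a + b) w"
  "jac Y1 Y2 Y3 I a w \<Longrightarrow> jac Y1 Y2 Y3 I (c *s a) w"
  "jac Y1 Y2 Y3 I a w \<Longrightarrow> jac Y1 Y2 Y3 I a v \<Longrightarrow> jac Y1 Y2 Y3 I a (w + v)"
  "jac Y1 Y2 Y3 I a w \<Longrightarrow> jac Y1 Y2 Y3 I a (c *s w)"
  unfolding jac_def L1 L2 L3 L4 R1 R2 R3 R4 by simp_all
qed

text \<open>In contrast to \<open>vertex_subalgebra\<close> only modes of generators act, so an
  induction changes the right-hand vector by one generator at a time.\<close>

inductive_set gen_span :: "('v::complex_vector, int, 'v, 'v) vop \<Rightarrow> 'v set \<Rightarrow> 'v set \<Rightarrow> 'v set" for Y S G where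
 base: "a \<in> S \<Longrightarrow> a \<in> gen_span Y S G"
| add: "a \<in> gen_span Y S G \<Longrightarrow> b \<in> gen_span Y S G \<Longrightarrow> a + b \<in> gen_span Y S G"
| scale: "a \<in> gen_span Y S G \<Longrightarrow> c *s a \<in> gen_span Y S G"
| mode: "g \<in> G \<Longrightarrow> b \<in> gen_span Y S G \<Longrightarrow> Y g n b \<in> gen_span Y S G"

text \<open>In the algebra, a_l g_n b is rewritten by the commutator of g and a;
  \<open>prd_comm\<close> performs the same rewriting on products of fields. The commutator brings
  in the vectors g_i a, hence the assumption on them.\<close>

lemma jac_right_mode:
 assumes YV: "is_vop YV" and YW: "is_vop YW"
  and gV: "jac YV YV YV YV g a" and gW: "\<And>b. jac YV YW YW YW g b"
  and ab: "jac YV YW YW YW a b" and gab: "\<And>i. jac YV YW YW YW (YV g (int i) a) b"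
 shows "jac YV YW YW YW a (YV g n b)"
proof (rule bor_jac)
 note f = is_vop_fld[OF YW] is_vop_fld[OF YV]
 have B1: "bo (YW g) (YW a)" by (rule jac_bor[OF f(2) YW gW])
 have B2: "bo (YW a) (YW b)" by (rule jac_bor[OF f(2) YW ab])
 have P1: "YW (YV g i y) = pr (YW g) i (YW y)" for i y by (rule jac_prd[OF gW])
 have B3: "bo (pr (YW g) (int i) (YW a)) (YW b)" for i
  using jac_bor[OF f(2) YW gab] unfolding P1 .
 show "bo (YW a) (YW (YV g n b))" unfolding P1 by (rule bor_right[OF f(1) f(1) f(1) B1 B2 B3])
 fix l
 obtain N where N: "\<forall>l\<ge>int N. YV g l a = 0" using fld_bound0[OF f(2)] by blast
 then have N': "\<forall>l\<ge>int N. pr (YW g) l (YW a) = (\<lambda>_ _. 0)" using is_vop_0[OF YW] P1 by metis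
 have "YV g n (YV a l b) - YV a l (YV g n b) = Sum_any (\<lambda>i. bin n i *s YV (YV g (int i) a) (n + l - int i) b)"
  by (rule jac_comm[OF gV])
 also have "\<dots> = (\<Sum>i<N. bin n i *s YV (YV g (int i) a) (n + l - int i) b)"
  by (rule SA_nat) (use N in \<open>auto simp: is_vop_0[OF YV]\<close>)
 finally have e: "YV a l (YV g n b) = YV g n (YV a l b) - (\<Sum>i<N. bin n i *s YV (YV g (int i) a) (n + l - int i) b)"
  by (simp add: algebra_simps)
 show "YW (YV a l (YV g n b)) = pr (YW a) l (YW (YV g n b))"
 proof (intro ext)
  fix q x
  have "YW (YV a l (YV g n b)) q x = pr (YW g) n (pr (YW a) l (YW b)) q x
    - (\<Sum>i<N. bin n i *s pr (pr (YW g) (int i) (YW a)) (n + l - int i) (YW b) q x)"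
   unfolding e
   by (simp add: vop1_diff[OF YW] vop1_sum[OF YW]
     vop1_scale[OF YW] P1 jac_prd[OF ab] jac_prd[OF gab, unfolded P1])
  then show "YW (YV a l (YV g n b)) q x = pr (YW a) l (YW (YV g n b)) q x"
   using prd_comm[OF f(1)[of g] f(1)[of a] f(1)[of b] B1 N', of n l q x] by (simp add: P1 f algebra_simps)
 qed
qed

text \<open>The induction runs over \<open>b\<close> for all \<open>a\<close> at once, because its
  step uses the pairs formed by g_i a and \<open>b\<close>.\<close>

theorem jac_reconstruction:
 assumes YV: "is_vop YV" and YW: "is_vop YW"
  and gV: "\<And>g b. g \<in> G \<Longrightarrow> jac YV YV YV YV g b" and gW: "\<And>g b. g \<in> G \<Longrightarrow> jac YV YW YW YW g b"
  and S: "\<And>a b. b \<in> S \<Longrightarrow> jac YV YW YW YW a b"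
  and b: "b \<in> gen_span YV S G"
 shows "jac YV YW YW YW a b"
 using b
proof (induction arbitrary: a)
 case (base b) then show ?case by (rule S)
next
 case (add b c) then show ?case by (intro jac_add_right YV YW)
next
 case (scale b c) then show ?case by (intro jac_scale_right YV YW)
next
 case (mode g b n)
 show ?case by (intro jac_right_mode YV YW gV gW mode)
qed

section \<open>Products determined by commutators\<close>

definition id_fld :: "('x::complex_vector, 'x) fld" where
 "id_fld n x = (if n = -1 then x else 0)"

text \<open>The modes of dA/dz.\<close>

definition der :: "('x, 'y::complex_vector) fld \<Rightarrow> ('x, 'y) fld" where
 "der A n x = - of_int n *s A (n - 1) x"

lemma is_fld_id: "is_fld id_fld"
proof (rule is_fldI)
 fix x :: 'a
 show "\<exists>N. \<forall>n\<ge>N. id_fld n x = 0" by (rule exI[of _ 0]) (simp add: id_fld_def)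
qed (simp add: id_fld_def clinear_iff)

lemma is_fld_der: "is_fld A \<Longrightarrow> is_fld (der A)"
 unfolding der_def using is_fld_scale[OF is_fld_shift, of A "\<lambda>n. - of_int n" "-1"] by simp

text \<open>The binomial inversion that recovers the products of nonnegative index from the
  commutators of the modes.\<close>

lemma alternating_choose: "(\<Sum>j\<le>l. (-1) ^ j * bin (int l) j * bin (int l - int j) i) = (if l = i then 1 else 0)"
proof -
 have "(\<Sum>j\<le>l. (-1) ^ j * bin (int l) j * bin (int l - int j) i) = bin (int l) i * (\<Sum>j\<le>l. (-1) ^ j * bin (int l - int i) j)"
  unfolding sum_distrib_left mult.assoc bin_comp[of "int l" _ i]
  by (simp only: mult_ac)
 also have "\<dots> = (if l = i then 1 else 0)"
 proof (cases "i > l")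
  case True then show ?thesis using bin_nat_0[of l i] by simp
 next
  case False
  have "(\<Sum>j\<le>l. (-1) ^ j * bin (int l - int i) j) = (\<Sum>j\<le>l. bin (int (l - i)) j * (-1) ^ j)"
   using False by (simp add: of_nat_diff mult.commute)
  also have "\<dots> = (-1) ^ l * bin (int (l - i) - 1) l"
   using gbinomial_sum_lower_neg[of "of_int (int (l - i)) :: complex" l] by simp
  also have "bin (int (l - i) - 1) l = (if l = i then (-1) ^ l else 0)"
  proof (cases "l = i")
   case True
   have "(- 1 :: complex) gchoose l = (-1) ^ l" using gbinomial_minus[of "1 :: complex" l]
    by (simp add: binomial_gbinomial[symmetric])
   then show ?thesis using True by simp
  next
   case False
   then have "int (l - i) - 1 = int (l - i - 1)" using \<open>\<not> i > l\<close> by simp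
   moreover have "bin (int (l - i - 1)) l = 0" by (rule bin_nat_0) (use False \<open>\<not> i > l\<close> in arith)
   ultimately show ?thesis using False by metis
  qed
  also have "(-1) ^ l * (if l = i then (-1) ^ l else 0) = (if l = i then 1 else (0::complex))"
   by (simp add: power_mult_distrib[symmetric])
  finally show ?thesis by (simp add: binomial_gbinomial[symmetric])
 qed
 finally show ?thesis .
qed

text \<open>For a nonnegative index both expansions are finite. Reversing the order of the second
  one pairs the terms into commutators.\<close>

lemma prd_nat:
 "prd A' A (int l) B q x = (\<Sum>j\<le>l. abin (int l) j *s
   (A' (int l - int j) (B (q + int j) x) - B (q + int j) (A (int l - int j) x)))"
proof -
 let ?b = "\<lambda>j. (-1) ^ j * bin (int l) j"
 have "prd A' A (int l) B q x = (\<Sum>j<Suc l. ?b j *s (A' (int l - int j) (B (q + int j) x)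
   - sg (int l) *s B (int l + q - int j) (A (int j) x)))"
  unfolding prd_def brs_def
  by (subst SA_nat[of "Suc l"]) (use bin_nat_0[of l] in \<open>auto simp: not_less\<close>)
 also have "\<dots> = (\<Sum>j\<le>l. ?b j *s A' (int l - int j) (B (q + int j) x))
   - (\<Sum>j\<le>l. (?b j * (-1) ^ l) *s B (int l + q - int j) (A (int j) x))"
  by (simp add: lessThan_Suc_atMost scaleC_diff_right sum_subtractf scaleC_scaleC sg_nat)
 also have "(\<Sum>j\<le>l. (?b j * (-1) ^ l) *s B (int l + q - int j) (A (int j) x)) =
   (\<Sum>j\<le>l. ?b j *s B (q + int j) (A (int l - int j) x))"
 proof (rule sum.reindex_bij_witness[of _ "\<lambda>j. l - j" "\<lambda>j. l - j"])
  fix j assume "j \<in> {..l}"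
  then have j: "j \<le> l" by simp
  have "(-1 :: complex) ^ (l - j) = (-1) ^ j * (-1) ^ l"
  proof -
   have "(-1 :: complex) ^ l = (-1) ^ j * (-1) ^ (l - j)" using j by (simp add: power_add[symmetric])
   then show ?thesis by (simp only: left_minus_one_mult_self)
  qed
  moreover have "bin (int l) (l - j) = bin (int l) j"
   using binomial_symmetric[OF j] by (simp only: bin_nat)
  ultimately show "?b (l - j) *s B (q + int (l - j)) (A (int l - int (l - j)) x) = (?b j * (-1) ^ l) *s B (int l + q - int j) (A (int j) x)"
   using j by (simp add: of_nat_diff algebra_simps)
 qed auto
 finally show ?thesis by (simp add: scaleC_diff_right sum_subtractf)
qed

text \<open>The coefficients of a commutator formula are unique, since its binomial sum can be
  inverted; hence they are the products. Explicit commutators thus give products without any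
  expansion of normal orderings.\<close>

lemma comm_prd:
 assumes c: "\<And>m n x. A' m (B n x) - B n (A m x) = (\<Sum>i<N. bin m i *s C i (m + n - int i) x)"
 shows "prd A' A (int l) B = (if l < N then C l else (\<lambda>_ _. 0))"
proof (intro ext)
 fix q x
 have "prd A' A (int l) B q x = (\<Sum>j\<le>l. \<Sum>i<N. ((-1) ^ j * bin (int l) j * bin (int l - int j) i) *s C i (int l + q - int i) x)"
  unfolding prd_nat c by (simp add: scaleC_sum_right scaleC_scaleC algebra_simps)
 also have "\<dots> = (\<Sum>i<N. (\<Sum>j\<le>l. (-1) ^ j * bin (int l) j * bin (int l - int j) i) *s C i (int l + q - int i) x)"
  by (subst sum.swap) (simp only: scaleC_sum_left)
 also have "\<dots> = (\<Sum>i<N. (if l = i then C i (int l + q - int i) x else 0))"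
  unfolding alternating_choose by (intro sum.cong refl) (simp add: scaleC_one)
 finally show "prd A' A (int l) B q x = (if l < N then C l else (\<lambda>_ _. 0)) q x"
  by simp
qed

lemma comm_bor:
 assumes f: "is_fld A'" "is_fld A" "is_fld B"
  and c: "\<And>m n x. A' m (B n x) - B n (A m x) = (\<Sum>i<N. bin m i *s C i (m + n - int i) x)"
 shows "bor A' A B"
proof (rule borI[OF f, of "int N"])
 note p = comm_prd[OF c]
 show "prd A' A l B = (\<lambda>_ _. 0)" if "l \<ge> int N" for l
 proof -
  have "prd A' A (int (nat l)) B = (\<lambda>_ _. 0)" unfolding p using that by auto
  then show ?thesis using that by simp
 qed
 show "A' m (B n x) - B n (A m x) = Sum_any (\<lambda>i. bin m i *s prd A' A (int i) B (m + n - int i) x)" for m n x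
  unfolding p c by (subst SA_nat[of N]) auto
qed

lemma comm_zero_prd:
 assumes "\<And>m n x. A' m (B n x) = B n (A m x)" "l \<ge> 0"
 shows "prd A' A l B = (\<lambda>_ _. 0)"
proof -
 have "prd A' A (int (nat l)) B = (if nat l < 0 then (\<lambda>_ _ _. 0) (nat l) else (\<lambda>_ _. 0))"
  by (rule comm_prd) (simp only: assms(1) sum.empty lessThan_0 diff_self)
 then show ?thesis using assms(2) by simp
qed

lemma comm_zero_bor:
 assumes "is_fld A'" "is_fld A" "is_fld B" "\<And>m n x. A' m (B n x) = B n (A m x)"
 shows "bor A' A B"
 by (rule comm_bor[OF assms(1-3), where N = 0 and C = "\<lambda>_ _ _. 0"]) (simp only: assms(4) sum.empty lessThan_0 diff_self)

lemma prd_id_left: "prd id_fld id_fld l B = (if l = -1 then B else (\<lambda>_ _. 0))" if "is_fld B"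
proof (cases "l \<ge> 0")
 case True then show ?thesis
  using comm_zero_prd[of id_fld B id_fld l] fld_0[OF that] by (auto simp: id_fld_def)
next
 case False
 show ?thesis
 proof (intro ext)
  fix q x
  have "prd id_fld id_fld l B q x = Sum_any (\<lambda>i::nat. if l = -1 \<and> i = 0 then B q x else 0)"
   unfolding prd_def brs_def
   by (rule Sum_any.cong) (use False that in \<open>auto simp: id_fld_def clinear_0[OF is_fld_linear] scaleC_one\<close>)
  also have "\<dots> = (if l = -1 then B q x else 0)"
   by (subst SA_single[of 0]) auto
  finally show "prd id_fld id_fld l B q x = (if l = -1 then B else (\<lambda>_ _. 0)) q x" by simp
 qed
qed

lemma prd_m1: "prd A' A (-1) B q x = Sum_any (\<lambda>i::nat. A' (- 1 - int i) (B (q + int i) x) + B (q - 1 - int i) (A (int i) x))"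
 unfolding prd_def brs_def
proof (rule Sum_any.cong)
 fix i :: nat
 have "(-1) ^ i * bin (-1) i = 1" using bin_negate[of "-1" i] binomial_gbinomial[of i i, where 'a=complex]
  by (simp add: power_mult_distrib[symmetric])
 moreover have "sg (-1) = -1" by simp
 ultimately show "abin (-1) i *s (A' (0 + - 1 - int i) (B (q + int i) x) - sg (-1) *s B (- 1 + q - int i) (A (0 + int i) x))
   = A' (- 1 - int i) (B (q + int i) x) + B (q - 1 - int i) (A (int i) x)"
  by (simp add: scaleC_one algebra_simps)
qed

lemma prd_id_right: "prd A A (-1) id_fld = A" if "is_fld A"
proof (intro ext)
 fix q x
 show "prd A A (-1) id_fld q x = A q x"
 proof (cases "q \<ge> 0")
  case True
  have "Sum_any (\<lambda>i::nat. A (- 1 - int i) (id_fld (q + int i) x) + id_fld (q - 1 - int i) (A (int i) x)) =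
   A (- 1 - int (nat q)) (id_fld (q + int (nat q)) x) + id_fld (q - 1 - int (nat q)) (A (int (nat q)) x)"
   by (rule SA_single) (use True that in \<open>auto simp: id_fld_def clinear_0[OF is_fld_linear]\<close>)
  then show ?thesis unfolding prd_m1 using True that by (simp add: id_fld_def clinear_0[OF is_fld_linear])
 next
  case False
  have "Sum_any (\<lambda>i::nat. A (- 1 - int i) (id_fld (q + int i) x) + id_fld (q - 1 - int i) (A (int i) x)) =
   A (- 1 - int (nat (-1-q))) (id_fld (q + int (nat (-1-q))) x) + id_fld (q - 1 - int (nat (-1-q))) (A (int (nat (-1-q))) x)"
   by (rule SA_single) (use False that in \<open>auto simp: id_fld_def clinear_0[OF is_fld_linear]\<close>)
  then show ?thesis unfolding prd_m1 using False that by (simp add: id_fld_def clinear_0[OF is_fld_linear])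
 qed
qed

section \<open>Derivatives of products of fields\<close>

lemma bin_absorb: "bin l (Suc i) * of_nat (Suc i) = of_int l * bin (l - 1) i"
 using gbinomial_absorption[of i "of_int l :: complex"] by (simp add: mult.commute)

lemma bin_absorb_comp: "bin l i * (of_int l - of_nat i) = of_int l * bin (l - 1) i"
 using gbinomial_absorb_comp[of "of_int l :: complex" i] by (simp add: mult.commute)

lemma alt_absorb:
 fixes f :: "nat \<Rightarrow> 'v::complex_vector"
 assumes "fs f"
 shows "Sum_any (\<lambda>i. ((-1) ^ i * bin l i * of_nat i) *s f i) =
  - of_int l *s Sum_any (\<lambda>i. abin (l - 1) i *s f (Suc i))"
proof -
 have "Sum_any (\<lambda>i. ((-1) ^ i * bin l i * of_nat i) *s f i) =
   Sum_any (\<lambda>i. ((-1) ^ Suc i * bin l (Suc i) * of_nat (Suc i)) *s f (Suc i))"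
  by (subst SA_Suc) (simp_all add: fs_scale assms)
 also have "\<dots> = Sum_any (\<lambda>i. - of_int l *s abin (l - 1) i *s f (Suc i))"
 proof (rule Sum_any.cong)
  fix i
  have "(-1) ^ Suc i * bin l (Suc i) * of_nat (Suc i) = - of_int l * abin (l - 1) i"
   using bin_absorb[of l i] by (simp only: power_Suc mult_ac) simp
  then show "((-1) ^ Suc i * bin l (Suc i) * of_nat (Suc i)) *s f (Suc i) = - of_int l *s abin (l - 1) i *s f (Suc i)"
   by (simp only: scaleC_scaleC)
 qed
 finally show ?thesis by (simp only: SA_scale)
qed

lemma alt_absorb_comp:
 fixes f :: "nat \<Rightarrow> 'v::complex_vector"
 shows "Sum_any (\<lambda>i. ((-1) ^ i * bin l i * (of_int l - of_nat i)) *s f i) =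
  of_int l *s Sum_any (\<lambda>i. abin (l - 1) i *s f i)"
 unfolding SA_scale[symmetric]
proof (rule Sum_any.cong)
 fix i
 have "(-1) ^ i * bin l i * (of_int l - of_nat i) = of_int l * abin (l - 1) i"
 proof -
  have "(-1) ^ i * bin l i * (of_int l - of_nat i) = (-1) ^ i * (bin l i * (of_int l - of_nat i))" by (rule mult.assoc)
  then show ?thesis unfolding bin_absorb_comp by (simp only: mult_ac)
 qed
 then show "((-1) ^ i * bin l i * (of_int l - of_nat i)) *s f i = of_int l *s abin (l - 1) i *s f i"
  by (simp only: scaleC_scaleC)
qed

text \<open>Together with \<open>der_prd\<close> this computes the product with index
  \<open>l - 1\<close> from those with index \<open>l\<close>, by which all negative indices are
  reached from -1.\<close>

lemma prd_der_left:
 assumes A: "is_fld A" and B: "is_fld B"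
 shows "prd (der A) (der A) l B q x = - of_int l *s prd A A (l - 1) B q x"
proof -
 let ?a = "\<lambda>l F. Sum_any (\<lambda>i::nat. abin l i *s F i)"
 let ?f = "\<lambda>i::nat. A (l - 1 - int i) (B (q + int i) x)"
 let ?g = "\<lambda>i::nat. B (l + q - int i) (A (int i - 1) x)"
 have g: "fs ?g" using fld_fs_lin[OF A, of "\<lambda>i. B (l + q - int i)" "-1" x] B by (simp add: is_fld_linear)
 have "prd (der A) (der A) l B q x =
   - Sum_any (\<lambda>i. ((-1) ^ i * bin l i * (of_int l - of_nat i)) *s ?f i)
   + sg l *s Sum_any (\<lambda>i. ((-1) ^ i * bin l i * of_nat i) *s ?g i)"
  unfolding prd_def brs_split[OF is_fld_der[OF A] is_fld_der[OF A] B] SA_minus[symmetric]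
  by (simp add: der_def scaleC_scaleC fld_scale[OF B] fld_minus[OF B] SA_minus algebra_simps)
 also have "\<dots> = - of_int l *s (?a (l - 1) ?f + sg l *s ?a (l - 1) (\<lambda>i. ?g (Suc i)))"
  unfolding alt_absorb_comp alt_absorb[OF g] by (simp add: scaleC_add_right scaleC_scaleC mult.commute)
 also have "?a (l - 1) ?f + sg l *s ?a (l - 1) (\<lambda>i. ?g (Suc i)) = prd A A (l - 1) B q x"
  unfolding prd_def brs_split[OF A A B] by (simp add: sg_diff algebra_simps)
 finally show ?thesis .
qed

lemma der_prd:
 assumes A': "is_fld A'" and A: "is_fld A" and B: "is_fld B"
 shows "der (prd A' A l B) q x = prd A' A l (der B) q x - of_int l *s prd A' A (l - 1) B q x"
proof -
 let ?f = "\<lambda>i::nat. A' (l - int i) (B (q - 1 + int i) x)"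
 let ?g = "\<lambda>i::nat. B (l + q - 1 - int i) (A (int i) x)"
 let ?a = "\<lambda>l F. Sum_any (\<lambda>i::nat. abin l i *s F i)"
 have f: "fs ?f" by (intro fld_fs_lin B is_fld_linear A')
 have g: "fs ?g" using fld_fs_lin[OF A, of "\<lambda>i. B (l + q - 1 - int i)" 0 x] B by (simp add: is_fld_linear)
 have 1: "der (prd A' A l B) q x = - of_int q *s (?a l ?f - sg l *s ?a l ?g)"
  unfolding der_def prd_def brs_split[OF A' A B] by (simp add: algebra_simps)
 have 2: "prd A' A l (der B) q x = - of_int q *s ?a l ?f - Sum_any (\<lambda>i. ((-1) ^ i * bin l i * of_nat i) *s ?f i)
   + sg l *s (of_int q *s ?a l ?g + Sum_any (\<lambda>i. ((-1) ^ i * bin l i * (of_int l - of_nat i)) *s ?g i))"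
 proof -
  have "?a l (\<lambda>i. A' (l - int i) (der B (q + int i) x)) = Sum_any (\<lambda>i. - of_int q *s abin l i *s ?f i) - Sum_any (\<lambda>i. ((-1) ^ i * bin l i * of_nat i) *s ?f i)"
  proof (subst SA_diff[symmetric])
   show "fs (\<lambda>i. - of_int q *s abin l i *s ?f i)" "fs (\<lambda>i. ((-1) ^ i * bin l i * of_nat i) *s ?f i)"
    by (intro fs_scale f)+
   show "?a l (\<lambda>i. A' (l - int i) (der B (q + int i) x)) = Sum_any (\<lambda>i. - of_int q *s abin l i *s ?f i - ((-1) ^ i * bin l i * of_nat i) *s ?f i)"
    by (rule Sum_any.cong)
     (simp add: der_def fld_scale[OF A'] scaleC_scaleC scaleC_diff_left[symmetric]
      del: scaleC_minus_left, simp add: algebra_simps)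
  qed
  moreover have "?a l (\<lambda>i. der B (l + q - int i) (A (int i) x)) = - (Sum_any (\<lambda>i. of_int q *s abin l i *s ?g i) + Sum_any (\<lambda>i. ((-1) ^ i * bin l i * (of_int l - of_nat i)) *s ?g i))"
  proof (subst SA_add[symmetric])
   show "fs (\<lambda>i. of_int q *s abin l i *s ?g i)" "fs (\<lambda>i. ((-1) ^ i * bin l i * (of_int l - of_nat i)) *s ?g i)"
    by (intro fs_scale g)+
   show "?a l (\<lambda>i. der B (l + q - int i) (A (int i) x)) = - Sum_any (\<lambda>i. of_int q *s abin l i *s ?g i + ((-1) ^ i * bin l i * (of_int l - of_nat i)) *s ?g i)"
    unfolding SA_minus[symmetric]
    by (rule Sum_any.cong)
     (simp add: der_def scaleC_scaleC scaleC_add_left[symmetric] scaleC_minus_left[symmetric] del: scaleC_minus_left, simp add: algebra_simps)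
  qed
  ultimately show ?thesis unfolding prd_def brs_split[OF A' A is_fld_der[OF B]] SA_scale
   by (simp add: scaleC_diff_right scaleC_add_right)
 qed
 have 3: "prd A' A (l - 1) B q x = ?a (l - 1) (\<lambda>i. ?f (Suc i)) + sg l *s ?a (l - 1) ?g"
  unfolding prd_def brs_split[OF A' A B] by (simp add: sg_diff algebra_simps)
 show ?thesis unfolding 1 2 3 alt_absorb[OF f] alt_absorb_comp
  by (simp add: scaleC_add_right scaleC_scaleC scaleC_diff_right mult.commute)
qed

section \<open>The Heisenberg operators\<close>

lemma lookup_scaleC: "lookup (c *s f) b = c *s lookup f b"
 by (simp add: scaleC_poly_mapping_def map.rep_eq when_def)

lemma keys_scaleC: "keys (c *s f) \<subseteq> keys f"
 by (auto simp: in_keys_iff lookup_scaleC)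

lemma scaleC_single: "c *s single b t = single b (c *s t)"
 by (rule poly_mapping_eqI) (simp add: lookup_scaleC lookup_single when_def)

lemma sum_keys_superset:
 assumes "finite S" "keys x \<subseteq> S" "\<And>b. F b 0 = 0"
 shows "(\<Sum>b\<in>keys x. F b (lookup x b)) = (\<Sum>b\<in>S. F b (lookup x b))"
 by (rule sum.mono_neutral_left) (use assms in \<open>auto simp: in_keys_iff\<close>)

lemma sum_keys_linear:
 fixes F :: "'b \<Rightarrow> 'v::complex_vector \<Rightarrow> 'w::complex_vector"
 assumes F: "\<And>b. clinear (F b)"
 shows "clinear (\<lambda>x :: 'b \<Rightarrow>\<^sub>0 'v. \<Sum>b\<in>keys x. F b (lookup x b))"
proof (rule clinearI)
 fix x y :: "'b \<Rightarrow>\<^sub>0 'v" and c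
 have s: "(\<Sum>b\<in>keys z. F b (lookup z b)) = (\<Sum>b\<in>keys x \<union> keys y. F b (lookup z b))"
  if "keys z \<subseteq> keys x \<union> keys y" for z
  by (rule sum_keys_superset) (use that clinear_0[OF F] in auto)
 show "(\<Sum>b\<in>keys (x + y). F b (lookup (x + y) b)) =
  (\<Sum>b\<in>keys x. F b (lookup x b)) + (\<Sum>b\<in>keys y. F b (lookup y b))"
  unfolding s[OF keys_add] s[OF Un_upper1] s[OF Un_upper2]
  by (simp add: lookup_add clinear_add[OF F] sum.distrib)
 show "(\<Sum>b\<in>keys (c *s x). F b (lookup (c *s x) b)) =
  c *s (\<Sum>b\<in>keys x. F b (lookup x b))"
  using sum_keys_superset[OF finite_keys keys_scaleC[of c x], of F] clinear_0[OF F]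
  by (simp add: lookup_scaleC clinear_scale[OF F] scaleC_sum_right)
qed

lemma clinear_scale_left: "clinear (\<lambda>t::complex. t *s v)"
 by (rule clinearI) (simp_all add: scaleC_add_left scaleC_complex_def scaleC_scaleC)

lemma lin_ext_linear: "clinear (lin_ext F)"
 unfolding lin_ext_def by (rule sum_keys_linear) (rule clinear_scale_left)

lemma lin_ext_single: "lin_ext F (single b t) = t *s F b"
 unfolding lin_ext_def by (cases "t = 0") simp_all

lemma pm_induct [consumes 0, case_names add single]:
 fixes x :: "'b \<Rightarrow>\<^sub>0 'v::comm_monoid_add"
 assumes "\<And>x y. P x \<Longrightarrow> P y \<Longrightarrow> P (x + y)" "\<And>b t. P (single b t)"
 shows "P x"
proof -
 have 0: "P 0" using assms(2)[of undefined 0] by simp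
 have "P (\<Sum>b\<in>S. single b (lookup x b))" if "finite S" for S
  using that by (induction S) (simp_all add: 0 assms)
 from this[OF finite_keys[of x]] show ?thesis
  by (subst (asm) poly_mapping_eqI[of _ x]) (simp_all add: lookup_sum lookup_single when_def in_keys_iff)
qed

lemma pi_linear_eq:
 fixes F G :: "pi \<Rightarrow> 'v::complex_vector"
 assumes "clinear F" "clinear G" "\<And>A B j. F (single (A, B, j) 1) = G (single (A, B, j) 1)"
 shows "F x = G x"
proof (induction x rule: pm_induct)
 case (single b t)
 obtain A B j where b: "b = (A, B, j)" by (cases b) auto
 have "single b t = t *s single b 1" by (simp add: scaleC_single scaleC_complex_def)
 then show ?case using assms by (simp add: clinear_scale b)
qed (simp add: assms clinear_add)

lemma form_simps [simp]:
 "form a c_vec = 2 * snd a" "form a d_vec = 2 * fst a" "form c_vec a = 2 * snd a" "form d_vec a = 2 * fst a"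
 by (simp_all add: form_def c_vec_def d_vec_def)

lemma fst_scaleC: "fst (t *s a) = t *s fst a" and snd_scaleC: "snd (t *s a) = t *s snd a"
 by (simp_all add: scaleC_prod_def)

lemma form_add_left: "form (a + b) v = form a v + form b v" by (simp add: form_def algebra_simps)
lemma form_add_right: "form v (a + b) = form v a + form v b" by (simp add: form_def algebra_simps)
lemma form_scale_left: "form (t *s a) v = t * form a v" by (simp add: form_def scaleC_prod_def scaleC_complex_def algebra_simps)
lemma form_scale_right: "form v (t *s a) = t * form v a" by (simp add: form_def scaleC_prod_def scaleC_complex_def algebra_simps)
lemma heis_decomp: "h = fst h *s c_vec + snd h *s d_vec"
 by (cases h) (simp add: c_vec_def d_vec_def scaleC_prod_def scaleC_complex_def)

text \<open>The weight of the exponential with label \<open>j\<close>: \<open>a(0)\<close> acts on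
  all basis elements with last entry \<open>j\<close> by the pairing of \<open>a\<close> with
  it.\<close>

definition top_wt :: "complex \<Rightarrow> int \<Rightarrow> complex \<Rightarrow> int \<Rightarrow> heis" where
 "top_wt k r lam j = of_int r *s mu_vec k + (lam + of_int j) *s c_vec"

context
 fixes k :: complex and r :: int and lam :: complex
begin

abbreviation (input) "H \<equiv> heis_op k r lam"

lemma heis_linear: "clinear (H a n)" unfolding heis_op_def by (rule lin_ext_linear)

lemmas heis_lin_0 = clinear_0[OF heis_linear] and heis_lin_add = clinear_add[OF heis_linear] and heis_lin_scale = clinear_scale[OF heis_linear] and heis_lin_diff = clinear_diff[OF heis_linear] and heis_lin_minus = clinear_minus[OF heis_linear] and heis_lin_Sum_any = clinear_Sum_any[OF heis_linear]

lemma heis_neg: "n < 0 \<Longrightarrow> H a n (single (A, B, j) t) =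
  single (add_mset (nat (- n - 1)) A, B, j) (t * fst a) +
  single (A, add_mset (nat (- n - 1)) B, j) (t * snd a)"
 by (simp add: heis_op_def lin_ext_single Let_def scaleC_add_right scaleC_single scaleC_complex_def)

lemma heis_zero: "H a 0 (single (A, B, j) t) =
  single (A, B, j) (t * form a (top_wt k r lam j))"
 by (simp add: heis_op_def lin_ext_single scaleC_single scaleC_complex_def top_wt_def)

lemma heis_pos: "n > 0 \<Longrightarrow> H a n (single (A, B, j) t) =
  single (A - {#nat (n - 1)#}, B, j) (t * (of_int n * (2 * snd a) * of_nat (count A (nat (n - 1))))) +
  single (A, B - {#nat (n - 1)#}, j) (t * (of_int n * (2 * fst a) * of_nat (count B (nat (n - 1)))))"
 by (simp add: heis_op_def lin_ext_single Let_def scaleC_add_right scaleC_single scaleC_complex_def)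

lemma heis_add: "H (a + b) n x = H a n x + H b n x"
proof (rule pi_linear_eq[of "H (a + b) n" "\<lambda>x. H a n x + H b n x"])
 fix A B j
 consider "n < 0" | "n = 0" | "n > 0" by linarith
 then show "H (a + b) n (single (A, B, j) 1) = H a n (single (A, B, j) 1) + H b n (single (A, B, j) 1)"
  by cases (simp_all add: heis_neg heis_zero heis_pos single_add[symmetric] form_add_left algebra_simps del: single_add)
qed (intro heis_linear clinear_plus)+

lemma heis_scale: "H (t *s a) n x = t *s H a n x"
proof (rule pi_linear_eq[of "H (t *s a) n" "\<lambda>x. t *s H a n x"])
 fix A B j
 consider "n < 0" | "n = 0" | "n > 0" by linarith
 then show "H (t *s a) n (single (A, B, j) 1) = t *s H a n (single (A, B, j) 1)"
  by cases (simp_all add: heis_neg heis_zero heis_pos scaleC_add_right scaleC_single form_scale_left fst_scaleC snd_scaleC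
    scaleC_complex_def algebra_simps)
qed (intro heis_linear clinear_scaleI)+

lemma heis_linear1: "clinear (\<lambda>a. H a n x)" by (rule clinearI) (simp_all add: heis_add heis_scale)

lemma heis_split: "H a n x = fst a *s H c_vec n x + snd a *s H d_vec n x"
 by (subst heis_decomp[of a]) (simp add: heis_add heis_scale)

abbreviation (input) "S A B j \<equiv> single (A, B, j) (1 :: complex)"

lemma heis_c_neg: "n < 0 \<Longrightarrow> H c_vec n (S A B j) = S (add_mset (nat (- n - 1)) A) B j"
 by (simp add: heis_neg c_vec_def)
lemma heis_d_neg: "n < 0 \<Longrightarrow> H d_vec n (S A B j) = S A (add_mset (nat (- n - 1)) B) j"
 by (simp add: heis_neg d_vec_def)
lemma heis_zero': "H a 0 (S A B j) = form a (top_wt k r lam j) *s S A B j"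
 by (simp add: heis_zero scaleC_single scaleC_complex_def)
lemma heis_c_pos: "n > 0 \<Longrightarrow> H c_vec n (S A B j) = (of_int (2 * n) * of_nat (count B (nat (n - 1)))) *s S A (B - {#nat (n - 1)#}) j"
 by (simp add: heis_pos c_vec_def scaleC_single scaleC_complex_def mult_ac)
lemma heis_d_pos: "n > 0 \<Longrightarrow> H d_vec n (S A B j) = (of_int (2 * n) * of_nat (count A (nat (n - 1)))) *s S (A - {#nat (n - 1)#}) B j"
 by (simp add: heis_pos d_vec_def scaleC_single scaleC_complex_def mult_ac)

lemma count_annihilate_commute:
 "of_nat (count (A - {#i#}) i') * of_nat (count A i) = of_nat (count (A - {#i'#}) i) * (of_nat (count A i') :: complex)"
 by (cases "i = i'") auto

text \<open>The relation d/dx x = x d/dx + 1 for the exponent of one variable. It is stated for a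
  function \<open>F\<close> of the multiset, because \<open>A - {#i#}\<close> is a genuine removal
  only if \<open>i\<close> occurs; otherwise the coefficient is 0.\<close>

lemma annihilate_create:
 "of_nat (count (add_mset i' A) i) *s (F (add_mset i' A - {#i#}) :: 'v::complex_vector) =
  of_nat (count A i) *s F (add_mset i' (A - {#i#})) + (if i = i' then F A else 0)"
proof (cases "i = i'")
 case True
 then show ?thesis
  by (cases "i \<in># A") (auto simp: scaleC_add_left scaleC_one add.commute count_eq_zero_iff[THEN iffD2])
next
 case False
 then show ?thesis by (auto simp: add_mset_diff_bothsides)
qed

lemma heis_comm_cc: "H c_vec m (H c_vec n (S A B j)) = H c_vec n (H c_vec m (S A B j))"
 by (cases "m < 0"; cases "m = 0"; cases "n < 0"; cases "n = 0")
   (simp_all add: heis_c_neg heis_zero' heis_c_pos heis_lin_scale scaleC_scaleC add_mset_commute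
    mult_ac diff_right_commute count_annihilate_commute)

lemma heis_comm_dd: "H d_vec m (H d_vec n (S A B j)) = H d_vec n (H d_vec m (S A B j))"
 by (cases "m < 0"; cases "m = 0"; cases "n < 0"; cases "n = 0")
   (simp_all add: heis_d_neg heis_zero' heis_d_pos heis_lin_scale scaleC_scaleC add_mset_commute
    mult_ac diff_right_commute count_annihilate_commute)

lemma heis_comm_cd: "H c_vec m (H d_vec n (S A B j)) =
  H d_vec n (H c_vec m (S A B j)) + (if m + n = 0 then of_int (2 * m) else 0) *s S A B j"
proof -
 consider "m < 0" "n > 0" | "m > 0" "n < 0" | "m < 0" "n \<le> 0" | "m = 0" | "m > 0" "n \<ge> 0" by linarith
 then show ?thesis
 proof cases
  case 1
  have "nat (n - 1) = nat (- m - 1) \<longleftrightarrow> m + n = 0" using 1 by auto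
  moreover have "(of_int m :: complex) = - of_int n" if "m + n = 0"
   using that by (metis add_eq_0_iff2 of_int_minus)
  ultimately show ?thesis using 1
   annihilate_create[of "nat (- m - 1)" A "nat (n - 1)" "\<lambda>A. S A B j", THEN arg_cong, of "\<lambda>x. of_int (2 * n) *s x"]
   by (simp add: heis_c_neg heis_d_pos heis_lin_scale scaleC_scaleC scaleC_add_right split: if_splits)
 next
  case 2
  have "nat (m - 1) = nat (- n - 1) \<longleftrightarrow> m + n = 0" using 2 by auto
  then show ?thesis using 2
   annihilate_create[of "nat (- n - 1)" B "nat (m - 1)" "\<lambda>B. S A B j", THEN arg_cong, of "\<lambda>x. of_int (2 * m) *s x"]
   by (simp add: heis_d_neg heis_c_pos heis_lin_scale scaleC_scaleC scaleC_add_right split: if_splits)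
 qed (cases "n = 0"; cases "n < 0"; simp add: heis_c_neg heis_d_neg heis_zero' heis_c_pos heis_d_pos heis_lin_scale scaleC_scaleC mult_ac)+
qed

lemma heis_comm: "H a m (H b n x) - H b n (H a m x) = (if m + n = 0 then of_int m * form a b else 0) *s x"
proof (rule pi_linear_eq[of "\<lambda>x. H a m (H b n x) - H b n (H a m x)" "\<lambda>x. (if m + n = 0 then of_int m * form a b else 0) *s x"])
 fix A B j
 have e: "m + n = n + m" by simp
 have "H a m (H b n (S A B j)) - H b n (H a m (S A B j)) =
   (fst a * snd b * (if m + n = 0 then of_int (2 * m) else 0) - snd a * fst b * (if n + m = 0 then of_int (2 * n) else 0)) *s S A B j"
  unfolding heis_split[of a] heis_split[of b]
  by (simp only: heis_lin_add heis_lin_scale heis_comm_cc[of m n] heis_comm_dd[of m n]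
     heis_comm_cd scaleC_add_right scaleC_scaleC scaleC_diff_left mult_ac add_ac)
   (simp add: algebra_simps)
 also have "\<dots> = (if m + n = 0 then of_int m * form a b else 0) *s S A B j"
  by (rule arg_cong[where f = "\<lambda>t. t *s S A B j"]) (auto simp: form_def add_eq_0_iff2 algebra_simps)
 finally show "H a m (H b n (S A B j)) - H b n (H a m (S A B j)) = (if m + n = 0 then of_int m * form a b else 0) *s S A B j" .
qed (intro clinear_minusI clinear_scaleI clinear_id clinear_compose[of "H a m" "H b n"] clinear_compose[of "H b n" "H a m"] heis_linear)+

end

section \<open>Exponentials of commuting operators\<close>

text \<open>The compositions of \<open>N\<close>. They index the words in the exponential series, a
  word of length n having the weight 1/n!.\<close>

definition comps :: "nat \<Rightarrow> nat list set" where
 "comps N = {ns. 0 \<notin> set ns \<and> sum_list ns = N}"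

lemma comps_0: "comps 0 = {[]}"
proof -
 have "ns = []" if "0 \<notin> set ns" "sum_list ns = 0" for ns :: "nat list"
  using that by (cases ns) auto
 then show ?thesis by (auto simp: comps_def)
qed

lemma comps_length: "0 \<notin> set ns \<Longrightarrow> length ns \<le> sum_list ns"
 by (induction ns) auto

lemma finite_comps: "finite (comps N)"
proof (rule finite_subset)
 show "comps N \<subseteq> {ns. set ns \<subseteq> {..N} \<and> length ns \<le> N}"
  using comps_length member_le_sum_list by (fastforce simp: comps_def)
 show "finite {ns. set ns \<subseteq> {..N} \<and> length ns \<le> N}" by (rule finite_lists_length_le) simp
qed

definition del_nth :: "nat \<Rightarrow> 'a list \<Rightarrow> 'a list" where "del_nth i ns = take i ns @ drop (Suc i) ns"

lemma del_nth_split: "i < length ns \<Longrightarrow> take i ns @ ns ! i # drop (Suc i) ns = ns"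
 by (simp add: Cons_nth_drop_Suc)

text \<open>Removing the marked part leaves a composition together with a place of insertion. A word
  of length n has n + 1 such places, which turns 1/(n+1)! into 1/n!. This is the derivative of the
  exponential in combinatorial form.\<close>

lemma sum_comps_marked:
 fixes g :: "nat \<Rightarrow> nat list \<Rightarrow> 'v::complex_vector"
 shows "(\<Sum>ns\<in>comps N. (1 / fact (length ns)) *s (\<Sum>i<length ns. g (ns ! i) (del_nth i ns))) =
  (\<Sum>m=1..N. \<Sum>ns\<in>comps (N - m). (1 / fact (length ns)) *s g m ns)"
proof -
 have "(\<Sum>ns\<in>comps N. (1 / fact (length ns)) *s (\<Sum>i<length ns. g (ns ! i) (del_nth i ns))) =
   (\<Sum>(ns, i)\<in>Sigma (comps N) (\<lambda>ns. {..<length ns}). (1 / fact (length ns)) *s g (ns ! i) (del_nth i ns))"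
  by (subst sum.Sigma[symmetric]) (auto simp: finite_comps scaleC_sum_right)
 also have "\<dots> = (\<Sum>((m, ns), i)\<in>Sigma (Sigma {1..N} (\<lambda>m. comps (N - m))) (\<lambda>(m, ns). {..length ns}).
   (1 / fact (Suc (length ns))) *s g m ns)"
 proof -
  have A: "(take i' ns' @ m' # drop i' ns', i') = (ns, i) \<and> m' \<in> {1..N} \<and> ns' \<in> comps (N - m') \<and> i' \<le> length ns' \<and> Suc (length ns') = length ns"
   if "ns \<in> comps N" "i < length ns" "m' = ns ! i" "ns' = del_nth i ns" "i' = i" for ns i m' ns' i'
  proof -
   have ns: "0 \<notin> set ns" "sum_list ns = N" and i: "i < length ns" using that by (auto simp: comps_def)
   have sp: "take i ns @ ns ! i # drop (Suc i) ns = ns" using del_nth_split[OF i] .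
   have "sum_list (take i ns) + (ns ! i + sum_list (drop (Suc i) ns)) = N"
    using arg_cong[OF sp, of sum_list] ns(2) by simp
   moreover have "set (del_nth i ns) \<subseteq> set ns" unfolding del_nth_def by (auto dest: in_set_takeD in_set_dropD)
   moreover have "ns ! i \<noteq> 0" using ns(1) nth_mem[OF i] by metis
   ultimately show ?thesis using i ns sp by (auto simp: that(3-5) comps_def del_nth_def)
  qed
  have B: "ns ! i = m \<and> del_nth i ns = ns' \<and> ns \<in> comps N \<and> i < length ns"
   if "m \<in> {1..N}" "ns' \<in> comps (N - m)" "i \<le> length ns'" "ns = take i ns' @ m # drop i ns'" for m ns' i ns
  proof -
   have "sum_list (take i ns') + sum_list (drop i ns') = N - m"
    using arg_cong[OF append_take_drop_id[of i ns'], of sum_list] that(2) by (simp add: comps_def del: append_take_drop_id)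
   then show ?thesis
    using that by (auto simp: comps_def del_nth_def nth_append dest: in_set_takeD in_set_dropD)
  qed
  show ?thesis
   by (rule sum.reindex_bij_witness[of _ "\<lambda>((m, ns), i). (take i ns @ m # drop i ns, i)" "\<lambda>(ns, i). ((ns ! i, del_nth i ns), i)"])
    (use A B in \<open>force simp del: fact_Suc\<close>)+
 qed
 also have "\<dots> = (\<Sum>m=1..N. \<Sum>ns\<in>comps (N - m). (1 / fact (length ns)) *s g m ns)"
 proof -
  have "(\<Sum>i\<le>length ns. (1 / fact (Suc (length ns))) *s g m ns) = (1 / fact (length ns)) *s g m ns" for m ns
  proof -
   have "of_nat (Suc (length ns)) * (1 / fact (Suc (length ns))) = (1 / fact (length ns) :: complex)"
    by (simp add: fact_Suc del: of_nat_Suc)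
   then show ?thesis by (simp add: cvec.sum_constant_scale scaleC_scaleC del: fact_Suc of_nat_Suc)
  qed
  note * = this
  let ?S = "Sigma {1..N} (\<lambda>m. comps (N - m))"
  have S: "finite ?S" by (simp add: finite_comps)
  have "(\<Sum>((m, ns), i)\<in>Sigma ?S (\<lambda>(m, ns). {..length ns}). (1 / fact (Suc (length ns))) *s g m ns) =
   (\<Sum>p\<in>?S. \<Sum>i\<le>length (snd p). (1 / fact (Suc (length (snd p)))) *s g (fst p) (snd p))"
  proof -
   have e: "(\<lambda>(m, ns). {..length ns}) = (\<lambda>p :: nat \<times> nat list. {..length (snd p)})" by auto
   show ?thesis unfolding e
    by (subst sum.Sigma) (use S in \<open>auto simp: case_prod_beta simp del: fact_Suc\<close>)
  qed
  also have "\<dots> = (\<Sum>p\<in>?S. (1 / fact (length (snd p))) *s g (fst p) (snd p))" unfolding * ..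
  also have "\<dots> = (\<Sum>m=1..N. \<Sum>ns\<in>comps (N - m). (1 / fact (length ns)) *s g m ns)"
   by (subst sum.Sigma) (auto simp: finite_comps case_prod_beta)
  finally show ?thesis .
 qed
 finally show ?thesis .
qed

lemma exp_coeff_comps: "exp_coeff X N v = (\<Sum>ns\<in>comps N. (1 / fact (length ns)) *s foldr X ns v)"
 by (simp add: exp_coeff_def comps_def)

lemma exp_coeff_0: "exp_coeff X 0 v = v"
 by (simp add: exp_coeff_comps comps_0 scaleC_one)

context
 fixes X :: "nat \<Rightarrow> 'v \<Rightarrow> 'v::complex_vector"
 assumes X: "\<And>m. clinear (X m)"
begin

lemma foldr_linear: "clinear (foldr X ns)"
 by (induction ns) (auto simp: X id_def comp_def intro: clinear_id clinear_compose)

lemma exp_coeff_linear: "clinear (exp_coeff X N)"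
 unfolding exp_coeff_comps[abs_def] by (intro clinear_sumI clinear_scaleI foldr_linear)

text \<open>Moving \<open>D\<close> through a word replaces one letter at a time by its scalar
  commutator, and \<open>sum_comps_marked\<close> collects these deletions.\<close>

lemma exp_coeff_comm:
 assumes D: "clinear D" and DX: "\<And>m v. D (X m v) = X m (D v) + \<kappa> m *s v"
 shows "D (exp_coeff X N v) = exp_coeff X N (D v) + (\<Sum>m=1..N. \<kappa> m *s exp_coeff X (N - m) v)"
proof -
 have f: "D (foldr X ns v) = foldr X ns (D v) + (\<Sum>i<length ns. \<kappa> (ns ! i) *s foldr X (del_nth i ns) v)" for ns
 proof (induction ns)
  case (Cons m ns)
  have "(\<Sum>i<length (m # ns). \<kappa> ((m # ns) ! i) *s foldr X (del_nth i (m # ns)) v) =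
    \<kappa> m *s foldr X ns v + X m (\<Sum>i<length ns. \<kappa> (ns ! i) *s foldr X (del_nth i ns) v)"
   unfolding length_Cons sum.lessThan_Suc_shift by (simp add: del_nth_def clinear_sum[OF X] clinear_scale[OF X])
  then show ?case by (simp add: DX Cons clinear_add[OF X])
 qed simp
 have "D (exp_coeff X N v) = exp_coeff X N (D v) + (\<Sum>ns\<in>comps N. (1 / fact (length ns)) *s (\<Sum>i<length ns. \<kappa> (ns ! i) *s foldr X (del_nth i ns) v))"
  unfolding exp_coeff_comps by (simp add: clinear_sum[OF D] clinear_scale[OF D] f scaleC_add_right sum.distrib)
 also have "(\<Sum>ns\<in>comps N. (1 / fact (length ns)) *s (\<Sum>i<length ns. \<kappa> (ns ! i) *s foldr X (del_nth i ns) v)) =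
   (\<Sum>m=1..N. \<Sum>ns\<in>comps (N - m). (1 / fact (length ns)) *s (\<kappa> m *s foldr X ns v))"
  by (rule sum_comps_marked)
 also have "\<dots> = (\<Sum>m=1..N. \<kappa> m *s exp_coeff X (N - m) v)"
  unfolding exp_coeff_comps by (simp add: scaleC_sum_right scaleC_scaleC mult.commute)
 finally show ?thesis .
qed

lemma exp_coeff_commute:
 assumes D: "clinear D" and DX: "\<And>m v. D (X m v) = X m (D v)"
 shows "D (exp_coeff X N v) = exp_coeff X N (D v)"
 using exp_coeff_comm[OF D, of "\<lambda>_. 0"] DX by simp

text \<open>The Euler operator z d/dz applied to the exponential: a part \<open>m\<close> is marked
  with weight \<open>m\<close>. For \<open>N > 0\<close> the recursion determines the
  coefficient.\<close>

lemma exp_coeff_rec: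
 assumes c: "\<And>m n v. X m (X n v) = X n (X m v)"
 shows "of_nat N *s exp_coeff X N v = (\<Sum>m=1..N. of_nat m *s X m (exp_coeff X (N - m) v))"
proof -
 have f: "of_nat (sum_list ns) *s foldr X ns v = (\<Sum>i<length ns. of_nat (ns ! i) *s X (ns ! i) (foldr X (del_nth i ns) v))" for ns
 proof (induction ns)
  case (Cons m ns)
  have "(\<Sum>i<length (m # ns). of_nat ((m # ns) ! i) *s X ((m # ns) ! i) (foldr X (del_nth i (m # ns)) v)) =
    of_nat m *s X m (foldr X ns v) + (\<Sum>i<length ns. of_nat (ns ! i) *s X (ns ! i) (X m (foldr X (del_nth i ns) v)))"
   unfolding length_Cons sum.lessThan_Suc_shift by (simp add: del_nth_def)
  also have "(\<Sum>i<length ns. of_nat (ns ! i) *s X (ns ! i) (X m (foldr X (del_nth i ns) v))) = X m (of_nat (sum_list ns) *s foldr X ns v)"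
   unfolding Cons by (simp add: clinear_sum[OF X] clinear_scale[OF X] c[of m])
  finally show ?case by (simp add: clinear_scale[OF X] scaleC_add_left)
 qed simp
 have "of_nat N *s exp_coeff X N v = (\<Sum>ns\<in>comps N. (1 / fact (length ns)) *s (of_nat (sum_list ns) *s foldr X ns v))"
  unfolding exp_coeff_comps scaleC_sum_right
  by (intro sum.cong refl) (simp add: comps_def scaleC_scaleC)
 also have "\<dots> = (\<Sum>m=1..N. \<Sum>ns\<in>comps (N - m). (1 / fact (length ns)) *s (of_nat m *s X m (foldr X ns v)))"
  unfolding f by (rule sum_comps_marked)
 also have "\<dots> = (\<Sum>m=1..N. of_nat m *s X m (exp_coeff X (N - m) v))"
  unfolding exp_coeff_comps
  by (simp add: scaleC_sum_right scaleC_scaleC clinear_sum[OF X] clinear_scale[OF X] mult.commute)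
 finally show ?thesis .
qed

end

lemma sum_atLeast1_shift: "(\<Sum>m=1..N. f m) = (\<Sum>m<N. f (Suc m))"
 by (rule sum.reindex_bij_witness[of _ Suc "\<lambda>m. m - 1"]) auto

text \<open>The product satisfies the recursion \<open>exp_coeff_rec\<close> of the exponential of
  the sum, and the coefficients at 0 agree.\<close>

lemma exp_coeff_add:
 fixes X Z :: "nat \<Rightarrow> 'v \<Rightarrow> 'v::complex_vector"
 assumes X: "\<And>m. clinear (X m)" and Z: "\<And>m. clinear (Z m)"
  and XX: "\<And>m n v. X m (X n v) = X n (X m v)" and ZZ: "\<And>m n v. Z m (Z n v) = Z n (Z m v)"
  and XZ: "\<And>m n v. X m (Z n v) = Z n (X m v)"
 shows "(\<Sum>a\<le>N. exp_coeff X a (exp_coeff Z (N - a) v)) = exp_coeff (\<lambda>m v. X m v + Z m v) N v"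
proof (induction N rule: less_induct)
 case (less N)
 let ?W = "\<lambda>m v. X m v + Z m v"
 have W: "clinear (?W m)" for m by (intro clinear_plus X Z)
 have WW: "?W m (?W n v) = ?W n (?W m v)" for m n v
  using XX[of m n v] ZZ[of m n v] XZ[of m n v] XZ[of n m v]
  by (simp add: clinear_add[OF X] clinear_add[OF Z])
 show ?case
 proof (cases "N = 0")
  case True then show ?thesis by (simp add: exp_coeff_0)
 next
  case False
  let ?P = "\<lambda>M. \<Sum>a\<le>M. exp_coeff X a (exp_coeff Z (M - a) v)"
  have zx: "Z m (exp_coeff X a u) = exp_coeff X a (Z m u)" for m a u
   by (rule exp_coeff_commute[OF X Z]) (simp add: XZ)
  have "of_nat N *s ?P N = (\<Sum>a\<le>N. of_nat a *s exp_coeff X a (exp_coeff Z (N - a) v))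
    + (\<Sum>a\<le>N. exp_coeff X a (of_nat (N - a) *s exp_coeff Z (N - a) v))"
   unfolding scaleC_sum_right sum.distrib[symmetric] clinear_scale[OF exp_coeff_linear[OF X]]
   by (intro sum.cong refl) (simp add: scaleC_add_left[symmetric] of_nat_diff)
  also have "(\<Sum>a\<le>N. of_nat a *s exp_coeff X a (exp_coeff Z (N - a) v)) = (\<Sum>m=1..N. of_nat m *s X m (?P (N - m)))"
  proof -
   have "(\<Sum>a\<le>N. of_nat a *s exp_coeff X a (exp_coeff Z (N - a) v)) =
    (\<Sum>a\<le>N. \<Sum>m=1..a. of_nat m *s X m (exp_coeff X (a - m) (exp_coeff Z (N - a) v)))"
    unfolding exp_coeff_rec[OF X XX] ..
   also have "\<dots> = (\<Sum>(a, m)\<in>Sigma {..N} (\<lambda>a. {1..a}). of_nat m *s X m (exp_coeff X (a - m) (exp_coeff Z (N - a) v)))"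
    by (rule sum.Sigma) auto
   also have "\<dots> = (\<Sum>(m, a)\<in>Sigma {1..N} (\<lambda>m. {..N - m}). of_nat m *s X m (exp_coeff X a (exp_coeff Z (N - m - a) v)))"
    by (rule sum.reindex_bij_witness[of _ "\<lambda>(m, a). (a + m, m)" "\<lambda>(a, m). (m, a - m)"]) (auto simp: add.commute)
   also have "\<dots> = (\<Sum>m=1..N. of_nat m *s X m (?P (N - m)))"
    by (subst sum.Sigma[symmetric]) (auto simp: clinear_sum[OF X] scaleC_sum_right)
   finally show ?thesis .
  qed
  also have "(\<Sum>a\<le>N. exp_coeff X a (of_nat (N - a) *s exp_coeff Z (N - a) v)) = (\<Sum>m=1..N. of_nat m *s Z m (?P (N - m)))"
  proof -
   have "(\<Sum>a\<le>N. exp_coeff X a (of_nat (N - a) *s exp_coeff Z (N - a) v)) =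
    (\<Sum>a\<le>N. \<Sum>m=1..N - a. of_nat m *s Z m (exp_coeff X a (exp_coeff Z (N - a - m) v)))"
    unfolding exp_coeff_rec[OF Z ZZ] clinear_sum[OF exp_coeff_linear[OF X]]
    by (simp add: clinear_scale[OF exp_coeff_linear[OF X]] zx)
   also have "\<dots> = (\<Sum>(a, m)\<in>Sigma {..N} (\<lambda>a. {1..N - a}). of_nat m *s Z m (exp_coeff X a (exp_coeff Z (N - a - m) v)))"
    by (rule sum.Sigma) auto
   also have "\<dots> = (\<Sum>(m, a)\<in>Sigma {1..N} (\<lambda>m. {..N - m}). of_nat m *s Z m (exp_coeff X a (exp_coeff Z (N - m - a) v)))"
    by (rule sum.reindex_bij_witness[of _ "\<lambda>(m, a). (a, m)" "\<lambda>(a, m). (m, a)"]) (auto simp: add.commute)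
   also have "\<dots> = (\<Sum>m=1..N. of_nat m *s Z m (?P (N - m)))"
    by (subst sum.Sigma[symmetric]) (auto simp: clinear_sum[OF Z] scaleC_sum_right)
   finally show ?thesis .
  qed
  also have "(\<Sum>m=1..N. of_nat m *s X m (?P (N - m))) + (\<Sum>m=1..N. of_nat m *s Z m (?P (N - m))) =
    (\<Sum>m=1..N. of_nat m *s ?W m (?P (N - m)))"
   by (simp add: sum.distrib[symmetric] scaleC_add_right)
  also have "\<dots> = (\<Sum>m=1..N. of_nat m *s ?W m (exp_coeff ?W (N - m) v))"
  proof (intro sum.cong refl)
   fix m assume "m \<in> {1..N}"
   then have "N - m < N" by auto
   from less[OF this] show "of_nat m *s ?W m (?P (N - m)) = of_nat m *s ?W m (exp_coeff ?W (N - m) v)"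
    by (simp only:)
  qed
  also have "\<dots> = of_nat N *s exp_coeff ?W N v"
   by (rule exp_coeff_rec[OF W WW, symmetric])
  finally show ?thesis using False by simp
 qed
qed

lemma exp_coeff_zero: "N > 0 \<Longrightarrow> (\<And>m v. m > 0 \<Longrightarrow> X m v = 0) \<Longrightarrow> exp_coeff X N v = 0"
 unfolding exp_coeff_comps
proof (rule sum.neutral, intro ballI)
 fix ns assume X: "\<And>m v. m > 0 \<Longrightarrow> X m v = (0 :: 'a)" and "ns \<in> comps N" "N > 0"
 then obtain m ns' where "ns = m # ns'" "m > 0" by (cases ns) (auto simp: comps_def)
 then show "(1 / fact (length ns)) *s foldr X ns v = 0" by (simp add: X)
qed

text \<open>Integer index with value 0 below 0, so that sums over modes carry no range
  conditions.\<close>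

definition expz :: "(nat \<Rightarrow> 'v \<Rightarrow> 'v::complex_vector) \<Rightarrow> int \<Rightarrow> 'v \<Rightarrow> 'v" where
 "expz X a v = (if a < 0 then 0 else exp_coeff X (nat a) v)"

lemma expz_neg: "a < 0 \<Longrightarrow> expz X a v = 0" by (simp add: expz_def)
lemma expz_0: "expz X 0 v = v" by (simp add: expz_def exp_coeff_0)
lemma expz_int: "expz X (int a) v = exp_coeff X a v" by (simp add: expz_def)

context
 fixes X :: "nat \<Rightarrow> 'v \<Rightarrow> 'v::complex_vector"
 assumes X: "\<And>m. clinear (X m)"
begin

lemma expz_linear: "clinear (expz X a)"
 unfolding expz_def using exp_coeff_linear[where X = X and N = "nat a", OF X] by (cases "a < 0") (auto simp: clinear_zero)

lemma expz_comm_single: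
 assumes D: "clinear D" and DX: "\<And>p v. D (X p v) = X p (D v) + (if int p = m then \<kappa> else 0) *s v"
  and m: "m = 0 \<Longrightarrow> \<kappa> = 0"
 shows "D (expz X a v) = expz X a (D v) + (if m > 0 then \<kappa> *s expz X (a - m) v else 0)"
proof (cases "a < 0")
 case True then show ?thesis using clinear_0[OF D] by (simp add: expz_neg)
next
 case False
 have "D (expz X a v) = expz X a (D v) + (\<Sum>p=1..nat a. (if int p = m then \<kappa> else 0) *s exp_coeff X (nat a - p) v)"
  using False exp_coeff_comm[where X = X and N = "nat a" and v = v, OF X D DX] by (simp add: expz_def)
 also have "(\<Sum>p=1..nat a. (if int p = m then \<kappa> else 0) *s exp_coeff X (nat a - p) v) =
   (\<Sum>p\<in>{1..nat a}. if p = nat m then (if m > 0 then \<kappa> *s exp_coeff X (nat a - nat m) v else 0) else 0)"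
  by (intro sum.cong refl) (use m in auto)
 also have "\<dots> = (if m > 0 then \<kappa> *s expz X (a - m) v else 0)"
  using False by (auto simp: expz_def nat_diff_distrib)
 finally show ?thesis .
qed

lemma expz_commute:
 assumes D: "clinear D" and DX: "\<And>m v. D (X m v) = X m (D v)"
 shows "D (expz X a v) = expz X a (D v)"
 using expz_comm_single[OF D, of 0 0] DX by simp

lemma expz_rec:
 assumes c: "\<And>m n v. X m (X n v) = X n (X m v)"
 shows "of_int a *s expz X a v = Sum_any (\<lambda>m::nat. of_nat (Suc m) *s X (Suc m) (expz X (a - 1 - int m) v))"
proof (cases "a < 0")
 case True then show ?thesis by (simp add: expz_neg clinear_0[OF X])
next
 case False
 have "of_int a *s expz X a v = (\<Sum>m<nat a. of_nat (Suc m) *s X (Suc m) (exp_coeff X (nat a - Suc m) v))"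
  using exp_coeff_rec[where X = X and N = "nat a" and v = v, OF X c] False unfolding sum_atLeast1_shift by (simp add: expz_def)
 also have "\<dots> = (\<Sum>m<nat a. of_nat (Suc m) *s X (Suc m) (expz X (a - 1 - int m) v))"
  by (intro sum.cong refl) (auto simp: expz_def nat_diff_distrib intro!: arg_cong2[where f = "exp_coeff X"])
 also have "\<dots> = Sum_any (\<lambda>m::nat. of_nat (Suc m) *s X (Suc m) (expz X (a - 1 - int m) v))"
  by (rule SA_nat[symmetric]) (simp add: expz_neg clinear_0[OF X])
 finally show ?thesis .
qed

end

lemma expz_add:
 fixes X Z :: "nat \<Rightarrow> 'v \<Rightarrow> 'v::complex_vector"
 assumes X: "\<And>m. clinear (X m)" and Z: "\<And>m. clinear (Z m)"
  and XX: "\<And>m n v. X m (X n v) = X n (X m v)" and ZZ: "\<And>m n v. Z m (Z n v) = Z n (Z m v)"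
  and XZ: "\<And>m n v. X m (Z n v) = Z n (X m v)"
 shows "Sum_any (\<lambda>a. expz X a (expz Z (N - a) v)) = expz (\<lambda>m v. X m v + Z m v) N v"
proof -
 have s: "{a. expz X a (expz Z (N - a) v) \<noteq> 0} \<subseteq> int ` {..nat N}"
 proof
  fix a assume "a \<in> {a. expz X a (expz Z (N - a) v) \<noteq> 0}"
  then have "0 \<le> a" "a \<le> N" using expz_neg[of a X] expz_neg[of "N - a" Z] clinear_0[OF expz_linear[OF X]]
   by force+
  then show "a \<in> int ` {..nat N}" by (intro image_eqI[of _ _ "nat a"]) auto
 qed
 have "Sum_any (\<lambda>a. expz X a (expz Z (N - a) v)) = (\<Sum>a\<in>int ` {..nat N}. expz X a (expz Z (N - a) v))"
  by (rule Sum_any.expand_superset[OF _ s]) simp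
 also have "\<dots> = (\<Sum>a\<le>nat N. expz X (int a) (expz Z (N - int a) v))"
  by (subst sum.reindex) (auto simp: inj_on_def)
 also have "\<dots> = expz (\<lambda>m v. X m v + Z m v) N v"
 proof (cases "N < 0")
  case True then show ?thesis by (simp add: expz_neg clinear_0[OF expz_linear[OF X]])
 next
  case False
  have "(\<Sum>a\<le>nat N. expz X (int a) (expz Z (N - int a) v)) = (\<Sum>a\<le>nat N. exp_coeff X a (exp_coeff Z (nat N - a) v))"
   by (intro sum.cong refl) (use False in \<open>auto simp: expz_def nat_diff_distrib\<close>)
  then show ?thesis using exp_coeff_add[where X = X and Z = Z and N = "nat N" and v = v, OF assms] False by (simp add: expz_def)
 qed
 finally show ?thesis .
qed

section \<open>The vertex operators of the exponentials of multiples of c\<close>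

definition shift_op :: "int \<Rightarrow> pi \<Rightarrow> pi" where
 "shift_op i = lin_ext (\<lambda>(A, B, j). single (A, B, j + i) 1)"

lemma shift_linear: "clinear (shift_op i)" unfolding shift_op_def by (rule lin_ext_linear)

lemma shift_single: "shift_op i (single (A, B, j) t) = single (A, B, j + i) t"
 by (simp add: shift_op_def lin_ext_single scaleC_single scaleC_complex_def)

lemma shift_shift: "shift_op i (shift_op j x) = shift_op (i + j) x"
 by (rule pi_linear_eq[of "\<lambda>x. shift_op i (shift_op j x)"])
  (auto intro: shift_linear clinear_compose simp: shift_single add_ac)

lemma shift_0: "shift_op 0 x = x"
 by (rule pi_linear_eq[of "shift_op 0" "\<lambda>x. x"]) (auto intro: shift_linear clinear_id simp: shift_single)

context
 fixes k :: complex and r :: int and lam :: complex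
begin

abbreviation (input) "Hk \<equiv> heis_op k r lam"
abbreviation (input) "Xm i \<equiv> \<lambda>m. Hk ((of_int i / of_nat m) *s c_vec) (- int m)"
abbreviation (input) "Xp i \<equiv> \<lambda>m. Hk ((- of_int i / of_nat m) *s c_vec) (int m)"
definition Em :: "int \<Rightarrow> int \<Rightarrow> pi \<Rightarrow> pi" where "Em i = expz (Xm i)"
definition Ep :: "int \<Rightarrow> int \<Rightarrow> pi \<Rightarrow> pi" where "Ep i = expz (Xp i)"

lemma Em_linear: "clinear (Em i a)" unfolding Em_def by (rule expz_linear) (rule heis_linear)
lemma Ep_linear: "clinear (Ep i a)" unfolding Ep_def by (rule expz_linear) (rule heis_linear)
lemma Em_neg: "a < 0 \<Longrightarrow> Em i a v = 0" by (simp add: Em_def expz_neg)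
lemma Ep_neg: "a < 0 \<Longrightarrow> Ep i a v = 0" by (simp add: Ep_def expz_neg)

abbreviation (input) "V (i::int) \<equiv> exp_vop k r lam i"

lemma form_minus_right: "form h (- a) = - form h a" by (simp add: form_def)

lemma form_top: "form h (top_wt k r lam (j + i)) = form h (top_wt k r lam j) + of_int i * form h c_vec"
 by (simp add: top_wt_def form_add_right form_scale_right algebra_simps del: form_simps)

lemma heis_shift: "Hk h m (shift_op i x) = shift_op i (Hk h m x) + (if m = 0 then of_int i * form h c_vec else 0) *s shift_op i x"
proof (rule pi_linear_eq[of "\<lambda>x. Hk h m (shift_op i x)" "\<lambda>x. shift_op i (Hk h m x) + (if m = 0 then of_int i * form h c_vec else 0) *s shift_op i x"])
 fix A B j
 show "Hk h m (shift_op i (single (A, B, j) 1)) = shift_op i (Hk h m (single (A, B, j) 1)) +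
   (if m = 0 then of_int i * form h c_vec else 0) *s shift_op i (single (A, B, j) 1)"
  by (cases "m < 0"; cases "m = 0")
   (simp_all add: shift_single heis_neg heis_zero heis_pos clinear_add[OF shift_linear] form_top[of h j i] form_top[of h j i, unfolded add.commute[of j i]] scaleC_single scaleC_complex_def single_add[symmetric] algebra_simps
    del: form_simps)
qed (intro clinear_plus clinear_scaleI shift_linear clinear_compose[of "Hk h m" "shift_op i"] clinear_compose[of "shift_op i" "Hk h m"] heis_linear)+

lemma Em_comm: "Hk h m (Em i a v) = Em i a (Hk h m v) + (if m > 0 then (of_int i * form h c_vec) *s Em i (a - m) v else 0)"
unfolding Em_def
\<comment> \<open>The letter with index 0 has the coefficient i/0 = 0 and commutes with everything;
  the case distinction in \<open>\<kappa>\<close> follows this default value.\<close>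
proof (rule trans[OF expz_comm_single[where X = "Xm i" and D = "Hk h m" and m = m and \<kappa> = "if m = 0 then 0 else of_int i * form h c_vec"]])
 fix p v
 show "Hk h m (Xm i p v) = Xm i p (Hk h m v) + (if int p = m then (if m = 0 then 0 else of_int i * form h c_vec) else 0) *s v"
  using heis_comm[of k r lam h m "(of_int i / of_nat p) *s c_vec" "- int p" v]
  by (auto simp: form_scale_right algebra_simps simp del: form_simps split: if_splits)
qed (auto intro: heis_linear)

lemma Ep_comm: "Hk h m (Ep i a v) = Ep i a (Hk h m v) + (if m < 0 then (of_int i * form h c_vec) *s Ep i (a + m) v else 0)"
unfolding Ep_def
proof (rule trans[OF expz_comm_single[where X = "Xp i" and D = "Hk h m" and m = "- m" and \<kappa> = "if m = 0 then 0 else of_int i * form h c_vec"]])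
 fix p v
 have "int p = - m \<Longrightarrow> m \<noteq> 0 \<Longrightarrow> of_int m * (- of_int i / of_nat p * form h c_vec) = of_int i * form h c_vec"
 proof -
  assume a: "int p = - m" "m \<noteq> 0"
  then have "(of_nat p :: complex) = - of_int m" by (metis of_int_minus of_int_of_nat_eq)
  then show ?thesis using a by (simp add: field_simps del: form_simps)
 qed
 then show "Hk h m (Xp i p v) = Xp i p (Hk h m v) + (if int p = - m then (if m = 0 then 0 else of_int i * form h c_vec) else 0) *s v"
  using heis_comm[of k r lam h m "(- of_int i / of_nat p) *s c_vec" "int p" v]
  by (auto simp: form_scale_right form_minus_right algebra_simps simp del: form_simps split: if_splits)
qed (auto intro: heis_linear)

lemma heis_cc: "Hk (s *s c_vec) m (Hk (t *s c_vec) n v) = Hk (t *s c_vec) n (Hk (s *s c_vec) m v)"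
proof -
 have "form (s *s c_vec) (t *s c_vec) = 0" by (simp add: form_def c_vec_def scaleC_prod_def)
 then show ?thesis using heis_comm[of k r lam "s *s c_vec" m "t *s c_vec" n v] by (simp split: if_splits)
qed

text \<open>A letter with index m deletes a part of size m from \<open>B\<close>, or gives 0. Parts
  are stored shifted by one, hence the \<open>Suc\<close> in the weight. Words longer than the
  weight of \<open>B\<close> leave nothing.\<close>

lemma annihilate_bound: "\<exists>K. \<forall>b\<ge>K. Ep i b y = 0"
proof (induction y rule: pm_induct)
 case (add x y)
 then obtain K L where "\<forall>b\<ge>K. Ep i b x = 0" "\<forall>b\<ge>L. Ep i b y = 0" by blast
 then have "\<forall>b\<ge>max K L. Ep i b (x + y) = 0" by (simp add: clinear_add[OF Ep_linear])
 then show ?case by blast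
next
 case (single bb t)
 obtain A B j where bb: "bb = (A, B, j)" by (cases bb) auto
 let ?w = "\<lambda>B. sum_mset (image_mset Suc B)"
 have P: "\<exists>t' B'. foldr (Xp i) ns (single (A, B, j) t) = single (A, B', j) t' \<and> (t' = 0 \<or> ?w B' + sum_list ns = ?w B)"
  if "0 \<notin> set ns" for ns
  using that
 proof (induction ns)
  case Nil then show ?case by (intro exI[of _ t] exI[of _ B]) simp
 next
  case (Cons m ns)
  then obtain t' B' where t': "foldr (Xp i) ns (single (A, B, j) t) = single (A, B', j) t'" "t' = 0 \<or> ?w B' + sum_list ns = ?w B" by auto
  obtain m' where m: "m = Suc m'" using Cons by (cases m) auto
  have e: "foldr (Xp i) (m # ns) (single (A, B, j) t) = single (A, B' - {#m'#}, j) (t' * (of_int (int m) * (2 * (- of_int i / of_nat m)) * of_nat (count B' m')))"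
  proof -
   have "Hk (s *s c_vec) (int m) (single (A, B', j) t') = single (A, B' - {#m'#}, j) (t' * (of_int (int m) * (2 * s) * of_nat (count B' m')))" for s
    by (simp add: m heis_pos c_vec_def scaleC_prod_def scaleC_complex_def)
   then show ?thesis by (simp only: foldr_Cons comp_apply t'(1))
  qed
  show ?case
  proof (cases "m' \<in># B'")
   case True
   then obtain B'' where B'': "B' = add_mset m' B''" by (metis insert_DiffM)
   show ?thesis unfolding e
    by (rule exI, rule exI, rule conjI, rule refl) (use t'(2) B'' in \<open>auto simp: m\<close>)
  next
   case False
   show ?thesis unfolding e by (rule exI, rule exI, rule conjI, rule refl) (use False in \<open>simp add: not_in_iff\<close>)
  qed
 qed
 have "Ep i b (single bb t) = 0" if b: "b \<ge> int (?w B + 1)" for b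
 proof -
  have "exp_coeff (Xp i) (nat b) (single bb t) = 0"
   unfolding exp_coeff_comps
  proof (rule sum.neutral, intro ballI)
   fix ns assume ns: "ns \<in> comps (nat b)"
   then obtain t' B' where t': "foldr (Xp i) ns (single (A, B, j) t) = single (A, B', j) t'" "t' = 0 \<or> ?w B' + sum_list ns = ?w B"
    using P[of ns] by (auto simp: comps_def)
   have "?w B + 1 \<le> nat b" using nat_mono[OF b] by (simp only: nat_int)
   then have "sum_list ns > ?w B" using ns by (simp add: comps_def)
   then have "t' = 0" using t'(2) by auto
   then show "(1 / fact (length ns)) *s foldr (Xp i) ns (single bb t) = 0" unfolding bb t'(1) by simp
  qed
  then show ?thesis using b by (simp add: Ep_def expz_def)
 qed
 then show ?case by blast
qed

lemma fs_Ep: "(\<And>b. clinear (F b)) \<Longrightarrow> fs (\<lambda>b. F b (Ep i b y))"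
proof -
 assume F: "\<And>b. clinear (F b)"
 obtain K where K: "\<forall>b\<ge>K. Ep i b y = 0" using annihilate_bound by blast
 show ?thesis by (rule fs_int[of 0 _ K]) (use K in \<open>auto simp: Ep_neg clinear_0[OF F]\<close>)
qed

text \<open>The power of z fixes the creation index once the annihilation index \<open>b\<close> is
  given, so the double sum of the definition becomes a single sum over integers.\<close>

lemma exp_vop_eq: "V i n x = Sum_any (\<lambda>b. Em i (b - i * r - n - 1) (Ep i b (shift_op i x)))"
proof -
 let ?y = "shift_op i x"
 obtain K where K: "\<And>b. b \<ge> K \<Longrightarrow> Ep i b ?y = 0" using annihilate_bound by blast
 let ?S = "{b. 0 \<le> b \<and> b < K \<and> 0 \<le> b - i * r - n - 1}"
 let ?g = "\<lambda>b. (nat (b - i * r - n - 1), nat b)"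
 let ?f = "\<lambda>(a, b). if int a - int b + i * r = - n - 1 then exp_coeff (Xm i) a (exp_coeff (Xp i) b ?y) else 0"
 have fin: "finite ?S" by (rule finite_subset[of _ "{0..K}"]) auto
 have inj: "inj_on ?g ?S" by (auto simp: inj_on_def)
 have "V i n x = Sum_any ?f" unfolding exp_vop_def shift_op_def ..
 also have "\<dots> = sum ?f (?g ` ?S)"
 proof (rule Sum_any.expand_superset)
  show "{a. ?f a \<noteq> 0} \<subseteq> ?g ` ?S"
  proof
   fix p assume "p \<in> {a. ?f a \<noteq> 0}"
   then obtain a b where p: "p = (a, b)" and ab: "int a - int b + i * r = - n - 1" and nz: "exp_coeff (Xm i) a (exp_coeff (Xp i) b ?y) \<noteq> 0"
    by (cases p) (auto split: if_splits)
   have "int b < K"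
   proof (rule ccontr)
    assume "\<not> int b < K"
    then have "exp_coeff (Xp i) b ?y = 0" using K[of "int b"] by (simp add: Ep_def expz_int)
    moreover have "clinear (exp_coeff (Xm i) a)" by (rule exp_coeff_linear) (rule heis_linear)
    ultimately show False using nz by (simp add: clinear_0)
   qed
   then show "p \<in> ?g ` ?S" using ab by (intro image_eqI[of _ _ "int b"]) (auto simp: p)
  qed
 qed (use fin in simp)
 also have "\<dots> = (\<Sum>b\<in>?S. Em i (b - i * r - n - 1) (Ep i b ?y))"
  unfolding sum.reindex[OF inj] comp_def
  by (intro sum.cong refl) (auto simp: Em_def Ep_def expz_def)
 also have "\<dots> = Sum_any (\<lambda>b. Em i (b - i * r - n - 1) (Ep i b ?y))"
 proof (rule Sum_any.expand_superset[symmetric])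
  show "{b. Em i (b - i * r - n - 1) (Ep i b ?y) \<noteq> 0} \<subseteq> ?S"
  proof
   fix b assume b: "b \<in> {b. Em i (b - i * r - n - 1) (Ep i b ?y) \<noteq> 0}"
   then have "Ep i b ?y \<noteq> 0" using clinear_0[OF Em_linear] by force
   then have "0 \<le> b" "b < K" using K[of b] Ep_neg[of b i ?y] by force+
   moreover have "0 \<le> b - i * r - n - 1" using b Em_neg[of "b - i * r - n - 1" i "Ep i b ?y"] by force
   ultimately show "b \<in> ?S" by simp
  qed
 qed (use fin in simp)
 finally show ?thesis .
qed

lemma exp_vop_fld: "is_fld (V i)"
proof (rule is_fldI)
 fix n
 have f: "fs (\<lambda>b. Em i (b - i * r - n - 1) (Ep i b (shift_op i x)))" for x by (rule fs_Ep) (rule Em_linear)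
 show "clinear (V i n)"
  unfolding exp_vop_eq[abs_def]
  by (rule clinearI)
   (simp_all add: clinear_add[OF shift_linear] clinear_add[OF Ep_linear] clinear_add[OF Em_linear] SA_add[OF f f]
    clinear_scale[OF shift_linear] clinear_scale[OF Ep_linear] clinear_scale[OF Em_linear] SA_scale)
next
 fix x
 obtain K where K: "\<And>b. b \<ge> K \<Longrightarrow> Ep i b (shift_op i x) = 0" using annihilate_bound by blast
 have "V i n x = 0" if "n \<ge> K - i * r" for n
  unfolding exp_vop_eq
 proof (rule SA_zero)
  fix b show "Em i (b - i * r - n - 1) (Ep i b (shift_op i x)) = 0"
   by (cases "b \<ge> K") (use that K in \<open>auto simp: clinear_0[OF Em_linear] Em_neg\<close>)
 qed
 then show "\<exists>N. \<forall>n\<ge>N. V i n x = 0" by blast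
qed

text \<open>The three factors contribute separately: the creation exponential for
  \<open>m > 0\<close>, the annihilation exponential for \<open>m < 0\<close> and the shift for
  \<open>m = 0\<close>. Each time the same scalar appears.\<close>

lemma exp_vop_comm: "Hk h m (V i n x) - V i n (Hk h m x) = (of_int i * form h c_vec) *s V i (m + n) x"
proof -
 let ?t = "of_int i * form h c_vec"
 let ?y = "shift_op i x"
 have f: "fs (\<lambda>b. Em i (b - i * r - n - 1) (Ep i b y))" for y n by (rule fs_Ep) (rule Em_linear)
 have f': "fs (\<lambda>b. Em i (b - i * r - n - 1) (Ep i (b + m) y))" for y
  using fs_inj[OF f[of "n + m" y], of "\<lambda>b. b + m"] by (simp add: inj_def algebra_simps)
 have "Hk h m (V i n x) = Sum_any (\<lambda>b. Hk h m (Em i (b - i * r - n - 1) (Ep i b ?y)))"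
  unfolding exp_vop_eq by (rule clinear_Sum_any[OF heis_linear f])
 also have "\<dots> = Sum_any (\<lambda>b. Em i (b - i * r - n - 1) (Ep i b (Hk h m ?y)) +
    ((if m < 0 then ?t else 0) *s Em i (b - i * r - n - 1) (Ep i (b + m) ?y) + (if m > 0 then ?t else 0) *s Em i (b - i * r - (m + n) - 1) (Ep i b ?y)))"
  by (rule Sum_any.cong) (auto simp: Em_comm Ep_comm clinear_0[OF Em_linear] clinear_add[OF Em_linear] clinear_scale[OF Em_linear] algebra_simps simp del: form_simps)
 also have "\<dots> = Sum_any (\<lambda>b. Em i (b - i * r - n - 1) (Ep i b (Hk h m ?y))) +
   ((if m < 0 then ?t else 0) *s Sum_any (\<lambda>b. Em i (b - i * r - n - 1) (Ep i (b + m) ?y)) + (if m > 0 then ?t else 0) *s V i (m + n) x)"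
  unfolding exp_vop_eq SA_scale[symmetric]
  by (subst SA_add[OF f], rule fs_add, rule fs_scale, rule f', rule fs_scale, rule f, subst SA_add, rule fs_scale, rule f', rule fs_scale, rule f, rule refl)
 also have "Sum_any (\<lambda>b. Em i (b - i * r - n - 1) (Ep i (b + m) ?y)) = V i (m + n) x"
  unfolding exp_vop_eq
  by (subst SA_shift[of _ m, symmetric]) (simp add: algebra_simps)
 also have "Sum_any (\<lambda>b. Em i (b - i * r - n - 1) (Ep i b (Hk h m ?y))) = V i n (Hk h m x) + (if m = 0 then ?t else 0) *s V i n x"
  unfolding exp_vop_eq SA_scale[symmetric] heis_shift
  by (subst SA_add[symmetric], rule f, rule fs_scale, rule f)
   (simp add: clinear_add[OF Ep_linear] clinear_add[OF Em_linear] clinear_scale[OF Ep_linear] clinear_scale[OF Em_linear])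
 finally show ?thesis by (cases "m = 0"; cases "m < 0") (auto simp: algebra_simps simp del: form_simps)
qed

end

lemma exp_coeff_annihilated:
 assumes X: "\<And>m. clinear (X m)" and v: "\<And>m. m > 0 \<Longrightarrow> X m v = 0" and N: "N > 0"
 shows "exp_coeff X N v = 0"
 unfolding exp_coeff_comps
proof (rule sum.neutral, intro ballI)
 fix ns assume ns: "ns \<in> comps N"
 then have "ns \<noteq> []" using N by (auto simp: comps_def)
 then obtain ns' m where m: "ns = ns' @ [m]" by (metis rev_exhaust)
 have "m > 0" using ns by (auto simp: m comps_def)
 have "clinear (foldr X ns')" by (rule foldr_linear) (rule X)
 then show "(1 / fact (length ns)) *s foldr X ns v = 0" by (simp add: m v[OF \<open>m > 0\<close>] clinear_0)
qed

context
 fixes k :: complex and r :: int and lam :: complex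
begin

abbreviation (input) "HH \<equiv> heis_op k r lam"
abbreviation (input) "EM \<equiv> Em k r lam"
abbreviation (input) "EP \<equiv> Ep k r lam"
abbreviation (input) "VV \<equiv> exp_vop k r lam"

lemma heis_fld: "is_fld (HH a)"
proof (rule is_fldI)
 fix x
 show "\<exists>N. \<forall>n\<ge>N. HH a n x = 0"
 proof (induction x rule: pm_induct)
  case (add x y)
  then obtain N M where "\<forall>n\<ge>N. HH a n x = 0" "\<forall>n\<ge>M. HH a n y = 0" by blast
  then have "\<forall>n\<ge>max N M. HH a n (x + y) = 0" by (simp add: heis_lin_add)
  then show ?case by blast
 next
  case (single b t)
  obtain A B j where b: "b = (A, B, j)" by (cases b) auto
  have "finite (set_mset (A + B))" by simp
  then obtain N where N: "\<forall>m\<in>set_mset (A + B). m < N" using finite_nat_set_iff_bounded by blast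
  have "HH a n (single b t) = 0" if "n \<ge> int N + 1" for n
  proof -
   have "N \<le> nat (n - 1)" using that by linarith
   then have "nat (n - 1) \<notin># A" "nat (n - 1) \<notin># B" using N by (auto simp: not_less[symmetric])
   then show ?thesis using that by (simp add: b heis_pos not_in_iff)
  qed
  then show ?case by blast
 qed
qed (rule heis_linear)

lemma heis_zero_vec: "HH 0 n x = 0" using clinear_0[OF heis_linear1] .

lemma c_commute_c: "form (t *s c_vec) c_vec = 0" by (simp add: form_def c_vec_def scaleC_prod_def)

lemma exp_vop_linear: "clinear (VV i n)" by (rule is_fld_linear[OF exp_vop_fld])

text \<open>Since <c,c> = 0, everything built from the modes of c and the shifts commutes; the
  following rules are instances of this.\<close>

lemma exp_vop_c: "VV i n (HH (t *s c_vec) m x) = HH (t *s c_vec) m (VV i n x)"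
 using exp_vop_comm[of k r lam "t *s c_vec" m i n x] by (simp add: c_commute_c del: form_simps)

lemma exp_vop_c1: "VV i n (HH c_vec m x) = HH c_vec m (VV i n x)"
 using exp_vop_c[of i n 1 m x] by (simp add: scaleC_one)

lemma exp_vop_Em: "VV i n (EM j a x) = EM j a (VV i n x)"
 unfolding Em_def by (rule expz_commute) (rule heis_linear exp_vop_linear exp_vop_c)+

lemma exp_vop_Ep: "VV i n (EP j a x) = EP j a (VV i n x)"
 unfolding Ep_def by (rule expz_commute) (rule heis_linear exp_vop_linear exp_vop_c)+

lemma shift_c: "shift_op j (HH (t *s c_vec) m x) = HH (t *s c_vec) m (shift_op j x)"
 using heis_shift[of k r lam "t *s c_vec" m j x] by (simp add: c_commute_c del: form_simps)

lemma shift_Em: "shift_op i (EM j a x) = EM j a (shift_op i x)"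
 unfolding Em_def by (rule expz_commute) (rule heis_linear shift_linear shift_c)+

lemma shift_Ep: "shift_op i (EP j a x) = EP j a (shift_op i x)"
 unfolding Ep_def by (rule expz_commute) (rule heis_linear shift_linear shift_c)+

lemma c_Em: "HH (t *s c_vec) m (EM j a x) = EM j a (HH (t *s c_vec) m x)"
 using Em_comm[of k r lam "t *s c_vec" m j a x] by (simp add: c_commute_c del: form_simps)

lemma c_Em1: "HH c_vec m (EM j a x) = EM j a (HH c_vec m x)"
 using c_Em[of 1] by (simp add: scaleC_one)

lemma Em_Ep: "EM i a (EP j b x) = EP j b (EM i a x)"
 unfolding Ep_def by (rule expz_commute) (rule heis_linear Em_linear c_Em[symmetric])+

lemma exp_vop_shift: "VV i n (shift_op j x) = shift_op j (VV i n x)"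
proof -
 have f: "fs (\<lambda>b. EM i (b - i * r - n - 1) (EP i b (shift_op i x)))" by (rule fs_Ep) (rule Em_linear)
 show ?thesis
  unfolding exp_vop_eq clinear_Sum_any[OF shift_linear f] shift_Em shift_Ep shift_shift by (simp add: add.commute)
qed

lemma exp_vop_commute: "VV i m (VV j n x) = VV j n (VV i m x)"
proof -
 have f: "fs (\<lambda>b. EM j (b - j * r - n - 1) (EP j b (shift_op j x)))" by (rule fs_Ep) (rule Em_linear)
 have "VV i m (VV j n x) = Sum_any (\<lambda>b. VV i m (EM j (b - j * r - n - 1) (EP j b (shift_op j x))))"
  unfolding exp_vop_eq[of k r lam j] by (rule clinear_Sum_any[OF exp_vop_linear f])
 then show ?thesis unfolding exp_vop_Em exp_vop_Ep exp_vop_shift exp_vop_eq[of k r lam j] .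
qed

lemma Em_rec: "of_int a *s EM i a v = of_int i *s Sum_any (\<lambda>m::nat. HH c_vec (- 1 - int m) (EM i (a - 1 - int m) v))"
 unfolding Em_def
proof (subst expz_rec)
 show "Sum_any (\<lambda>m. of_nat (Suc m) *s HH ((of_int i / of_nat (Suc m)) *s c_vec) (- int (Suc m)) (expz (Xm k r lam i) (a - 1 - int m) v)) =
  of_int i *s Sum_any (\<lambda>m. HH c_vec (- 1 - int m) (expz (Xm k r lam i) (a - 1 - int m) v))"
  unfolding SA_scale[symmetric]
 proof (rule Sum_any.cong)
  fix m
  have "of_nat (Suc m) * (of_int i / of_nat (Suc m)) = (of_int i :: complex)" by (simp del: of_nat_Suc)
  then show "of_nat (Suc m) *s HH ((of_int i / of_nat (Suc m)) *s c_vec) (- int (Suc m)) (expz (Xm k r lam i) (a - 1 - int m) v) =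
   of_int i *s HH c_vec (- 1 - int m) (expz (Xm k r lam i) (a - 1 - int m) v)"
   unfolding heis_scale scaleC_scaleC by simp
 qed
qed (rule heis_linear heis_cc)+

lemma Ep_rec: "of_int a *s EP i a v = - of_int i *s Sum_any (\<lambda>m::nat. HH c_vec (1 + int m) (EP i (a - 1 - int m) v))"
 unfolding Ep_def
proof (subst expz_rec)
 show "Sum_any (\<lambda>m. of_nat (Suc m) *s HH ((- of_int i / of_nat (Suc m)) *s c_vec) (int (Suc m)) (expz (Xp k r lam i) (a - 1 - int m) v)) =
  - of_int i *s Sum_any (\<lambda>m. HH c_vec (1 + int m) (expz (Xp k r lam i) (a - 1 - int m) v))"
  unfolding SA_scale[symmetric]
 proof (rule Sum_any.cong)
  fix m
  have "of_nat (Suc m) * (- of_int i / of_nat (Suc m)) = (- of_int i :: complex)" by (simp del: of_nat_Suc)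
  then show "of_nat (Suc m) *s HH ((- of_int i / of_nat (Suc m)) *s c_vec) (int (Suc m)) (expz (Xp k r lam i) (a - 1 - int m) v) =
   - of_int i *s HH c_vec (1 + int m) (expz (Xp k r lam i) (a - 1 - int m) v)"
   unfolding heis_scale scaleC_scaleC by simp
 qed
qed (rule heis_linear heis_cc)+

lemma heis_c_zero: "HH c_vec 0 x = of_int r *s x"
proof (rule pi_linear_eq[of "HH c_vec 0" "\<lambda>x. of_int r *s x"])
 fix A B j
 have "form c_vec (top_wt k r lam j) = of_int r"
  by (simp add: top_wt_def mu_vec_def c_vec_def scaleC_prod_def scaleC_complex_def del: form_simps) (simp add: form_def)
 then show "HH c_vec 0 (single (A, B, j) 1) = of_int r *s single (A, B, j) 1"
  by (simp add: heis_zero scaleC_single scaleC_complex_def del: form_simps)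
qed (intro heis_linear clinear_scaleI clinear_id)+

text \<open>The logarithmic derivative of the exponential is i c(z). The recursions of the two
  exponentials give the two halves of the normally ordered product, and the power of z gives its
  term with c(0).\<close>

lemma exp_vop_der: "der (VV i) n x = of_int i *s prd (HH c_vec) (HH c_vec) (-1) (VV i) n x"
proof -
 let ?y = "shift_op i x"
 let ?al = "\<lambda>b. b - i * r - n"
 obtain K where K: "\<And>b. b \<ge> K \<Longrightarrow> EP i b ?y = 0" using annihilate_bound by blast
 have Ez: "EP i b ?y = 0" if "b < 0 \<or> b \<ge> K" for b using that K Ep_neg by auto
 obtain M where M: "\<And>m b. m \<ge> M \<Longrightarrow> HH c_vec (1 + int m) (EP i (int b) ?y) = 0"
  using is_fld_uniform[OF heis_fld[of c_vec], of "nat K" "\<lambda>b. EP i (int b) ?y" "\<lambda>_. 1"] Ez by (auto simp: nat_le_iff)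
 have M': "HH c_vec (1 + int m) (EP i b ?y) = 0" if "m \<ge> M" for m b
  by (cases "b < 0") (use M[OF that, of "nat b"] in \<open>auto simp: Ez heis_lin_0\<close>)
 have fE: "fs (\<lambda>b. F b (EP i b ?y))" if "\<And>b. clinear (F b)" for F :: "int \<Rightarrow> pi \<Rightarrow> pi" by (rule fs_Ep) (rule that)
 have lin: "clinear (VV i n)" for n by (rule exp_vop_linear)
 \<comment> \<open>The factor of the mode \<open>n - 1\<close> is split as
   \<open>- n = ?al b - b + i * r\<close>: the degree of the creation part, that of the annihilation
   part, and the power of z from c(0).\<close>
 let ?T1 = "Sum_any (\<lambda>b. of_int (?al b) *s EM i (?al b) (EP i b ?y))"
 let ?T2 = "Sum_any (\<lambda>b. of_int b *s EM i (?al b) (EP i b ?y))"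
 let ?T3 = "of_int (i * r) *s VV i (n - 1) x"
 have V1: "VV i (n - 1) x = Sum_any (\<lambda>b. EM i (?al b) (EP i b ?y))" by (simp add: exp_vop_eq algebra_simps)
 have "der (VV i) n x = (?T1 - ?T2) + ?T3"
  unfolding der_def V1 SA_scale[symmetric]
  by (subst SA_diff[symmetric], (rule fs_scale, rule fE, rule Em_linear)+,
    subst SA_add[symmetric], rule fs_diff, (rule fs_scale, rule fE, rule Em_linear)+, rule Sum_any.cong)
   (simp add: scaleC_add_left[symmetric] scaleC_diff_left[symmetric] del: scaleC_minus_left)
 moreover have "?T1 = of_int i *s Sum_any (\<lambda>m::nat. HH c_vec (- 1 - int m) (VV i (n + int m) x))"
 proof -
  have "?T1 = of_int i *s Sum_any (\<lambda>b. Sum_any (\<lambda>m::nat. HH c_vec (- 1 - int m) (EM i (?al b - 1 - int m) (EP i b ?y))))"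
   unfolding Em_rec SA_scale ..
  also have "Sum_any (\<lambda>b. Sum_any (\<lambda>m::nat. HH c_vec (- 1 - int m) (EM i (?al b - 1 - int m) (EP i b ?y)))) =
    Sum_any (\<lambda>m::nat. Sum_any (\<lambda>b. HH c_vec (- 1 - int m) (EM i (?al b - 1 - int m) (EP i b ?y))))"
  proof (rule SA_swap, rule finite_subset)
   show "{(b, m). HH c_vec (- 1 - int m) (EM i (?al b - 1 - int m) (EP i b ?y)) \<noteq> 0} \<subseteq> {0..K} \<times> {..nat (K - i * r - n)}"
   proof (clarify, intro conjI)
    fix b m assume nz: "HH c_vec (- 1 - int m) (EM i (?al b - 1 - int m) (EP i b ?y)) \<noteq> 0"
    have "\<not> (b < 0 \<or> b \<ge> K)" using nz Ez[of b] by (auto simp: heis_lin_0 clinear_0[OF Em_linear])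
    then have b: "0 \<le> b" "b < K" by auto
    have "0 \<le> ?al b - 1 - int m" using nz Em_neg[of "?al b - 1 - int m"] by (force simp: heis_lin_0)
    then show "b \<in> {0..K}" "m \<in> {..nat (K - i * r - n)}" using b by auto
   qed
  qed simp
  also have "\<dots> = Sum_any (\<lambda>m::nat. HH c_vec (- 1 - int m) (VV i (n + int m) x))"
  proof (rule Sum_any.cong)
   fix m :: nat
   show "Sum_any (\<lambda>b. HH c_vec (- 1 - int m) (EM i (?al b - 1 - int m) (EP i b ?y))) = HH c_vec (- 1 - int m) (VV i (n + int m) x)"
    unfolding exp_vop_eq
    by (subst heis_lin_Sum_any) (rule fE, rule Em_linear, simp add: algebra_simps)
  qed
  finally show ?thesis .
 qed
 moreover have "- ?T2 + ?T3 = of_int i *s Sum_any (\<lambda>m::nat. VV i (n - 1 - int m) (HH c_vec (int m) x))"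
 proof -
  have "?T2 = - of_int i *s Sum_any (\<lambda>b. Sum_any (\<lambda>m::nat. EM i (?al b) (HH c_vec (1 + int m) (EP i (b - 1 - int m) ?y))))"
  proof -
   have "of_int b *s EM i (?al b) (EP i b ?y) = - of_int i *s Sum_any (\<lambda>m::nat. EM i (?al b) (HH c_vec (1 + int m) (EP i (b - 1 - int m) ?y)))" for b
   proof -
    have "fs (\<lambda>m::nat. HH c_vec (1 + int m) (EP i (b - 1 - int m) ?y))"
     by (rule fs_nat[of M]) (rule M')
    then show ?thesis
     unfolding clinear_scale[OF Em_linear, symmetric] Ep_rec by (simp add: clinear_scale[OF Em_linear] clinear_minus[OF Em_linear] clinear_Sum_any[OF Em_linear])
   qed
   then show ?thesis unfolding SA_scale[symmetric] by simp
  qed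
  also have "Sum_any (\<lambda>b. Sum_any (\<lambda>m::nat. EM i (?al b) (HH c_vec (1 + int m) (EP i (b - 1 - int m) ?y)))) =
    Sum_any (\<lambda>m::nat. Sum_any (\<lambda>b. EM i (?al b) (HH c_vec (1 + int m) (EP i (b - 1 - int m) ?y))))"
  proof (rule SA_swap, rule finite_subset)
   show "{(b, m). EM i (?al b) (HH c_vec (1 + int m) (EP i (b - 1 - int m) ?y)) \<noteq> 0} \<subseteq> {0..K + int M + 1} \<times> {..M}"
   proof (clarify, intro conjI)
    fix b m assume nz: "EM i (?al b) (HH c_vec (1 + int m) (EP i (b - 1 - int m) ?y)) \<noteq> 0"
    have "\<not> (b - 1 - int m < 0 \<or> b - 1 - int m \<ge> K)" using nz Ez[of "b - 1 - int m"]
     by (auto simp: heis_lin_0 clinear_0[OF Em_linear])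
    then have b: "0 \<le> b - 1 - int m" "b - 1 - int m < K" by auto
    have "\<not> m \<ge> M" using nz M'[of m "b - 1 - int m"] by (auto simp: clinear_0[OF Em_linear])
    then have "m < M" by simp
    then show "b \<in> {0..K + int M + 1}" "m \<in> {..M}" using b by auto
   qed
  qed simp
  also have "\<dots> = Sum_any (\<lambda>m::nat. VV i (n - 1 - int (Suc m)) (HH c_vec (int (Suc m)) x))"
  proof (rule Sum_any.cong)
   fix m :: nat
   have "VV i (n - 1 - int (Suc m)) (HH c_vec (int (Suc m)) x) = HH c_vec (1 + int m) (VV i (n - 2 - int m) x)"
    unfolding exp_vop_c1 by (simp add: algebra_simps)
   also have "\<dots> = Sum_any (\<lambda>b. EM i (?al (b + (1 + int m))) (HH c_vec (1 + int m) (EP i b ?y)))"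
    unfolding exp_vop_eq
    by (subst heis_lin_Sum_any) (rule fE, rule Em_linear, simp add: c_Em1 algebra_simps)
   also have "\<dots> = Sum_any (\<lambda>b. EM i (?al b) (HH c_vec (1 + int m) (EP i (b - 1 - int m) ?y)))"
    by (subst SA_shift[of _ "1 + int m", symmetric]) simp
   finally show "Sum_any (\<lambda>b. EM i (?al b) (HH c_vec (1 + int m) (EP i (b - 1 - int m) ?y))) = VV i (n - 1 - int (Suc m)) (HH c_vec (int (Suc m)) x)" ..
  qed
  finally have T2: "?T2 = - of_int i *s Sum_any (\<lambda>m::nat. VV i (n - 1 - int (Suc m)) (HH c_vec (int (Suc m)) x))" .
  have fm: "fs (\<lambda>m::nat. VV i (n - 1 - int m) (HH c_vec (int m) x))"
   using fld_fs_lin[OF heis_fld[of c_vec], of "\<lambda>m. VV i (n - 1 - int m)" 0 x] lin by simp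
  show ?thesis unfolding T2 SA_Suc[OF fm]
   by (simp add: heis_c_zero clinear_scale[OF lin] scaleC_add_right scaleC_scaleC)
 qed
 moreover have "prd (HH c_vec) (HH c_vec) (-1) (VV i) n x = Sum_any (\<lambda>m::nat. HH c_vec (- 1 - int m) (VV i (n + int m) x)) + Sum_any (\<lambda>m::nat. VV i (n - 1 - int m) (HH c_vec (int m) x))"
  unfolding prd_m1
  by (rule SA_add[OF fld_fs_lin[OF exp_vop_fld heis_linear]])
   (use fld_fs_lin[OF heis_fld[of c_vec], of "\<lambda>m. VV i (n - 1 - int m)" 0 x] lin in simp)
 ultimately show ?thesis by (simp add: scaleC_add_right)
qed

lemma Em_add: "Sum_any (\<lambda>a. EM i a (EM j (N - a) x)) = EM (i + j) N x"
proof -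
 have "Sum_any (\<lambda>a. EM i a (EM j (N - a) x)) = expz (\<lambda>m v. Xm k r lam i m v + Xm k r lam j m v) N x"
  unfolding Em_def by (rule expz_add) (rule heis_linear heis_cc)+
 also have "(\<lambda>m v. Xm k r lam i m v + Xm k r lam j m v) = Xm k r lam (i + j)"
  by (simp add: fun_eq_iff heis_add[symmetric] scaleC_add_left[symmetric] add_divide_distrib)
 finally show ?thesis unfolding Em_def .
qed

lemma Ep_add: "Sum_any (\<lambda>a. EP i a (EP j (N - a) x)) = EP (i + j) N x"
proof -
 have "Sum_any (\<lambda>a. EP i a (EP j (N - a) x)) = expz (\<lambda>m v. Xp k r lam i m v + Xp k r lam j m v) N x"
  unfolding Ep_def by (rule expz_add) (rule heis_linear heis_cc)+
 also have "(\<lambda>m v. Xp k r lam i m v + Xp k r lam j m v) = Xp k r lam (i + j)"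
  by (simp add: fun_eq_iff heis_add[symmetric] scaleC_diff_left scaleC_add_left diff_divide_distrib)
 finally show ?thesis unfolding Ep_def .
qed

text \<open>As <c,c> = 0 there is no contraction, so the two operators can be multiplied at the same
  point and their exponentials simply add.\<close>

lemma exp_vop_mult: "Sum_any (\<lambda>m. VV i m (VV j (q - 1 - m) x)) = VV (i + j) q x"
proof -
 let ?y = "shift_op (i + j) x"
 obtain K where K: "\<And>b. b \<ge> K \<Longrightarrow> EP i b ?y = 0" using annihilate_bound by blast
 have Ei: "EP i b ?y = 0" if "b < 0 \<or> b \<ge> K" for b using that K Ep_neg by auto
 let ?P = "\<lambda>b b'. EP j b' (EP i b ?y)"
 let ?X = "\<lambda>m n b b'. EM i (b - i * r - m - 1) (EM j (b' - j * r - n - 1) (?P b b'))"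
 let ?E = "\<lambda>c. EM (i + j) (c - (i + j) * r - q - 1)"
 have "\<exists>L. \<forall>b b'. b' \<ge> L \<longrightarrow> ?P b b' = 0"
 proof -
  have "\<exists>L. \<forall>b'\<ge>L. ?P b b' = 0" for b using annihilate_bound by blast
  then obtain L where L: "\<And>b b'. b' \<ge> L b \<Longrightarrow> ?P b b' = 0" by metis
  have "?P b b' = 0" if "b' \<ge> Max (insert 0 (L ` {0..K}))" for b b'
  proof (cases "b \<in> {0..K}")
   case True
   then have "L b \<le> Max (insert 0 (L ` {0..K}))" by (intro Max_ge) auto
   then show ?thesis using L that by (meson order_trans)
  next
   case False
   then have "b < 0 \<or> b \<ge> K" by auto
   then show ?thesis by (simp add: Ei clinear_0[OF Ep_linear])
  qed
  then show ?thesis by blast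
 qed
 then obtain L where L: "\<And>b b'. b' \<ge> L \<Longrightarrow> ?P b b' = 0" by blast
 have z: "?P b b' = 0" if "b < 0 \<or> b \<ge> K \<or> b' < 0 \<or> b' \<ge> L" for b b'
  using that Ei[of b] L[of b' b] Ep_neg by (auto simp: clinear_0[OF Ep_linear])
 let ?B = "{0..K} \<times> {0..L}"
 have nz1: "b \<in> {0..K} \<and> b' \<in> {0..L}" if "EM i' c (?P b b') \<noteq> 0" for i' c b b'
 proof -
  have "\<not> (b < 0 \<or> b \<ge> K \<or> b' < 0 \<or> b' \<ge> L)" using that z[of b b'] by (auto simp: clinear_0[OF Em_linear])
  then show ?thesis by auto
 qed
 have nz2: "b \<in> {0..K} \<and> b' \<in> {0..L}" if "EM i c (EM j d (?P b b')) \<noteq> 0" for c d b b'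
 proof (rule nz1)
  show "EM j d (?P b b') \<noteq> 0" using that clinear_0[OF Em_linear] by metis
 qed
 have VVij: "VV i m (VV j n x) = (\<Sum>p\<in>?B. ?X m n (fst p) (snd p))" for m n
 proof -
  have fj: "fs (\<lambda>b. EM j (b - j * r - n - 1) (EP j b (shift_op j z)))" for z by (rule fs_Ep) (rule Em_linear)
  have fi: "fs (\<lambda>b. EM i (b - i * r - n - 1) (EP i b (shift_op i z)))" for n z by (rule fs_Ep) (rule Em_linear)
  \<comment> \<open>Commuting first puts the annihilation part of \<open>i\<close> innermost, on the
    fixed vector \<open>?y\<close>, where it has a bound independent of \<open>b'\<close>.\<close>
  have "VV i m (VV j n x) = Sum_any (\<lambda>b'. EM j (b' - j * r - n - 1) (EP j b' (shift_op j (VV i m x))))"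
   by (subst exp_vop_commute) (rule exp_vop_eq)
  also have "\<dots> = Sum_any (\<lambda>b'. Sum_any (\<lambda>b. ?X m n b b'))"
  proof (rule Sum_any.cong)
   fix b'
   have l: "clinear (\<lambda>u. EM j (b' - j * r - n - 1) (EP j b' (shift_op j u)))"
    by (intro clinear_compose[OF Em_linear] clinear_compose[OF Ep_linear] shift_linear)
   have a: "EM j c (EM i d u) = EM i d (EM j c u)" for c d u
    unfolding Em_def[of _ _ _ i] by (rule expz_commute) (rule heis_linear Em_linear c_Em[symmetric])+
   show "EM j (b' - j * r - n - 1) (EP j b' (shift_op j (VV i m x))) =
    Sum_any (\<lambda>b. ?X m n b b')"
    unfolding exp_vop_eq clinear_Sum_any[OF l fi]
    by (simp add: shift_Em shift_Ep shift_shift Em_Ep[symmetric] a add.commute)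
  qed
  also have "\<dots> = (\<Sum>b'\<in>{0..L}. \<Sum>b\<in>{0..K}. ?X m n b b')"
  proof -
   have "Sum_any (\<lambda>b. ?X m n b b') =
     (\<Sum>b\<in>{0..K}. ?X m n b b')" for b'
    by (rule Sum_any.expand_superset) (use nz2 in auto)
   moreover have "Sum_any (\<lambda>b'. (\<Sum>b\<in>{0..K}. ?X m n b b')) =
     (\<Sum>b'\<in>{0..L}. (\<Sum>b\<in>{0..K}. ?X m n b b'))"
   proof (rule Sum_any.expand_superset)
    show "{b'. (\<Sum>b\<in>{0..K}. ?X m n b b') \<noteq> 0} \<subseteq> {0..L}"
    proof
     fix b' assume "b' \<in> {b'. (\<Sum>b\<in>{0..K}. ?X m n b b') \<noteq> 0}"
     then have "(\<Sum>b\<in>{0..K}. ?X m n b b') \<noteq> 0" by simp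
     then obtain b where "?X m n b b' \<noteq> 0"
      by (rule sum.not_neutral_contains_not_neutral)
     then show "b' \<in> {0..L}" using nz2 by blast
    qed
   qed simp
   ultimately show ?thesis by simp
  qed
  also have "\<dots> = (\<Sum>p\<in>?B. ?X m n (fst p) (snd p))"
   by (subst sum.swap) (simp add: sum.cartesian_product case_prod_beta)
  finally show ?thesis .
 qed
 have fm: "fs (\<lambda>m. EM i (c - m) (EM j (d + m) u))" for c d u
  by (rule fs_int[of "- d" _ c]) (auto simp: Em_neg clinear_0[OF Em_linear])
 have "Sum_any (\<lambda>m. VV i m (VV j (q - 1 - m) x)) = (\<Sum>p\<in>?B. Sum_any (\<lambda>m. ?X m (q - 1 - m) (fst p) (snd p)))"
  unfolding VVij
 proof (rule SA_finite_sum_swap[where f = "\<lambda>p m. ?X m (q - 1 - m) (fst p) (snd p)"])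
  fix p :: "int \<times> int"
  show "fs (\<lambda>m. ?X m (q - 1 - m) (fst p) (snd p))"
   by (rule fs_sub[OF fm[of "fst p - i * r - 1" "snd p - j * r - q" "?P (fst p) (snd p)"]])
    (simp add: algebra_simps)
 qed simp
 also have "\<dots> = (\<Sum>p\<in>?B. ?E (fst p + snd p) (?P (fst p) (snd p)))"
 proof (intro sum.cong refl)
  fix p :: "int \<times> int" and u
  let ?c = "fst p - i * r - 1" and ?N = "fst p + snd p - (i + j) * r - q - 1"
  have "Sum_any (\<lambda>m. EM i (fst p - i * r - m - 1) (EM j (snd p - j * r - (q - 1 - m) - 1) u)) = Sum_any (\<lambda>m. (\<lambda>a. EM i a (EM j (?N - a) u)) (?c - m))" for u
   by (rule Sum_any.cong) (simp add: algebra_simps)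
  also have "\<dots> u = EM (i + j) ?N u" for u
   using SA_neg[of "\<lambda>a. EM i a (EM j (?N - a) u)" ?c] Em_add[of i j ?N u] by simp
  finally show "Sum_any (\<lambda>m. ?X m (q - 1 - m) (fst p) (snd p)) =
    EM (i + j) ?N (?P (fst p) (snd p))" .
 qed
 \<comment> \<open>The creation parts are merged; regrouping by the total annihilation degree merges
   the annihilation parts.\<close>
 also have "\<dots> = Sum_any (\<lambda>b'. Sum_any (\<lambda>b. ?E b' (?P b (b' - b))))"
 proof -
  have "finite {(b, b'). ?E b' (?P b (b' - b)) \<noteq> 0}" (is "finite ?F")
  proof (rule finite_subset)
   show "?F \<subseteq> {0..K} \<times> {0..K + L}" using nz1 by fastforce
  qed simp
  from SA_swap[OF this] have "Sum_any (\<lambda>b'. Sum_any (\<lambda>b. ?E b' (?P b (b' - b)))) =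
   Sum_any (\<lambda>b. Sum_any (\<lambda>b'. ?E b' (?P b (b' - b))))" by simp
  also have "\<dots> = Sum_any (\<lambda>b. Sum_any (\<lambda>b'. ?E (b + b') (?P b b')))"
  proof (rule Sum_any.cong)
   fix b
   show "Sum_any (\<lambda>b'. ?E b' (?P b (b' - b))) =
    Sum_any (\<lambda>b'. ?E (b + b') (?P b b'))"
    by (subst SA_shift[of _ b, symmetric]) (simp add: algebra_simps)
  qed
  also have "\<dots> = Sum_any (\<lambda>(b, b'). ?E (b + b') (?P b b'))"
   by (rule Sum_any.cartesian_product[of ?B]) (use nz1 in auto)
  also have "\<dots> = (\<Sum>p\<in>?B. ?E (fst p + snd p) (?P (fst p) (snd p)))"
   unfolding case_prod_beta by (rule Sum_any.expand_superset) (use nz1 in auto)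
  finally show ?thesis ..
 qed
 also have "\<dots> = Sum_any (\<lambda>b'. ?E b' (EP (i + j) b' ?y))"
 proof (rule Sum_any.cong)
  fix b'
  have "fs (\<lambda>b. ?P b (b' - b))"
   by (rule fs_int[of 0 _ K]) (use z in auto)
  then have "Sum_any (\<lambda>b. ?E b' (?P b (b' - b))) =
    ?E b' (Sum_any (\<lambda>b. ?P b (b' - b)))"
   by (rule clinear_Sum_any[OF Em_linear, symmetric])
  also have "Sum_any (\<lambda>b. ?P b (b' - b)) = EP (i + j) b' ?y"
   using SA_neg[of "\<lambda>b. EP j b (EP i (b' - b) ?y)" b'] by (simp add: Ep_add add.commute)
  finally show "Sum_any (\<lambda>b. ?E b' (?P b (b' - b))) = ?E b' (EP (i + j) b' ?y)" .
 qed
 also have "\<dots> = VV (i + j) q x" unfolding exp_vop_eq ..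
 finally show ?thesis .
qed

lemma exp_vop_0: "VV 0 = id_fld"
proof (intro ext)
 fix n x
 have m: "EM 0 a v = (if a = 0 then v else 0)" for a v
  by (cases "a > 0") (auto simp: Em_def expz_def heis_zero_vec exp_coeff_0 intro!: exp_coeff_zero)
 have p: "EP 0 a v = (if a = 0 then v else 0)" for a v
  by (cases "a > 0") (auto simp: Ep_def expz_def heis_zero_vec exp_coeff_0 intro!: exp_coeff_zero)
 show "VV 0 n x = id_fld n x"
  unfolding exp_vop_eq by (subst SA_single[of 0]) (auto simp: m p shift_0 id_fld_def)
qed

text \<open>No annihilation term survives on an exponential vector, so the mode is a single creation
  coefficient. It vanishes for \<open>n \<ge> - i * r\<close>.\<close>

lemma exp_vop_pi_exp: "VV i n (pi_exp j) = EM i (- i * r - n - 1) (pi_exp (i + j))"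
proof -
 have "EP i b (pi_exp (i + j)) = 0" if "b > 0" for b
  using that unfolding Ep_def expz_def
  by (simp, intro exp_coeff_annihilated heis_linear) (simp_all add: pi_exp_def heis_pos)
 moreover have "shift_op i (pi_exp j) = pi_exp (i + j)" by (simp add: pi_exp_def shift_single add.commute)
 ultimately show ?thesis unfolding exp_vop_eq
  by (subst SA_single[of 0]) (auto simp: clinear_0[OF Em_linear] Ep_neg neq_iff, simp add: Ep_def expz_0)
qed

end

section \<open>The modules over the lattice vertex algebra\<close>

lemma prd_scale_left: "prd (\<lambda>n x. t *s A' n x) (\<lambda>n x. t *s A n x) l B q x = t *s prd A' A l B q x" if "is_fld B"
 unfolding prd_def brs_def SA_scale[symmetric]
 by (simp add: fld_scale[OF that] scaleC_scaleC scaleC_diff_right mult_ac)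

lemma prd_add_left:
 assumes "is_fld A'" "is_fld A" "is_fld C'" "is_fld C" "is_fld B"
 shows "prd (\<lambda>n x. A' n x + C' n x) (\<lambda>n x. A n x + C n x) l B q x = prd A' A l B q x + prd C' C l B q x"
proof -
 note f = fld_fs_lin is_fld_linear assms
 have "Sum_any (\<lambda>i. ((- 1) ^ i * bin l i) *s (A' (0 + l - int i) (B (q + int i) x) + C' (0 + l - int i) (B (q + int i) x))) =
  Sum_any (\<lambda>i. ((- 1) ^ i * bin l i) *s A' (0 + l - int i) (B (q + int i) x)) + Sum_any (\<lambda>i. ((- 1) ^ i * bin l i) *s C' (0 + l - int i) (B (q + int i) x))"
  unfolding scaleC_add_right by (intro SA_add fs_scale f)
 moreover have "Sum_any (\<lambda>i. ((- 1) ^ i * bin l i) *s B (l + q - int i) (A (0 + int i) x + C (0 + int i) x)) =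
  Sum_any (\<lambda>i. ((- 1) ^ i * bin l i) *s B (l + q - int i) (A (0 + int i) x)) + Sum_any (\<lambda>i. ((- 1) ^ i * bin l i) *s B (l + q - int i) (C (0 + int i) x))"
  unfolding scaleC_add_right fld_add[OF assms(5)] by (intro SA_add fs_scale f)
 ultimately show ?thesis
  unfolding prd_def brs_split[OF assms(1,2,5)] brs_split[OF assms(3,4,5)]
   brs_split[OF is_fld_add[OF assms(1,3)] is_fld_add[OF assms(2,4)] assms(5)]
  by (simp add: scaleC_add_right)
qed

lemma prd_add_right:
 assumes "is_fld A'" "is_fld A" "is_fld B" "is_fld C"
 shows "prd A' A l (\<lambda>n x. B n x + C n x) q x = prd A' A l B q x + prd A' A l C q x"
proof -
 note f = fld_fs_lin is_fld_linear assms
 have "Sum_any (\<lambda>i. ((- 1) ^ i * bin l i) *s A' (0 + l - int i) (B (q + int i) x + C (q + int i) x)) =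
  Sum_any (\<lambda>i. ((- 1) ^ i * bin l i) *s A' (0 + l - int i) (B (q + int i) x)) + Sum_any (\<lambda>i. ((- 1) ^ i * bin l i) *s A' (0 + l - int i) (C (q + int i) x))"
  unfolding scaleC_add_right fld_add[OF assms(1)] by (intro SA_add fs_scale f)
 moreover have "Sum_any (\<lambda>i. ((- 1) ^ i * bin l i) *s (B (l + q - int i) (A (0 + int i) x) + C (l + q - int i) (A (0 + int i) x))) =
  Sum_any (\<lambda>i. ((- 1) ^ i * bin l i) *s B (l + q - int i) (A (0 + int i) x)) + Sum_any (\<lambda>i. ((- 1) ^ i * bin l i) *s C (l + q - int i) (A (0 + int i) x))"
  unfolding scaleC_add_right by (intro SA_add fs_scale f)
 ultimately show ?thesis
  unfolding prd_def brs_split[OF assms(1,2,3)] brs_split[OF assms(1,2,4)]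
   brs_split[OF assms(1,2) is_fld_add[OF assms(3,4)]]
  by (simp add: scaleC_add_right)
qed

lemma prd_scale_right: "prd A' A l (\<lambda>n x. t *s B n x) q x = t *s prd A' A l B q x" if "is_fld A'"
 unfolding prd_def brs_def SA_scale[symmetric]
 by (simp add: fld_scale[OF that] scaleC_scaleC scaleC_diff_right mult_ac)

lemma prd_zero_left: "prd (\<lambda>_ _. 0) (\<lambda>_ _. 0) l B = (\<lambda>_ _. 0)" if "is_fld B"
 unfolding prd_def brs_def fun_eq_iff by (simp add: fld_0[OF that])

lemma SA_int_split: "fs f \<Longrightarrow> Sum_any f = Sum_any (\<lambda>a::nat. f (- 1 - int a) + f (int a))"
 for f :: "int \<Rightarrow> 'v::comm_monoid_add"
proof -
 assume f: "fs f"
 let ?N = "range (\<lambda>a. - 1 - int a)"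
 have split: "UNIV = ?N \<union> range int" "?N \<inter> range int = {}"
 proof -
  show "UNIV = ?N \<union> range int"
  proof (intro set_eqI iffI UnCI)
   fix z :: int assume "z \<notin> range int"
   then have "z < 0" by (metis linorder_not_less rangeI nonneg_int_cases)
   then show "z \<in> ?N" by (intro image_eqI[of _ _ "nat (- 1 - z)"]) auto
  qed auto
 qed auto
 let ?S = "{i. f i \<noteq> 0}"
 let ?A = "{a::nat. f (- 1 - int a) \<noteq> 0}" and ?B = "{a::nat. f (int a) \<noteq> 0}"
 have fA: "finite ?A" and fB: "finite ?B"
  using fs_inj[OF f, of "\<lambda>a::nat. - 1 - int a"] fs_inj[OF f, of int] by (auto simp: inj_def)
 have "?S = (\<lambda>a. - 1 - int a) ` ?A \<union> int ` ?B"
 proof (intro set_eqI iffI)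
  fix z assume "z \<in> ?S"
  then show "z \<in> (\<lambda>a. - 1 - int a) ` ?A \<union> int ` ?B"
  proof (cases "z < 0")
   case True then show ?thesis using \<open>z \<in> ?S\<close> by (intro UnI1 image_eqI[of _ _ "nat (- 1 - z)"]) auto
  next
   case False then show ?thesis using \<open>z \<in> ?S\<close> by (intro UnI2 image_eqI[of _ _ "nat z"]) auto
  qed
 qed auto
 then have "Sum_any f = sum f ((\<lambda>a. - 1 - int a) ` ?A \<union> int ` ?B)" by (simp add: Sum_any.expand_set)
 also have "\<dots> = sum f ((\<lambda>a. - 1 - int a) ` ?A) + sum f (int ` ?B)"
  by (rule sum.union_disjoint) (use fA fB in auto)
 also have "\<dots> = (\<Sum>a\<in>?A. f (- 1 - int a)) + (\<Sum>a\<in>?B. f (int a))"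
  by (simp add: sum.reindex inj_on_def)
 also have "\<dots> = Sum_any (\<lambda>a. f (- 1 - int a)) + Sum_any (\<lambda>a. f (int a))" by (simp add: Sum_any.expand_set)
 also have "\<dots> = Sum_any (\<lambda>a. f (- 1 - int a) + f (int a))" by (rule SA_add[symmetric]) (use fA fB in auto)
 finally show ?thesis .
qed

lemma foldr_insort:
 assumes "\<And>x U. P U \<Longrightarrow> P (f x U)" "\<And>x y U. P U \<Longrightarrow> f x (f y U) = f y (f x U)" "P U"
 shows "foldr f (insort x xs) U = f x (foldr f xs U)"
proof (induction xs)
 case (Cons y ys)
 have "P (foldr f ys U)" using assms by (induction ys) auto
 then show ?case using Cons by (simp add: assms(2))
qed simp

text \<open>\<open>pi_vop_basis\<close> folds over sorted lists. The normal products commute, so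
  inserting a part anywhere amounts to applying its factor last. Commutation is available on fields
  only, hence the invariant \<open>P\<close>.\<close>

lemma foldr_sorted_add_mset:
 assumes "\<And>x U. P U \<Longrightarrow> P (f x U)" "\<And>x y U. P U \<Longrightarrow> f x (f y U) = f y (f x U)" "P U"
 shows "foldr f (sorted_list_of_multiset (add_mset x M)) U = f x (foldr f (sorted_list_of_multiset M) U)"
 using foldr_insort[of P f U x, OF assms] by (simp add: sorted_list_of_multiset_insert)

lemma foldr_invariant: "(\<And>x U. P U \<Longrightarrow> P (f x U)) \<Longrightarrow> P U \<Longrightarrow> P (foldr f xs U)"
 by (induction xs) auto

lemma foldr_pass: "(\<And>x U. P U \<Longrightarrow> P (f x U)) \<Longrightarrow> (\<And>x U. P U \<Longrightarrow> g (f x U) = f x (g U)) \<Longrightarrow> P U \<Longrightarrow>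
  g (foldr f xs U) = foldr f xs (g U)"
proof (induction xs)
 case (Cons x xs)
 have "P (foldr f xs U)" by (rule foldr_invariant) (use Cons in auto)
 then show ?case using Cons by simp
qed simp

lemma heis_induct:
 assumes "\<And>x y. P x \<Longrightarrow> P y \<Longrightarrow> P (x + y)" "\<And>t x. P x \<Longrightarrow> P (t *s x)" "\<And>j. P (pi_exp j)"
  and H: "\<And>a n x. n < 0 \<Longrightarrow> P x \<Longrightarrow> P (heis_op k r lam a n x)"
 shows "P x"
proof (induction x rule: pm_induct)
 case (single b t)
 obtain A B j where b: "b = (A, B, j)" by (cases b) auto
 have "P (single ({#}, B, j) 1)"
 proof (induction B)
  case (add m B)
  then show ?case using H[of "- int m - 1" _ d_vec] by (force simp: heis_d_neg)
 qed (use assms(3)[of j] in \<open>simp add: pi_exp_def\<close>)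
 then have "P (single (A, B, j) 1)"
 proof (induction A)
  case (add m A)
  then show ?case using H[of "- int m - 1" _ c_vec] by (force simp: heis_c_neg)
 qed
 from assms(2)[OF this, of t] show ?case by (simp add: scaleC_single scaleC_complex_def b)
qed (use assms in auto)

text \<open>The coefficients of the divided derivatives of \<open>U(z)\<close> are binomials with
  negative upper index; \<open>bin_negate\<close> identifies them with those of the product of index
  \<open>- m - 1\<close>.\<close>

lemma normal_product_eq: "normal_product U m W = pr U (- int m - 1) W"
proof (intro ext)
 fix n x
 show "normal_product U m W n x = pr U (- int m - 1) W n x"
  unfolding normal_product_def prd_def brs_def
 proof (rule Sum_any.cong)
  fix j :: nat
  have "(-1) ^ j * bin (- int m - 1) j = bin (int (m + j)) j"
   using bin_negate[of "- int m - 1" j] by (simp add: algebra_simps power_mult_distrib[symmetric])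
  also have "\<dots> = of_nat ((m + j) choose j)" by (rule bin_nat)
  finally have 1: "(-1) ^ j * bin (- int m - 1) j = of_nat ((m + j) choose j)" .
  have 2: "sg (- int m - 1) = - ((-1) ^ m)" using sg_Suc(1)[of "int m"] sg_minus[of "int m + 1"] by (simp add: sg_nat)
  show "of_nat ((m + j) choose j) *s (U (- int m - 1 - int j) (W (n + int j) x) + ((-1) ^ m) *s W (n - int m - 1 - int j) (U (int j) x)) =
   abin (- int m - 1) j *s (U (0 + (- int m - 1) - int j) (W (n + int j) x) - sg (- int m - 1) *s W (- int m - 1 + n - int j) (U (0 + int j) x))"
   unfolding 1 2 by (simp add: algebra_simps)
 qed
qed

section \<open>Compatibility of the lattice action with the Heisenberg modes\<close>

context
 fixes k :: complex and r :: int and lam :: complex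
begin

abbreviation (input) "HW \<equiv> heis_op k r lam"
abbreviation (input) "HV \<equiv> heis_op k 0 0"
abbreviation (input) "EW \<equiv> exp_vop k r lam"
abbreviation (input) "YW \<equiv> pi_vop k r lam"
abbreviation (input) "YV \<equiv> pi_vop k 0 0"

lemma HW_fld: "is_fld (HW a)" by (rule heis_fld)

text \<open>The operator product a(z) b(w) ~ <a,b> / (z - w)^2: among the nonnegative indices only 1
  gives a nonzero product.\<close>

definition hh_sing :: "heis \<Rightarrow> heis \<Rightarrow> nat \<Rightarrow> (pi, pi) fld" where
 "hh_sing a b i = (if i = 1 then (\<lambda>n x. form a b *s id_fld n x) else (\<lambda>_ _. 0))"

lemma HW_comm: "HW a m (HW b n x) - HW b n (HW a m x) = (\<Sum>i<2. bin m i *s hh_sing a b i (m + n - int i) x)"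
 by (simp add: heis_comm numeral_2_eq_2 hh_sing_def id_fld_def scaleC_scaleC)

lemma HW_prd: "pr (HW a) (int i) (HW b) = hh_sing a b i"
proof -
 have "pr (HW a) (int i) (HW b) = (if i < 2 then hh_sing a b i else (\<lambda>_ _. 0))"
  by (rule comm_prd) (rule HW_comm)
 then show ?thesis by (auto simp: hh_sing_def)
qed

lemma HW_bor: "bo (HW a) (HW b)"
 by (rule comm_bor[OF HW_fld HW_fld HW_fld HW_comm])

lemma hh_sing_bor: "bo (hh_sing a b i) U" if "is_fld U"
proof -
 have "is_fld (hh_sing a b i)"
  unfolding hh_sing_def using is_fld_scale[OF is_fld_id, of "\<lambda>_. form a b"] is_fld_zero by auto
 then show ?thesis using that fld_scale[OF that] fld_0[OF that]
  by (intro comm_zero_bor) (auto simp: hh_sing_def id_fld_def)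
qed

lemma HW_prd_comm:
 assumes U: "is_fld U"
 shows "pr (HW a) n (pr (HW b) l U) q x = pr (HW b) l (pr (HW a) n U) q x + (if n + l = 0 then of_int n * form a b else 0) *s U q x"
proof -
 have N: "\<forall>l\<ge>int 2. pr (HW a) l (HW b) = (\<lambda>_ _. 0)"
 proof (intro allI impI)
  fix l assume "int 2 \<le> l"
  then show "pr (HW a) l (HW b) = (\<lambda>_ _. 0)" using HW_prd[of a "nat l" b] by (auto simp: hh_sing_def)
 qed
 have "pr (HW a) n (pr (HW b) l U) q x - pr (HW b) l (pr (HW a) n U) q x =
  (\<Sum>j<2. bin n j *s pr (hh_sing a b j) (n + l - int j) U q x)"
  using prd_comm[OF HW_fld[of a] HW_fld[of b] U HW_bor N, of n l q x] unfolding HW_prd .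
 also have "\<dots> = (if n + l = 0 then of_int n * form a b else 0) *s U q x"
  using prd_scale_left[OF U, of "form a b" id_fld id_fld "n + l - 1" q x]
  by (simp add: numeral_2_eq_2 hh_sing_def prd_zero_left[OF U] prd_id_left[OF U] scaleC_scaleC)
 finally show ?thesis by (simp add: algebra_simps)
qed

lemma HW_prd_add: "is_fld U \<Longrightarrow> pr (HW (a + b)) n U q x = pr (HW a) n U q x + pr (HW b) n U q x"
 using prd_add_left[OF HW_fld[of a] HW_fld[of a] HW_fld[of b] HW_fld[of b], of U n q x] by (simp add: heis_add[abs_def])

lemma HW_prd_scale: "is_fld U \<Longrightarrow> pr (HW (t *s a)) n U q x = t *s pr (HW a) n U q x"
 using prd_scale_left[of U t "HW a" "HW a" n q x] by (simp add: heis_scale[abs_def])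

abbreviation (input) "cop \<equiv> \<lambda>m. pr (HW c_vec) (- int m - 1)"
abbreviation (input) "dop \<equiv> \<lambda>m. pr (HW d_vec) (- int m - 1)"

lemma basis_eq: "pi_vop_basis k r lam (A, B, i) =
  foldr cop (sorted_list_of_multiset A) (foldr dop (sorted_list_of_multiset B) (EW i))"
 by (simp add: pi_vop_basis_def normal_product_eq[abs_def])

lemma op_commute: "is_fld U \<Longrightarrow> pr (HW a) (- int m - 1) (pr (HW b) (- int n - 1) U) = pr (HW b) (- int n - 1) (pr (HW a) (- int m - 1) U)"
 using HW_prd_comm[of U a "- int m - 1" b "- int n - 1"] by (auto simp: fun_eq_iff)

lemma op_fld: "is_fld U \<Longrightarrow> is_fld (pr (HW a) n U)" by (intro prd_fld HW_fld)

lemma basis_fld: "is_fld (pi_vop_basis k r lam b)"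
proof -
 obtain A B i where b: "b = (A, B, i)" by (cases b) auto
 show ?thesis unfolding b basis_eq
  by (intro foldr_invariant[where P = is_fld] op_fld exp_vop_fld)
qed

lemma basis_c: "pi_vop_basis k r lam (add_mset m A, B, i) = cop m (pi_vop_basis k r lam (A, B, i))"
 unfolding basis_eq
 by (rule foldr_sorted_add_mset[where P = is_fld and f = cop]) (auto intro!: op_fld op_commute foldr_invariant[where P = is_fld] exp_vop_fld)

lemma basis_d: "pi_vop_basis k r lam (A, add_mset m B, i) = dop m (pi_vop_basis k r lam (A, B, i))"
proof -
 have "foldr dop (sorted_list_of_multiset (add_mset m B)) (EW i) = dop m (foldr dop (sorted_list_of_multiset B) (EW i))"
  by (rule foldr_sorted_add_mset[where P = is_fld and f = dop]) (auto intro!: op_fld op_commute exp_vop_fld)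
 moreover have "dop m (foldr cop xs U) = foldr cop xs (dop m U)" if "is_fld U" for xs U
  by (rule foldr_pass[where P = is_fld and f = cop and g = "dop m"]) (auto intro!: op_fld op_commute that)
 ultimately show ?thesis unfolding basis_eq
  by (simp add: foldr_invariant[where P = is_fld] op_fld exp_vop_fld)
qed

lemma YW_linear: "clinear (\<lambda>u. YW u n x)"
 unfolding pi_vop_def by (rule sum_keys_linear) (rule clinear_scale_left)

lemma YW_single: "YW (single b t) n x = t *s pi_vop_basis k r lam b n x"
 unfolding pi_vop_def by (cases "t = 0") simp_all

lemma YW_pi_exp: "YW (pi_exp i) = EW i"
 by (simp add: fun_eq_iff pi_exp_def YW_single basis_eq scaleC_one)

lemma YW_fld: "is_fld (YW u)"
proof (induction u rule: pm_induct)
 case (add x y)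
 have "YW (x + y) = (\<lambda>n z. YW x n z + YW y n z)" by (simp add: fun_eq_iff clinear_add[OF YW_linear])
 then show ?case using is_fld_add[OF add] by simp
next
 case (single b t)
 have "YW (single b t) = (\<lambda>n z. t *s pi_vop_basis k r lam b n z)" by (simp add: fun_eq_iff YW_single)
 then show ?case using is_fld_scale[OF basis_fld, of "\<lambda>_. t"] by simp
qed

lemma pi_is_vop: "is_vop YW"
 by (simp add: is_vop_def YW_fld YW_linear)

lemma prd_YW_linear: "clinear (\<lambda>u. pr (HW a) n (YW u) q x)"
proof (rule clinearI)
 fix u v t
 have "YW (u + v) = (\<lambda>n z. YW u n z + YW v n z)" by (simp add: fun_eq_iff clinear_add[OF YW_linear])
 then show "pr (HW a) n (YW (u + v)) q x = pr (HW a) n (YW u) q x + pr (HW a) n (YW v) q x"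
  by (simp add: prd_add_right HW_fld YW_fld)
 have "YW (t *s u) = (\<lambda>n z. t *s YW u n z)" by (simp add: fun_eq_iff clinear_scale[OF YW_linear])
 then show "pr (HW a) n (YW (t *s u)) q x = t *s pr (HW a) n (YW u) q x"
  by (simp add: prd_scale_right HW_fld)
qed

lemma YW_heis_neg: "n < 0 \<Longrightarrow> YW (HV a n u) = pr (HW a) n (YW u)"
proof (intro ext)
 fix q x assume n: "n < 0"
 show "YW (HV a n u) q x = pr (HW a) n (YW u) q x"
 proof (rule pi_linear_eq[of "\<lambda>u. YW (HV a n u) q x"])
  show "clinear (\<lambda>u. YW (HV a n u) q x)" by (rule clinear_compose[OF YW_linear heis_linear])
  show "clinear (\<lambda>u. pr (HW a) n (YW u) q x)" by (rule prd_YW_linear)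
  fix A B i
  let ?b = "pi_vop_basis k r lam (A, B, i)"
  have Y: "YW (single (A, B, i) 1) = ?b" by (simp add: fun_eq_iff YW_single scaleC_one)
  have m: "- int (nat (- n - 1)) - 1 = n" using n by simp
  have "pr (HW a) n ?b q x = fst a *s pr (HW c_vec) n ?b q x + snd a *s pr (HW d_vec) n ?b q x"
  proof -
   have "pr (HW (fst a *s c_vec + snd a *s d_vec)) n ?b q x = fst a *s pr (HW c_vec) n ?b q x + snd a *s pr (HW d_vec) n ?b q x"
    by (simp add: HW_prd_add HW_prd_scale basis_fld)
   then show ?thesis by (simp only: heis_decomp[symmetric])
  qed
  then show "YW (HV a n (single (A, B, i) 1)) q x = pr (HW a) n (YW (single (A, B, i) 1)) q x"
   unfolding Y heis_neg[OF n] using basis_c[of "nat (- n - 1)" A B i, unfolded m] basis_d[of A "nat (- n - 1)" B i, unfolded m]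
   by (simp add: clinear_add[OF YW_linear] YW_single)
 qed
qed

lemma exp_heis_comm: "HW a m (EW i n x) - EW i n (HW a m x) = (\<Sum>j<1. bin m j *s (\<lambda>_ q x. (of_int i * form a c_vec) *s EW i q x) j (m + n - int j) x)"
 by (simp add: exp_vop_comm scaleC_one del: form_simps)

lemma top_wt_0: "top_wt k 0 0 j = of_int j *s c_vec" by (simp add: top_wt_def)

lemma HV_exp: "n \<ge> 0 \<Longrightarrow> HV a n (pi_exp j) = (if n = 0 then of_int j * form a c_vec else 0) *s pi_exp j"
 by (cases "n = 0") (simp_all add: pi_exp_def heis_zero heis_pos top_wt_0 form_scale_right scaleC_single scaleC_complex_def del: form_simps)

text \<open>For \<open>n < 0\<close> this is how the action is constructed. For
  \<open>n \<ge> 0\<close> the mode is moved through the creation modes down to an exponential; the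
  Heisenberg relations for vectors and \<open>HW_prd_comm\<close> for fields produce the same
  terms.\<close>

lemma YW_heis: "YW (HV a n u) = pr (HW a) n (YW u)"
proof (induction u arbitrary: a n rule: heis_induct[where k = k and r = 0 and lam = 0])
 case (1 x y)
 show ?case
  unfolding fun_eq_iff using 1 clinear_add[OF prd_YW_linear]
  by (simp add: clinear_add[OF YW_linear] heis_lin_add)
next
 case (2 t x)
 show ?case
  unfolding fun_eq_iff using 2 clinear_scale[OF prd_YW_linear]
  by (simp add: clinear_scale[OF YW_linear] heis_lin_scale)
next
 case (3 j)
 show ?case
 proof (cases "n < 0")
  case False
  then have n: "int (nat n) = n" by simp
  have "pr (HW a) (int (nat n)) (EW j) = (if nat n < 1 then (\<lambda>q x. (of_int j * form a c_vec) *s EW j q x) else (\<lambda>_ _. 0))"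
   by (rule comm_prd) (rule exp_heis_comm)
  then show ?thesis using False unfolding n
   by (auto simp: fun_eq_iff HV_exp clinear_scale[OF YW_linear] YW_pi_exp clinear_0[OF YW_linear] simp del: form_simps)
 qed (simp add: YW_heis_neg)
next
 case (4 b l u)
 show ?case
 proof (intro ext)
  fix q x
  have "HV a n (HV b l u) = HV b l (HV a n u) + (if n + l = 0 then of_int n * form a b else 0) *s u"
   using heis_comm[of k 0 0 a n b l u] by (simp add: algebra_simps)
  then show "YW (HV a n (HV b l u)) q x = pr (HW a) n (YW (HV b l u)) q x"
   using 4 HW_prd_comm[OF YW_fld, of a n b l u q x] YW_heis_neg[OF 4(1), of b "HV a n u"]
   by (simp add: clinear_add[OF YW_linear] clinear_scale[OF YW_linear])
 qed
qed

definition h_vec :: "heis \<Rightarrow> pi" where "h_vec a = HV a (-1) (pi_exp 0)"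

lemma YW_h_vec: "YW (h_vec a) = HW a"
 unfolding h_vec_def YW_heis YW_pi_exp exp_vop_0 by (rule prd_id_right[OF HW_fld])

end

text \<open>\<open>YW_heis\<close> says that the products are the right ones. The identity between
  the fields is carried along the creation modes by \<open>bor_right\<close>, starting from the
  explicit commutator with an exponential.\<close>

lemma pi_jac_heis_exp: "jac (pi_vop k 0 0) (pi_vop k r lam) (pi_vop k r lam) (pi_vop k r lam) (h_vec k a) u"
proof (induction u arbitrary: a rule: heis_induct[where k = k and r = 0 and lam = 0])
 case (1 x y) then show ?case by (intro jac_add_right pi_is_vop)
next
 case (2 t x) then show ?case by (intro jac_scale_right pi_is_vop)
next
 case (3 j)
 show ?case
 proof (rule bor_jac)
  show "pi_vop k r lam (pi_vop k 0 0 (h_vec k a) l (pi_exp j)) = pr (pi_vop k r lam (h_vec k a)) l (pi_vop k r lam (pi_exp j))" for l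
   by (simp only: YW_h_vec YW_heis)
  show "bo (pi_vop k r lam (h_vec k a)) (pi_vop k r lam (pi_exp j))"
   unfolding YW_h_vec YW_pi_exp
   by (rule comm_bor[OF heis_fld heis_fld exp_vop_fld exp_heis_comm])
 qed
next
 case (4 b l u)
 show ?case
 proof (rule bor_jac)
  show "pi_vop k r lam (pi_vop k 0 0 (h_vec k a) m (heis_op k 0 0 b l u)) = pr (pi_vop k r lam (h_vec k a)) m (pi_vop k r lam (heis_op k 0 0 b l u))" for m
   by (simp only: YW_h_vec YW_heis)
  have "bo (heis_op k r lam a) (pi_vop k r lam u)"
   using jac_bor[OF is_vop_fld[OF pi_is_vop] pi_is_vop 4(2)[of a]] unfolding YW_h_vec .
  then show "bo (pi_vop k r lam (h_vec k a)) (pi_vop k r lam (heis_op k 0 0 b l u))"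
   unfolding YW_h_vec YW_heis
   by (intro bor_right heis_fld YW_fld HW_bor) (simp_all add: HW_prd hh_sing_bor YW_fld)
 qed
qed

section \<open>The conformal vector and translation on the lattice side\<close>

context
 fixes k :: complex and r :: int and lam :: complex
begin

abbreviation (input) "hW \<equiv> heis_op k r lam"
abbreviation (input) "hV \<equiv> heis_op k 0 0"
abbreviation (input) "eW \<equiv> exp_vop k r lam"
abbreviation (input) "yW \<equiv> pi_vop k r lam"
abbreviation (input) "yV \<equiv> pi_vop k 0 0"
abbreviation (input) "vc \<equiv> pi_exp 0"
abbreviation (input) "om \<equiv> pi_omega k"

lemma pi_omega_eq: "om = (1/2) *s hV c_vec (-1) (hV d_vec (-1) vc) - hV (nu_vec k) (-2) vc"
 by (simp add: pi_omega_def pi_heis_def)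

lemma hV_vac: "n \<ge> 0 \<Longrightarrow> hV a n vc = 0"
 by (simp add: HV_exp)

lemma hV_omega: "hV a (int i) om =
  (if i = 1 then h_vec k a else if i = 2 then (- 2 * form a (nu_vec k)) *s vc else 0)"
proof -
 note hc = heis_comm[of k 0 0, THEN diff_eq_eq[THEN iffD1]]
 have 1: "hV a (int i) (hV c_vec (-1) (hV d_vec (-1) vc)) = (if i = 1 then 2 *s h_vec k a else 0)"
 proof -
  have "hV a (int i) (hV c_vec (-1) (hV d_vec (-1) vc)) =
   (if i = 1 then form a c_vec else 0) *s hV d_vec (-1) vc + (if i = 1 then form a d_vec else 0) *s hV c_vec (-1) vc"
   by (simp add: hc[of a "int i"] hV_vac heis_lin_add heis_lin_scale heis_lin_0 del: form_simps)
  then show ?thesis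
   by (simp add: h_vec_def heis_split[of k 0 0 a] scaleC_add_right scaleC_scaleC add.commute)
 qed
 have 2: "hV a (int i) (hV (nu_vec k) (-2) vc) = (if i = 2 then 2 * form a (nu_vec k) else 0) *s vc"
  by (simp add: hc[of a "int i"] hV_vac heis_lin_0)
 show ?thesis unfolding pi_omega_eq
  by (auto simp: heis_lin_diff heis_lin_scale 1 2 scaleC_scaleC scaleC_one)
qed

lemma pi_heis_comm_general: "hW a n (yW u m x) - yW u m (hW a n x) = Sum_any (\<lambda>i::nat. bin n i *s yW (hV a (int i) u) (n + m - int i) x)"
 using jac_comm[OF pi_jac_heis_exp, of k r lam a n u m x] by (simp only: YW_h_vec)

text \<open>The linear term of the conformal vector keeps a(z) from being primary by a central term.
  For \<open>m = 0\<close> and \<open>m = 1\<close>, that is for L(-1) and L(0), its coefficient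
  \<open>n * (n - 1)\<close> vanishes wherever \<open>id_fld\<close> does not.\<close>

lemma pi_omega_comm: "hW a n (yW om m x) - yW om m (hW a n x) =
  of_int n *s hW a (n + m - 1) x - (of_int (n * (n - 1)) * form a (nu_vec k)) *s id_fld (n + m - 2) x"
proof -
 have b2: "bin n 2 = of_int (n * (n - 1)) / 2"
  by (simp add: gbinomial_pochhammer pochhammer_rec numeral_2_eq_2 field_simps)
 have "hW a n (yW om m x) - yW om m (hW a n x) = (\<Sum>i<3. bin n i *s yW (hV a (int i) om) (n + m - int i) x)"
  unfolding pi_heis_comm_general by (rule SA_nat) (auto simp: hV_omega clinear_0[OF YW_linear])
 also have "\<dots> = of_int n *s hW a (n + m - 1) x - (of_int (n * (n - 1)) * form a (nu_vec k)) *s id_fld (n + m - 2) x"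
  unfolding hV_omega
  by (simp add: eval_nat_numeral YW_h_vec clinear_0[OF YW_linear] clinear_scale[OF YW_linear] clinear_minus[OF YW_linear] YW_pi_exp exp_vop_0 scaleC_scaleC)
   (simp add: b2[unfolded numeral_2_eq_2] field_simps)
 finally show ?thesis .
qed

definition pi_D :: "pi \<Rightarrow> pi" where "pi_D = yW om 0"

lemma pi_D_linear: "clinear pi_D" unfolding pi_D_def by (rule is_vop_linear[OF pi_is_vop])

lemma pi_D_heis: "pi_D (hW a n x) = hW a n (pi_D x) - of_int n *s hW a (n - 1) x"
 using pi_omega_comm[of a n 0 x] unfolding pi_D_def by (cases "n = 1") (auto simp: id_fld_def algebra_simps)

lemma pi_L0_heis: "yW om 1 (hW a n x) = hW a n (yW om 1 x) - of_int n *s hW a n x"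
 using pi_omega_comm[of a n 1 x] by (cases "n = 0") (auto simp: id_fld_def algebra_simps)

lemma yW_omega: "yW om n x = (1/2) *s Sum_any (\<lambda>i::nat. hW c_vec (- 1 - int i) (hW d_vec (n + int i) x) + hW d_vec (n - 1 - int i) (hW c_vec (int i) x))
  + of_int n *s hW (nu_vec k) (n - 1) x"
proof -
 have "der id_fld n x = (0 :: pi)" for n x by (simp add: der_def id_fld_def)
 then have D0: "der id_fld = (\<lambda>_ _. 0 :: pi)" by (simp add: fun_eq_iff)
 have 1: "pr (hW a) (-2) id_fld = der (hW a)" for a
  using der_prd[OF HW_fld HW_fld is_fld_id, of k r lam a k r lam a "-1"] prd_id_right[OF HW_fld, of k r lam a]
  unfolding D0 by (simp add: fun_eq_iff prd_zero_right[OF HW_fld] scaleC_one)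
 have 2: "yW (hV d_vec (-1) vc) = hW d_vec" using YW_h_vec[of k r lam d_vec] by (simp add: h_vec_def)
 have 3: "yW (hV c_vec (-1) (hV d_vec (-1) vc)) = pr (hW c_vec) (-1) (hW d_vec)"
  using YW_heis[of k r lam c_vec "-1" "hV d_vec (-1) vc"] 2 by simp
 have 4: "yW (hV (nu_vec k) (-2) vc) = der (hW (nu_vec k))"
  using YW_heis[of k r lam "nu_vec k" "-2" vc] by (simp add: YW_pi_exp exp_vop_0 1)
 show ?thesis
  unfolding pi_omega_eq clinear_diff[OF YW_linear] clinear_scale[OF YW_linear] 3 4 prd_m1 der_def
  by simp
qed

lemma pi_D_exp: "pi_D (pi_exp j) = hW (top_wt k r lam j) (-1) (pi_exp j)"
proof -
 have z: "hW a (int (Suc i)) (pi_exp j) = 0" "hW a (0 + int (Suc i)) (pi_exp j) = 0" for a i by (simp_all add: pi_exp_def heis_pos)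
 have h0: "hW a 0 (pi_exp j) = form a (top_wt k r lam j) *s pi_exp j" for a by (simp add: pi_exp_def heis_zero')
 have "Sum_any (\<lambda>i::nat. hW c_vec (- 1 - int i) (hW d_vec (0 + int i) (pi_exp j)) + hW d_vec (0 - 1 - int i) (hW c_vec (int i) (pi_exp j)))
  = hW c_vec (- 1) (hW d_vec 0 (pi_exp j)) + hW d_vec (- 1) (hW c_vec 0 (pi_exp j))"
 proof (subst SA_single[of 0])
  fix i :: nat assume "i \<noteq> 0"
  then obtain i' where "i = Suc i'" by (cases i) auto
  then show "hW c_vec (- 1 - int i) (hW d_vec (0 + int i) (pi_exp j)) + hW d_vec (0 - 1 - int i) (hW c_vec (int i) (pi_exp j)) = 0"
   using z(1)[of c_vec i'] z(2)[of d_vec i'] by (simp add: heis_lin_0)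
 qed simp
 then show ?thesis unfolding pi_D_def yW_omega h0 heis_lin_scale
  by (simp add: heis_split[of k r lam "top_wt k r lam j"] scaleC_add_right scaleC_scaleC)
qed

lemma pi_L0_exp: "\<exists>c. yW om 1 (pi_exp j) = c *s pi_exp j"
proof -
 have z: "hW a (int (Suc i)) (pi_exp j) = 0" "hW a (1 + int i) (pi_exp j) = 0" for a i by (simp_all add: pi_exp_def heis_pos)
 have h0: "hW a 0 (pi_exp j) = form a (top_wt k r lam j) *s pi_exp j" for a by (simp add: pi_exp_def heis_zero')
 have "Sum_any (\<lambda>i::nat. hW c_vec (- 1 - int i) (hW d_vec (1 + int i) (pi_exp j)) + hW d_vec (1 - 1 - int i) (hW c_vec (int i) (pi_exp j)))
  = hW d_vec 0 (hW c_vec 0 (pi_exp j))"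
 proof (subst SA_single[of 0])
  fix i :: nat assume "i \<noteq> 0"
  then obtain i' where "i = Suc i'" by (cases i) auto
  then show "hW c_vec (- 1 - int i) (hW d_vec (1 + int i) (pi_exp j)) + hW d_vec (1 - 1 - int i) (hW c_vec (int i) (pi_exp j)) = 0"
   using z(1)[of c_vec i'] z(2)[of d_vec i] by (simp add: heis_lin_0)
 qed (use z(2)[of d_vec 0] in \<open>simp add: heis_lin_0\<close>)
 then show ?thesis unfolding yW_omega h0 heis_lin_scale
  by (simp add: scaleC_scaleC h0 scaleC_add_left[symmetric] del: form_simps)
qed

text \<open>In twice L(-1), written through modes of c and d, only d fails to commute with the
  exponential operator. Its commutators add up to the normally ordered product with c, which is a
  derivative by \<open>exp_vop_der\<close>.\<close>

lemma pi_D_exp_vop: "pi_D (eW i n x) = eW i n (pi_D x) - of_int n *s eW i (n - 1) x"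
proof -
 note lin = is_fld_linear[OF exp_vop_fld]
 have dE: "hW d_vec m (eW i n x) = eW i n (hW d_vec m x) + (2 * of_int i) *s eW i (m + n) x" for m n x
  using exp_vop_comm[of k r lam d_vec m i n x] by (simp add: c_vec_def algebra_simps)
 note cE = exp_vop_c1[of k r lam i, symmetric]
 have f1: "fs (\<lambda>j::nat. eW i n (hW c_vec (- 1 - int j) (hW d_vec (int j) x)))"
  using fld_fs_lin[OF HW_fld[of k r lam d_vec], of "\<lambda>j z. eW i n (hW c_vec (- 1 - int j) z)" 0 x]
  by (simp add: clinear_compose[OF lin heis_linear])
 have f2: "fs (\<lambda>j::nat. eW i n (hW d_vec (- 1 - int j) (hW c_vec (int j) x)))"
  using fld_fs_lin[OF HW_fld[of k r lam c_vec], of "\<lambda>j z. eW i n (hW d_vec (- 1 - int j) z)" 0 x]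
  by (simp add: clinear_compose[OF lin heis_linear])
 have f1': "fs (\<lambda>j::nat. hW c_vec (- 1 - int j) (hW d_vec (int j) x))"
  using fld_fs_lin[OF HW_fld[of k r lam d_vec], of "\<lambda>j z. hW c_vec (- 1 - int j) z" 0 x] by (simp add: heis_linear)
 have f2': "fs (\<lambda>j::nat. hW d_vec (- 1 - int j) (hW c_vec (int j) x))"
  using fld_fs_lin[OF HW_fld[of k r lam c_vec], of "\<lambda>j z. hW d_vec (- 1 - int j) z" 0 x] by (simp add: heis_linear)
 have f3: "fs (\<lambda>j::nat. hW c_vec (- 1 - int j) (eW i (n + int j) x))"
  by (intro fld_fs_lin exp_vop_fld heis_linear)
 have f4: "fs (\<lambda>j::nat. eW i (n - 1 - int j) (hW c_vec (int j) x))"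
  using fld_fs_lin[OF HW_fld[of k r lam c_vec], of "\<lambda>j z. eW i (n - 1 - int j) z" 0 x] by (simp add: lin)
 have "2 *s pi_D (eW i n x) = Sum_any (\<lambda>j::nat. hW c_vec (- 1 - int j) (hW d_vec (int j) (eW i n x)) + hW d_vec (- 1 - int j) (hW c_vec (int j) (eW i n x)))"
  unfolding pi_D_def yW_omega by (simp add: scaleC_scaleC scaleC_one)
 also have "\<dots> = Sum_any (\<lambda>j::nat. (eW i n (hW c_vec (- 1 - int j) (hW d_vec (int j) x)) + eW i n (hW d_vec (- 1 - int j) (hW c_vec (int j) x)))
    + (2 * of_int i) *s (hW c_vec (- 1 - int j) (eW i (n + int j) x) + eW i (n - 1 - int j) (hW c_vec (int j) x)))"
  by (rule Sum_any.cong)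
   (simp add: dE cE heis_lin_add heis_lin_scale scaleC_add_right algebra_simps)
 also have "\<dots> = Sum_any (\<lambda>j::nat. eW i n (hW c_vec (- 1 - int j) (hW d_vec (int j) x)) + eW i n (hW d_vec (- 1 - int j) (hW c_vec (int j) x)))
   + (2 * of_int i) *s prd (hW c_vec) (hW c_vec) (-1) (eW i) n x"
  unfolding prd_m1 SA_scale[symmetric]
  by (intro SA_add fs_add fs_scale f1 f2 f3 f4)
 also have "Sum_any (\<lambda>j::nat. eW i n (hW c_vec (- 1 - int j) (hW d_vec (int j) x)) + eW i n (hW d_vec (- 1 - int j) (hW c_vec (int j) x))) = eW i n (2 *s pi_D x)"
 proof -
  have "2 *s pi_D x = Sum_any (\<lambda>j::nat. hW c_vec (- 1 - int j) (hW d_vec (int j) x) + hW d_vec (- 1 - int j) (hW c_vec (int j) x))"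
   unfolding pi_D_def yW_omega by (simp add: scaleC_scaleC scaleC_one)
  then show ?thesis
   by (simp add: clinear_Sum_any[OF lin] fs_add[OF f1' f2'] clinear_add[OF lin])
 qed
 also have "(2 * of_int i) *s prd (hW c_vec) (hW c_vec) (-1) (eW i) n x = 2 *s der (eW i) n x"
  unfolding exp_vop_der by (simp add: scaleC_scaleC)
 finally have "2 *s pi_D (eW i n x) = 2 *s (eW i n (pi_D x) + der (eW i) n x)"
  by (simp add: clinear_scale[OF lin] scaleC_add_right)
 then show ?thesis unfolding cvec.scale_cancel_left by (simp add: der_def)
qed

end

text \<open>For exponentials this is \<open>exp_vop_der\<close>. It passes to all vectors because
  \<open>pi_D_heis\<close> and \<open>der_prd\<close> are the same rule for vectors and for
  fields.\<close>

lemma pi_vop_T: "pi_vop k r lam (pi_D k 0 0 u) = der (pi_vop k r lam u)"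
proof (induction u rule: heis_induct[where k = k and r = 0 and lam = 0])
 case (1 x y)
 then show ?case
  by (simp add: fun_eq_iff clinear_add[OF pi_D_linear] clinear_add[OF YW_linear] der_def scaleC_add_right)
next
 case (2 t x)
 then show ?case
  by (simp add: fun_eq_iff clinear_scale[OF pi_D_linear] clinear_scale[OF YW_linear] der_def scaleC_scaleC mult.commute)
next
 case (3 j)
 have "pr (heis_op k r lam (of_int j *s c_vec)) (-1) (exp_vop k r lam j) n x = der (exp_vop k r lam j) n x" for n x
  by (simp add: HW_prd_scale[OF exp_vop_fld] exp_vop_der)
 then show ?case unfolding pi_D_exp YW_heis top_wt_0 YW_pi_exp by (simp add: fun_eq_iff)
next
 case (4 a n u)
 have "pi_vop k r lam (heis_op k 0 0 a n (pi_D k 0 0 u) - of_int n *s heis_op k 0 0 a (n - 1) u) q x =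
   der (pr (heis_op k r lam a) n (pi_vop k r lam u)) q x" for q x
  by (simp add: clinear_diff[OF YW_linear] clinear_scale[OF YW_linear] YW_heis der_prd[OF heis_fld heis_fld YW_fld] 4)
 then show ?case unfolding pi_D_heis YW_heis by (simp add: fun_eq_iff)
qed

text \<open>The products of index \<open>l \<ge> 0\<close> vanish on both sides, that of index -1 is
  \<open>exp_vop_mult\<close>, and translation yields the lower ones. The fields commute, so the
  identity between them is immediate.\<close>

lemma pi_jac_exp_exp: "jac (pi_vop k 0 0) (pi_vop k r lam) (pi_vop k r lam) (pi_vop k r lam) (pi_exp i) (pi_exp j)"
proof (rule bor_jac)
 let ?E = "exp_vop k r lam" and ?Y = "pi_vop k r lam" and ?a = "exp_vop k 0 0 i"
 have comm: "bo (?E i) (?E j)"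
  by (rule comm_zero_bor) (rule exp_vop_fld exp_vop_commute)+
 then show "bo (?Y (pi_exp i)) (?Y (pi_exp j))" unfolding YW_pi_exp .
 have l0: "?Y (?a l (pi_exp j)) = pr (?E i) l (?E j)" if "l \<ge> 0" for l
 proof -
  have "pr (?E i) l (?E j) = (\<lambda>_ _. 0)" by (rule comm_zero_prd) (rule exp_vop_commute that)+
  moreover have "?a l (pi_exp j) = 0" unfolding exp_vop_pi_exp by (rule Em_neg) (use that in simp)
  ultimately show ?thesis by (simp add: fun_eq_iff clinear_0[OF YW_linear])
 qed
 have l1: "?Y (?a (-1) (pi_exp j)) = pr (?E i) (-1) (?E j)"
 proof (intro ext)
  fix q x
  have f: "fs (\<lambda>m. ?E i m (?E j (q - 1 - m) x))"
  proof -
   obtain K where K: "\<forall>n\<ge>K. ?E i n x = 0" using exp_vop_fld[of k r lam i] unfolding is_fld_def by blast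
   obtain L where L: "\<forall>n\<ge>L. ?E j n x = 0" using exp_vop_fld[of k r lam j] unfolding is_fld_def by blast
   show ?thesis
   proof (rule fs_int[of "q - 1 - L" _ K])
    show "?E i m (?E j (q - 1 - m) x) = 0" if "m > K" for m
     unfolding exp_vop_commute[of k r lam i m] using K that by (simp add: fld_0[OF exp_vop_fld])
   qed (use L in \<open>simp add: fld_0[OF exp_vop_fld]\<close>)
  qed
  have "pr (?E i) (-1) (?E j) q x = Sum_any (\<lambda>a::nat. ?E i (- 1 - int a) (?E j (q - 1 - (- 1 - int a)) x) + ?E i (int a) (?E j (q - 1 - int a) x))"
   unfolding prd_m1
  proof (rule Sum_any.cong)
   fix a :: nat
   show "?E i (- 1 - int a) (?E j (q + int a) x) + ?E j (q - 1 - int a) (?E i (int a) x) =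
     ?E i (- 1 - int a) (?E j (q - 1 - (- 1 - int a)) x) + ?E i (int a) (?E j (q - 1 - int a) x)"
    using exp_vop_commute[of k r lam i "int a" j "q - 1 - int a" x] by simp
  qed
  also have "\<dots> = ?E (i + j) q x"
   using SA_int_split[OF f] exp_vop_mult[of k r lam i j q x] by simp
  finally show "?Y (?a (-1) (pi_exp j)) q x = pr (?E i) (-1) (?E j) q x"
   by (simp add: exp_vop_pi_exp Em_def expz_0 YW_pi_exp)
 qed
 have neg: "?Y (?a (- 1 - int m) (pi_exp j)) = pr (?E i) (- 1 - int m) (?E j)" for m
 proof (induction m)
  case 0 then show ?case using l1 by simp
 next
  case (Suc m)
  let ?l = "- 1 - int m"
  let ?T = "pi_D k 0 0"
  let ?c0 = "heis_op k 0 0 c_vec (-1)"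
  have l: "(of_int ?l :: complex) \<noteq> 0" by (metis of_int_eq_0_iff diff_eq_eq int_one_le_iff_zero_less negative_eq_positive of_nat_0_le_iff add.commute minus_add_distrib add_increasing2 zero_le_one of_nat_Suc not_less_eq_eq order_refl eq_neg_iff_add_eq_0 add_eq_0_iff uminus_add_conv_diff zero_neq_neg_one of_nat_eq_0_iff nat.distinct(1))
  have Tj: "?T (pi_exp j) = of_int j *s ?c0 (pi_exp j)"
   by (simp add: pi_D_exp top_wt_0 heis_scale)
  \<comment> \<open>The commutator of translation with the mode \<open>?l\<close>, solved for the
    mode \<open>?l - 1\<close>.\<close>
  have "of_int ?l *s ?a (?l - 1) (pi_exp j) = ?a ?l (?T (pi_exp j)) - ?T (?a ?l (pi_exp j))"
   unfolding pi_D_exp_vop by simp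
  also have "?a ?l (?T (pi_exp j)) = of_int j *s ?c0 (?a ?l (pi_exp j))"
   unfolding Tj by (simp add: fld_scale[OF exp_vop_fld] exp_vop_c1)
  finally have V: "of_int ?l *s ?a (?l - 1) (pi_exp j) = of_int j *s ?c0 (?a ?l (pi_exp j)) - ?T (?a ?l (pi_exp j))" .
  have cE: "bo (heis_op k r lam c_vec) (?E i)" "\<forall>l\<ge>int 0. pr (heis_op k r lam c_vec) l (?E i) = (\<lambda>_ _. 0)"
   using comm_zero_bor[OF heis_fld heis_fld exp_vop_fld, of k r lam c_vec k r lam i]
    comm_zero_prd[of "heis_op k r lam c_vec" "?E i" "heis_op k r lam c_vec"] exp_vop_c1[of k r lam i, symmetric] by auto
  show ?case
  proof (intro ext)
   fix q x
   have "of_int ?l *s ?Y (?a (?l - 1) (pi_exp j)) q x = of_int j *s pr (heis_op k r lam c_vec) (-1) (pr (?E i) ?l (?E j)) q x - der (pr (?E i) ?l (?E j)) q x"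
    unfolding clinear_scale[OF YW_linear, symmetric] V
    by (simp add: clinear_diff[OF YW_linear] clinear_scale[OF YW_linear] pi_vop_T YW_heis Suc)
   also have "of_int j *s pr (heis_op k r lam c_vec) (-1) (pr (?E i) ?l (?E j)) q x = pr (?E i) ?l (der (?E j)) q x"
   proof -
    have "pr (heis_op k r lam c_vec) (-1) (pr (?E i) ?l (?E j)) q x = pr (?E i) ?l (pr (heis_op k r lam c_vec) (-1) (?E j)) q x"
     using prd_comm[OF heis_fld exp_vop_fld exp_vop_fld cE, of "-1" ?l k r lam j q x] by simp
    moreover have "der (?E j) = (\<lambda>n z. of_int j *s pr (heis_op k r lam c_vec) (-1) (?E j) n z)"
     by (simp add: fun_eq_iff exp_vop_der)
    ultimately show ?thesis by (simp add: prd_scale_right[OF exp_vop_fld])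
   qed
   also have "pr (?E i) ?l (der (?E j)) q x - der (pr (?E i) ?l (?E j)) q x = of_int ?l *s pr (?E i) (?l - 1) (?E j) q x"
    unfolding der_prd[OF exp_vop_fld exp_vop_fld exp_vop_fld] by simp
   finally have "?Y (?a (?l - 1) (pi_exp j)) q x = pr (?E i) (?l - 1) (?E j) q x"
    using l unfolding cvec.scale_cancel_left by simp
   then show "?Y (?a (- 1 - int (Suc m)) (pi_exp j)) q x = pr (?E i) (- 1 - int (Suc m)) (?E j) q x"
    by (simp add: algebra_simps)
  qed
 qed
 show "?Y (pi_vop k 0 0 (pi_exp i) l (pi_exp j)) = pr (?Y (pi_exp i)) l (?Y (pi_exp j))" for l
  unfolding YW_pi_exp using l0[of l] neg[of "nat (- 1 - l)"] by (cases "l \<ge> 0") auto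
qed

text \<open>Here the right-hand vector is built up by Heisenberg generators. Their nonnegative modes
  send an exponential to a multiple of itself, so the extra pairs demanded by
  \<open>jac_right_mode\<close> are covered by induction.\<close>

lemma pi_jac_exp: "jac (pi_vop k 0 0) (pi_vop k r lam) (pi_vop k r lam) (pi_vop k r lam) (pi_exp i) u"
proof (induction u rule: heis_induct[where k = k and r = 0 and lam = 0])
 case (1 x y) then show ?case by (intro jac_add_right pi_is_vop)
next
 case (2 t x) then show ?case by (intro jac_scale_right pi_is_vop)
next
 case (3 j) then show ?case by (rule pi_jac_exp_exp)
next
 case (4 a n u)
 have "heis_op k 0 0 a n u = pi_vop k 0 0 (h_vec k a) n u" by (simp add: YW_h_vec)
 moreover have "jac (pi_vop k 0 0) (pi_vop k r lam) (pi_vop k r lam) (pi_vop k r lam) (pi_exp i) (pi_vop k 0 0 (h_vec k a) n u)"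
 proof (rule jac_right_mode[OF pi_is_vop pi_is_vop pi_jac_heis_exp pi_jac_heis_exp 4(2)])
  fix i'
  show "jac (pi_vop k 0 0) (pi_vop k r lam) (pi_vop k r lam) (pi_vop k r lam) (pi_vop k 0 0 (h_vec k a) (int i') (pi_exp i)) u"
   unfolding YW_h_vec HV_exp[OF of_nat_0_le_iff] by (intro jac_scale_left pi_is_vop 4)
 qed
 ultimately show ?case by simp
qed

lemma pi_vac: "n \<ge> 0 \<Longrightarrow> pi_vop k 0 0 u n (pi_exp 0) = 0"
 and pi_create: "pi_vop k 0 0 u (-1) (pi_exp 0) = u"
proof -
 have "(\<forall>n\<ge>0. pi_vop k 0 0 u n (pi_exp 0) = 0) \<and> pi_vop k 0 0 u (-1) (pi_exp 0) = u"
 proof (induction u rule: heis_induct[where k = k and r = 0 and lam = 0])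
  case (3 j)
  then show ?case by (auto simp: YW_pi_exp exp_vop_pi_exp Em_neg) (simp add: Em_def expz_0)
 next
  case (4 a m u)
  have e: "pr (heis_op k 0 0 a) m (pi_vop k 0 0 u) q (pi_exp 0) = (if q \<ge> 0 then 0 else heis_op k 0 0 a m u)" if "q \<ge> -1" for q
   unfolding prd_def brs_def
  proof (subst SA_single[of 0])
   fix i :: nat assume "i \<noteq> 0"
   then have "q + int i \<ge> 0" using that by simp
   then show "((- 1) ^ i * bin m i) *s (heis_op k 0 0 a (0 + m - int i) (pi_vop k 0 0 u (q + int i) (pi_exp 0)) -
      sg m *s pi_vop k 0 0 u (m + q - int i) (heis_op k 0 0 a (0 + int i) (pi_exp 0))) = 0"
    using 4 by (simp add: hV_vac heis_lin_0 fld_0[OF YW_fld])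
  next
   have "q = -1 \<or> q \<ge> 0" using that by auto
   then show "((- 1) ^ 0 * bin m 0) *s (heis_op k 0 0 a (0 + m - int 0) (pi_vop k 0 0 u (q + int 0) (pi_exp 0)) -
      sg m *s pi_vop k 0 0 u (m + q - int 0) (heis_op k 0 0 a (0 + int 0) (pi_exp 0))) = (if q \<ge> 0 then 0 else heis_op k 0 0 a m u)"
    using 4 by (auto simp: hV_vac heis_lin_0 fld_0[OF YW_fld] scaleC_one)
  qed
  show ?case unfolding YW_heis using e[of "-1"] e by auto
 qed (auto simp: clinear_add[OF YW_linear] clinear_scale[OF YW_linear])
 then show "n \<ge> 0 \<Longrightarrow> pi_vop k 0 0 u n (pi_exp 0) = 0" "pi_vop k 0 0 u (-1) (pi_exp 0) = u" by auto
qed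

text \<open>The start of the reconstruction. The vectors u_l vac are known for \<open>l = -1\<close>
  by creation, and translation, acting as d/dz on either side, lowers the index.\<close>

lemma vac_jac:
 assumes Ya: "is_vop Ya" and Yb: "is_vop Yb"
  and vac: "Yb vac = id_fld" and v0: "\<And>u n. n \<ge> 0 \<Longrightarrow> Ya u n vac = 0" and v1: "\<And>u. Ya u (-1) vac = u"
  and TV: "\<And>u. Ya (T u) = der (Ya u)" and TW: "\<And>u. Yb (T u) = der (Yb u)"
 shows "jac Ya Yb Yb Yb u vac"
proof (rule bor_jac)
 note f = is_vop_fld[OF Yb]
 show "bo (Yb u) (Yb vac)" unfolding vac
  by (rule comm_zero_bor) (auto simp: f is_fld_id id_fld_def fld_0[OF f])
 have neg: "Yb (Ya u (- 1 - int m) vac) = pr (Yb u) (- 1 - int m) id_fld" for m u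
 proof (induction m arbitrary: u)
  case 0 then show ?case by (simp add: v1 prd_id_right[OF f])
 next
  case (Suc m)
  let ?l = "- 1 - int m"
  have "(of_int (1 + int m) :: complex) \<noteq> 0" unfolding of_int_eq_0_iff by simp
  then have l: "- (of_int ?l :: complex) \<noteq> 0" by (metis minus_diff_eq of_int_minus diff_minus_eq_add add.commute)
  show ?case
  proof (intro ext)
   fix q x
   have "- of_int ?l *s Yb (Ya u (?l - 1) vac) q x = Yb (Ya (T u) ?l vac) q x"
    unfolding TV by (simp add: der_def vop1_scale[OF Yb] vop1_minus[OF Yb] del: of_int_diff of_int_minus of_int_add)
   also have "\<dots> = - of_int ?l *s pr (Yb u) (?l - 1) id_fld q x"
    unfolding Suc TW by (rule prd_der_left[OF f is_fld_id])
   finally have "Yb (Ya u (?l - 1) vac) q x = pr (Yb u) (?l - 1) id_fld q x" using l unfolding cvec.scale_cancel_left by simp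
   then show "Yb (Ya u (- 1 - int (Suc m)) vac) q x = pr (Yb u) (- 1 - int (Suc m)) id_fld q x" by (simp add: algebra_simps)
  qed
 qed
 show "Yb (Ya u l vac) = pr (Yb u) l (Yb vac)" for l
 proof (cases "l \<ge> 0")
  case True
  have "pr (Yb u) l id_fld = (\<lambda>_ _. 0)"
   by (rule comm_zero_prd) (auto simp: True id_fld_def fld_0[OF f])
  then show ?thesis using True by (simp add: v0 vac is_vop_0[OF Yb])
 next
  case False then show ?thesis using neg[of u "nat (- 1 - l)"] by (simp add: vac)
 qed
qed

theorem pi_jacobi: "jac (pi_vop k 0 0) (pi_vop k r lam) (pi_vop k r lam) (pi_vop k r lam) u v"
proof (rule jac_reconstruction[where G = "range (h_vec k) \<union> range pi_exp" and S = "{pi_exp 0}"])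
 show "jac (pi_vop k 0 0) (pi_vop k r lam) (pi_vop k r lam) (pi_vop k r lam) a b" if "b \<in> {pi_exp 0}" for a b
  using that vac_jac[OF pi_is_vop pi_is_vop, of k r lam "pi_exp 0" k 0 0 "pi_D k 0 0" a]
  by (simp add: YW_pi_exp exp_vop_0 pi_vac pi_create pi_vop_T)
 let ?S = "gen_span (pi_vop k 0 0) {pi_exp 0} (range (h_vec k) \<union> range pi_exp)"
 show "v \<in> ?S"
 proof (induction v rule: heis_induct[where k = k and r = 0 and lam = 0])
  case (3 j)
  have "pi_vop k 0 0 (pi_exp j) (-1) (pi_exp 0) \<in> ?S" by (intro gen_span.mode gen_span.base) auto
  then show ?case by (simp add: pi_create)
 next
  case (4 a n x)
  have "pi_vop k 0 0 (h_vec k a) n x \<in> ?S" by (intro gen_span.mode 4) auto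
  then show ?case by (simp add: YW_h_vec)
 qed (auto intro: gen_span.add gen_span.scale)
qed (auto intro: pi_is_vop pi_jac_heis_exp pi_jac_exp)

section \<open>Products of commuting fields\<close>

text \<open>The product A(z) U(z) at one point. It makes sense without normal ordering when the two
  fields commute.\<close>

definition conv :: "('x::complex_vector, 'x) fld \<Rightarrow> ('x, 'x) fld \<Rightarrow> ('x, 'x) fld" where
 "conv A U n v = Sum_any (\<lambda>m. A m (U (n - 1 - m) v))"

lemma conv_fs:
 assumes A: "is_fld A" and U: "is_fld U" and AU: "\<And>m n v. A m (U n v) = U n (A m v)"
 shows "fs (\<lambda>m. A (m + c) (U (d - m) v))"
proof -
 obtain K where K: "\<forall>n\<ge>K. A n v = 0" using A unfolding is_fld_def by blast
 obtain L where L: "\<forall>n\<ge>L. U n v = 0" using U unfolding is_fld_def by blast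
 show ?thesis
 proof (rule fs_int[of "d - L" _ "K - c"])
  show "A (m + c) (U (d - m) v) = 0" if "m > K - c" for m
   unfolding AU using K that by (simp add: fld_0[OF U])
 qed (use L in \<open>simp add: fld_0[OF A]\<close>)
qed

lemma conv_shift: "conv A U n v = Sum_any (\<lambda>m. A (m + c) (U (n - 1 - c - m) v))"
 unfolding conv_def by (subst SA_shift[of _ c, symmetric]) (simp add: algebra_simps)

lemma conv_zero:
 assumes A: "is_fld A" and U: "is_fld U" and AU: "\<And>m n v. A m (U n v) = U n (A m v)"
  and K: "\<And>n. n \<ge> K \<Longrightarrow> A n v = 0" and L: "\<And>n. n \<ge> L \<Longrightarrow> U n v = 0" and n: "n \<ge> K + L"
 shows "conv A U n v = 0"
 unfolding conv_def
proof (rule SA_zero)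
 fix m
 show "A m (U (n - 1 - m) v) = 0"
 proof (cases "m \<ge> K")
  case True then show ?thesis unfolding AU using K by (simp add: fld_0[OF U])
 next
  case False then show ?thesis using L n by (simp add: fld_0[OF A])
 qed
qed

lemma conv_fld:
 assumes A: "is_fld A" and U: "is_fld U" and AU: "\<And>m n v. A m (U n v) = U n (A m v)"
 shows "is_fld (conv A U)"
proof (rule is_fldI)
 fix n
 have f: "fs (\<lambda>m. A m (U (n - 1 - m) v))" for v using conv_fs[OF assms, of 0 "n - 1" v] by simp
 show "clinear (conv A U n)"
  by (rule clinearI) (simp_all add: conv_def clinear_add[OF is_fld_linear] clinear_scale[OF is_fld_linear] A U SA_add f SA_scale)
next
 fix v
 obtain K where K: "\<forall>n\<ge>K. A n v = 0" using A unfolding is_fld_def by blast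
 obtain L where L: "\<forall>n\<ge>L. U n v = 0" using U unfolding is_fld_def by blast
 show "\<exists>N. \<forall>n\<ge>N. conv A U n v = 0"
  by (rule exI[of _ "K + L"]) (use conv_zero[OF assms, of K v L] K L in auto)
qed

lemma brs_nat:
 assumes "is_fld A'" "is_fld A" "is_fld B"
 shows "brs A' A B p (int l) q x = (\<Sum>i<Suc l. abin (int l) i *s A' (p + int l - int i) (B (q + int i) x))
  - sg (int l) *s (\<Sum>i<Suc l. abin (int l) i *s B (int l + q - int i) (A (p + int i) x))"
proof -
 have z: "bin (int l) i = 0" if "i \<ge> Suc l" for i by (rule bin_nat_0) (use that in simp)
 show ?thesis
  unfolding brs_split[OF assms] using z by (subst (1 2) SA_nat[of "Suc l"]) auto
qed

lemma sum_square_Vandermonde: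
 fixes F :: "nat \<Rightarrow> 'v::complex_vector"
 shows "(\<Sum>i<Suc a. \<Sum>j<Suc b. (bin (int a) i * bin (int b) j) *s F (i + j)) =
  (\<Sum>u<Suc (a + b). bin (int (a + b)) u *s F u)"
proof -
 let ?K = "Suc (a + b)"
 let ?f = "\<lambda>i j. (bin (int a) i * bin (int b) j) *s F (i + j)"
 have za: "bin (int a) i = 0" if "i > a" for i by (rule bin_nat_0[OF that])
 have zb: "bin (int b) i = 0" if "i > b" for i by (rule bin_nat_0[OF that])
 have "(\<Sum>i<Suc a. \<Sum>j<Suc b. ?f i j) = (\<Sum>i<?K. \<Sum>j<Suc b. ?f i j)"
  by (rule sum.mono_neutral_left) (use za in auto)
 also have "\<dots> = (\<Sum>i<?K. \<Sum>j<?K. ?f i j)"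
  by (intro sum.cong refl sum.mono_neutral_left) (use zb in auto)
 also have "\<dots> = (\<Sum>u<?K. \<Sum>i\<le>u. ?f i (u - i))"
 proof (rule sum_triangle)
  fix i k assume "?K \<le> i + k"
  then have "i > a \<or> k > b" by auto
  then show "?f i k = 0" using za zb by auto
 qed
 also have "\<dots> = (\<Sum>u<?K. bin (int (a + b)) u *s F u)"
 proof (intro sum.cong refl)
  fix u
  have "(\<Sum>i\<le>u. ?f i (u - i)) = (\<Sum>i\<le>u. (bin (int a) i * bin (int b) (u - i)) *s F u)"
   by (intro sum.cong refl) auto
  also have "\<dots> = bin (int a + int b) u *s F u"
   unfolding bin_Vandermonde[symmetric] scaleC_sum_left ..
  finally show "(\<Sum>i\<le>u. ?f i (u - i)) = bin (int (a + b)) u *s F u" by simp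
 qed
 finally show ?thesis .
qed

lemma sum_square_Vandermonde_alt:
 fixes F :: "nat \<Rightarrow> 'v::complex_vector"
 shows "(\<Sum>i<Suc a. \<Sum>j<Suc b. (abin (int a) i * abin (int b) j) *s F (i + j)) =
  (\<Sum>u<Suc (a + b). abin (int (a + b)) u *s F u)"
 using sum_square_Vandermonde[of a b "\<lambda>u. (-1) ^ u *s F u"]
 by (simp add: scaleC_scaleC power_add mult_ac)

text \<open>Negating both upper indices frees them of \<open>i\<close>, and Vandermonde applies.
  That the result does not depend on \<open>m\<close> is what allows the sum over modes to be
  collected into \<open>conv\<close>.\<close>

lemma bin_shifted_Vandermonde:
 "(\<Sum>i\<le>s. bin (m + int i) i * bin (l - 1 - m - int i) (s - i)) = bin l s"
proof -
 have "(\<Sum>i\<le>s. bin (m + int i) i * bin (l - 1 - m - int i) (s - i)) =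
   (\<Sum>i\<le>s. (-1) ^ s * (bin (- m - 1) i * bin (- (l - 1 - int s - m) - 1) (s - i)))"
 proof (intro sum.cong refl)
  fix i assume "i \<in> {..s}"
  then have i: "i \<le> s" by simp
  have 1: "bin (m + int i) i = (-1) ^ i * bin (- m - 1) i" using bin_negate[of "m + int i" i] by simp
  have e: "int (s - i) - (l - 1 - m - int i) - 1 = - (l - 1 - int s - m) - 1" using i by simp
  from bin_negate[of "l - 1 - m - int i" "s - i"]
  have 2: "bin (l - 1 - m - int i) (s - i) = (-1) ^ (s - i) * bin (- (l - 1 - int s - m) - 1) (s - i)"
   unfolding e .
  have pw: "(-1 :: complex) ^ i * (-1) ^ (s - i) = (-1) ^ s" using i by (simp add: power_add[symmetric])
  have "bin (m + int i) i * bin (l - 1 - m - int i) (s - i) = ((-1) ^ i * (-1) ^ (s - i)) * (bin (- m - 1) i * bin (- (l - 1 - int s - m) - 1) (s - i))"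
   unfolding 1 2 by (simp only: mult_ac)
  then show "bin (m + int i) i * bin (l - 1 - m - int i) (s - i) = (-1) ^ s * (bin (- m - 1) i * bin (- (l - 1 - int s - m) - 1) (s - i))"
   unfolding pw .
 qed
 also have "\<dots> = (-1) ^ s * bin ((- m - 1) + (- (l - 1 - int s - m) - 1)) s"
  by (simp only: sum_distrib_left[symmetric] bin_Vandermonde)
 also have "(- m - 1) + (- (l - 1 - int s - m) - 1) = int s - l - 1" by simp
 also have "(-1) ^ s * bin (int s - l - 1) s = bin l s" by (rule bin_negate[symmetric])
 finally show ?thesis .
qed

lemma bls_nat: "bls F (int p) l q x = (\<Sum>i<Suc p. bin (int p) i *s F (l + int i) (int p + q - int i) x)"
proof -
 have z: "bin (int p) i = 0" if "i \<ge> Suc p" for i by (rule bin_nat_0) (use that in simp)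
 show ?thesis unfolding bls_def by (rule SA_nat) (simp only: z cvec.scale_zero_left)
qed

text \<open>When the modes of \<open>A\<close> from \<open>p\<close> on kill \<open>x\<close>, one
  half of the identity disappears; what remains is weak associativity.\<close>

lemma brs_weak_assoc:
 assumes "is_fld A'" "is_fld A" "is_fld B" "\<And>i. A (p + int i) x = 0"
 shows "brs A' A B p l q x = Sum_any (\<lambda>i::nat. abin l i *s A' (p + l - int i) (B (q + int i) x))"
 unfolding brs_split[OF assms(1-3)] by (simp add: assms(4) fld_0[OF assms(3)])

lemma SA_sum2_swap:
 fixes f :: "nat \<Rightarrow> nat \<Rightarrow> 'i \<Rightarrow> 'v::complex_vector"
 assumes "\<And>i j. fs (f i j)"
 shows "Sum_any (\<lambda>m. \<Sum>i<a. \<Sum>j<b. f i j m) = (\<Sum>i<a. \<Sum>j<b. Sum_any (f i j))"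
proof -
 have "Sum_any (\<lambda>m. \<Sum>u\<in>{..<a}\<times>{..<b}. f (fst u) (snd u) m) = (\<Sum>u\<in>{..<a}\<times>{..<b}. Sum_any (f (fst u) (snd u)))"
  by (rule SA_finite_sum_swap) (use assms in auto)
 then show ?thesis by (simp only: sum.cartesian_product case_prod_unfold)
qed

text \<open>\<open>WAU l l'\<close> stands for the field of a_l u_l' w, and the sum over
  \<open>l1\<close> for the field of the product vector. Locality of order \<open>N\<close> for each
  factor gives order \<open>2 * N\<close> for the product, and weak associativity from
  \<open>p1\<close> and \<open>p2\<close> on gives it from \<open>p1 + p2\<close> on;
  \<open>defect_zero_large\<close> does the rest.\<close>

theorem bor_conv:
 fixes A' U' :: "('y::complex_vector, 'y) fld" and A U :: "('x::complex_vector, 'x) fld" and W :: "('x, 'y) fld"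
 assumes A': "is_fld A'" and A: "is_fld A" and U': "is_fld U'" and U: "is_fld U" and W: "is_fld W"
  and AU': "\<And>m n v. A' m (U' n v) = U' n (A' m v)" and AU: "\<And>m n v. A m (U n v) = U n (A m v)"
  and WU: "\<And>p l q x. bls WU p l q x = brs U' U W p l q x" and WUf: "\<And>l. is_fld (WU l)"
  and WA: "\<And>p l q x. bls WA p l q x = brs A' A W p l q x"
  and WAU: "\<And>l' p l q x. bls (\<lambda>l. WAU l l') p l q x = brs A' A (WU l') p l q x"
  and N: "\<And>l. l \<ge> int N \<Longrightarrow> WU l = (\<lambda>_ _. 0)" "\<And>l. l \<ge> int N \<Longrightarrow> WA l = (\<lambda>_ _. 0)"
   "\<And>l l'. l \<ge> int N \<or> l' \<ge> int N \<Longrightarrow> WAU l l' = (\<lambda>_ _. 0)"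
 shows "bls (\<lambda>l q x. Sum_any (\<lambda>l1. WAU l1 (l - 1 - l1) q x)) p l q x = brs (conv A' U') (conv A U) W p l q x"
proof -
 define XX where "XX = (\<lambda>l q x. Sum_any (\<lambda>l1. WAU l1 (l - 1 - l1) q x))"
 let ?X' = "conv A' U'" and ?X = "conv A U"
 have X': "is_fld ?X'" and X: "is_fld ?X" by (intro conv_fld A' U' AU' A U AU)+
 have XX0: "XX l = (\<lambda>_ _. 0)" if "l \<ge> int (2 * N)" for l
 proof (intro ext)
  fix q x
  have "WAU l1 (l - 1 - l1) q x = 0" for l1 using N(3)[of l1 "l - 1 - l1"] that by (cases "l1 \<ge> int N") auto
  then show "XX l q x = 0" unfolding XX_def by simp
 qed
 have XXfs: "fs (\<lambda>l1. WAU (l1 + c) (d - l1) q x)" for c d q x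
  by (rule fs_int[of "d - int N" _ "int N - c"]) (use N(3) in auto)
 have locU: "(\<Sum>j<Suc l. abin (int l) j *s U' (p + int l - int j) (W (q + int j) x)) =
   sg (int l) *s (\<Sum>j<Suc l. abin (int l) j *s W (int l + q - int j) (U (p + int j) x))" if "l \<ge> N" for p l q x
 proof -
  have "bls WU p (int l) q x = 0" unfolding bls_def using N(1) that by simp
  then show ?thesis unfolding WU brs_nat[OF U' U W] by simp
 qed
 have locA: "(\<Sum>j<Suc l. abin (int l) j *s A' (p + int l - int j) (W (q + int j) x)) =
   sg (int l) *s (\<Sum>j<Suc l. abin (int l) j *s W (int l + q - int j) (A (p + int j) x))" if "l \<ge> N" for p l q x
 proof -
  have "bls WA p (int l) q x = 0" unfolding bls_def using N(2) that by simp
  then show ?thesis unfolding WA brs_nat[OF A' A W] by simp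
 qed
 have large_l: "brs ?X' ?X W p l q x = 0" if l: "l \<ge> int (2 * N)" for p l q x
 proof -
  \<comment> \<open>The power \<open>l\<close> of z1 - z2 is split into \<open>N\<close> for
    \<open>A\<close> and \<open>l2 \<ge> N\<close> for \<open>U\<close>; each part suffices to
    exchange its field with \<open>W\<close>.\<close>
  define l2 where "l2 = nat l - N"
  have l_eq: "l = int (N + l2)" and l2: "l2 \<ge> N" using l by (auto simp: l2_def)
  let ?a = "\<lambda>i. (-1) ^ i * bin (int N) i" and ?b = "\<lambda>j. (-1) ^ j * bin (int l2) j"
  let ?L = "\<lambda>m i j. (?a i * ?b j) *s A' (m + int N - int i) (U' (p - 1 - m + int l2 - int j) (W (q + int (i + j)) x))" and ?R = "\<lambda>m i j. (?a i * ?b j) *s W (l + q - int (i + j)) (A (m + int i) (U (p - 1 - m + int j) x))"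
  have FF: "(\<Sum>i<Suc N. \<Sum>j<Suc l2. ?L m i j) =
   sg l *s (\<Sum>i<Suc N. \<Sum>j<Suc l2. ?R m i j)" for m
  proof -
   have "(\<Sum>i<Suc N. \<Sum>j<Suc l2. ?L m i j) =
    (\<Sum>i<Suc N. ?a i *s A' (m + int N - int i) (\<Sum>j<Suc l2. ?b j *s U' (p - 1 - m + int l2 - int j) (W ((q + int i) + int j) x)))"
    by (simp add: fld_sum[OF A'] fld_scale[OF A'] scaleC_sum_right scaleC_scaleC add.assoc del: sum.lessThan_Suc)
   also have "\<dots> = (\<Sum>i<Suc N. \<Sum>j<Suc l2. (sg (int l2) * (?a i * ?b j)) *s A' (m + int N - int i) (W (int l2 + q - int j + int i) (U (p - 1 - m + int j) x)))"
    unfolding locU[OF l2]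
    by (simp add: fld_sum[OF A'] fld_scale[OF A'] scaleC_sum_right scaleC_scaleC algebra_simps del: sum.lessThan_Suc)
   also have "\<dots> = (\<Sum>j<Suc l2. (sg (int l2) * ?b j) *s (\<Sum>i<Suc N. ?a i *s A' (m + int N - int i) (W (int l2 + q - int j + int i) (U (p - 1 - m + int j) x))))"
    by (subst sum.swap) (simp add: scaleC_sum_right scaleC_scaleC mult_ac del: sum.lessThan_Suc)
   also have "\<dots> = sg l *s (\<Sum>j<Suc l2. \<Sum>i<Suc N. ?R m i j)"
    unfolding locA[OF order_refl] l_eq of_nat_add sg_mult
    by (simp add: scaleC_sum_right scaleC_scaleC algebra_simps del: sum.lessThan_Suc)
   also have "(\<Sum>j<Suc l2. \<Sum>i<Suc N. ?R m i j) =
     (\<Sum>i<Suc N. \<Sum>j<Suc l2. ?R m i j)"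
    by (rule sum.swap)
   finally show ?thesis .
  qed
  have f1: "fs (\<lambda>m. A' (m + int N - int i) (U' (p - 1 - m + int l2 - int j) v))" for i j v
   using conv_fs[OF A' U' AU', of "int N - int i" "p - 1 + int l2 - int j" v] by (simp add: algebra_simps)
  have f2: "fs (\<lambda>m. W t (A (m + int i) (U (p - 1 - m + int j) v)))" for i j v t
   using conv_fs[OF A U AU, of "int i" "p - 1 + int j" v]
   by (rule fs_sub) (simp add: fld_0[OF W] algebra_simps)
  have c1: "Sum_any (\<lambda>m. A' (m + int N - int i) (U' (p - 1 - m + int l2 - int j) v)) = ?X' (p + l - int (i + j)) v" for i j v
   unfolding conv_shift[of A' U' _ _ "int N - int i"] l_eq by (simp add: algebra_simps)
  have c2: "Sum_any (\<lambda>m. W t (A (m + int i) (U (p - 1 - m + int j) v))) = W t (?X (p + int (i + j)) v)" for i j v t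
  proof -
   have "fs (\<lambda>m. A (m + int i) (U (p - 1 - m + int j) v))"
    using conv_fs[OF A U AU, of "int i" "p - 1 + int j" v] by (simp add: algebra_simps)
   then have "Sum_any (\<lambda>m. W t (A (m + int i) (U (p - 1 - m + int j) v))) = W t (Sum_any (\<lambda>m. A (m + int i) (U (p - 1 - m + int j) v)))"
    by (rule fld_Sum_any[OF W, symmetric])
   then show ?thesis unfolding conv_shift[of A U _ _ "int i"] by (simp add: algebra_simps)
  qed
  have "(\<Sum>i<Suc N. \<Sum>j<Suc l2. (?a i * ?b j) *s ?X' (p + l - int (i + j)) (W (q + int (i + j)) x)) =
    Sum_any (\<lambda>m. \<Sum>i<Suc N. \<Sum>j<Suc l2. ?L m i j)"
   by (subst SA_sum2_swap, rule fs_scale, rule f1) (simp only: SA_scale c1)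
  also have "\<dots> = Sum_any (\<lambda>m. sg l *s (\<Sum>i<Suc N. \<Sum>j<Suc l2. ?R m i j))"
   by (rule Sum_any.cong) (rule FF)
  also have "\<dots> = sg l *s (\<Sum>i<Suc N. \<Sum>j<Suc l2. (?a i * ?b j) *s W (l + q - int (i + j)) (?X (p + int (i + j)) x))"
   by (subst SA_scale, subst SA_sum2_swap, rule fs_scale, rule f2) (simp only: SA_scale c2)
  finally show ?thesis
   unfolding sum_square_Vandermonde_alt[of N l2 "\<lambda>u. ?X' (p + l - int u) (W (q + int u) x)"]
    sum_square_Vandermonde_alt[of N l2 "\<lambda>u. W (l + q - int u) (?X (p + int u) x)"]
   using brs_nat[OF X' X W, of p "N + l2" q x] by (simp only: l_eq[symmetric] diff_self)
 qed
 have large_p: "brs ?X' ?X W p l q x = bls XX p l q x"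
  if P1: "\<And>n. n \<ge> int p1 \<Longrightarrow> A n x = 0" and P2: "\<And>n. n \<ge> int P2 \<Longrightarrow> U n x = 0" and p: "p \<ge> int p1 + int P2" for p p1 P2 l q x
 proof -
  define p2 where "p2 = nat (p - int p1)"
  have p_eq: "p = int p1 + int p2" using p by (simp add: p2_def)
  have p2: "p2 \<ge> P2" using p by (simp add: p2_def)
  obtain S where S: "\<And>u. u \<ge> S \<Longrightarrow> W (q + int u) x = 0" using is_fld_bound[OF W] by metis
  have S': "W (q + int i + int j) x = 0" if "i + j \<ge> S" for i j using S[OF that] by (simp add: add.assoc)
  have WUx: "WU l (q + int i) x = WU l (q + int i) x" for l i ..
  let ?Z = "\<lambda>s i l1. ((-1) ^ s * (bin l1 i * bin (l - 1 - l1) (s - i))) *s A' (int p1 + l1 - int i) (U' (int p2 + (l - 1 - l1) - int (s - i)) (W (q + int s) x))"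
  let ?G = "\<lambda>l1. \<Sum>s<S. \<Sum>i\<le>s. ?Z s i l1"
  have f: "fs (\<lambda>l1. c l1 *s A' (int p1 + l1 - int i) (U' (int p2 + (l - 1 - l1) - int j) v))" for c i j v
   using fs_scale[OF conv_fs[OF A' U' AU', of "int p1 - int i" "int p2 + l - 1 - int j" v], of c] by (simp add: algebra_simps)
  \<comment> \<open>The index \<open>l\<close> is distributed over the two factors by the sum over
    \<open>l1\<close>. The shift \<open>m = l1 - i\<close> makes the mode expression independent of
    \<open>i\<close>, and \<open>bin_shifted_Vandermonde\<close> restores the coefficient
    \<open>bin l s\<close>.\<close>
  have step1: "brs ?X' ?X W p l q x = Sum_any ?G"
  proof -
   have X0: "?X (p + int i) x = 0" for i
    by (rule conv_zero[OF A U AU, of "int p1" x "int P2"]) (use P1 P2 p in auto)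
   have "brs ?X' ?X W p l q x = (\<Sum>s<S. abin l s *s ?X' (p + l - int s) (W (q + int s) x))"
    unfolding brs_weak_assoc[of ?X' ?X W p x, OF X' X W X0]
    by (rule SA_nat) (simp add: S fld_0[OF X'])
   also have "\<dots> = (\<Sum>s<S. \<Sum>i\<le>s. Sum_any (\<lambda>l1. ?Z s i l1))"
   proof (intro sum.cong refl)
    fix s :: nat
    let ?v = "W (q + int s) x"
    let ?h = "\<lambda>m. A' (int p1 + m) (U' (int p2 + l - 1 - int s - m) ?v)"
    let ?H = "\<lambda>i m. ((-1) ^ s * (bin (m + int i) i * bin (l - 1 - m - int i) (s - i))) *s ?h m"
    have fh: "fs (\<lambda>m. c m *s ?h m)" for c
     using fs_scale[OF conv_fs[OF A' U' AU', of "int p1" "int p2 + l - 1 - int s" ?v], of c] by (simp add: add.commute)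
    have "(\<Sum>i\<le>s. Sum_any (\<lambda>l1. ?Z s i l1)) =
     (\<Sum>i\<le>s. Sum_any (\<lambda>m. ?H i m))"
    proof (intro sum.cong refl)
     fix i assume "i \<in> {..s}"
     then have i: "i \<le> s" by simp
     show "Sum_any (\<lambda>l1. ?Z s i l1) =
      Sum_any (\<lambda>m. ?H i m)"
      by (subst SA_shift[of _ "int i", symmetric]) (use i in \<open>simp add: of_nat_diff algebra_simps\<close>)
    qed
    also have "\<dots> = Sum_any (\<lambda>m. \<Sum>i\<le>s. ?H i m)"
     by (rule SA_finite_sum_swap[symmetric, where f = "\<lambda>i m. ?H i m"]) (simp, rule fh)
    also have "\<dots> = Sum_any (\<lambda>m. abin l s *s ?h m)"
     by (rule Sum_any.cong) (simp only: scaleC_sum_left[symmetric] sum_distrib_left[symmetric] bin_shifted_Vandermonde)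
    also have "\<dots> = abin l s *s ?X' (p + l - int s) ?v"
     unfolding SA_scale conv_shift[of A' U' _ _ "int p1"] by (simp add: p_eq algebra_simps)
    finally show "abin l s *s ?X' (p + l - int s) ?v = (\<Sum>i\<le>s. Sum_any (\<lambda>l1. ?Z s i l1))" ..
   qed
   also have "\<dots> = (\<Sum>s<S. Sum_any (\<lambda>l1. \<Sum>i\<le>s. ?Z s i l1))"
    by (intro sum.cong refl, rule SA_finite_sum_swap[symmetric, where f = "\<lambda>i l1. ?Z _ i l1"]) (simp, rule f)
   also have "\<dots> = Sum_any ?G"
   proof (rule SA_finite_sum_swap[symmetric, where f = "\<lambda>s l1. \<Sum>i\<le>s. ?Z s i l1"])
    fix s :: nat assume "s \<in> {..<S}"
    have "finite (\<Union>i\<in>{..s}. {l1. ?Z s i l1 \<noteq> 0})"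
     by (intro finite_UN_I f) simp
    then show "fs (\<lambda>l1. \<Sum>i\<le>s. ?Z s i l1)"
     by (rule rev_finite_subset) (blast elim: sum.not_neutral_contains_not_neutral)
   qed simp
   finally show ?thesis .
  qed
  \<comment> \<open>For fixed \<open>l1\<close> weak associativity is applied first to
    \<open>U\<close> and then to \<open>A\<close>; this is possible because the modes of
    \<open>U\<close> from \<open>p2\<close> on and those of \<open>A\<close> from \<open>p1\<close>
    on kill \<open>x\<close>.\<close>
  have step2: "?G l1 = (\<Sum>i<Suc p1. \<Sum>j<Suc p2. (bin (int p1) i * bin (int p2) j) *s WAU (l1 + int i) (l - 1 - l1 + int j) (p + q - int (i + j)) x)" for l1
  proof -
   let ?l2 = "l - 1 - l1" and ?B = "\<lambda>i. A' (int p1 + l1 - int i)"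
   let ?c = "\<lambda>i. (-1) ^ i * bin l1 i" and ?d = "\<lambda>j. (-1) ^ j * bin (l - 1 - l1) j" and ?E = "\<lambda>j. U' (int p2 + (l - 1 - l1) - int j)"
   let ?K = "\<lambda>i. bls WU (int p2) (l - 1 - l1) (q + int i) x" and ?M = "\<lambda>i j. WU (l - 1 - l1 + int j) ((int p2 + q - int j) + int i) x"
   have "?G l1 = (\<Sum>i<S. \<Sum>j<S. (?c i * ?d j) *s ?B i (?E j (W (q + int i + int j) x)))"
   proof (subst sum_triangle)
    fix i k assume "S \<le> i + k"
    then show "(?c i * ?d k) *s ?B i (?E k (W (q + int i + int k) x)) = 0"
     by (simp add: S' fld_0[OF U'] fld_0[OF A'])
   next
    show "?G l1 = (\<Sum>u<S. \<Sum>i\<le>u. (?c i * ?d (u - i)) *s ?B i (?E (u - i) (W (q + int i + int (u - i)) x)))"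
    proof (intro sum.cong refl)
     fix s i :: nat assume "i \<in> {..s}"
     then have i: "i \<le> s" by simp
     have pw: "(-1 :: complex) ^ s = (-1) ^ i * (-1) ^ (s - i)" using i by (simp add: power_add[symmetric])
     have "q + int i + int (s - i) = q + int s" using i by simp
     then show "((-1) ^ s * (bin l1 i * bin ?l2 (s - i))) *s ?B i (?E (s - i) (W (q + int s) x)) =
      (?c i * ?d (s - i)) *s ?B i (?E (s - i) (W (q + int i + int (s - i)) x))"
      unfolding pw by (simp only: mult_ac)
    qed
   qed
   also have "\<dots> = (\<Sum>i<S. ?c i *s ?B i (\<Sum>j<S. ?d j *s ?E j (W (q + int i + int j) x)))"
    by (simp add: fld_sum[OF A'] fld_scale[OF A'] scaleC_sum_right scaleC_scaleC)
   also have "\<dots> = (\<Sum>i<S. ?c i *s ?B i (?K i))"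
   proof (intro sum.cong refl)
    fix i
    have U0: "U (int p2 + int j) x = 0" for j using P2 p2 by simp
    have "?K i = (\<Sum>j<S. ?d j *s ?E j (W (q + int i + int j) x))"
     unfolding WU brs_weak_assoc[of U' U W "int p2" x, OF U' U W U0]
     by (rule SA_nat) (simp add: S' fld_0[OF U'])
    then show "?c i *s ?B i (\<Sum>j<S. ?d j *s ?E j (W (q + int i + int j) x)) =
     ?c i *s ?B i (?K i)" by simp
   qed
   also have "\<dots> = Sum_any (\<lambda>i::nat. ?c i *s ?B i (?K i))"
   proof (rule SA_nat[symmetric])
    fix i assume "S \<le> i"
    have U0: "U (int p2 + int j) x = 0" for j using P2 p2 by simp
    have "?K i = 0"
     unfolding WU brs_weak_assoc[of U' U W "int p2" x, OF U' U W U0]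
     by (rule SA_zero) (use \<open>S \<le> i\<close> in \<open>simp add: S' fld_0[OF U']\<close>)
    then show "?c i *s ?B i (?K i) = 0"
     by (simp add: fld_0[OF A'])
   qed
   also have "\<dots> = Sum_any (\<lambda>i::nat. \<Sum>j<Suc p2. bin (int p2) j *s (?c i *s ?B i (?M i j)))"
    unfolding bls_nat
    by (rule Sum_any.cong) (simp add: fld_sum[OF A'] fld_scale[OF A'] scaleC_sum_right scaleC_scaleC algebra_simps del: sum.lessThan_Suc)
   also have "\<dots> = (\<Sum>j<Suc p2. bin (int p2) j *s Sum_any (\<lambda>i::nat. ?c i *s ?B i (?M i j)))"
    unfolding SA_scale[symmetric]
    by (rule SA_finite_sum_swap[where f = "\<lambda>j i. bin (int p2) j *s (?c i *s ?B i (?M i j))"])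
     (simp, intro fs_scale fld_fs_lin WUf is_fld_linear A')
   also have "\<dots> = (\<Sum>j<Suc p2. bin (int p2) j *s bls (\<lambda>l. WAU l (?l2 + int j)) (int p1) l1 (int p2 + q - int j) x)"
   proof (intro sum.cong refl arg_cong[where f = "(*s) _"])
    fix j
    have A0: "A (int p1 + int i) x = 0" for i using P1 by simp
    show "Sum_any (\<lambda>i::nat. ?c i *s ?B i (?M i j)) =
      bls (\<lambda>l. WAU l (?l2 + int j)) (int p1) l1 (int p2 + q - int j) x"
     unfolding WAU brs_weak_assoc[of A' A "WU (?l2 + int j)" "int p1" x, OF A' A WUf A0] ..
   qed
   also have "\<dots> = (\<Sum>j<Suc p2. \<Sum>i<Suc p1. (bin (int p1) i * bin (int p2) j) *s WAU (l1 + int i) (?l2 + int j) (p + q - int (i + j)) x)"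
    unfolding bls_nat p_eq by (simp add: scaleC_sum_right scaleC_scaleC algebra_simps del: sum.lessThan_Suc)
   also have "\<dots> = (\<Sum>i<Suc p1. \<Sum>j<Suc p2. (bin (int p1) i * bin (int p2) j) *s WAU (l1 + int i) (?l2 + int j) (p + q - int (i + j)) x)"
    by (rule sum.swap)
   finally show ?thesis .
  qed
  have f3: "fs (\<lambda>l1. WAU (l1 + int i) (l - 1 - l1 + int j) q' x)" for i j q'
   using XXfs[of "int i" "l - 1 + int j" q' x] by (simp add: algebra_simps)
  have c3: "Sum_any (\<lambda>l1. WAU (l1 + int i) (l - 1 - l1 + int j) q' x) = XX (l + int (i + j)) q' x" for i j q'
   unfolding XX_def by (subst (2) SA_shift[of _ "int i", symmetric]) (simp add: algebra_simps)
  have "Sum_any ?G = (\<Sum>i<Suc p1. \<Sum>j<Suc p2. (bin (int p1) i * bin (int p2) j) *s XX (l + int (i + j)) (p + q - int (i + j)) x)"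
   unfolding step2 by (subst SA_sum2_swap, rule fs_scale, rule f3) (simp only: SA_scale c3)
  also have "\<dots> = bls XX p l q x"
   unfolding sum_square_Vandermonde[of p1 p2 "\<lambda>u. XX (l + int u) (p + q - int u) x"]
   using bls_nat[of XX "p1 + p2" l q x] by (simp add: p_eq)
  finally show ?thesis unfolding step1 .
 qed
 have "bls XX p l q x - brs ?X' ?X W p l q x = 0" for p l q x
 proof -
  obtain K where K: "\<forall>i\<ge>K. A (0 + int i) x = 0" using is_fld_bound[OF A] by blast
  obtain L where L: "\<forall>i\<ge>L. U (0 + int i) x = 0" using is_fld_bound[OF U] by blast
  have K': "A n x = 0" if "n \<ge> int K" for n using K[rule_format, of "nat n"] that by (simp add: le_nat_iff)
  have L': "U n x = 0" if "n \<ge> int L" for n using L[rule_format, of "nat n"] that by (simp add: le_nat_iff)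
  show ?thesis
  proof (rule defect_zero_large[of "\<lambda>p l q. bls XX p l q x - brs ?X' ?X W p l q x" "int (2 * N)" "int K + int L"])
   fix p l q
   show "bls XX (p + 1) l q x - brs ?X' ?X W (p + 1) l q x =
    bls XX p (l + 1) q x - brs ?X' ?X W p (l + 1) q x + (bls XX p l (q + 1) x - brs ?X' ?X W p l (q + 1) x)"
    using brs_rec[OF X' X W, of p l q x] bls_rec[of "int (2 * N)" XX p l q x] XX0 by simp
   show "bls XX p l q x - brs ?X' ?X W p l q x = 0" if "int (2 * N) \<le> l"
   proof -
    have "bls XX p l q x = 0" unfolding bls_def by (rule SA_zero) (use XX0 that in simp)
    then show ?thesis using large_l[OF that] by simp
   qed
   show "bls XX p l q x - brs ?X' ?X W p l q x = 0" if "int K + int L \<le> p"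
    using large_p[OF K' L' that] by simp
  qed
 qed
 then show ?thesis unfolding XX_def by simp
qed

section \<open>Tensor products\<close>

definition bilin :: "('a::complex_vector \<Rightarrow> 'b::complex_vector \<Rightarrow> 'c::complex_vector) \<Rightarrow> bool" where
 "bilin f \<longleftrightarrow> (\<forall>x. clinear (f x)) \<and> (\<forall>y. clinear (\<lambda>x. f x y))"

lemma bilinD: "bilin f \<Longrightarrow> clinear (f x)" "bilin f \<Longrightarrow> clinear (\<lambda>x. f x y)"
 by (simp_all add: bilin_def)

text \<open>Convolution of two mode sequences under a bilinear map. It allows work in one tensor
  factor while the modes \<open>G\<close> of the other stay fixed.\<close>

definition cvl :: "('a \<Rightarrow> 'b \<Rightarrow> 'c::comm_monoid_add) \<Rightarrow> (int \<Rightarrow> 'a) \<Rightarrow> (int \<Rightarrow> 'b) \<Rightarrow> int \<Rightarrow> 'c" where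
 "cvl \<beta> P G q = Sum_any (\<lambda>j. \<beta> (P j) (G (q - 1 - j)))"

lemma cvl_flip: "cvl \<beta> P G q = cvl (\<lambda>x y. \<beta> y x) G P q"
 unfolding cvl_def by (subst SA_neg[of _ "q - 1", symmetric]) simp

lemma cvl_fs:
 fixes \<beta> :: "'x::complex_vector \<Rightarrow> 'y::complex_vector \<Rightarrow> 'c::complex_vector" and P :: "int \<Rightarrow> 'x" and G :: "int \<Rightarrow> 'y"
 assumes \<beta>: "bilin \<beta>" and P: "\<And>j. j \<ge> K \<Longrightarrow> P j = 0" and G: "\<And>j. j \<ge> J \<Longrightarrow> G j = 0"
 shows "fs (\<lambda>j. \<beta> (P j) (G (q - 1 - j)))"
 by (rule fs_int[of "q - 1 - J" _ K]) (use P G in \<open>auto simp: clinear_0[OF bilinD(1)[OF \<beta>]] clinear_0[OF bilinD(2)[OF \<beta>]]\<close>)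

lemma SA_swap_bounded:
 fixes h :: "nat \<Rightarrow> int \<Rightarrow> 'c::comm_monoid_add"
 assumes "\<And>i j. i \<ge> M \<or> j < a \<or> j > b \<Longrightarrow> h i j = 0"
 shows "Sum_any (\<lambda>i. Sum_any (h i)) = Sum_any (\<lambda>j. Sum_any (\<lambda>i. h i j))"
proof (rule SA_swap, rule finite_subset)
 show "{(i, j). h i j \<noteq> 0} \<subseteq> {..<M} \<times> {a..b}" using assms by (clarsimp, metis not_le)
qed simp

text \<open>The identity holds for each mode \<open>j\<close> of the first factor. Convolution with
  \<open>G\<close> requires only an exchange of sums, for which the truncations of \<open>F\<close>,
  \<open>A\<close>, \<open>B\<close> and \<open>G\<close> supply finite supports.\<close>

lemma cvl_borcherds:
 fixes \<beta> :: "'y::complex_vector \<Rightarrow> 'z::complex_vector \<Rightarrow> 'c::complex_vector" and A :: "('x::complex_vector, 'x) fld"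
 assumes \<beta>: "bilin \<beta>" and A': "is_fld A'" and A: "is_fld A" and B: "is_fld B"
  and F: "\<And>l. is_fld (F l)" and N: "\<And>l. l \<ge> int N \<Longrightarrow> F l = (\<lambda>_ _. 0)"
  and G: "\<And>j. j \<ge> J \<Longrightarrow> G j = 0"
  and eq: "\<And>j. bls F p l j y = brs A' A B p l j y"
 shows "Sum_any (\<lambda>i::nat. bin p i *s cvl \<beta> (\<lambda>j. F (l + int i) j y) G (p + q - int i)) =
  Sum_any (\<lambda>i::nat. abin l i *s cvl \<beta> (\<lambda>j. A' (p + l - int i) (B j y)) G (q + int i))
  - sg l *s Sum_any (\<lambda>i::nat. abin l i *s cvl \<beta> (\<lambda>j. B j (A (p + int i) y)) G (l + q - int i))"
proof -
 note b0 = clinear_0[OF bilinD(1)[OF \<beta>]] clinear_0[OF bilinD(2)[OF \<beta>]]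
 note bs = clinear_scale[OF bilinD(2)[OF \<beta>]]
 have J: "\<beta> u (G (q - 1 - j)) = 0" if "j < q - J" for u j using that by (simp add: G b0)
 obtain Kb where Kb: "\<forall>n\<ge>Kb. B n y = 0" using B unfolding is_fld_def by blast
 obtain Ka where Ka: "\<And>i. i \<ge> Ka \<Longrightarrow> A (p + int i) y = 0" using is_fld_bound[OF A] by blast
 have swap: "Sum_any (\<lambda>i::nat. c i *s cvl \<beta> (Q i) G (q + s i)) =
   Sum_any (\<lambda>j. \<beta> (Sum_any (\<lambda>i. c i *s Q i (j + s i))) (G (q - 1 - j)))"
  if Q: "\<And>i j. i \<ge> M \<or> j > b \<Longrightarrow> j \<ge> q - J \<Longrightarrow> Q i (j + s i) = 0" and fi: "\<And>j. fs (\<lambda>i. Q i (j + s i))"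
  for c :: "nat \<Rightarrow> complex" and Q s M b
 proof -
  have "Sum_any (\<lambda>i::nat. c i *s cvl \<beta> (Q i) G (q + s i)) =
   Sum_any (\<lambda>i. Sum_any (\<lambda>j. \<beta> (c i *s Q i (j + s i)) (G (q - 1 - j))))"
  proof (rule Sum_any.cong)
   fix i
   have "cvl \<beta> (Q i) G (q + s i) = Sum_any (\<lambda>j. \<beta> (Q i (j + s i)) (G (q - 1 - j)))"
    unfolding cvl_def by (subst SA_shift[of _ "s i", symmetric]) (simp add: algebra_simps)
   then show "c i *s cvl \<beta> (Q i) G (q + s i) = Sum_any (\<lambda>j. \<beta> (c i *s Q i (j + s i)) (G (q - 1 - j)))"
    by (simp add: SA_scale bs)
  qed
  also have "\<dots> = Sum_any (\<lambda>j. Sum_any (\<lambda>i. \<beta> (c i *s Q i (j + s i)) (G (q - 1 - j))))"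
   by (rule SA_swap_bounded[of M "q - J" b]) (use Q J in \<open>metis b0(2) scaleC_0 not_le\<close>)
  also have "\<dots> = Sum_any (\<lambda>j. \<beta> (Sum_any (\<lambda>i. c i *s Q i (j + s i))) (G (q - 1 - j)))"
   by (rule Sum_any.cong, rule clinear_Sum_any[OF bilinD(2)[OF \<beta>], symmetric], rule fs_scale, rule fi)
  finally show ?thesis .
 qed
 have L: "Sum_any (\<lambda>i::nat. bin p i *s cvl \<beta> (\<lambda>j. F (l + int i) j y) G (p + q - int i)) = Sum_any (\<lambda>j. \<beta> (bls F p l j y) (G (q - 1 - j)))"
 proof -
  have F0: "F (l + int i) = (\<lambda>_ _. 0)" if "i \<ge> nat (int N - l)" for i using N that by auto
  obtain K where K: "\<forall>i. \<forall>u\<ge>K. F (l + int i) (p - int i + int u) y = 0"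
   using is_fld_uniform_fam[of "\<lambda>i. F (l + int i)" "nat (int N - l)" "\<lambda>i. p - int i" y, OF F F0] by auto
  have "Sum_any (\<lambda>i::nat. bin p i *s cvl \<beta> (\<lambda>j. F (l + int i) j y) G (q + (p - int i))) =
   Sum_any (\<lambda>j. \<beta> (Sum_any (\<lambda>i. bin p i *s F (l + int i) (j + (p - int i)) y)) (G (q - 1 - j)))"
  proof (rule swap)
   show "F (l + int i) (j + (p - int i)) y = 0" if "i \<ge> nat (int N - l) \<or> j > int K" for i j
    using that F0[of i] K[rule_format, of "nat j" i] by (auto simp: algebra_simps)
   show "fs (\<lambda>i. F (l + int i) (j + (p - int i)) y)" for j
    by (rule fs_nat[of "nat (int N - l)"]) (simp add: F0)
  qed
  then show ?thesis unfolding bls_def by (simp add: algebra_simps)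
 qed
 have R1: "Sum_any (\<lambda>i::nat. abin l i *s cvl \<beta> (\<lambda>j. A' (p + l - int i) (B j y)) G (q + int i)) =
   Sum_any (\<lambda>j. \<beta> (Sum_any (\<lambda>i. abin l i *s A' (p + l - int i) (B (j + int i) y))) (G (q - 1 - j)))"
 proof (rule swap)
  show "A' (p + l - int i) (B (j + int i) y) = 0" if "i \<ge> nat (Kb - q + J) \<or> j > Kb" "j \<ge> q - J" for i j
  proof -
   have "j + int i \<ge> Kb" using that by auto
   then show ?thesis using Kb by (simp add: fld_0[OF A'])
  qed
  show "fs (\<lambda>i. A' (p + l - int i) (B (j + int i) y))" for j by (intro fld_fs_lin B is_fld_linear A')
 qed
 have R2: "Sum_any (\<lambda>i::nat. abin l i *s cvl \<beta> (\<lambda>j. B j (A (p + int i) y)) G (l + q - int i)) =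
   Sum_any (\<lambda>j. \<beta> (Sum_any (\<lambda>i. abin l i *s B (l + j - int i) (A (p + int i) y))) (G (q - 1 - j)))"
 proof -
  obtain K where K: "\<forall>i\<ge>K. \<forall>k. B (l - int k + int i) (A (p + int k) y) = 0"
   using is_fld_uniform[OF B, of Ka "\<lambda>k. A (p + int k) y" "\<lambda>k. l - int k"] Ka by auto
  have "Sum_any (\<lambda>i::nat. abin l i *s cvl \<beta> (\<lambda>j. B j (A (p + int i) y)) G (q + (l - int i))) =
   Sum_any (\<lambda>j. \<beta> (Sum_any (\<lambda>i. abin l i *s B (j + (l - int i)) (A (p + int i) y))) (G (q - 1 - j)))"
  proof (rule swap)
   show "B (j + (l - int i)) (A (p + int i) y) = 0" if "i \<ge> Ka \<or> j > int K" for i j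
    using that Ka[of i] K[rule_format, of "nat j" i] by (auto simp: algebra_simps fld_0[OF B])
   show "fs (\<lambda>i. B (j + (l - int i)) (A (p + int i) y))" for j by (intro fld_fs_lin A is_fld_linear B)
  qed
  then show ?thesis by (simp add: algebra_simps)
 qed
 have f1: "fs (\<lambda>j. \<beta> (Sum_any (\<lambda>i::nat. abin l i *s A' (p + l - int i) (B (j + int i) y))) (G (q - 1 - j)))"
 proof (rule cvl_fs[OF \<beta>, of Kb _ J])
  fix j assume "Kb \<le> j"
  then show "Sum_any (\<lambda>i::nat. abin l i *s A' (p + l - int i) (B (j + int i) y)) = 0"
   by (intro SA_zero) (use Kb in \<open>auto simp: fld_0[OF A']\<close>)
 qed (rule G)
 have f2: "fs (\<lambda>j. \<beta> (Sum_any (\<lambda>i::nat. abin l i *s B (l + j - int i) (A (p + int i) y))) (G (q - 1 - j)))"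
 proof -
  obtain K where K: "\<forall>i\<ge>K. \<forall>k. B (l - int k + int i) (A (p + int k) y) = 0"
   using is_fld_uniform[OF B, of Ka "\<lambda>k. A (p + int k) y" "\<lambda>k. l - int k"] Ka by auto
  show ?thesis
  proof (rule cvl_fs[OF \<beta>, of "int K" _ J])
   fix j assume j: "int K \<le> j"
   show "Sum_any (\<lambda>i::nat. abin l i *s B (l + j - int i) (A (p + int i) y)) = 0"
   proof (rule SA_zero)
    fix i show "abin l i *s B (l + j - int i) (A (p + int i) y) = 0"
     using K[rule_format, of "nat j" i] j by (simp add: algebra_simps)
   qed
  qed (rule G)
 qed
 have "Sum_any (\<lambda>j. \<beta> (bls F p l j y) (G (q - 1 - j))) =
   Sum_any (\<lambda>j. \<beta> (Sum_any (\<lambda>i. abin l i *s A' (p + l - int i) (B (j + int i) y))) (G (q - 1 - j)))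
   - sg l *s Sum_any (\<lambda>j. \<beta> (Sum_any (\<lambda>i. abin l i *s B (l + j - int i) (A (p + int i) y))) (G (q - 1 - j)))"
  unfolding SA_scale[symmetric]
  by (subst SA_diff[symmetric], rule f1, rule fs_scale, rule f2)
   (simp add: eq brs_split[OF A' A B] clinear_diff[OF bilinD(2)[OF \<beta>]] bs)
 then show ?thesis unfolding L R1 R2 .
qed

section \<open>Vertex operators on tensor products\<close>

lemma lookup_tensor: "lookup (tensor w x) b = lookup x b *s w"
 by (simp add: tensor_def map.rep_eq when_def)

lemma tensor_bilin: "bilin tensor"
 unfolding bilin_def
 by (auto intro!: clinearI poly_mapping_eqI simp: lookup_tensor lookup_add lookup_scaleC scaleC_add_left scaleC_add_right scaleC_scaleC scaleC_complex_def mult.commute)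

lemmas tensor_linear1 = bilinD(2)[OF tensor_bilin] and tensor_linear2 = bilinD(1)[OF tensor_bilin]

lemmas tensor_0_left = clinear_0[OF tensor_linear1] and tensor_add_left = clinear_add[OF tensor_linear1] and tensor_scale_left = clinear_scale[OF tensor_linear1]

lemmas tensor_0_right = clinear_0[OF tensor_linear2] and tensor_add_right = clinear_add[OF tensor_linear2] and tensor_scale_right = clinear_scale[OF tensor_linear2] and tensor_diff_right = clinear_diff[OF tensor_linear2] and tensor_minus_right = clinear_minus[OF tensor_linear2]

lemma tensor_single: "tensor w (single b 1) = single b w"
 by (rule poly_mapping_eqI) (simp add: lookup_tensor lookup_single when_def scaleC_one)

lemma tpi_linear_eq:
 fixes F G :: "'w::complex_vector tpi \<Rightarrow> 'v::complex_vector"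
 assumes "clinear F" "clinear G" "\<And>w b. F (tensor w (single b 1)) = G (tensor w (single b 1))"
 shows "F x = G x"
 by (induction x rule: pm_induct) (use assms in \<open>simp_all add: clinear_add tensor_single\<close>)

definition tmap :: "('x::complex_vector \<Rightarrow> 'y::complex_vector) \<Rightarrow> (pi \<Rightarrow> pi) \<Rightarrow> 'x tpi \<Rightarrow> 'y tpi" where
 "tmap F G x = (\<Sum>b\<in>keys x. tensor (F (lookup x b)) (G (single b 1)))"

lemma tmap_linear: "clinear F \<Longrightarrow> clinear (tmap F G)"
 unfolding tmap_def by (rule sum_keys_linear) (rule clinear_compose[OF tensor_linear1])

lemma tmap_tensor: "clinear F \<Longrightarrow> clinear G \<Longrightarrow> tmap F G (tensor w x) = tensor (F w) (G x)"
proof -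
 assume F: "clinear F" and G: "clinear G"
 show ?thesis
 proof (rule pi_linear_eq[of "\<lambda>x. tmap F G (tensor w x)" "\<lambda>x. tensor (F w) (G x)"])
  show "clinear (\<lambda>x. tmap F G (tensor w x))" by (rule clinear_compose[OF tmap_linear[OF F] tensor_linear2])
  show "clinear (\<lambda>x. tensor (F w) (G x))" by (rule clinear_compose[OF tensor_linear2 G])
  fix A B j
  show "tmap F G (tensor w (single (A, B, j) 1)) = tensor (F w) (G (single (A, B, j) 1))"
   unfolding tensor_single tmap_def by (cases "w = 0") (simp_all add: clinear_0[OF F] tensor_0_left)
 qed
qed

lemma tmap_compose:
 "clinear F \<Longrightarrow> clinear G \<Longrightarrow> clinear F' \<Longrightarrow> clinear G' \<Longrightarrow> tmap F G (tmap F' G' x) = tmap (\<lambda>w. F (F' w)) (\<lambda>p. G (G' p)) x"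
 by (rule tpi_linear_eq[of "\<lambda>x. tmap F G (tmap F' G' x)" "tmap (\<lambda>w. F (F' w)) (\<lambda>p. G (G' p))"])
  (simp_all add: tmap_linear clinear_compose[of "tmap F G"] clinear_compose[of F] clinear_compose[of G] tmap_tensor)

lemma fld_max: "is_fld A \<Longrightarrow> \<exists>K. \<forall>j\<ge>K. A j x = 0" by (simp add: is_fld_def)

context
 fixes I1 :: "('a::complex_vector, int, 'x::complex_vector, 'y::complex_vector) vop" and I2 :: "(pi, int, pi, pi) vop"
 assumes I1: "is_vop I1" and I2: "is_vop I2"
begin

abbreviation (input) "TT a f n y g \<equiv> cvl tensor (\<lambda>j. I1 a j y) (\<lambda>j. I2 f j g) n"

lemma TT_fs: "fs (\<lambda>j. tensor (I1 a j y) (I2 f (n - 1 - j) g))"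
proof -
 obtain K L where "\<forall>j\<ge>K. I1 a j y = 0" "\<forall>j\<ge>L. I2 f j g = 0"
  using fld_max[OF is_vop_fld[OF I1]] fld_max[OF is_vop_fld[OF I2]] by meson
 then show ?thesis by (intro cvl_fs[OF tensor_bilin, of K _ L]) auto
qed

lemma TT_linear:
 "clinear (\<lambda>a. TT a f n y g)" "clinear (\<lambda>f. TT a f n y g)" "clinear (\<lambda>y. TT a f n y g)" "clinear (\<lambda>g. TT a f n y g)"
 unfolding cvl_def
 by (rule clinearI; simp add: vop1_add[OF I1] vop1_add[OF I2] vop_add[OF I1]
   vop_add[OF I2] vop1_scale[OF I1] vop1_scale[OF I2] vop_scale[OF I1]
   vop_scale[OF I2] tensor_add_left tensor_add_right tensor_scale_left tensor_scale_right
   SA_scale SA_add[OF TT_fs TT_fs])+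

lemma tensor_vop_eq: "tensor_vop I1 I2 u n v =
  (\<Sum>b\<in>keys u. \<Sum>b'\<in>keys v. TT (lookup u b) (single b 1) n (lookup v b') (single b' 1))"
 by (simp add: tensor_vop_def cvl_def)

lemma tensor_vop_linear1: "clinear (\<lambda>u. tensor_vop I1 I2 u n v)"
 unfolding tensor_vop_eq by (rule sum_keys_linear) (intro clinear_sumI TT_linear)

lemma tensor_vop_linear2: "clinear (tensor_vop I1 I2 u n)"
proof -
 have e: "tensor_vop I1 I2 u n = (\<lambda>v. \<Sum>b'\<in>keys v. \<Sum>b\<in>keys u. TT (lookup u b) (single b 1) n (lookup v b') (single b' 1))"
  unfolding tensor_vop_eq fun_eq_iff by (intro allI sum.swap)
 show ?thesis unfolding e by (rule sum_keys_linear) (intro clinear_sumI TT_linear)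
qed

lemma tensor_vop_pure: "tensor_vop I1 I2 (tensor a f) n (tensor y g) = TT a f n y g"
proof -
 have s: "tensor_vop I1 I2 (tensor a (single b 1)) n (tensor y (single b' 1)) = TT a (single b 1) n y (single b' 1)" for b b'
 proof (cases "a = 0 \<or> y = 0")
  case True
  then show ?thesis
   by (auto simp: tensor_single clinear_0[OF tensor_vop_linear1] clinear_0[OF tensor_vop_linear2] clinear_0[OF TT_linear(1)] clinear_0[OF TT_linear(3)])
 next
  case False then show ?thesis unfolding tensor_single tensor_vop_eq by simp
 qed
 have s': "tensor_vop I1 I2 (tensor a f) n (tensor y (single b' 1)) = TT a f n y (single b' 1)" for b'
  by (rule pi_linear_eq[of "\<lambda>f. tensor_vop I1 I2 (tensor a f) n (tensor y (single b' 1))" "\<lambda>f. TT a f n y (single b' 1)"])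
   (auto intro: clinear_compose[OF tensor_vop_linear1 tensor_linear2] TT_linear s)
 show ?thesis
  by (rule pi_linear_eq[of "\<lambda>g. tensor_vop I1 I2 (tensor a f) n (tensor y g)" "\<lambda>g. TT a f n y g"])
   (auto intro: clinear_compose[OF tensor_vop_linear2 tensor_linear2] TT_linear s')
qed

lemma tensor_is_vop: "is_vop (tensor_vop I1 I2)"
proof -
 have "\<exists>N. \<forall>n\<ge>N. tensor_vop I1 I2 u n v = 0" for u v
 proof (induction u rule: pm_induct)
  case (add u u')
  then obtain N M where "\<forall>n\<ge>N. tensor_vop I1 I2 u n v = 0" "\<forall>n\<ge>M. tensor_vop I1 I2 u' n v = 0" by blast
  then have "\<forall>n\<ge>max N M. tensor_vop I1 I2 (u + u') n v = 0" by (simp add: clinear_add[OF tensor_vop_linear1])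
  then show ?case by blast
 next
  case (single b a)
  show ?case
  proof (induction v rule: pm_induct)
   case (add u u')
   then obtain N M where "\<forall>n\<ge>N. tensor_vop I1 I2 (single b a) n u = 0" "\<forall>n\<ge>M. tensor_vop I1 I2 (single b a) n u' = 0" by blast
   then have "\<forall>n\<ge>max N M. tensor_vop I1 I2 (single b a) n (u + u') = 0" by (simp add: clinear_add[OF tensor_vop_linear2])
   then show ?case by blast
  next
   case (single b' y)
   let ?f = "single b 1" and ?g = "single b' 1"
   obtain K L where K: "\<forall>j\<ge>K. I1 a j y = 0" and L: "\<forall>j\<ge>L. I2 ?f j ?g = 0"
    using fld_max[OF is_vop_fld[OF I1]] fld_max[OF is_vop_fld[OF I2]] by meson
   have "tensor_vop I1 I2 (tensor a ?f) n (tensor y ?g) = 0" if "n \<ge> K + L" for n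
    unfolding tensor_vop_pure cvl_def
   proof (rule SA_zero)
    fix j show "tensor (I1 a j y) (I2 ?f (n - 1 - j) ?g) = 0"
     by (cases "j \<ge> K") (use K L that in \<open>auto simp: tensor_0_left tensor_0_right\<close>)
   qed
   then show ?case unfolding tensor_single by blast
  qed
 qed
 then show ?thesis unfolding is_vop_def is_fld_def using tensor_vop_linear1 tensor_vop_linear2 by blast
qed

end

text \<open>\<open>tA\<close> and \<open>tU\<close> act on one tensor factor each and therefore
  commute. The operator of a pure tensor is their \<open>conv\<close>, which makes
  \<open>bor_conv\<close> applicable.\<close>

definition tA :: "('x::complex_vector, 'x) fld \<Rightarrow> ('x tpi, 'x tpi) fld" where "tA A m = tmap (A m) (\<lambda>p. p)"
definition tU :: "(pi, pi) fld \<Rightarrow> ('x::complex_vector tpi, 'x tpi) fld" where "tU U m = tmap (\<lambda>w. w) (U m)"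

lemma tA_tensor: "is_fld A \<Longrightarrow> tA A m (tensor w x) = tensor (A m w) x"
 unfolding tA_def by (rule tmap_tensor) (auto simp: is_fld_linear clinear_id)

lemma tU_tensor: "is_fld U \<Longrightarrow> tU U m (tensor w x) = tensor w (U m x)"
 unfolding tU_def by (rule tmap_tensor) (auto simp: is_fld_linear clinear_id)

lemma tA_fld: "is_fld A \<Longrightarrow> is_fld (tA A)"
proof (rule is_fldI)
 assume A: "is_fld A"
 show l: "clinear (tA A n)" for n unfolding tA_def by (intro tmap_linear is_fld_linear A)
 fix x :: "'a tpi"
 show "\<exists>N. \<forall>n\<ge>N. tA A n x = 0"
 proof (induction x rule: pm_induct)
  case (add u u')
  then obtain N M where "\<forall>n\<ge>N. tA A n u = 0" "\<forall>n\<ge>M. tA A n u' = 0" by blast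
  then have "\<forall>n\<ge>max N M. tA A n (u + u') = 0" by (simp add: clinear_add[OF l])
  then show ?case by blast
 next
  case (single b w)
  obtain K where "\<forall>j\<ge>K. A j w = 0" using fld_max[OF A] by blast
  then have "\<forall>j\<ge>K. tA A j (tensor w (single b 1)) = 0" by (simp add: tA_tensor[OF A] tensor_0_left)
  then show ?case unfolding tensor_single by blast
 qed
qed

lemma tU_fld: "is_fld U \<Longrightarrow> is_fld (tU U)"
proof (rule is_fldI)
 assume A: "is_fld U"
 show l: "clinear (tU U n)" for n unfolding tU_def by (intro tmap_linear clinear_id)
 fix x :: "'a tpi"
 show "\<exists>N. \<forall>n\<ge>N. tU U n x = 0"
 proof (induction x rule: pm_induct)
  case (add u u')
  then obtain N M where "\<forall>n\<ge>N. tU U n u = 0" "\<forall>n\<ge>M. tU U n u' = 0" by blast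
  then have "\<forall>n\<ge>max N M. tU U n (u + u') = 0" by (simp add: clinear_add[OF l])
  then show ?case by blast
 next
  case (single b w)
  obtain K where "\<forall>j\<ge>K. U j (single b 1) = 0" using fld_max[OF A] by blast
  then have "\<forall>j\<ge>K. tU U j (tensor w (single b 1)) = 0" by (simp add: tU_tensor[OF A] tensor_0_right)
  then show ?case unfolding tensor_single by blast
 qed
qed

lemma tA_tU: "is_fld A \<Longrightarrow> is_fld U \<Longrightarrow> tA A m (tU U n v) = tU U n (tA A m v)"
 unfolding tA_def tU_def by (simp add: tmap_compose is_fld_linear clinear_id)

lemma tensor_vop_conv:
 assumes Y: "is_vop Y" and P: "is_vop P"
 shows "tensor_vop Y P (tensor a f) = conv (tA (Y a)) (tU (P f))"
proof (intro ext)
 fix n v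
 note f = is_vop_fld[OF Y] is_vop_fld[OF P]
 note ff = tA_fld[OF f(1)] tU_fld[OF f(2)] tA_tU[OF f(1) f(2)]
 show "tensor_vop Y P (tensor a f) n v = conv (tA (Y a)) (tU (P f)) n v"
 proof (rule tpi_linear_eq[of "tensor_vop Y P (tensor a f) n" "conv (tA (Y a)) (tU (P f)) n"])
  show "clinear (tensor_vop Y P (tensor a f) n)" by (rule tensor_vop_linear2[OF Y P])
  show "clinear (conv (tA (Y a)) (tU (P f)) n)" by (rule is_fld_linear[OF conv_fld[OF ff]])
  fix w b
  show "tensor_vop Y P (tensor a f) n (tensor w (single b 1)) = conv (tA (Y a)) (tU (P f)) n (tensor w (single b 1))"
   unfolding tensor_vop_pure[OF Y P] conv_def tU_tensor[OF f(2)] tA_tensor[OF f(1)] cvl_def ..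
 qed
qed

lemma brs_as_prd: "brs A' A B p l q x = prd (\<lambda>n. A' (n + p)) (\<lambda>n. A (n + p)) l B q x"
 unfolding prd_def brs_def by (simp add: algebra_simps)

lemma brs_linear: "is_fld A' \<Longrightarrow> is_fld A \<Longrightarrow> is_fld B \<Longrightarrow> clinear (brs A' A B p l q)"
 unfolding brs_as_prd[abs_def] by (rule is_fld_linear, intro prd_fld is_fld_shift)

lemma bls_linear: "(\<And>l. is_fld (F l)) \<Longrightarrow> (\<And>l. l \<ge> int N \<Longrightarrow> F l = (\<lambda>_ _. 0)) \<Longrightarrow> clinear (bls F p l q)"
proof -
 assume F: "\<And>l. is_fld (F l)" and N: "\<And>l. l \<ge> int N \<Longrightarrow> F l = (\<lambda>_ _. 0)"
 have "bls F p l q x = (\<Sum>i<nat (int N - l). bin p i *s F (l + int i) (p + q - int i) x)" for x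
  unfolding bls_def by (rule SA_nat) (use N in auto)
 then have e: "bls F p l q = (\<lambda>x. \<Sum>i<nat (int N - l). bin p i *s F (l + int i) (p + q - int i) x)" by blast
 show ?thesis unfolding e by (intro clinear_sumI clinear_scaleI is_fld_linear F)
qed

lemma vop_bound: "is_vop Y \<Longrightarrow> \<exists>N::nat. \<forall>l\<ge>int N. Y a l w = 0"
 by (rule fld_bound0) (rule is_vop_fld)

text \<open>For pure tensors the identities of the two factors, each with the other factor carried
  along (\<open>WA\<close> and \<open>WU\<close>), are the input of \<open>bor_conv\<close>.
  Bilinearity extends the result.\<close>

theorem jac_tensor:
 assumes Y1: "is_vop Y1" and Y2: "is_vop Y2" and Y3: "is_vop Y3" and I: "is_vop I"
  and P1: "is_vop P1" and P2: "is_vop P2" and P3: "is_vop P3" and J: "is_vop J"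
  and jY: "\<And>a w. jac Y1 Y2 Y3 I a w" and jP: "\<And>f g. jac P1 P2 P3 J f g"
 shows "jac (tensor_vop Y1 P1) (tensor_vop Y2 P2) (tensor_vop Y3 P3) (tensor_vop I J) u v"
proof -
 note V = tensor_is_vop[OF Y1 P1] tensor_is_vop[OF Y2 P2] tensor_is_vop[OF Y3 P3] tensor_is_vop[OF I J]
 let ?I = "tensor_vop I J"
 note If = is_vop_fld[OF V(4)]
 note f = is_vop_fld[OF Y2] is_vop_fld[OF Y3] is_vop_fld[OF P2] is_vop_fld[OF P3] is_vop_fld[OF I] is_vop_fld[OF J]
 have WA: "bls (\<lambda>l. ?I (tensor (Y1 a l w) g)) p l q x = brs (tA (Y3 a)) (tA (Y2 a)) (?I (tensor w g)) p l q x" for a w g p l q x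
 proof (rule tpi_linear_eq[of "bls (\<lambda>l. ?I (tensor (Y1 a l w) g)) p l q" "brs (tA (Y3 a)) (tA (Y2 a)) (?I (tensor w g)) p l q"])
  obtain N where N: "\<forall>l\<ge>int N. Y1 a l w = 0" using vop_bound[OF Y1] by blast
  show "clinear (bls (\<lambda>l. ?I (tensor (Y1 a l w) g)) p l q)"
   by (rule bls_linear[of _ N]) (use N in \<open>auto simp: If tensor_0_left is_vop_0[OF V(4)]\<close>)
  show "clinear (brs (tA (Y3 a)) (tA (Y2 a)) (?I (tensor w g)) p l q)" by (intro brs_linear tA_fld f If)
  fix y and b :: pi_basis
  let ?z = "single b (1::complex)"
  obtain L where L: "\<forall>j\<ge>L. J g j ?z = 0" using fld_max[OF f(6)] by blast
  have eq: "bls (\<lambda>l. I (Y1 a l w)) p l j y = brs (Y3 a) (Y2 a) (I w) p l j y" for j using jY unfolding jac_def by blast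
  have "bls (\<lambda>l. ?I (tensor (Y1 a l w) g)) p l q (tensor y ?z) =
   Sum_any (\<lambda>i::nat. bin p i *s cvl tensor (\<lambda>j. I (Y1 a (l + int i) w) j y) (\<lambda>j. J g j ?z) (p + q - int i))"
   unfolding bls_def tensor_vop_pure[OF I J] ..
  also have "\<dots> = Sum_any (\<lambda>i::nat. abin l i *s cvl tensor (\<lambda>j. Y3 a (p + l - int i) (I w j y)) (\<lambda>j. J g j ?z) (q + int i))
  - sg l *s Sum_any (\<lambda>i::nat. abin l i *s cvl tensor (\<lambda>j. I w j (Y2 a (p + int i) y)) (\<lambda>j. J g j ?z) (l + q - int i))"
   by (rule cvl_borcherds[OF tensor_bilin f(2) f(1) f(5), where N = N and J = L and F = "\<lambda>l. I (Y1 a l w)"])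
    (use N L eq in \<open>auto simp: f is_vop_0[OF I]\<close>)
  also have "\<dots> = brs (tA (Y3 a)) (tA (Y2 a)) (?I (tensor w g)) p l q (tensor y ?z)"
   unfolding brs_split[OF tA_fld[OF f(2)] tA_fld[OF f(1)] If] tA_tensor[OF f(1)] tensor_vop_pure[OF I J]
   unfolding cvl_def fld_Sum_any[OF tA_fld[OF f(2)] TT_fs[OF I J]] tA_tensor[OF f(2)] ..
  finally show "bls (\<lambda>l. ?I (tensor (Y1 a l w) g)) p l q (tensor y ?z) = brs (tA (Y3 a)) (tA (Y2 a)) (?I (tensor w g)) p l q (tensor y ?z)" .
 qed
 have WU: "bls (\<lambda>l. ?I (tensor w (P1 h l g))) p l q x = brs (tU (P3 h)) (tU (P2 h)) (?I (tensor w g)) p l q x" for h w g p l q x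
 proof (rule tpi_linear_eq[of "bls (\<lambda>l. ?I (tensor w (P1 h l g))) p l q" "brs (tU (P3 h)) (tU (P2 h)) (?I (tensor w g)) p l q"])
  obtain N where N: "\<forall>l\<ge>int N. P1 h l g = 0" using vop_bound[OF P1] by blast
  show "clinear (bls (\<lambda>l. ?I (tensor w (P1 h l g))) p l q)"
   by (rule bls_linear[of _ N]) (use N in \<open>auto simp: If tensor_0_right is_vop_0[OF V(4)]\<close>)
  show "clinear (brs (tU (P3 h)) (tU (P2 h)) (?I (tensor w g)) p l q)" by (intro brs_linear tU_fld f If)
  fix y and b :: pi_basis
  let ?z = "single b (1::complex)"
  obtain L where L: "\<forall>j\<ge>L. I w j y = 0" using fld_max[OF f(5)] by blast
  have eq: "bls (\<lambda>l. J (P1 h l g)) p l j ?z = brs (P3 h) (P2 h) (J g) p l j ?z" for j using jP unfolding jac_def by blast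
  have bl: "bilin (\<lambda>x y. tensor y x :: 'd tpi)" using tensor_bilin unfolding bilin_def by blast
  have "bls (\<lambda>l. ?I (tensor w (P1 h l g))) p l q (tensor y ?z) =
   Sum_any (\<lambda>i::nat. bin p i *s cvl (\<lambda>x y. tensor y x) (\<lambda>j. J (P1 h (l + int i) g) j ?z) (\<lambda>j. I w j y) (p + q - int i))"
   unfolding bls_def tensor_vop_pure[OF I J] cvl_flip[of tensor] ..
  also have "\<dots> = Sum_any (\<lambda>i::nat. abin l i *s cvl (\<lambda>x y. tensor y x) (\<lambda>j. P3 h (p + l - int i) (J g j ?z)) (\<lambda>j. I w j y) (q + int i))
  - sg l *s Sum_any (\<lambda>i::nat. abin l i *s cvl (\<lambda>x y. tensor y x) (\<lambda>j. J g j (P2 h (p + int i) ?z)) (\<lambda>j. I w j y) (l + q - int i))"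
   by (rule cvl_borcherds[OF bl f(4) f(3) f(6), where N = N and J = L and F = "\<lambda>l. J (P1 h l g)"])
    (use N L eq in \<open>auto simp: f is_vop_0[OF J]\<close>)
  also have "\<dots> = brs (tU (P3 h)) (tU (P2 h)) (?I (tensor w g)) p l q (tensor y ?z)"
   unfolding brs_split[OF tU_fld[OF f(4)] tU_fld[OF f(3)] If] tU_tensor[OF f(3)] tensor_vop_pure[OF I J]
   unfolding cvl_flip[of "\<lambda>x y. tensor y x"]
   unfolding cvl_def fld_Sum_any[OF tU_fld[OF f(4)] TT_fs[OF I J]] tU_tensor[OF f(4)] ..
  finally show "bls (\<lambda>l. ?I (tensor w (P1 h l g))) p l q (tensor y ?z) = brs (tU (P3 h)) (tU (P2 h)) (?I (tensor w g)) p l q (tensor y ?z)" .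
 qed
 have pure: "jac (tensor_vop Y1 P1) (tensor_vop Y2 P2) (tensor_vop Y3 P3) ?I (tensor a h) (tensor w g)" for a h w g
  unfolding jac_def
 proof (intro allI)
  fix p l q x
  obtain N1 N2 where N1: "\<forall>l\<ge>int N1. Y1 a l w = 0" and N2: "\<forall>l\<ge>int N2. P1 h l g = 0" using vop_bound[OF Y1] vop_bound[OF P1] by meson
  have "bls (\<lambda>l q x. Sum_any (\<lambda>l1. ?I (tensor (Y1 a l1 w) (P1 h (l - 1 - l1) g)) q x)) p l q x =
   brs (conv (tA (Y3 a)) (tU (P3 h))) (conv (tA (Y2 a)) (tU (P2 h))) (?I (tensor w g)) p l q x"
   by (rule bor_conv[where WU = "\<lambda>l. ?I (tensor w (P1 h l g))" and WA = "\<lambda>l. ?I (tensor (Y1 a l w) g)"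
      and WAU = "\<lambda>l l'. ?I (tensor (Y1 a l w) (P1 h l' g))" and N = "max N1 N2"])
    (use N1 N2 in \<open>auto simp: tA_fld tU_fld f If tA_tU WA WU is_vop_0[OF V(4)] tensor_0_left tensor_0_right\<close>)
  moreover have "(\<lambda>q x. Sum_any (\<lambda>l1. ?I (tensor (Y1 a l1 w) (P1 h (l - 1 - l1) g)) q x)) = ?I (tensor_vop Y1 P1 (tensor a h) l (tensor w g))" for l
   unfolding tensor_vop_pure[OF Y1 P1] cvl_def fun_eq_iff vop1_Sum_any[OF V(4) TT_fs[OF Y1 P1]] by simp
  ultimately show "bls (\<lambda>l. ?I (tensor_vop Y1 P1 (tensor a h) l (tensor w g))) p l q x =
    brs (tensor_vop Y3 P3 (tensor a h)) (tensor_vop Y2 P2 (tensor a h)) (?I (tensor w g)) p l q x"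
   unfolding tensor_vop_conv[OF Y3 P3] tensor_vop_conv[OF Y2 P2] by simp
 qed
 show ?thesis
 proof (induction u rule: pm_induct)
  case (add x y) then show ?case by (rule jac_add_left[OF V])
 next
  case (single b a)
  show ?case
  proof (induction v rule: pm_induct)
   case (add x y) then show ?case by (rule jac_add_right[OF V])
  next
   case (single b' w)
   show ?case using pure[of a "single b 1" w "single b' 1"] unfolding tensor_single .
  qed
 qed
qed

section \<open>Skew-symmetry and the deformation of modules\<close>

definition dpow :: "('w::complex_vector \<Rightarrow> 'w) \<Rightarrow> nat \<Rightarrow> 'w \<Rightarrow> 'w" where
 "dpow L j w = (1 / fact j) *s (L ^^ j) w"

lemma dpow_0: "dpow L 0 w = w" by (simp add: dpow_def scaleC_one)

lemma dpow_Suc: "clinear L \<Longrightarrow> of_nat (Suc j) *s dpow L (Suc j) w = L (dpow L j w)"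
 by (simp add: dpow_def clinear_scale scaleC_scaleC field_simps del: of_nat_Suc)

lemma dpow_Suc': "clinear L \<Longrightarrow> of_nat (Suc j) *s dpow L (Suc j) w = dpow L j (L w)"
 by (simp add: dpow_def scaleC_scaleC funpow_swap1 field_simps del: of_nat_Suc)

lemma dpow_linear: "clinear L \<Longrightarrow> clinear (dpow L j)"
proof -
 assume L: "clinear L"
 have "clinear (L ^^ j)" by (induction j) (auto simp: clinear_id comp_def id_def intro: clinear_compose[OF L])
 then show ?thesis unfolding dpow_def[abs_def] by (rule clinear_scaleI)
qed

text \<open>Conjugation by e^(zL) translates the argument: A(x) e^(zL) = e^(zL) A(x - z), read off
  coefficientwise.\<close>

lemma commutator_dpow:
 fixes A :: "('w::complex_vector, 'w) fld"
 assumes L: "clinear L" and A: "\<And>n. clinear (A n)" and LA: "\<And>n w. L (A n w) = A n (L w) - of_int n *s A (n - 1) w"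
 shows "A m (dpow L j w) = (\<Sum>i\<le>j. bin m i *s dpow L (j - i) (A (m - int i) w))"
proof (induction j arbitrary: w)
 case 0 show ?case by (simp add: dpow_0 scaleC_one)
next
 case (Suc j)
 let ?F = "\<lambda>i. bin m i *s dpow L (Suc j - i) (A (m - int i) w)"
 have b: "bin m i * (of_int m - of_nat i) = of_nat (Suc i) * bin m (Suc i)" for i
  using bin_absorb[of m i] bin_absorb_comp[of m i] by (simp add: mult.commute)
 have "of_nat (Suc j) *s A m (dpow L (Suc j) w) = A m (dpow L j (L w))"
  unfolding clinear_scale[OF A, symmetric] dpow_Suc'[OF L] ..
 also have "\<dots> = (\<Sum>i\<le>j. bin m i *s dpow L (j - i) (A (m - int i) (L w)))" by (rule Suc.IH)
 also have "\<dots> = (\<Sum>i\<le>j. of_nat (Suc j - i) *s ?F i + of_nat (Suc i) *s ?F (Suc i))"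
 proof (rule sum.cong[OF refl])
  fix i assume "i \<in> {..j}"
  then have i: "Suc j - i = Suc (j - i)" by auto
  have "A (m - int i) (L w) = L (A (m - int i) w) + (of_int m - of_nat i) *s A (m - int (Suc i)) w"
   by (simp add: LA algebra_simps)
  then have "bin m i *s dpow L (j - i) (A (m - int i) (L w)) =
   bin m i *s (of_nat (Suc (j - i)) *s dpow L (Suc (j - i)) (A (m - int i) w)) + (bin m i * (of_int m - of_nat i)) *s dpow L (j - i) (A (m - int (Suc i)) w)"
   by (simp add: clinear_add[OF dpow_linear[OF L]] clinear_scale[OF dpow_linear[OF L]] dpow_Suc'[OF L] scaleC_add_right scaleC_scaleC del: of_nat_Suc)
  then show "bin m i *s dpow L (j - i) (A (m - int i) (L w)) = of_nat (Suc j - i) *s ?F i + of_nat (Suc i) *s ?F (Suc i)"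
   unfolding b i by (simp add: scaleC_scaleC mult.commute del: of_nat_Suc)
 qed
 also have "\<dots> = (\<Sum>i\<le>Suc j. of_nat (Suc j - i) *s ?F i) + (\<Sum>i\<le>Suc j. of_nat i *s ?F i)"
  unfolding sum.distrib sum.atMost_Suc[of "\<lambda>i. of_nat (Suc j - i) *s ?F i"] sum.atMost_Suc_shift[of "\<lambda>i. of_nat i *s ?F i"] by simp
 also have "\<dots> = (\<Sum>i\<le>Suc j. of_nat (Suc j) *s ?F i)"
  unfolding sum.distrib[symmetric]
 proof (rule sum.cong[OF refl])
  fix i assume "i \<in> {..Suc j}"
  then have "Suc j = (Suc j - i) + i" by auto
  then have "(of_nat (Suc j) :: complex) = of_nat (Suc j - i) + of_nat i" by (metis of_nat_add)
  then show "of_nat (Suc j - i) *s ?F i + of_nat i *s ?F i = of_nat (Suc j) *s ?F i" by (simp only: scaleC_add_left)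
 qed
 finally have "of_nat (Suc j) *s A m (dpow L (Suc j) w) = of_nat (Suc j) *s (\<Sum>i\<le>Suc j. ?F i)"
  by (simp only: scaleC_sum_right)
 then show ?case unfolding cvec.scale_cancel_left by (auto simp del: of_nat_Suc)
qed

text \<open>Taylor's formula: inserting e^(zL) w into the operator amounts to replacing its variable
  x by x + z.\<close>

lemma vop_dpow:
 assumes L: "clinear L" and I: "is_vop I" and Ider: "\<And>w n x. I (L w) n x = - of_int n *s I w (n - 1) x"
 shows "I (dpow L j w) m x = abin m j *s I w (m - int j) x"
proof (induction j arbitrary: m)
 case 0 show ?case by (simp add: dpow_0 scaleC_one)
next
 case (Suc j)
 have "of_nat (Suc j) *s I (dpow L (Suc j) w) m x = I (L (dpow L j w)) m x"
  unfolding vop1_scale[OF I, symmetric] dpow_Suc[OF L] ..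
 also have "\<dots> = (- ((-1) ^ j) * (of_int m * bin (m - 1) j)) *s I w (m - int (Suc j)) x"
  unfolding Ider Suc.IH by (simp add: scaleC_scaleC algebra_simps)
 also have "\<dots> = of_nat (Suc j) *s ((-1) ^ Suc j * bin m (Suc j)) *s I w (m - int (Suc j)) x"
  unfolding bin_absorb[symmetric] by (simp add: scaleC_scaleC algebra_simps del: of_nat_Suc)
 finally show ?case unfolding cvec.scale_cancel_left by (auto simp del: of_nat_Suc)
qed

text \<open>A mode of e^(zL) Y(b,-z) w, which is how w acts on b in the extended algebra. The sign
  is that of the power of -z.\<close>

definition skew :: "('w::complex_vector \<Rightarrow> 'w) \<Rightarrow> ('v::complex_vector, int, 'w, 'w) vop \<Rightarrow> ('w, int, 'v, 'w) vop" where
 "skew L Y w n b = Sum_any (\<lambda>j::nat. sg (n + int j + 1) *s dpow L j (Y b (n + int j) w))"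

context
 fixes L :: "'w::complex_vector \<Rightarrow> 'w" and YV :: "('v::complex_vector, int, 'v, 'v) vop" and Y :: "('v, int, 'w, 'w) vop"
 assumes L: "clinear L" and YV: "is_vop YV" and Y: "is_vop Y"
  and LY: "\<And>a n w. L (Y a n w) = Y a n (L w) - of_int n *s Y a (n - 1) w"
begin

lemma skew_fs: "fs (\<lambda>j::nat. sg (n + int j + 1) *s dpow L j (Y b (n + int j) w))"
 by (rule fs_scale, rule fld_fs_lin[OF is_vop_fld[OF Y] dpow_linear[OF L]])

lemma skew_sum: "(\<And>j. j \<ge> K \<Longrightarrow> Y b (n + int j) w = 0) \<Longrightarrow>
 skew L Y w n b = (\<Sum>j<K. sg (n + int j + 1) *s dpow L j (Y b (n + int j) w))"
 unfolding skew_def by (rule SA_nat) (simp add: clinear_0[OF dpow_linear[OF L]])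

lemma skew_bound: "\<exists>K. \<forall>n\<ge>K. skew L Y w n b = 0"
proof -
 obtain K where K: "\<forall>n\<ge>K. Y b n w = 0" using fld_max[OF is_vop_fld[OF Y]] by blast
 then have "skew L Y w n b = 0" if "n \<ge> K" for n using that by (subst skew_sum[of 0]) auto
 then show ?thesis by blast
qed

lemma skew_is_vop: "is_vop (skew L Y)"
 unfolding is_vop_def is_fld_def
proof (intro conjI allI skew_bound)
 note l = vop1_add[OF Y] vop1_scale[OF Y] vop_add[OF Y] vop_scale[OF Y]
  clinear_add[OF dpow_linear[OF L]] clinear_scale[OF dpow_linear[OF L]]
 fix w n b
 show "clinear (skew L Y w n)"
  by (rule clinearI) (simp_all add: skew_def l scaleC_add_right SA_add[OF skew_fs skew_fs] SA_scale[symmetric] scaleC_scaleC mult.commute)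
 show "clinear (\<lambda>w. skew L Y w n b)"
  by (rule clinearI) (simp_all add: skew_def l scaleC_add_right SA_add[OF skew_fs skew_fs] SA_scale[symmetric] scaleC_scaleC mult.commute)
qed

lemma skew_der: "skew L Y (L w) n b = - of_int n *s skew L Y w (n - 1) b"
proof -
 obtain K0 where K0: "\<forall>n\<ge>K0. Y b n w = 0" using fld_max[OF is_vop_fld[OF Y]] by blast
 obtain K1 where K1: "\<forall>n\<ge>K1. Y b n (L w) = 0" using fld_max[OF is_vop_fld[OF Y]] by blast
 define K where "K = nat (max (K0 + 1 - n) (K1 - n))"
 have K: "Y b (n - 1 + int j) w = 0" "Y b (n + int j) (L w) = 0" if "j \<ge> K" for j
  using that K0 K1 unfolding K_def by auto
 let ?F = "\<lambda>u. dpow L u (Y b (n - 1 + int u) w)"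
 have F0: "?F K = 0" using K[of K] by (simp add: clinear_0[OF dpow_linear[OF L]])
 have t: "sg (n + int j + 1) *s dpow L j (Y b (n + int j) (L w)) =
   (sg (n + int j + 1) * of_nat (Suc j)) *s ?F (Suc j) + (sg (n + int j + 1) * (of_int n + of_nat j)) *s ?F j" for j
 proof -
  have "Y b (n + int j) (L w) = L (Y b (n + int j) w) + (of_int n + of_nat j) *s Y b (n - 1 + int j) w"
   by (simp add: LY algebra_simps)
  then show ?thesis
   by (simp add: clinear_add[OF dpow_linear[OF L]] clinear_scale[OF dpow_linear[OF L]] scaleC_add_right scaleC_scaleC
    dpow_Suc'[OF L, symmetric] del: of_nat_Suc) (simp add: add.commute)
 qed
 have "skew L Y (L w) n b = (\<Sum>j<K. (sg (n + int j + 1) * of_nat (Suc j)) *s ?F (Suc j)) + (\<Sum>j<K. (sg (n + int j + 1) * (of_int n + of_nat j)) *s ?F j)"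
  by (subst skew_sum[of K]) (use K(2) in \<open>auto simp: t sum.distrib\<close>)
 also have "(\<Sum>j<K. (sg (n + int j + 1) * of_nat (Suc j)) *s ?F (Suc j)) = (\<Sum>j<Suc K. (sg (n + int j) * of_nat j) *s ?F j)"
  by (subst sum.lessThan_Suc_shift) (simp add: algebra_simps)
 also have "\<dots> = (\<Sum>j<K. (sg (n + int j) * of_nat j) *s ?F j)" using F0 by simp
 also have "(\<Sum>j<K. (sg (n + int j) * of_nat j) *s ?F j) + (\<Sum>j<K. (sg (n + int j + 1) * (of_int n + of_nat j)) *s ?F j) =
   (\<Sum>j<K. - of_int n *s (sg (n - 1 + int j + 1) *s ?F j))"
  unfolding sum.distrib[symmetric] scaleC_add_left[symmetric] scaleC_scaleC by (simp add: sg_Suc algebra_simps)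
 also have "\<dots> = - of_int n *s skew L Y w (n - 1) b"
  unfolding scaleC_sum_right[symmetric] by (subst skew_sum[of K]) (use K(1) in auto)
 finally show ?thesis .
qed

text \<open>\<open>a_m\<close> passes e^(zL) by \<open>commutator_dpow\<close>, and the field of a_m
  b is expanded as a product of fields. The terms \<open>?P\<close> occur in both and cancel; the
  terms \<open>?Q\<close> are \<open>skew\<close> of the vectors a_i w.\<close>

lemma skew_comm:
 assumes jY: "jac YV Y Y Y a b"
 shows "Y a m (skew L Y w N b) - skew L Y w N (YV a m b) = Sum_any (\<lambda>i::nat. bin m i *s skew L Y (Y a (int i) w) (m + N - int i) b)"
proof -
 note f = is_vop_fld[OF Y]
 note l0 = clinear_0[OF dpow_linear[OF L]] vop_0[OF Y]
 obtain K1 where K1: "\<And>j. j \<ge> K1 \<Longrightarrow> Y b (N + int j) w = 0" using is_fld_bound[OF f] by blast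
 obtain K2 where K2: "\<And>j. j \<ge> K2 \<Longrightarrow> Y a (int j) w = 0" using is_fld_bound[OF f, of a 0 w] by auto
 obtain K3 where K3: "\<forall>u\<ge>K3. \<forall>i. Y b (m + N - int i + int u) (Y a (int i) w) = 0"
  using is_fld_uniform[OF f, of K2 "\<lambda>i. Y a (int i) w" b "\<lambda>i. m + N - int i"] K2 by auto
 define K where "K = max K1 (max K2 K3)"
 have K: "Y b (N + int j) w = 0" "Y a (int j) w = 0" "Y b (m + N - int i + int j) (Y a (int i) w) = 0" if "j \<ge> K" for i j
  using that K1 K2 K3 unfolding K_def by auto
 have prd: "Y (YV a m b) (N + int u) w = (\<Sum>i<K. abin m i *s Y a (m - int i) (Y b (N + int u + int i) w))
   - sg m *s (\<Sum>i<K. abin m i *s Y b (m + N - int i + int u) (Y a (int i) w))" for u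
 proof -
  have b: "Y b (N + int u + int i) w = 0" if "i \<ge> K" for i using K(1)[of "u + i"] that by (simp add: algebra_simps)
  show ?thesis unfolding jac_prd[OF jY] prd_def brs_split[OF f f f]
   by (subst (1 2) SA_nat[of K]) (use K(2) b in \<open>auto simp: l0 algebra_simps\<close>)
 qed
 have cd: "Y a m (dpow L j w) = (\<Sum>i\<le>j. bin m i *s dpow L (j - i) (Y a (m - int i) w))" for j w
  by (rule commutator_dpow[of L "Y a", OF L is_vop_linear[OF Y] LY])
 let ?Q = "\<lambda>i u. (sg (N + int u + 1) * sg m * abin m i) *s dpow L u (Y b (m + N - int i + int u) (Y a (int i) w))"
 let ?P = "\<lambda>i u. (sg (N + int i + int u + 1) * bin m i) *s dpow L u (Y a (m - int i) (Y b (N + int i + int u) w))"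
 have 1: "Y a m (skew L Y w N b) = (\<Sum>i<K. \<Sum>u<K. ?P i u)"
 proof -
  have "Y a m (skew L Y w N b) = (\<Sum>j<K. sg (N + int j + 1) *s (\<Sum>i\<le>j. bin m i *s dpow L (j - i) (Y a (m - int i) (Y b (N + int j) w))))"
   by (subst skew_sum[of K], erule K(1)) (simp add: vop_sum[OF Y] vop_scale[OF Y] cd)
  also have "\<dots> = (\<Sum>j<K. \<Sum>i\<le>j. ?P i (j - i))"
   by (intro sum.cong refl) (auto simp: scaleC_sum_right scaleC_scaleC of_nat_diff intro!: sum.cong)
  also have "\<dots> = (\<Sum>i<K. \<Sum>u<K. ?P i u)"
   by (rule sum_triangle[symmetric]) (use K(1) in \<open>auto simp: l0 of_nat_add[symmetric] add.assoc simp del: of_nat_add\<close>)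
  finally show ?thesis .
 qed
 have 2: "skew L Y w N (YV a m b) = (\<Sum>i<K. \<Sum>u<K. ?P i u) - (\<Sum>i<K. \<Sum>u<K. ?Q i u)"
 proof -
  have z: "Y (YV a m b) (N + int u) w = 0" if "u \<ge> K" for u
  proof -
   have "Y b (N + int u + int i) w = 0" for i using K(1)[of "u + i"] that by (simp add: algebra_simps)
   then show ?thesis unfolding prd using K(3)[OF that] by (simp add: l0)
  qed
  have e: "(sg (N + int u + 1) * abin m i) *s dpow L u (Y a (m - int i) (Y b (N + int u + int i) w)) = ?P i u" for u i
  proof -
   have "sg (N + int i + int u + 1) = sg (N + int u + 1) * (-1) ^ i" by (simp add: sg_mult sg_nat)
   moreover have "N + int u + int i = N + int i + int u" by simp
   ultimately show ?thesis by (simp only: mult.assoc)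
  qed
  have t: "sg (N + int u + 1) *s dpow L u (Y (YV a m b) (N + int u) w) = (\<Sum>i<K. ?P i u) -
    (\<Sum>i<K. ?Q i u)" for u
   unfolding prd clinear_diff[OF dpow_linear[OF L]] clinear_scale[OF dpow_linear[OF L]] clinear_sum[OF dpow_linear[OF L]] scaleC_diff_right
    scaleC_sum_right scaleC_scaleC e mult.assoc ..
  have "skew L Y w N (YV a m b) = (\<Sum>u<K. \<Sum>i<K. ?P i u) - (\<Sum>u<K. \<Sum>i<K. ?Q i u)"
   by (subst skew_sum[of K], erule z) (simp only: t sum_subtractf)
  then show ?thesis by (simp only:) (intro arg_cong2[where f=minus] sum.swap)
 qed
 have 3: "Sum_any (\<lambda>i::nat. bin m i *s skew L Y (Y a (int i) w) (m + N - int i) b) =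
  (\<Sum>i<K. \<Sum>u<K. ?Q i u)"
 proof -
  have "bin m i *s skew L Y (Y a (int i) w) (m + N - int i) b =
   (\<Sum>u<K. ?Q i u)" for i
   by (subst skew_sum[of K], erule K(3))
    (simp add: scaleC_sum_right scaleC_scaleC sg_mult sg_nat sg_diff algebra_simps)
  moreover have "(\<Sum>u<K. ?Q i u) = 0" if "i \<ge> K" for i
   using K(2)[OF that] by (simp add: l0)
  ultimately show ?thesis by (subst SA_nat[of K]) simp_all
 qed
 show ?thesis unfolding 1 2 3 by simp
qed

lemma alternating_Vandermonde: "(\<Sum>i\<le>M. (-1) ^ i * bin p i * bin (p + q - int i) (M - i)) = bin q M"
proof -
 have "(-1) ^ i * bin p i * bin (p + q - int i) (M - i) = (-1) ^ M * (bin p i * bin (int M - 1 - p - q) (M - i))" if "i \<le> M" for i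
 proof -
  have e: "(-1::complex) ^ i * (-1) ^ (M - i) = (-1) ^ M" using that by (simp add: power_add[symmetric])
  show ?thesis unfolding bin_negate[of "p + q - int i"] using that by (simp add: e[symmetric] of_nat_diff algebra_simps)
 qed
 then have "(\<Sum>i\<le>M. (-1) ^ i * bin p i * bin (p + q - int i) (M - i)) = (-1) ^ M * bin (p + (int M - 1 - p - q)) M"
  unfolding bin_Vandermonde[symmetric] sum_distrib_left by (intro sum.cong) auto
 then show ?thesis by (simp add: bin_negate[of q] algebra_simps)
qed

text \<open>Exchanging the two arguments exchanges \<open>p\<close> and \<open>q\<close>. Under
  \<open>I\<close> the exponential of \<open>L\<close> is a shift of the variable
  (\<open>vop_dpow\<close>), and the alternating Vandermonde sum converts the expansion in one
  variable into that in the other.\<close>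

lemma skew_bls:
 assumes I: "is_vop I" and Ider: "\<And>w n x. I (L w) n x = - of_int n *s I w (n - 1) x"
 shows "bls (\<lambda>l. I (skew L Y w l b)) p l q x = - sg l *s bls (\<lambda>l. I (Y b l w)) q l p x"
proof -
 obtain K where K: "\<And>j. j \<ge> K \<Longrightarrow> Y b (l + int j) w = 0" using is_fld_bound[OF is_vop_fld[OF Y]] by blast
 have K': "Y b (l + int i + int j) w = 0" if "i + j \<ge> K" for i j using K[OF that] by (simp add: algebra_simps)
 have s: "I (skew L Y w (l + int i) b) m x = (\<Sum>j<K. (sg (l + int i + 1) * bin m j) *s I (Y b (l + int i + int j) w) (m - int j) x)" for i m
 proof -
  have "I (skew L Y w (l + int i) b) m x = (\<Sum>j<K. (sg (l + int i + int j + 1) * abin m j) *s I (Y b (l + int i + int j) w) (m - int j) x)"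
   by (subst skew_sum[of K], rule K', simp)
    (simp add: vop1_sum[OF I] vop1_scale[OF I] vop_dpow[OF L I Ider] scaleC_scaleC)
  moreover have "sg (l + int i + int j + 1) * abin m j = sg (l + int i + 1) * bin m j" for j
  proof -
   have "sg (l + int i + int j + 1) = sg (l + int i + 1) * (-1) ^ j" by (simp add: sg_mult sg_nat)
   then show ?thesis by (simp add: power_add[symmetric] mult_2[symmetric])
  qed
  ultimately show ?thesis by simp
 qed
 have z: "I (skew L Y w (l + int i) b) m x = 0" if "i \<ge> K" for i m unfolding s using that by (simp add: K' is_vop_0[OF I])
 have "bls (\<lambda>l. I (skew L Y w l b)) p l q x = (\<Sum>i<K. \<Sum>j<K. (sg (l + int i + 1) * bin p i * bin (p + q - int i) j) *s I (Y b (l + int i + int j) w) (p + q - int i - int j) x)"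
  unfolding bls_def by (subst SA_nat[of K], simp only: z scaleC_0)
   (simp only: s scaleC_sum_right scaleC_scaleC mult.assoc mult.left_commute[of "bin p _" "sg _"])
 also have "\<dots> = (\<Sum>M<K. \<Sum>i\<le>M. (sg (l + int i + 1) * bin p i * bin (p + q - int i) (M - i)) *s I (Y b (l + int i + int (M - i)) w) (p + q - int i - int (M - i)) x)"
  by (rule sum_triangle) (simp add: K' is_vop_0[OF I])
 also have "\<dots> = (\<Sum>M<K. (- sg l * bin q M) *s I (Y b (l + int M) w) (p + q - int M) x)"
 proof (rule sum.cong[OF refl])
  fix M
  have "(\<Sum>i\<le>M. (sg (l + int i + 1) * bin p i * bin (p + q - int i) (M - i)) *s I (Y b (l + int i + int (M - i)) w) (p + q - int i - int (M - i)) x)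
   = (\<Sum>i\<le>M. (- sg l * ((-1) ^ i * bin p i * bin (p + q - int i) (M - i))) *s I (Y b (l + int M) w) (p + q - int M) x)"
   by (intro sum.cong refl) (auto simp: of_nat_diff sg_Suc sg_mult sg_nat algebra_simps)
  then show "(\<Sum>i\<le>M. (sg (l + int i + 1) * bin p i * bin (p + q - int i) (M - i)) *s I (Y b (l + int i + int (M - i)) w) (p + q - int i - int (M - i)) x)
   = (- sg l * bin q M) *s I (Y b (l + int M) w) (p + q - int M) x"
   unfolding scaleC_sum_left[symmetric] sum_distrib_left[symmetric] alternating_Vandermonde .
 qed
 also have "\<dots> = - sg l *s bls (\<lambda>l. I (Y b l w)) q l p x"
  unfolding bls_def by (subst SA_nat[of K]) (simp_all add: K is_vop_0[OF I] scaleC_sum_right scaleC_scaleC add.commute[of p])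
 finally show ?thesis .
qed

text \<open>The commutator formula for w_N and a_l. It is \<open>skew_bls\<close> for the operator
  \<open>skew\<close> itself, with the middle index 0, combined with \<open>skew_comm\<close>. At
  \<open>N = 0\<close> it says that w_0 is a derivation.\<close>

lemma skew_skew_comm:
 assumes "jac YV Y Y Y a b" "\<And>b. jac YV Y Y Y a b"
 shows "skew L Y w N (YV a l b) = Y a l (skew L Y w N b) + Sum_any (\<lambda>j::nat. bin N j *s skew L Y (skew L Y w (int j) a) (N + l - int j) b)"
proof -
 have "bls (\<lambda>l. skew L Y (skew L Y w l a)) N 0 l b = - sg 0 *s bls (\<lambda>l. skew L Y (Y a l w)) l 0 N b"
  by (rule skew_bls[OF skew_is_vop skew_der])
 also have "\<dots> = - (Y a l (skew L Y w N b) - skew L Y w N (YV a l b))"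
  unfolding skew_comm[OF assms(2)] bls_def by simp
 finally show ?thesis unfolding bls_def add_0 minus_diff_eq by simp
qed

end

section \<open>The logarithmic correction and the deformed action\<close>

definition log_coeff :: "nat \<Rightarrow> complex" where "log_coeff N = (-1) ^ N / (- of_nat N)"

text \<open>A default value: division by zero gives 0, so sums may start at index 0 although the
  exponent of Delta starts at 1.\<close>

lemma log_coeff_0: "log_coeff 0 = 0" by (simp add: log_coeff_def)

text \<open>\<^term>\<open>log_coeff N\<close> is the derivative at 0 of \<open>t \<mapsto> t choose N\<close>.\<close>

lemma log_coeff_bin:
 assumes "j > 0"
 shows "log_coeff (j + u) * bin (int (j + u)) j = log_coeff j * bin (- int j) u"
proof -
 have "j * ((j + u) choose j) = (j + u) * ((j + u - 1) choose (j - 1))" using assms by (rule times_binomial_minus1_eq)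
 also have "((j + u - 1) choose (j - 1)) = ((j + u - 1) choose u)"
  using assms binomial_symmetric[of "j - 1" "j + u - 1"] by simp
 finally have "(of_nat j * of_nat ((j + u) choose j) :: complex) = of_nat (j + u) * of_nat ((j + u - 1) choose u)"
  by (simp only: of_nat_mult[symmetric])
 moreover have "bin (- int j) u = (-1) ^ u * of_nat ((j + u - 1) choose u)"
 proof -
  have "int u - - int j - 1 = int (j + u - 1)" using assms by (simp add: of_nat_diff)
  then show ?thesis unfolding bin_negate[of "- int j"] bin_nat[symmetric] by (simp only:)
 qed
 ultimately show ?thesis
  using assms unfolding bin_nat by (simp add: log_coeff_def power_add field_simps del: of_nat_add)
qed

lemma brs_sum:
 assumes A': "is_fld A'" and A: "is_fld A" and B: "\<And>N. is_fld (B N)"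
 shows "brs A' A (\<lambda>n x. \<Sum>N<K. c N *s B N (n - int N) x) p l q x = (\<Sum>N<K. c N *s brs A' A (B N) p l (q - int N) x)"
proof -
 let ?t = "\<lambda>N i. abin l i *s (A' (p + l - int i) (B N (q - int N + int i) x) - sg l *s B N (l + (q - int N) - int i) (A (p + int i) x))"
 have f: "fs (?t N)" for N
  by (intro fs_scale fs_diff fld_fs_lin A B is_fld_linear A')
 have "brs A' A (\<lambda>n x. \<Sum>N<K. c N *s B N (n - int N) x) p l q x = Sum_any (\<lambda>i. \<Sum>N<K. c N *s ?t N i)"
  unfolding brs_def
  by (rule Sum_any.cong) (simp add: fld_sum[OF A'] fld_scale[OF A'] scaleC_sum_right
   scaleC_scaleC sum_subtractf scaleC_diff_right algebra_simps)
 also have "\<dots> = (\<Sum>N<K. c N *s brs A' A (B N) p l (q - int N) x)"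
  by (subst SA_finite_sum_swap, simp, rule fs_scale, rule f) (simp only: SA_scale brs_def)
 finally show ?thesis .
qed

lemma clinear_fst: "clinear fst" and clinear_snd: "clinear snd"
 by (auto intro!: clinearI simp: scaleC_prod_def)

lemma SA_prod: "fs f \<Longrightarrow> Sum_any f = (Sum_any (\<lambda>i. fst (f i)), Sum_any (\<lambda>i. snd (f i)))"
 for f :: "'i \<Rightarrow> 'x::complex_vector \<times> 'y::complex_vector"
 by (simp add: prod_eq_iff clinear_Sum_any[OF clinear_fst] clinear_Sum_any[OF clinear_snd])

lemma clinear_Pair: "clinear f \<Longrightarrow> clinear g \<Longrightarrow> clinear (\<lambda>x. (f x, g x))"
 by (simp add: clinear_iff scaleC_prod_def)

text \<open>The modes of \<open>I\<close> applied to the part of Delta(s,z) a beyond a; the power of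
  z attached to s_N a moves the mode index by \<open>N\<close>.\<close>

definition skew_log :: "('w::complex_vector \<Rightarrow> 'w) \<Rightarrow> ('v::complex_vector, int, 'w, 'w) vop \<Rightarrow> ('w, int, 'x, 'y::complex_vector) vop \<Rightarrow> 'w \<Rightarrow> ('v, int, 'x, 'y) vop" where
 "skew_log L Y I s a n x = Sum_any (\<lambda>N::nat. log_coeff N *s I (skew L Y s (int N) a) (n - int N) x)"

text \<open>The action is triangular: the correction leads from the quotient (first component) to
  the submodule (second component).\<close>

definition deform :: "('w::complex_vector \<Rightarrow> 'w) \<Rightarrow> ('v::complex_vector, int, 'w, 'w) vop \<Rightarrow> ('v, int, 'x, 'x) vop \<Rightarrow> ('v, int, 'y, 'y) vop \<Rightarrow>
 ('w, int, 'x, 'y::complex_vector) vop \<Rightarrow> 'w \<Rightarrow> ('v, int, 'x \<times> 'y, 'x \<times> 'y) vop" where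
 "deform L Y Y2 Y3 I s a n v = (Y2 a n (fst v), Y3 a n (snd v) + skew_log L Y I s a n (fst v))"

context
 fixes L :: "'w::complex_vector \<Rightarrow> 'w" and YV :: "('v::complex_vector, int, 'v, 'v) vop" and Y :: "('v, int, 'w, 'w) vop"
  and Y2 :: "('v, int, 'x::complex_vector, 'x) vop" and Y3 :: "('v, int, 'y::complex_vector, 'y) vop" and I :: "('w, int, 'x, 'y) vop" and s :: 'w
 assumes L: "clinear L" and YV: "is_vop YV" and Y: "is_vop Y" and Y2: "is_vop Y2" and Y3: "is_vop Y3" and I: "is_vop I"
  and LY: "\<And>a n w. L (Y a n w) = Y a n (L w) - of_int n *s Y a (n - 1) w"
  and Ider: "\<And>w n x. I (L w) n x = - of_int n *s I w (n - 1) x"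
  and jY: "\<And>a b. jac YV Y Y Y a b" and jI: "\<And>a w. jac Y Y2 Y3 I a w"
begin

abbreviation (input) "sk N a \<equiv> skew L Y s (int N) a"
abbreviation (input) "KK \<equiv> skew_log L Y I s"

lemma sk_vop: "is_vop (skew L Y)" by (rule skew_is_vop[OF L YV Y LY])

lemma sk_bound: "\<exists>K::nat. \<forall>N\<ge>K. sk N a = 0"
 using is_fld_bound[OF is_vop_fld[OF sk_vop], where q = 0 and x = a] by simp

lemma KK_sum: "\<forall>N\<ge>B. sk N a = 0 \<Longrightarrow> KK a n x = (\<Sum>N<B. log_coeff N *s I (sk N a) (n - int N) x)"
 unfolding skew_log_def by (rule SA_nat) (simp add: is_vop_0[OF I])

lemma KK_fs: "fs (\<lambda>N::nat. log_coeff N *s I (sk N a) (n - int N) x)"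
proof -
 obtain K where "\<forall>N\<ge>K. sk N a = 0" using sk_bound by blast
 then show ?thesis by (intro fs_nat[of K]) (simp add: is_vop_0[OF I])
qed

lemma KK_vop: "is_vop KK"
 unfolding is_vop_def is_fld_def
proof (intro conjI allI)
 note l = vop1_add[OF I] vop1_scale[OF I] vop_add[OF I] vop_scale[OF I]
  vop_add[OF sk_vop] vop_scale[OF sk_vop]
 fix a n x
 show "clinear (KK a n)"
  by (rule clinearI) (simp_all add: skew_log_def l scaleC_add_right SA_add[OF KK_fs KK_fs] SA_scale[symmetric] scaleC_scaleC mult.commute)
 show "clinear (\<lambda>a. KK a n x)"
  by (rule clinearI) (simp_all add: skew_log_def l scaleC_add_right SA_add[OF KK_fs KK_fs] SA_scale[symmetric] scaleC_scaleC mult.commute)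
 obtain B where B: "\<forall>N\<ge>B. sk N a = 0" using sk_bound by blast
 obtain K where K: "\<forall>j. \<forall>u\<ge>K. I (sk j a) (- int j + int u) x = 0"
  using is_fld_uniform_fam[of "\<lambda>j. I (sk j a)" B "\<lambda>j. - int j" x, OF is_vop_fld[OF I]] B is_vop_0[OF I] by auto
 have "KK a n x = 0" if "n \<ge> int K" for n
  unfolding KK_sum[OF B]
 proof (rule sum.neutral, rule ballI)
  fix N show "log_coeff N *s I (sk N a) (n - int N) x = 0"
   using K[rule_format, of "nat n" N] that by simp
 qed
 then show "\<exists>N. \<forall>n\<ge>N. KK a n x = 0" by blast
qed

lemma deform_vop: "is_vop (deform L Y Y2 Y3 I s)"
 unfolding is_vop_def is_fld_def
proof (intro conjI allI)
 fix a n v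
 show "clinear (deform L Y Y2 Y3 I s a n)"
  unfolding deform_def[abs_def]
  by (intro clinear_Pair clinear_plus clinear_compose[OF is_vop_linear[OF Y2]] clinear_compose[OF is_vop_linear[OF Y3]]
    clinear_compose[OF is_vop_linear[OF KK_vop]] clinear_fst clinear_snd)
 show "clinear (\<lambda>a. deform L Y Y2 Y3 I s a n v)"
  unfolding deform_def by (intro clinear_Pair clinear_plus is_vop_linear1 Y2 Y3 KK_vop)
 obtain K1 K2 K3 where "\<forall>n\<ge>K1. Y2 a n (fst v) = 0" "\<forall>n\<ge>K2. Y3 a n (snd v) = 0" "\<forall>n\<ge>K3. KK a n (fst v) = 0"
  using fld_max[OF is_vop_fld[OF Y2]] fld_max[OF is_vop_fld[OF Y3]] fld_max[OF is_vop_fld[OF KK_vop]] by meson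
 then have "\<forall>n\<ge>max K1 (max K2 K3). deform L Y Y2 Y3 I s a n v = 0" by (simp add: deform_def zero_prod_def)
 then show "\<exists>N. \<forall>n\<ge>N. deform L Y Y2 Y3 I s a n v = 0" by blast
qed

text \<open>Fix \<open>j\<close> in the terms \<open>(s\<^sub>j a)\<^sub>n b\<close> of \<open>s\<^sub>N (a\<^sub>l b)\<close>; then \<open>log_coeff_bin\<close> and Vandermonde turn their sum into the skew Jacobi identity for \<open>s\<^sub>j a\<close>.\<close>

lemma KK_derivation:
 assumes s0: "skew L Y s 0 a = 0"
 shows "bls (\<lambda>l. KK (YV a l b)) p l q x = brs (Y3 a) (Y2 a) (KK b) p l q x - sg l *s brs (Y3 b) (Y2 b) (KK a) q l p x"
proof -
 note z = is_vop_0[OF I] is_vop_0[OF Y] is_vop_0[OF sk_vop] is_vop_0[OF KK_vop]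
 note z1 = vop1_0[OF I] vop_0[OF sk_vop] vop_0[OF Y]
 have iii: "sk N (YV a m b) = Y a m (sk N b) + Sum_any (\<lambda>j::nat. bin (int N) j *s skew L Y (sk j a) (int N + m - int j) b)" for N m
  by (rule skew_skew_comm[OF L YV Y LY jY jY])
 obtain B1 where B1: "\<forall>i\<ge>B1. YV a (l + int i) b = 0" using is_fld_bound[OF is_vop_fld[OF YV]] by blast
 obtain B2 where B2: "\<forall>N\<ge>B2. \<forall>i. sk N (YV a (l + int i) b) = 0"
  using is_fld_uniform[OF is_vop_fld[OF sk_vop], of B1 "\<lambda>i. YV a (l + int i) b" s "\<lambda>i. 0"] B1 by auto
 obtain B3 B4 where B3: "\<forall>N\<ge>B3. sk N a = 0" and B4: "\<forall>N\<ge>B4. sk N b = 0" using sk_bound by meson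
 obtain B5 where B5: "\<forall>i\<ge>B5. \<forall>N. Y a (l + int i) (sk N b) = 0"
  using is_fld_uniform[OF is_vop_fld[OF Y], of B4 "\<lambda>N. sk N b" a "\<lambda>N. l"] B4 by auto
 obtain B6 where B6: "\<forall>j. \<forall>u\<ge>B6. skew L Y (sk j a) (l + int u) b = 0"
  using is_fld_uniform_fam[of "\<lambda>j. skew L Y (sk j a)" B3 "\<lambda>j. l" b, OF is_vop_fld[OF sk_vop]] B3 z by auto
 define B where "B = max B1 B2 + max B3 B4 + max B5 B6"
 define G where "G j M = I (skew L Y (sk j a) (l + int M) b) (p + q - int j - int M) x" for j M
 have b1: "YV a (l + int i) b = 0" if "i \<ge> B" for i using B1 that unfolding B_def by simp
 have b2: "\<forall>N\<ge>B. sk N (YV a (l + int i) b) = 0" for i using B2 unfolding B_def by simp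
 have b3: "\<forall>N\<ge>B. sk N a = 0" using B3 unfolding B_def by simp
 have b4: "\<forall>N\<ge>B. sk N b = 0" using B4 unfolding B_def by simp
 have b5: "Y a (l + int i) (sk N b) = 0" if "i \<ge> B" for i N using B5 that unfolding B_def by simp
 \<comment> \<open>\<open>log_coeff_bin\<close> is false at \<open>j = 0\<close>. The assumption s_0
   a = 0 removes exactly this term.\<close>
 have G0: "G 0 M = 0" for M unfolding G_def using s0 by (simp add: z)
 have G1: "G j M = 0" if "j + M \<ge> B" for j M
 proof (cases "j \<ge> B3")
  case True then show ?thesis unfolding G_def using B3 by (simp add: z)
 next
  case False then have "M \<ge> B6" using that unfolding B_def by auto
  then show ?thesis unfolding G_def using B6 by (simp add: z)
 qed
 have Gb: "G j M = 0" if "j \<ge> B" for j M using that by (intro G1) simp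
 have t: "I (sk N (YV a (l + int i) b)) (p + q - int i - int N) x =
   I (Y a (l + int i) (sk N b)) (p + q - int i - int N) x + (\<Sum>j\<le>N. bin (int N) j *s G j (i + (N - j)))" for i N
 proof -
  have "Sum_any (\<lambda>j::nat. bin (int N) j *s skew L Y (sk j a) (int N + (l + int i) - int j) b) = (\<Sum>j\<le>N. bin (int N) j *s skew L Y (sk j a) (int N + (l + int i) - int j) b)"
   unfolding lessThan_Suc_atMost[symmetric] by (rule SA_nat) (simp only: bin_nat_0 Suc_le_eq cvec.scale_zero_left)
  then show ?thesis unfolding iii G_def
   by (simp add: vop1_add[OF I] vop1_sum[OF I] vop1_scale[OF I])
    (intro sum.cong refl; simp add: of_nat_diff algebra_simps)
 qed
 let ?g = "\<lambda>i N. (bin p i * log_coeff N) *s (\<Sum>j\<le>N. bin (int N) j *s G j (i + (N - j)))"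
 let ?h = "\<lambda>i N. (bin p i * log_coeff N) *s I (Y a (l + int i) (sk N b)) (p + q - int i - int N) x"
 let ?k = "\<lambda>j i u. (log_coeff j * (bin p i * bin (- int j) u)) *s G j (i + u)"
 let ?W = "\<lambda>j. bls (\<lambda>l. I (skew L Y (sk j a) l b)) (p - int j) l q x"
 have "bls (\<lambda>l. KK (YV a l b)) p l q x = (\<Sum>i<B. \<Sum>N<B. (bin p i * log_coeff N) *s I (sk N (YV a (l + int i) b)) (p + q - int i - int N) x)"
  unfolding bls_def by (subst SA_nat[of B], simp add: b1 z, simp only: KK_sum[OF b2] scaleC_sum_right scaleC_scaleC)
 also have "\<dots> = (\<Sum>i<B. \<Sum>N<B. ?h i N)
   + (\<Sum>i<B. \<Sum>N<B. ?g i N)"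
  unfolding t scaleC_add_right sum.distrib ..
 also have "(\<Sum>i<B. \<Sum>N<B. ?h i N) = brs (Y3 a) (Y2 a) (KK b) p l q x"
 proof -
  have "brs (Y3 a) (Y2 a) (KK b) p l q x = (\<Sum>N<B. log_coeff N *s brs (Y3 a) (Y2 a) (I (sk N b)) p l (q - int N) x)"
   unfolding brs_sum[OF is_vop_fld[OF Y3] is_vop_fld[OF Y2] is_vop_fld[OF I], symmetric] KK_sum[OF b4, symmetric] ..
  also have "\<dots> = (\<Sum>N<B. \<Sum>i<B. ?h i N)"
  proof (rule sum.cong[OF refl])
   fix N
   have "brs (Y3 a) (Y2 a) (I (sk N b)) p l (q - int N) x = bls (\<lambda>l. I (Y a l (sk N b))) p l (q - int N) x"
    using jI unfolding jac_def by simp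
   also have "\<dots> = (\<Sum>i<B. bin p i *s I (Y a (l + int i) (sk N b)) (p + (q - int N) - int i) x)"
    unfolding bls_def by (rule SA_nat) (simp add: b5 z)
   finally show "log_coeff N *s brs (Y3 a) (Y2 a) (I (sk N b)) p l (q - int N) x = (\<Sum>i<B. ?h i N)"
    by (simp add: scaleC_sum_right scaleC_scaleC algebra_simps)
  qed
  finally show ?thesis by (simp only:) (rule sum.swap)
 qed
 also have "(\<Sum>i<B. \<Sum>N<B. ?g i N) = - sg l *s brs (Y3 b) (Y2 b) (KK a) q l p x"
 proof -
  have "(\<Sum>N<B. ?g i N) =
   (\<Sum>j<B. \<Sum>u<B. ?k j i u)" for i
  proof -
   have "(\<Sum>j<B. \<Sum>u<B. ?k j i u) = (\<Sum>N<B. \<Sum>j\<le>N. ?k j i (N - j))"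
    by (rule sum_triangle) (simp add: G1)
   also have "\<dots> = (\<Sum>N<B. ?g i N)"
    unfolding scaleC_sum_right scaleC_scaleC
   proof (intro sum.cong refl)
    fix N j :: nat assume "j \<in> {..N}"
    then have N: "N = j + (N - j)" by simp
    show "?k j i (N - j) = (bin p i * log_coeff N * bin (int N) j) *s G j (i + (N - j))"
    proof (cases "j = 0")
     case False
     then have "log_coeff N * bin (int N) j = log_coeff j * bin (- int j) (N - j)" using log_coeff_bin[of j "N - j"] N by simp
     then show ?thesis by (simp only: mult.assoc mult.left_commute[of "bin p i"])
    qed (simp add: G0)
   qed
   finally show ?thesis ..
  qed
  then have "(\<Sum>i<B. \<Sum>N<B. ?g i N) =
   (\<Sum>j<B. \<Sum>i<B. \<Sum>u<B. ?k j i u)"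
   by (simp only:) (rule sum.swap)
  also have "\<dots> = (\<Sum>j<B. log_coeff j *s ?W j)"
  proof (rule sum.cong[OF refl])
   fix j
   have "(\<Sum>i<B. \<Sum>u<B. ?k j i u) = (\<Sum>M<B. \<Sum>i\<le>M. ?k j i (M - i))"
    by (rule sum_triangle) (simp add: G1)
   also have "\<dots> = (\<Sum>M<B. log_coeff j *s (bin (p - int j) M *s G j M))"
   proof (rule sum.cong[OF refl])
    fix M
    have "(\<Sum>i\<le>M. ?k j i (M - i)) = (\<Sum>i\<le>M. (log_coeff j * (bin p i * bin (- int j) (M - i))) *s G j M)"
     by (intro sum.cong refl) simp
    then show "(\<Sum>i\<le>M. ?k j i (M - i)) = log_coeff j *s (bin (p - int j) M *s G j M)"
     using bin_Vandermonde[of p "- int j" M] unfolding scaleC_sum_left[symmetric] sum_distrib_left[symmetric] by (simp add: scaleC_scaleC)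
   qed
   also have "\<dots> = log_coeff j *s ?W j"
    unfolding bls_def scaleC_sum_right[symmetric]
   proof (subst SA_nat[of B])
    show "bin (p - int j) i *s I (skew L Y (sk j a) (l + int i) b) (p - int j + q - int i) x = 0" if "B \<le> i" for i
    proof -
     have "p - int j + q - int i = p + q - int j - int i" by simp
     then show ?thesis using G1[of j i] that unfolding G_def by (simp only: trans_le_add2 scaleC_0)
    qed
   qed (simp add: G_def algebra_simps)
   finally show "(\<Sum>i<B. \<Sum>u<B. ?k j i u) = log_coeff j *s ?W j" .
  qed
  also have "\<dots> = - sg l *s (\<Sum>j<B. log_coeff j *s brs (Y3 b) (Y2 b) (I (sk j a)) q l (p - int j) x)"
  proof -
   have "?W j = - sg l *s brs (Y3 b) (Y2 b) (I (sk j a)) q l (p - int j) x" for j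
    unfolding skew_bls[OF L YV Y LY I Ider] using jI unfolding jac_def by simp
   then show ?thesis by (simp add: scaleC_sum_right scaleC_scaleC mult.commute)
  qed
  also have "(\<Sum>j<B. log_coeff j *s brs (Y3 b) (Y2 b) (I (sk j a)) q l (p - int j) x) = brs (Y3 b) (Y2 b) (KK a) q l p x"
   unfolding brs_sum[OF is_vop_fld[OF Y3] is_vop_fld[OF Y2] is_vop_fld[OF I], symmetric] KK_sum[OF b3, symmetric] ..
  finally show ?thesis .
 qed
 finally show ?thesis by simp
qed

text \<open>The diagonal entries are the Jacobi identities of the two modules. In the off-diagonal
  entry the correction occurs once in each term, once for \<open>a\<close> and once for
  \<open>b\<close>, and what is needed there is \<open>KK_derivation\<close>.\<close>

theorem deform_jac:
 assumes s0: "skew L Y s 0 a = 0" and j2: "jac YV Y2 Y2 Y2 a b" and j3: "jac YV Y3 Y3 Y3 a b"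
 shows "jac YV (deform L Y Y2 Y3 I s) (deform L Y Y2 Y3 I s) (deform L Y Y2 Y3 I s) a b"
 unfolding jac_def
proof (intro allI)
 let ?D = "deform L Y Y2 Y3 I s"
 fix p l q and v :: "'x \<times> 'y"
 obtain x y where v: "v = (x, y)" by (cases v)
 note f = is_vop_fld[OF Y2] is_vop_fld[OF Y3] is_vop_fld[OF KK_vop] is_vop_fld[OF deform_vop]
 obtain B where B: "\<forall>i\<ge>B. YV a (l + int i) b = 0" using is_fld_bound[OF is_vop_fld[OF YV]] by blast
 have sp: "bls F p l q u = (\<Sum>i<B. bin p i *s F (l + int i) (p + q - int i) u)" if "\<And>l. YV a l b = 0 \<Longrightarrow> F l = (\<lambda>_ _. 0)" for F :: "int \<Rightarrow> ('e, 'f::complex_vector) fld" and u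
  unfolding bls_def by (rule SA_nat) (use B that in auto)
 have 1: "bls (\<lambda>l. ?D (YV a l b)) p l q v = (bls (\<lambda>l. Y2 (YV a l b)) p l q x, bls (\<lambda>l. Y3 (YV a l b)) p l q y + bls (\<lambda>l. KK (YV a l b)) p l q x)"
  by (simp add: sp is_vop_0[OF deform_vop] is_vop_0[OF Y2] is_vop_0[OF Y3] is_vop_0[OF KK_vop])
   (simp add: v deform_def prod_eq_iff clinear_sum[OF clinear_fst] clinear_sum[OF clinear_snd] scaleC_prod_def sum.distrib scaleC_add_right)
 have fsA: "fs (\<lambda>i::nat. abin l i *s A (p + l - int i) (C (q + int i) u))" if "is_fld A" "is_fld C" for A :: "('g::complex_vector, 'h::complex_vector) fld" and C :: "('e::complex_vector, 'g) fld" and u q p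
  by (intro fs_scale fld_fs_lin that is_fld_linear)
 have 2: "brs (?D a) (?D a) (?D b) p l q v = (brs (Y2 a) (Y2 a) (Y2 b) p l q x,
   brs (Y3 a) (Y3 a) (Y3 b) p l q y + (brs (Y3 a) (Y2 a) (KK b) p l q x - sg l *s brs (Y3 b) (Y2 b) (KK a) q l p x))"
 proof -
  let ?u = "\<lambda>i::nat. Y3 b (l + q - int i) (KK a (p + int i) x) + KK b (l + q - int i) (Y2 a (p + int i) x)"
  have D: "brs (?D a) (?D a) (?D b) p l q v = Sum_any (\<lambda>i::nat. abin l i *s ?D a (p + l - int i) (?D b (q + int i) v))
   - sg l *s Sum_any (\<lambda>i::nat. abin l i *s ?D b (q + l - int i) (?D a (p + int i) v))"
   unfolding brs_split[OF f(4) f(4) f(4)] by (simp add: add.commute)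
  have S: "Sum_any (\<lambda>i::nat. abin l i *s ?D a (p + l - int i) (?D b (q + int i) v)) =
    (Sum_any (\<lambda>i::nat. abin l i *s Y2 a (p + l - int i) (Y2 b (q + int i) x)),
    Sum_any (\<lambda>i::nat. abin l i *s Y3 a (p + l - int i) (Y3 b (q + int i) y))
    + Sum_any (\<lambda>i::nat. abin l i *s Y3 a (p + l - int i) (KK b (q + int i) x))
    + Sum_any (\<lambda>i::nat. abin l i *s KK a (p + l - int i) (Y2 b (q + int i) x)))" for a b p q
   unfolding SA_prod[OF fsA[OF f(4) f(4)]]
   by (simp add: v deform_def scaleC_prod_def vop_add[OF Y3] scaleC_add_right add.assoc)
    (subst SA_add, rule fsA[OF f(2) f(2)], rule fs_add[OF fsA[OF f(2) f(3)] fsA[OF f(3) f(1)]], subst SA_add, rule fsA[OF f(2) f(3)], rule fsA[OF f(3) f(1)], rule refl)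
  show ?thesis
   unfolding D S brs_split[OF f(1) f(1) f(1)] brs_split[OF f(2) f(2) f(2)] brs_split[OF f(2) f(1) f(3)]
   by (simp add: prod_eq_iff scaleC_prod_def scaleC_add_right scaleC_diff_right scaleC_scaleC sg_sq scaleC_one add.commute[of l])
 qed
 show "bls (\<lambda>l. ?D (YV a l b)) p l q v = brs (?D a) (?D a) (?D b) p l q v"
  unfolding 1 2 KK_derivation[OF s0] using j2 j3 unfolding jac_def by simp
qed

end

section \<open>Generalized eigenspaces\<close>

definition tc :: "('v::complex_vector \<Rightarrow> 'v) \<Rightarrow> complex \<Rightarrow> 'v \<Rightarrow> 'v" where "tc T c x = T x - c *s x"

lemma gen_eigenspace_tc: "gen_eigenspace T c = {v. \<exists>n. (tc T c ^^ n) v = 0}"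
 by (simp add: gen_eigenspace_def tc_def[abs_def])

context
 fixes T :: "'v::complex_vector \<Rightarrow> 'v" assumes T: "clinear T"
begin

lemma TC_linear: "clinear (tc T c)" unfolding tc_def[abs_def] by (intro clinear_minusI T clinear_scaleI clinear_id)

lemma TC_funpow_linear: "clinear (tc T c ^^ n)"
 by (induction n) (auto simp: comp_def id_def clinear_id intro: clinear_compose[OF TC_linear])

lemma TC_commute: "tc T c (tc T a x) = tc T a (tc T c x)"
 by (simp add: tc_def clinear_diff[OF T] clinear_scale[OF T] scaleC_diff_right scaleC_scaleC mult.commute)

lemma TC_commute_funpow: "(tc T c ^^ m) ((tc T a ^^ n) x) = (tc T a ^^ n) ((tc T c ^^ m) x)"
proof -
 have 1: "tc T c ((tc T a ^^ n) x) = (tc T a ^^ n) (tc T c x)" for x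
  by (induction n arbitrary: x) (simp_all add: TC_commute)
 show ?thesis by (induction m arbitrary: x) (simp_all add: 1)
qed

text \<open>The induction reduces to \<open>T x = a *s x\<close>. On such a vector
  \<open>T - c\<close> is the nonzero scalar \<open>a - c\<close>, which cannot be
  nilpotent.\<close>

lemma gen_eigenspace_inj:
 assumes x: "x \<in> gen_eigenspace T c" and "a \<noteq> c" and 0: "(tc T a ^^ n) x = 0"
 shows "x = 0"
 using x 0
proof (induction n arbitrary: x)
 case (Suc n)
 obtain m where m: "(tc T c ^^ m) x = 0" using Suc.prems(1) unfolding gen_eigenspace_tc by blast
 have "(tc T c ^^ m) (tc T a x) = tc T a ((tc T c ^^ m) x)" using TC_commute_funpow[where c=c and m=m and a=a and n=1 and x=x] by simp
 then have "tc T a x \<in> gen_eigenspace T c" unfolding gen_eigenspace_tc using m by (auto simp: clinear_0[OF TC_linear])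
 then have "tc T a x = 0" using Suc.IH Suc.prems(2) by (simp add: funpow_Suc_right del: funpow.simps)
 then have c: "tc T c x = (a - c) *s x" by (simp add: tc_def scaleC_diff_left)
 have "(tc T c ^^ m) x = (a - c) ^ m *s x" for m
  by (induction m) (simp_all add: scaleC_one clinear_scale[OF TC_linear] c scaleC_scaleC mult.commute)
 then show ?case using m assms(2) by simp
qed simp

lemma gen_eigenspace_independent:
 assumes "finite F" "\<And>c. c \<in> F \<Longrightarrow> x c \<in> gen_eigenspace T c" "(\<Sum>c\<in>F. x c) = 0" "c \<in> F"
 shows "x c = 0"
 using assms
proof (induction F arbitrary: x c)
 case (insert a F)
 obtain n where n: "(tc T a ^^ n) (x a) = 0" using insert.prems(1)[of a] unfolding gen_eigenspace_tc by blast
 have "(\<Sum>c\<in>F. (tc T a ^^ n) (x c)) = (tc T a ^^ n) (\<Sum>c\<in>insert a F. x c)"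
  using insert.hyps by (simp add: clinear_add[OF TC_funpow_linear] clinear_sum[OF TC_funpow_linear] n)
 also have "\<dots> = 0" by (simp add: insert.prems clinear_0[OF TC_funpow_linear])
 finally have s: "(\<Sum>c\<in>F. (tc T a ^^ n) (x c)) = 0" .
 have z: "x c = 0" if c: "c \<in> F" for c
 proof -
  have g: "(tc T a ^^ n) (x c) \<in> gen_eigenspace T c" if c: "c \<in> F" for c
  proof -
   obtain m where "(tc T c ^^ m) (x c) = 0" using insert.prems(1)[of c] c unfolding gen_eigenspace_tc by blast
   then have "(tc T c ^^ m) ((tc T a ^^ n) (x c)) = 0" by (subst TC_commute_funpow) (simp add: clinear_0[OF TC_funpow_linear])
   then show ?thesis unfolding gen_eigenspace_tc by blast
  qed
  have "(tc T a ^^ n) (x c) = 0" by (rule insert.IH[OF g s c])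
  moreover have "a \<noteq> c" using c insert.hyps by auto
  ultimately show ?thesis using gen_eigenspace_inj insert.prems(1)[of c] c by blast
 qed
 then show ?case using insert by (cases "c = a") auto
qed simp

lemma eigen_decomp:
 assumes "y \<in> cvec.span {v. \<exists>c\<in>\<Lambda>. T v = c *s v}"
 shows "\<exists>f. keys f \<subseteq> \<Lambda> \<and> (\<forall>c. T (lookup f c) = c *s lookup f c) \<and>
   y = (\<Sum>c\<in>keys f. lookup f c)"
 using assms
proof (induction rule: cvec.span_induct_alt)
 case base
 show ?case by (intro exI[of _ 0]) (simp add: clinear_0[OF T])
next
 case (step b v w)
 then obtain c f where c: "c \<in> \<Lambda>" "T v = c *s v" and f: "keys f \<subseteq> \<Lambda>"
  "\<forall>c. T (lookup f c) = c *s lookup f c" "w = (\<Sum>c\<in>keys f. lookup f c)" by blast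
 let ?g = "single c (b *s v) + f"
 have k: "keys ?g \<subseteq> insert c (keys f)" using keys_add[of "single c (b *s v)" f] by (auto split: if_splits)
 have "(\<Sum>c\<in>keys ?g. lookup ?g c) = (\<Sum>d\<in>insert c (keys f). lookup ?g d)"
  by (rule sum.mono_neutral_left) (use k in \<open>auto simp: in_keys_iff\<close>)
 also have "\<dots> = (\<Sum>d\<in>insert c (keys f). lookup (single c (b *s v)) d) + (\<Sum>d\<in>insert c (keys f). lookup f d)"
  by (simp only: lookup_add sum.distrib)
 also have "(\<Sum>d\<in>insert c (keys f). lookup (single c (b *s v)) d) = b *s v"
  by (simp add: lookup_single when_def sum.delta)
 also have "(\<Sum>d\<in>insert c (keys f). lookup f d) = w"
  unfolding f(3) by (rule sum.mono_neutral_right) (auto simp: in_keys_iff)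
 finally have "b *s v + w = (\<Sum>c\<in>keys ?g. lookup ?g c)" by simp
 moreover have "T (lookup ?g d) = d *s lookup ?g d" for d
  using f(2) c by (simp add: lookup_add lookup_single when_def clinear_add[OF T] clinear_scale[OF T] clinear_0[OF T] scaleC_add_right scaleC_scaleC mult.commute)
 ultimately show ?case using k c f(1) by blast
qed

lemma eigenvector_gen_eigenspace: "T x = c *s x \<Longrightarrow> x \<in> gen_eigenspace T c"
 unfolding gen_eigenspace_tc by (auto simp: tc_def intro!: exI[of _ 1])

lemma eigenvector_not_in_span:
 assumes "y \<in> cvec.span {v. \<exists>c\<in>\<Lambda>. T v = c *s v}" "T y = \<mu> *s y" "\<mu> \<notin> \<Lambda>"
 shows "y = 0"
proof -
 obtain f where f: "keys f \<subseteq> \<Lambda>" "\<forall>c. T (lookup f c) = c *s lookup f c"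
  "y = (\<Sum>c\<in>keys f. lookup f c)" using eigen_decomp[OF assms(1)] by blast
 \<comment> \<open>Placing \<open>- y\<close> at the new eigenvalue turns the decomposition of
   \<open>y\<close> into a vanishing sum over distinct eigenvalues.\<close>
 let ?x = "\<lambda>c. if c = \<mu> then - y else lookup f c"
 have m: "\<mu> \<notin> keys f" using f(1) assms(3) by auto
 then have e: "(\<Sum>c\<in>keys f. ?x c) = y" unfolding f(3) by (intro sum.cong) auto
 have "?x \<mu> = 0"
 proof (rule gen_eigenspace_independent[where x = ?x and F = "insert \<mu> (keys f)"])
  show "(\<Sum>c\<in>insert \<mu> (keys f). ?x c) = 0" using m e by simp
  show "?x c \<in> gen_eigenspace T c" for c
   using f(2) assms(2) by (auto intro!: eigenvector_gen_eigenspace simp: clinear_minus[OF T])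
 qed auto
 then show ?thesis by simp
qed

lemma gen_eigen_decomp_unique:
 assumes f: "gen_eigen_decomp T v f" and g: "gen_eigen_decomp T v g"
 shows "f = g"
proof (rule poly_mapping_eqI)
 fix c
 let ?K = "keys f \<union> keys g"
 let ?x = "\<lambda>c. lookup f c - lookup g c"
 have s: "v = (\<Sum>c\<in>?K. lookup h c)" if "gen_eigen_decomp T v h" "keys h \<subseteq> ?K" for h
  using that unfolding gen_eigen_decomp_def by (auto simp: in_keys_iff intro!: sum.mono_neutral_left)
 have d: "?x c \<in> gen_eigenspace T c" for c
 proof -
  obtain m n where m: "(tc T c ^^ m) (lookup f c) = 0" and n: "(tc T c ^^ n) (lookup g c) = 0"
   using f g unfolding gen_eigen_decomp_def gen_eigenspace_tc by blast
  have "(tc T c ^^ (m + n)) (?x c) = (tc T c ^^ n) ((tc T c ^^ m) (lookup f c)) - (tc T c ^^ m) ((tc T c ^^ n) (lookup g c))"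
   unfolding clinear_diff[OF TC_funpow_linear] by (intro arg_cong2[where f = minus]) (simp only: add.commute[of m n] funpow_add comp_def, simp only: funpow_add comp_def)
  then have "(tc T c ^^ (m + n)) (?x c) = 0" by (simp add: m n clinear_0[OF TC_funpow_linear])
  then show ?thesis unfolding gen_eigenspace_tc by blast
 qed
 have s0: "(\<Sum>c\<in>?K. ?x c) = 0" unfolding sum_subtractf s[OF f, symmetric, OF Un_upper1] s[OF g, symmetric, OF Un_upper2] by simp
 have "?x c = 0" if "c \<in> ?K" by (rule gen_eigenspace_independent[where F = ?K and x = ?x, OF _ d s0 that]) simp
 then show "lookup f c = lookup g c" by (cases "c \<in> ?K") (auto simp: in_keys_iff)
qed

end

text \<open>An eigenvector of \<open>D\<close> is killed by the square of \<open>T - c\<close>,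
  because \<open>N\<close> commutes with \<open>D\<close> and has square zero. So the eigenvector
  decomposition for \<open>D\<close> is the generalized one for \<open>T\<close>, which is
  unique.\<close>

lemma jordan_decomposition:
 assumes D: "clinear D" "semisimple D" and N: "clinear N" "\<And>x. N (N x) = 0" "\<And>x. D (N x) = N (D x)"
  and T: "\<And>x. T x = D x + N x"
 shows logarithmic_jordan: "logarithmic T" and semisimple_part_jordan: "semisimple_part T v = D v"
proof -
 have lT: "clinear T" unfolding T[abs_def] by (intro clinear_plus D N)
 have ex: "\<exists>f. gen_eigen_decomp T v f \<and> D v = (\<Sum>c\<in>keys f. c *s lookup f c)" for v
 proof -
  have "v \<in> cvec.span {v. \<exists>c\<in>UNIV. D v = c *s v}" using D(2) by (simp add: semisimple_def)
  then obtain f where f: "\<forall>c. D (lookup f c) = c *s lookup f c" "v = (\<Sum>c\<in>keys f. lookup f c)"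
   using eigen_decomp[OF D(1)] by blast
  have "(tc T c ^^ 2) (lookup f c) = 0" for c
   by (simp add: numeral_2_eq_2 tc_def T clinear_add[OF N(1)] clinear_diff[OF N(1)] clinear_add[OF D(1)] clinear_diff[OF D(1)] f(1) N clinear_scale[OF D(1)]
    clinear_scale[OF N(1)])
  then have "gen_eigen_decomp T v f" unfolding gen_eigen_decomp_def gen_eigenspace_tc using f(2) by blast
  moreover have "D v = (\<Sum>c\<in>keys f. c *s lookup f c)" by (subst f(2)) (simp add: clinear_sum[OF D(1)] f(1))
  ultimately show ?thesis by blast
 qed
 show l: "logarithmic T" unfolding logarithmic_def using ex gen_eigen_decomp_unique[OF lT] by blast
 obtain f where f: "gen_eigen_decomp T v f" "D v = (\<Sum>c\<in>keys f. c *s lookup f c)" using ex by blast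
 have "(THE f. gen_eigen_decomp T v f) = f" using f(1) gen_eigen_decomp_unique[OF lT] by blast
 then show "semisimple_part T v = D v" by (simp add: semisimple_part_def f(2))
qed

lemma has_nilpotent_rank_jordan:
 assumes D: "clinear D" "semisimple D" and N: "clinear N" "\<And>x. N (N x) = 0" "\<And>x. D (N x) = N (D x)"
  and T: "\<And>x. T x = D x + N x" and "N x \<noteq> 0"
 shows "has_nilpotent_rank T 2"
proof -
 have e: "(\<lambda>x. T x - semisimple_part T x) = N" using semisimple_part_jordan[of D N T, OF D N T] T by (auto simp: fun_eq_iff)
 show ?thesis unfolding has_nilpotent_rank_def e using N(2) \<open>N x \<noteq> 0\<close> by (auto simp: numeral_2_eq_2)
qed

section \<open>Highest weight Virasoro modules\<close>

text \<open>Only negative modes act. That the result is stable under all modes depends on starting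
  from a singular vector.\<close>

inductive_set lowering :: "(int \<Rightarrow> 'v::complex_vector \<Rightarrow> 'v) \<Rightarrow> 'v \<Rightarrow> 'v set" for L v where
 base: "v \<in> lowering L v"
| zero: "0 \<in> lowering L v"
| add: "x \<in> lowering L v \<Longrightarrow> y \<in> lowering L v \<Longrightarrow> x + y \<in> lowering L v"
| scale: "x \<in> lowering L v \<Longrightarrow> c *s x \<in> lowering L v"
| lower: "x \<in> lowering L v \<Longrightarrow> n < 0 \<Longrightarrow> L n x \<in> lowering L v"

context
 fixes c :: complex and L :: "int \<Rightarrow> 'v::complex_vector \<Rightarrow> 'v" and h :: complex and v0 :: 'v
 assumes irr: "irreducible_highest_weight c h L v0"
begin

lemma vir_linear: "clinear (L n)" using irr by (simp add: irreducible_highest_weight_def virasoro_rep_def)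

lemma vir_comm: "L m (L n x) = L n (L m x) + of_int (m - n) *s L (m + n) x + (if m + n = 0 then (of_int (m ^ 3 - m) / 12 * c) *s x else 0)"
 using irr unfolding irreducible_highest_weight_def virasoro_rep_def by (metis add.commute diff_add_cancel add.assoc)

lemma vir_irr: "cvec.subspace U \<Longrightarrow> (\<And>n u. u \<in> U \<Longrightarrow> L n u \<in> U) \<Longrightarrow> x \<in> U \<Longrightarrow> x \<noteq> 0 \<Longrightarrow> U = UNIV"
 using irr unfolding irreducible_highest_weight_def by blast

lemma vir_L0_shift: "L 0 x = \<mu> *s x \<Longrightarrow> L 0 (L n x) = (\<mu> - of_int n) *s L n x"
 by (simp add: vir_comm[of 0] clinear_scale[OF vir_linear] scaleC_diff_left)

text \<open>The Virasoro relations move nonnegative modes to the right until they meet the singular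
  vector, so the lowering span is a submodule; irreducibility makes it everything.\<close>

lemma lowering_UNIV:
 assumes u: "u \<noteq> 0" "L 0 u = \<mu> *s u" "\<And>n. n > 0 \<Longrightarrow> L n u = 0"
 shows "lowering L u = UNIV"
proof (rule vir_irr)
 show "cvec.subspace (lowering L u)" unfolding cvec.subspace_def by (auto intro: lowering.intros)
 have pos: "\<forall>n\<ge>0. L n x \<in> lowering L u" if "x \<in> lowering L u" for x
  using that
 proof induction
  case base
  show ?case
  proof (intro allI impI)
   fix n :: int assume "n \<ge> 0"
   then show "L n u \<in> lowering L u" using u by (cases "n = 0") (auto intro: lowering.intros)
  qed
 next
  case (lower x m)
  show ?case
  proof (intro allI impI)
   fix n :: int assume n: "n \<ge> 0"
   have "L m (L n x) \<in> lowering L u" using lower n by (auto intro: lowering.intros)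
   moreover have "L (n + m) x \<in> lowering L u" using lower by (cases "n + m \<ge> 0") (auto intro: lowering.intros)
   ultimately show "L n (L m x) \<in> lowering L u" using lower(1) unfolding vir_comm[of n m] by (intro lowering.add lowering.scale) (simp_all add: lowering.zero lowering.scale)
  qed
 qed (auto simp: clinear_0[OF vir_linear] clinear_add[OF vir_linear] clinear_scale[OF vir_linear] intro: lowering.intros)
 show "L n x \<in> lowering L u" if "x \<in> lowering L u" for n x
  using pos[OF that] lowering.lower[OF that] by (cases "n \<ge> 0") auto
 show "u \<in> lowering L u" by (rule lowering.base)
qed (rule u)

text \<open>The generator is kept apart from the weights strictly above it, so that its coefficient
  can be split off in \<open>singular_unique\<close>.\<close>

lemma lowering_weights:
 assumes u: "L 0 u = \<mu> *s u" and x: "x \<in> lowering L u"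
 shows "x \<in> cvec.span (insert u {y. \<exists>a\<in>{\<mu> + of_nat n |n. n \<ge> 1}. L 0 y = a *s y})" (is "_ \<in> cvec.span ?E")
 using x
proof induction
 case (lower x n)
 have "L n y \<in> ?E" if "y \<in> ?E" for y
 proof -
  have "\<exists>m. L 0 y = (\<mu> + of_nat m) *s y" using that u by (auto intro: exI[of _ 0])
  then obtain m where m: "L 0 y = (\<mu> + of_nat m) *s y" by blast
  have "L 0 (L n y) = (\<mu> + of_nat (m + nat (- n))) *s L n y"
   unfolding vir_L0_shift[OF m] using lower(2) by simp
  moreover have "m + nat (- n) \<ge> 1" using lower(2) by simp
  ultimately show ?thesis by blast
 qed
 note E = this
 show ?case using lower(3)
 proof (induction rule: cvec.span_induct_alt)
  case (step a y z)
  then show ?case using cvec.span_base[OF E[OF step(1)]] by (simp add: clinear_add[OF vir_linear] clinear_scale[OF vir_linear] cvec.span_add cvec.span_scale)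
 qed (simp add: clinear_0[OF vir_linear] cvec.span_zero)
qed (auto intro: cvec.span_base cvec.span_zero cvec.span_add cvec.span_scale)

lemma hw_L0: "L 0 v0 = h *s v0" and hw_nonzero: "v0 \<noteq> 0" and hw_pos: "n > 0 \<Longrightarrow> L n v0 = 0"
 using irr by (simp_all add: irreducible_highest_weight_def)

lemma vir_L0_semisimple: "semisimple (L 0)"
proof -
 have "x \<in> cvec.span {v. \<exists>c. L 0 v = c *s v}" for x
  using lowering_weights[OF hw_L0, of x] lowering_UNIV[OF hw_nonzero hw_L0 hw_pos] hw_L0
   cvec.span_mono[of "insert v0 {y. \<exists>a\<in>{h + of_nat n |n. n \<ge> 1}. L 0 y = a *s y}" "{v. \<exists>c. L 0 v = c *s v}"] by blast
 then show ?thesis unfolding semisimple_def by blast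
qed

lemma singular_weight:
 assumes u: "u \<noteq> 0" "L 0 u = \<mu> *s u" "\<And>n. n > 0 \<Longrightarrow> L n u = 0" and w: "w \<noteq> 0" "L 0 w = \<nu> *s w"
 shows "\<exists>n::nat. \<nu> = \<mu> + of_nat n"
proof (rule ccontr)
 assume n: "\<not> ?thesis"
 let ?E = "\<lambda>\<Lambda>. {y. \<exists>a\<in>\<Lambda>. L 0 y = a *s y}"
 have "w \<in> cvec.span (insert u (?E {\<mu> + of_nat n |n. n \<ge> 1}))"
  using lowering_weights[OF u(2), of w] lowering_UNIV[OF u] by simp
 moreover have "insert u (?E {\<mu> + of_nat n |n. n \<ge> 1}) \<subseteq> ?E (range (\<lambda>n. \<mu> + of_nat n))"
  using u(2) by (auto intro: bexI[of _ "\<mu> + of_nat 0"])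
 ultimately have "w \<in> cvec.span (?E (range (\<lambda>n. \<mu> + of_nat n)))" using cvec.span_mono by blast
 then have "w = 0" by (rule eigenvector_not_in_span[OF vir_linear _ w(2)]) (use n in auto)
 then show False using w by simp
qed

text \<open>\<open>u\<close> and \<open>v0\<close> both generate, so each weight exceeds the other
  by a natural number and the two agree. After a multiple of \<open>v0\<close> is subtracted,
  \<open>u\<close> lies in the span of weights above \<open>h\<close>, where weight \<open>h\<close>
  does not occur.\<close>

lemma singular_unique:
 assumes u: "u \<noteq> 0" "L 0 u = \<mu> *s u" "\<And>n. n > 0 \<Longrightarrow> L n u = 0"
 shows "\<mu> = h" "\<exists>a. u = a *s v0"
proof -
 obtain m n :: nat where "\<mu> = h + of_nat m" "h = \<mu> + of_nat n"
  using singular_weight[OF hw_nonzero hw_L0 hw_pos u(1,2)] singular_weight[OF u hw_nonzero hw_L0] by blast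
 then have "of_nat (m + n) = (0 :: complex)" by (simp add: algebra_simps)
 then have "m + n = 0" unfolding of_nat_eq_0_iff .
 then show \<mu>: "\<mu> = h" using \<open>\<mu> = h + of_nat m\<close> by simp
 have "u \<in> cvec.span (insert v0 {y. \<exists>a\<in>{h + of_nat n |n. n \<ge> 1}. L 0 y = a *s y})"
  using lowering_weights[OF hw_L0, of u] lowering_UNIV[OF hw_nonzero hw_L0 hw_pos] by simp
 then obtain a where a: "u - a *s v0 \<in> cvec.span {y. \<exists>a\<in>{h + of_nat n |n. n \<ge> 1}. L 0 y = a *s y}"
  unfolding cvec.span_breakdown_eq by blast
 have "u - a *s v0 = 0"
 proof (rule eigenvector_not_in_span[OF vir_linear a])
  show "L 0 (u - a *s v0) = h *s (u - a *s v0)"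
   using u(2) \<mu> by (simp add: clinear_diff[OF vir_linear] clinear_scale[OF vir_linear] hw_L0 scaleC_diff_right scaleC_scaleC mult.commute)
 qed auto
 then show "\<exists>a. u = a *s v0" by auto
qed

lemma singular_zero:
 assumes "L 0 u = \<mu> *s u" "\<And>n. n > 0 \<Longrightarrow> L n u = 0" "\<mu> \<noteq> h"
 shows "u = 0"
 using singular_unique(1)[OF _ assms(1,2)] assms(3) by blast

end

section \<open>Leading terms of the intertwining operators\<close>

text \<open>Restriction to one coset of the integers. The Jacobi identity relates only indices of
  the same coset, so each restriction satisfies it with integral indices.\<close>

definition shift_vop :: "complex \<Rightarrow> ('w, complex, 'x, 'y) vop \<Rightarrow> ('w, int, 'x, 'y) vop" where
 "shift_vop \<alpha> I w n = I w (\<alpha> + of_int n)"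

lemma int_top:
 fixes P :: "int \<Rightarrow> bool"
 assumes "P n" "\<And>m. m \<ge> K \<Longrightarrow> \<not> P m"
 shows "\<exists>n0. P n0 \<and> (\<forall>m>n0. \<not> P m)"
proof -
 obtain N :: nat where "P (K - int N)" "\<forall>i<N. \<not> P (K - int i)"
  using exists_least_iff[of "\<lambda>N. P (K - int N)"] assms(1) assms(2)[of n]
  by (metis diff_diff_eq2 add_diff_cancel_left' linear zle_iff_zadd)
 moreover have "\<not> P m" if "m > K - int N" for m
  using calculation(2)[rule_format, of "nat (K - m)"] assms(2)[of m] that by (cases "m \<ge> K") auto
 ultimately show ?thesis by blast
qed

context
 fixes conf :: "'v::complex_vector" and Y1 :: "('v::complex_vector, int, 'w::complex_vector, 'w) vop" and Y2 :: "('v, int, 'x::complex_vector, 'x) vop"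
  and Y3 :: "('v, int, 'y::complex_vector, 'y) vop" and I :: "('w, complex, 'x, 'y) vop"
 assumes I: "intertwining_operator conf Y1 Y2 Y3 I"
begin

lemma shift_vop_is_vop: "is_vop (shift_vop \<alpha> I)"
proof -
 have v: "vertex_operator UNIV I" using I by (simp add: intertwining_operator_def)
 have "\<exists>K. \<forall>n\<ge>K. I w (\<alpha> + of_int n) x = 0" for w x
 proof -
  obtain N where N: "\<forall>n\<ge>N. I w (\<alpha> + of_nat n) x = 0" using v unfolding vertex_operator_def by blast
  have "I w (\<alpha> + of_int n) x = 0" if "n \<ge> int N" for n
  proof -
   have "of_int n = (of_nat (nat n) :: complex)" using that by simp
   then show ?thesis using N[rule_format, of "nat n"] that by (simp only:)
  qed
  then show ?thesis by blast
 qed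
 then show ?thesis using v unfolding is_vop_def is_fld_def shift_vop_def vertex_operator_def clinear_iff by simp
qed

lemma shift_vop_jac: "jac Y1 Y2 Y3 (shift_vop \<alpha> I) a w"
proof -
 have j: "jacobi UNIV UNIV Y1 Y2 Y3 I" using I by (simp add: intertwining_operator_def)
 show ?thesis
  unfolding jac_def
 proof (intro allI)
  fix p l q x
  have e: "\<alpha> + of_int (p + q - int i) = of_int p + (\<alpha> + of_int q) - of_nat i" "\<alpha> + of_int (q + int i) = (\<alpha> + of_int q) + of_nat i" for i p q by simp_all
  show "bls (\<lambda>l. shift_vop \<alpha> I (Y1 a l w)) p l q x = brs (Y3 a) (Y2 a) (shift_vop \<alpha> I w) p l q x"
   unfolding bls_def brs_def shift_vop_def e using j unfolding jacobi_def by blast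
 qed
qed

lemma shift_vop_der: "shift_vop \<alpha> I (Y1 conf 0 w) n x = - (\<alpha> + of_int n) *s shift_vop \<alpha> I w (n - 1) x"
 using I by (simp add: intertwining_operator_def shift_vop_def add_diff_eq del: scaleC_minus_left minus_add_distrib)

end

lemma clinear_vanish_subspace: "(\<And>i. clinear (F i)) \<Longrightarrow> cvec.subspace {x. \<forall>i. F i x = 0}"
 unfolding cvec.subspace_def by (simp add: clinear_0 clinear_add clinear_scale)

lemma jac_vanish:
 assumes "jac Y1 Y2 Y3 J a w" "\<And>n x. J w n x = 0" "is_vop Y3"
 shows "J (Y1 a m w) n x = 0"
proof -
 have z: "J w = (\<lambda>_ _. 0)" using assms(2) by blast
 show ?thesis unfolding jac_prd[OF assms(1)] z prd_zero_right[OF is_vop_fld[OF assms(3)]] ..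
qed

text \<open>On a coset where \<open>I\<close> is nonzero the last nonzero mode of \<open>v1\<close>
  on \<open>v2\<close> exists by truncation and is singular, since positive modes raise the index.
  Its weight, \<open>h1 + h2 - 1\<close> minus the index, has to be \<open>h3\<close>; this fixes
  the index and therefore the coset.\<close>

theorem virasoro_intertwining_leading_term:
 fixes Y1 :: "('v::complex_vector, int, 'w::complex_vector, 'w) vop" and Y2 :: "('v, int, 'x::complex_vector, 'x) vop"
  and Y3 :: "('v, int, 'y::complex_vector, 'y) vop"
 assumes I: "intertwining_operator conf Y1 Y2 Y3 I"
  and M1: "irreducible_highest_weight c h1 (\<lambda>n. Y1 conf (n + 1)) v1"
  and M2: "irreducible_highest_weight c h2 (\<lambda>n. Y2 conf (n + 1)) v2"
  and M3: "irreducible_highest_weight c h3 (\<lambda>n. Y3 conf (n + 1)) v3" and Y3: "is_vop Y3"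
 defines "\<delta> \<equiv> h1 + h2 - h3 - 1"
 shows "(\<And>n. q \<noteq> \<delta> + of_int n) \<Longrightarrow> I w q x = 0"
  and "nontrivial_vop I \<Longrightarrow> \<exists>a. a \<noteq> 0 \<and> I v1 \<delta> v2 = a *s v3"
  and "n > 0 \<Longrightarrow> I v1 (\<delta> + of_int n) v2 = 0"
proof -
 let ?J = "\<lambda>\<alpha>. shift_vop \<alpha> I"
 note vop = shift_vop_is_vop[OF I] and der = shift_vop_der[OF I]
 have comm: "Y3 conf (m + 1) (?J \<alpha> v1 n x) = ?J \<alpha> v1 n (Y2 conf (m + 1) x) + (of_int (m + 1) * h1 - (\<alpha> + of_int (m + 1 + n))) *s ?J \<alpha> v1 (m + n) x" for \<alpha> m n x
 proof -
  have 2: "Y1 conf (int i) v1 = 0" if "i \<ge> 2" for i using hw_pos[OF M1, of "int i - 1"] that by simp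
  have "Sum_any (\<lambda>i::nat. bin (m + 1) i *s ?J \<alpha> (Y1 conf (int i) v1) (m + 1 + n - int i) x) = (\<Sum>i<2. bin (m + 1) i *s ?J \<alpha> (Y1 conf (int i) v1) (m + 1 + n - int i) x)"
   by (rule SA_nat) (simp add: 2 is_vop_0[OF vop])
  also have "\<dots> = - (\<alpha> + of_int (m + 1 + n)) *s ?J \<alpha> v1 (m + n) x + (of_int (m + 1) * h1) *s ?J \<alpha> v1 (m + n) x"
   using hw_L0[OF M1] der[of \<alpha> v1 "m + 1 + n" x] by (simp add: numeral_2_eq_2 scaleC_one vop1_scale[OF vop] scaleC_scaleC algebra_simps)
  finally show ?thesis using jac_comm[OF shift_vop_jac[OF I, of \<alpha> conf v1], where m = "m + 1" and n = n and x = x]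
   by (simp add: algebra_simps scaleC_diff_left)
 qed
 \<comment> \<open>Irreducibility is used twice: the vectors killed by all modes of
   \<open>v1\<close> form a submodule of the second module, and the vectors all of whose modes
   vanish form one of the first.\<close>
 have zero: "?J \<alpha> w n x = 0" if z: "\<And>n. ?J \<alpha> v1 n v2 = 0" for \<alpha> w n x
 proof -
  have "{x. \<forall>n. ?J \<alpha> v1 n x = 0} = UNIV"
  proof (rule vir_irr[OF M2])
   show "cvec.subspace {x. \<forall>n. ?J \<alpha> v1 n x = 0}" by (intro clinear_vanish_subspace is_vop_linear vop)
   show "Y2 conf (m + 1) x \<in> {x. \<forall>n. ?J \<alpha> v1 n x = 0}" if "x \<in> {x. \<forall>n. ?J \<alpha> v1 n x = 0}" for m x
    using comm[of m \<alpha> _ x] that by (auto simp: vop_0[OF Y3])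
  qed (use z hw_nonzero[OF M2] in auto)
  then have v: "?J \<alpha> v1 n x = 0" for n x by blast
  have "{w. \<forall>i. (\<lambda>(n, x). \<lambda>w. ?J \<alpha> w n x) i w = 0} = UNIV"
  proof (rule vir_irr[OF M1])
   show "cvec.subspace {w. \<forall>i. (\<lambda>(n, x). \<lambda>w. ?J \<alpha> w n x) i w = 0}" by (rule clinear_vanish_subspace) (auto intro: is_vop_linear1 vop)
  qed (use v hw_nonzero[OF M1] in \<open>auto intro: jac_vanish[OF shift_vop_jac[OF I] _ Y3]\<close>)
  then show ?thesis by (auto simp: set_eq_iff)
 qed
 have top: "\<exists>n0. \<alpha> + of_int n0 = \<delta> \<and> (\<exists>a. a \<noteq> 0 \<and> ?J \<alpha> v1 n0 v2 = a *s v3) \<and> (\<forall>m>n0. ?J \<alpha> v1 m v2 = 0)" if nz: "?J \<alpha> w n x \<noteq> 0" for \<alpha> w n x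
 proof -
  obtain n1 where n1: "?J \<alpha> v1 n1 v2 \<noteq> 0" using zero nz by blast
  obtain K where "\<forall>m\<ge>K. ?J \<alpha> v1 m v2 = 0" using fld_max[OF is_vop_fld[OF vop]] by blast
  then obtain n0 where n0: "?J \<alpha> v1 n0 v2 \<noteq> 0" "\<forall>m>n0. ?J \<alpha> v1 m v2 = 0"
   using int_top[of "\<lambda>n. ?J \<alpha> v1 n v2 \<noteq> 0", OF n1] by blast
  have s: "Y3 conf (m + 1) (?J \<alpha> v1 n0 v2) = 0" if "m > 0" for m
   using that n0(2) hw_pos[OF M2 that] unfolding comm by (simp add: vop_0[OF vop])
  have w: "Y3 conf (0 + 1) (?J \<alpha> v1 n0 v2) = (h2 + h1 - (\<alpha> + 1 + of_int n0)) *s ?J \<alpha> v1 n0 v2"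
   unfolding comm hw_L0[OF M2] unfolding vop_scale[OF vop] add_0 scaleC_add_left[symmetric] by (simp add: add_diff_eq add.assoc)
  have "h2 + h1 - (\<alpha> + 1 + of_int n0) = h3" "\<exists>a. ?J \<alpha> v1 n0 v2 = a *s v3"
   using singular_unique[OF M3 n0(1) w s] by blast+
  then have "\<alpha> + of_int n0 = \<delta>" "\<exists>a. a \<noteq> 0 \<and> ?J \<alpha> v1 n0 v2 = a *s v3"
   using n0(1) unfolding \<delta>_def by (auto simp: algebra_simps)
  then show ?thesis using n0(2) by blast
 qed
 show "I w q x = 0" if "\<And>n. q \<noteq> \<delta> + of_int n"
 proof (rule ccontr)
  assume "I w q x \<noteq> 0"
  then have "?J q w 0 x \<noteq> 0" by (simp add: shift_vop_def)
  then obtain n0 where "q + of_int n0 = \<delta>" using top by blast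
  then have "q = \<delta> + of_int (- n0)" by (simp add: algebra_simps)
  then show False using that by blast
 qed
 show "\<exists>a. a \<noteq> 0 \<and> I v1 \<delta> v2 = a *s v3" if nt: "nontrivial_vop I"
 proof -
  obtain w q x where "I w q x \<noteq> 0" using nt unfolding nontrivial_vop_def by blast
  then have "?J q w 0 x \<noteq> 0" by (simp add: shift_vop_def)
  then show ?thesis using top[of q w 0 x] by (auto simp: shift_vop_def)
 qed
 show "I v1 (\<delta> + of_int n) v2 = 0" if n: "n > 0"
 proof (rule ccontr)
  assume "I v1 (\<delta> + of_int n) v2 \<noteq> 0"
  then have z: "?J \<delta> v1 n v2 \<noteq> 0" by (simp add: shift_vop_def)
  obtain n0 where n0: "\<delta> + of_int n0 = \<delta>" "\<forall>m>n0. ?J \<delta> v1 m v2 = 0" using top[OF z] by blast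
  then show False using z n by simp
 qed
qed

section \<open>The leading term on the lattice side\<close>

lemma heis_pi_exp: "n \<ge> 0 \<Longrightarrow> heis_op k r lam a n (pi_exp j) = (if n = 0 then form a (top_wt k r lam j) else 0) *s pi_exp j"
 unfolding pi_exp_def by (auto simp: heis_zero' heis_pos)

lemma pi_exp_generates:
 assumes "\<And>x y. P x \<Longrightarrow> P y \<Longrightarrow> P (x + y)" "\<And>t x. P x \<Longrightarrow> P (t *s x)"
  and H: "\<And>a n x. P x \<Longrightarrow> P (heis_op k r lam a n x)" and E: "\<And>i n x. i \<in> {1, -1} \<Longrightarrow> P x \<Longrightarrow> P (exp_vop k r lam i n x)"
  and j0: "P (pi_exp j0)"
 shows "P x"
proof -
 have e: "P (pi_exp (i + j))" if "i \<in> {1, -1}" "P (pi_exp j)" for i j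
  using E[OF that, of "- i * r - 1"] by (simp add: exp_vop_pi_exp Em_def expz_0)
 have "P (pi_exp j)" for j
  by (rule int_induct[of _ j0]) (use j0 e[of 1] e[of "-1"] in \<open>auto simp: add.commute\<close>)
 then show ?thesis using heis_induct[of P] assms(1,2) H by blast
qed

lemma lookup_linear: "clinear (\<lambda>x. lookup x b)"
 by (rule clinearI) (simp_all add: lookup_add lookup_scaleC)

text \<open>Positive modes are partial derivatives, d differentiating by c and c by d. A coefficient
  of the derivative is a nonzero multiple of the coefficient at the monomial with one more
  factor.\<close>

lemma lookup_heis_pos:
 "lookup (heis_op k r lam d_vec (int m + 1) x) (A, B, i) = of_nat (2 * (m + 1) * (count A m + 1)) *s lookup x (add_mset m A, B, i)"
 "lookup (heis_op k r lam c_vec (int m + 1) x) (A, B, i) = of_nat (2 * (m + 1) * (count B m + 1)) *s lookup x (A, add_mset m B, i)"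
 "lookup (heis_op k r lam a 0 x) (A, B, i) = form a (top_wt k r lam i) *s lookup x (A, B, i)"
proof -
 have c: "count A' m = 0 \<and> A' \<noteq> add_mset m A \<or> A' - {#m#} \<noteq> A \<and> A' \<noteq> add_mset m A \<or> A' - {#m#} = A \<and> count A' m = Suc (count A m) \<and> A' = add_mset m A" for A' m and A :: "nat multiset"
  by (metis add_mset_remove_trivial count_add_mset count_greater_zero_iff insert_DiffM nat.distinct(1) neq0_conv)
 show "lookup (heis_op k r lam d_vec (int m + 1) x) (A, B, i) = of_nat (2 * (m + 1) * (count A m + 1)) *s lookup x (add_mset m A, B, i)"
 proof (rule pi_linear_eq[where F = "\<lambda>x. lookup (heis_op k r lam d_vec (int m + 1) x) (A, B, i)"])
  fix A' B' i'
  show "lookup (heis_op k r lam d_vec (int m + 1) (single (A', B', i') 1)) (A, B, i) =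
   of_nat (2 * (m + 1) * (count A m + 1)) *s lookup (single (A', B', i') 1) (add_mset m A, B, i)"
   using c[of A' m A] by (cases "B' = B \<and> i' = i") (auto simp: heis_d_pos lookup_scaleC lookup_single when_def scaleC_complex_def ring_distribs)
 qed (intro clinear_compose[OF lookup_linear heis_linear] clinear_scaleI lookup_linear)+
 show "lookup (heis_op k r lam c_vec (int m + 1) x) (A, B, i) = of_nat (2 * (m + 1) * (count B m + 1)) *s lookup x (A, add_mset m B, i)"
 proof (rule pi_linear_eq[where F = "\<lambda>x. lookup (heis_op k r lam c_vec (int m + 1) x) (A, B, i)"])
  fix A' B' i'
  show "lookup (heis_op k r lam c_vec (int m + 1) (single (A', B', i') 1)) (A, B, i) =
   of_nat (2 * (m + 1) * (count B m + 1)) *s lookup (single (A', B', i') 1) (A, add_mset m B, i)"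
   using c[of B' m B] by (cases "A' = A \<and> i' = i") (auto simp: heis_c_pos lookup_scaleC lookup_single when_def scaleC_complex_def ring_distribs)
 qed (intro clinear_compose[OF lookup_linear heis_linear] clinear_scaleI lookup_linear)+
 show "lookup (heis_op k r lam a 0 x) (A, B, i) = form a (top_wt k r lam i) *s lookup x (A, B, i)"
  by (rule pi_linear_eq[where F = "\<lambda>x. lookup (heis_op k r lam a 0 x) (A, B, i)"], (intro clinear_compose[OF lookup_linear heis_linear] clinear_scaleI lookup_linear)+)
   (auto simp: heis_zero' lookup_scaleC lookup_single when_def scaleC_complex_def)
qed

text \<open>Vanishing derivatives leave a constant polynomial, and d(0) separates the exponentials;
  c(0) acts on all of them by the same scalar.\<close>

lemma heis_singular_vector:
 assumes pos: "\<And>a m. m > 0 \<Longrightarrow> heis_op k r lam a m x = 0" and 0: "heis_op k r lam d_vec 0 x = form d_vec (top_wt k r lam j) *s x"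
 shows "\<exists>t. x = t *s pi_exp j"
proof -
 have "lookup x (A, B, i) = 0" if "(A, B, i) \<noteq> ({#}, {#}, j)" for A B i
 proof -
  have A: "lookup x (add_mset m A, B, i) = 0" for m A B i
   using lookup_heis_pos(1)[of k r lam m x A B i] pos by (simp add: scaleC_complex_def del: of_nat_Suc of_nat_add of_nat_mult)
  have B: "lookup x (A, add_mset m B, i) = 0" for m A B i
   using lookup_heis_pos(2)[of k r lam m x A B i] pos by (simp add: scaleC_complex_def del: of_nat_Suc of_nat_add of_nat_mult)
  have "(form d_vec (top_wt k r lam i) - form d_vec (top_wt k r lam j)) * lookup x (A, B, i) = 0"
   using lookup_heis_pos(3)[of k r lam d_vec x A B i] unfolding 0 by (simp add: scaleC_complex_def lookup_scaleC algebra_simps) metis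
  then have "i = j \<or> lookup x (A, B, i) = 0"
   by (auto simp: top_wt_def form_add_right form_scale_right c_vec_def d_vec_def form_def scaleC_prod_def scaleC_complex_def)
  then show ?thesis using that A B by (cases A; cases B) auto
 qed
 then have z: "lookup x b = 0" if "b \<noteq> ({#}, {#}, j)" for b using that by (cases b) blast
 have "x = lookup x ({#}, {#}, j) *s pi_exp j"
 proof (rule poly_mapping_eqI)
  fix b show "lookup x b = lookup (lookup x ({#}, {#}, j) *s pi_exp j) b"
   using z[of b] by (cases "b = ({#}, {#}, j)") (auto simp: pi_exp_def lookup_scaleC lookup_single when_def scaleC_complex_def)
 qed
 then show ?thesis by blast
qed

text \<open>The argument of the Virasoro side, with Heisenberg modes and the operators of e^c and
  e^(-c) generating the modules. The vector \<open>pi_exp (-1)\<close> is chosen because its leading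
  index is \<open>- lam\<close>, which complements the index \<open>lam - 1\<close> of the Virasoro
  side to -1.\<close>

theorem pi_intertwining_leading_term:
 fixes l :: int and k lam :: complex
 assumes I: "intertwining_operator (pi_omega k) (pi_vop k 1 (- k / 2)) (pi_vop k l lam) (pi_vop k (l + 1) (- k / 2 + lam)) I"
 shows "(\<And>n. q \<noteq> - lam + of_int n) \<Longrightarrow> I w q x = 0"
  and "nontrivial_vop I \<Longrightarrow> \<exists>a. a \<noteq> 0 \<and> I (pi_exp 0) (- lam) (pi_exp (- 1)) = a *s pi_exp (- 1)"
  and "n > 0 \<Longrightarrow> I (pi_exp 0) (- lam + of_int n) (pi_exp (- 1)) = 0"
proof -
 let ?J = "\<lambda>\<alpha>. shift_vop \<alpha> I" and ?v = "pi_exp 0"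
 let ?H1 = "heis_op k 1 (- k / 2)" and ?H2 = "heis_op k l lam" and ?H3 = "heis_op k (l + 1) (- k / 2 + lam)"
 let ?\<nu> = "top_wt k 1 (- k / 2) 0"
 note vop = shift_vop_is_vop[OF I] and der = shift_vop_der[OF I] and jj = shift_vop_jac[OF I]
 note J0 = vop_0[OF vop]
 note H0 = heis_lin_0
 have comm: "?H3 h m (?J \<alpha> ?v n x) = ?J \<alpha> ?v n (?H2 h m x) + form h ?\<nu> *s ?J \<alpha> ?v (m + n) x" for \<alpha> h m n x
 proof -
  have "Sum_any (\<lambda>i::nat. bin m i *s ?J \<alpha> (?H1 h (int i) ?v) (m + n - int i) x) = bin m 0 *s ?J \<alpha> (?H1 h (int 0) ?v) (m + n - int 0) x"
   by (rule SA_single) (simp add: heis_pi_exp is_vop_0[OF vop])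
  also have "\<dots> = form h ?\<nu> *s ?J \<alpha> ?v (m + n) x" by (simp add: scaleC_one heis_pi_exp vop1_scale[OF vop])
  finally show ?thesis using jac_comm[OF jj[of \<alpha> "h_vec k h" ?v], where m = m and n = n and x = x]
   by (simp add: YW_h_vec algebra_simps)
 qed
 have zero: "?J \<alpha> w n x = 0" if z: "\<And>n. ?J \<alpha> ?v n (pi_exp j) = 0" for \<alpha> w n x j
 proof -
  have E1: "exp_vop k 1 (- k / 2) i m ?v = 0" if "i \<in> {1, -1}" "m \<ge> 1" for i m
   using that by (auto simp: exp_vop_pi_exp Em_neg)
  have "\<forall>n. ?J \<alpha> ?v n x = 0" for x
  proof (rule pi_exp_generates[where P = "\<lambda>x. \<forall>n. ?J \<alpha> ?v n x = 0" and ?j0.0 = j])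
   show "\<forall>n. ?J \<alpha> ?v n (?H2 a m x) = 0" if "\<forall>n. ?J \<alpha> ?v n x = 0" for a m x
   proof
    fix n show "?J \<alpha> ?v n (?H2 a m x) = 0" using comm[of a m \<alpha> n x] that by (simp add: H0)
   qed
   \<comment> \<open>The modes of e^(ic) on e^nu vanish from index 1 on, so the two fields are local
     of order 1. As all modes of e^nu kill \<open>x\<close>, locality trades the index of one mode
     against that of the other until the mode of e^(ic) vanishes.\<close>
   show "\<forall>n. ?J \<alpha> ?v n (exp_vop k l lam i m x) = 0" if i: "i \<in> {1, -1}" and x: "\<forall>n. ?J \<alpha> ?v n x = 0" for i m x
   proof -
    let ?E = "exp_vop k l lam i"
    have "?J \<alpha> ?v (q + 1) (?E p x) = ?J \<alpha> ?v q (?E (p + 1) x)" for p q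
    proof -
     have "bls (\<lambda>l. ?J \<alpha> (pi_vop k 1 (- k / 2) (pi_exp i) l ?v)) p 1 q x = 0"
      unfolding bls_def by (rule SA_zero) (use E1[OF i] in \<open>simp add: YW_pi_exp is_vop_0[OF vop]\<close>)
     then have "brs (exp_vop k (l + 1) (- k / 2 + lam) i) ?E (?J \<alpha> ?v) p 1 q x = 0"
      using jj[of \<alpha> "pi_exp i" ?v] unfolding jac_def YW_pi_exp by simp
     also have "brs (exp_vop k (l + 1) (- k / 2 + lam) i) ?E (?J \<alpha> ?v) p 1 q x =
      (\<Sum>i<2. abin 1 i *s (?J \<alpha> ?v (1 + q - int i) (?E (p + int i) x)))"
      unfolding brs_def using bin_nat_0[of 1] by (subst SA_nat[of 2]) (auto simp: x clinear_0[OF exp_vop_linear] simp del: of_int_1)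
     finally show ?thesis by (simp add: numeral_2_eq_2 scaleC_one algebra_simps)
    qed
    note st = this
    have "?J \<alpha> ?v (q + int N) (?E p x) = ?J \<alpha> ?v q (?E (p + int N) x)" for N p q
    proof (induction N arbitrary: p)
     case (Suc N)
     have "q + int (Suc N) = (q + int N) + 1" "p + int (Suc N) = (p + 1) + int N" by simp_all
     then show ?case by (simp only: st Suc.IH)
    qed simp
    moreover obtain N where "\<forall>i\<ge>N. ?E (m + int i) x = 0" using is_fld_bound[OF exp_vop_fld] by blast
    ultimately have "?J \<alpha> ?v (n - int N + int N) (?E m x) = 0" for n by (simp only: J0)
    then show ?thesis by simp
   qed
  qed (use z in \<open>simp_all add: vop_add[OF vop] vop_scale[OF vop]\<close>)
  then have v: "?J \<alpha> ?v n x = 0" for n x by blast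
  have "\<forall>n x. ?J \<alpha> w n x = 0"
  proof (rule pi_exp_generates[where P = "\<lambda>w. \<forall>n x. ?J \<alpha> w n x = 0" and ?j0.0 = 0])
   show "\<forall>n x. ?J \<alpha> (?H1 a m w) n x = 0" if "\<forall>n x. ?J \<alpha> w n x = 0" for a m w
    using jac_vanish[OF jj[of \<alpha> "h_vec k a"] _ pi_is_vop] that by (simp add: YW_h_vec)
   show "\<forall>n x. ?J \<alpha> (exp_vop k 1 (- k / 2) i m w) n x = 0" if "\<forall>n x. ?J \<alpha> w n x = 0" for i m w
    using jac_vanish[OF jj[of \<alpha> "pi_exp i"] _ pi_is_vop] that by (simp add: YW_pi_exp)
  qed (use v in \<open>simp_all add: vop1_add[OF vop] vop1_scale[OF vop]\<close>)
  then show ?thesis by blast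
 qed
 have top: "\<exists>n0. \<alpha> + of_int n0 = - lam \<and> (\<exists>a. a \<noteq> 0 \<and> ?J \<alpha> ?v n0 (pi_exp (-1)) = a *s pi_exp (-1)) \<and> (\<forall>m>n0. ?J \<alpha> ?v m (pi_exp (-1)) = 0)"
  if nz: "?J \<alpha> w n x \<noteq> 0" for \<alpha> w n x
 proof -
  let ?x = "pi_exp (-1)"
  obtain n1 where n1: "?J \<alpha> ?v n1 ?x \<noteq> 0" using zero nz by blast
  obtain K where "\<forall>m\<ge>K. ?J \<alpha> ?v m ?x = 0" using fld_max[OF is_vop_fld[OF vop]] by blast
  then obtain n0 where n0: "?J \<alpha> ?v n0 ?x \<noteq> 0" "\<forall>m>n0. ?J \<alpha> ?v m ?x = 0"
   using int_top[of "\<lambda>n. ?J \<alpha> ?v n ?x \<noteq> 0", OF n1] by blast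
  have "\<exists>a. ?J \<alpha> ?v n0 ?x = a *s ?x"
  proof (rule heis_singular_vector)
   show "?H3 a m (?J \<alpha> ?v n0 ?x) = 0" if "m > 0" for a m
    unfolding comm using n0(2) that by (simp add: heis_pi_exp J0)
   show "?H3 d_vec 0 (?J \<alpha> ?v n0 ?x) = form d_vec (top_wt k (l + 1) (- k / 2 + lam) (-1)) *s ?J \<alpha> ?v n0 ?x"
    unfolding comm by (simp add: heis_pi_exp vop_scale[OF vop] scaleC_add_left[symmetric])
     (simp add: top_wt_def form_def c_vec_def d_vec_def mu_vec_def scaleC_prod_def scaleC_complex_def algebra_simps)
  qed
  \<comment> \<open>Both sides of L(-1) e^nu = nu(-1) e^nu are evaluated one index above the leading
    mode. The derivative property gives minus the leading index minus 1, the zero mode of nu gives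
    <nu, l mu + (lam - 1) c> = \<open>lam - 1\<close>.\<close>
  moreover have "\<alpha> + of_int n0 = - lam"
  proof -
   have f: "form ?\<nu> (top_wt k l lam (-1)) = lam - 1"
    by (simp add: top_wt_def form_def c_vec_def mu_vec_def scaleC_prod_def scaleC_complex_def algebra_simps)
   have "?J \<alpha> (?H1 ?\<nu> (-1) ?v) (n0 + 1) ?x = prd (?H3 ?\<nu>) (?H2 ?\<nu>) (-1) (?J \<alpha> ?v) (n0 + 1) ?x"
    using jac_prd[OF jj[of \<alpha> "h_vec k ?\<nu>" ?v], of "-1"] by (simp add: YW_h_vec)
   also have "\<dots> = ?J \<alpha> ?v n0 (?H2 ?\<nu> 0 ?x)"
    unfolding prd_m1 by (subst SA_single[of 0]) (use n0(2) in \<open>auto simp: H0 heis_pi_exp J0\<close>)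
   also have "\<dots> = (lam - 1) *s ?J \<alpha> ?v n0 ?x" unfolding f[symmetric] by (simp add: heis_pi_exp vop_scale[OF vop])
   also have "?J \<alpha> (?H1 ?\<nu> (-1) ?v) (n0 + 1) ?x = - (\<alpha> + of_int (n0 + 1)) *s ?J \<alpha> ?v n0 ?x"
    using der[of \<alpha> ?v "n0 + 1" ?x] pi_D_exp[of k 1 "- k / 2" 0] unfolding pi_D_def by simp
   finally have "(- (\<alpha> + of_int (n0 + 1)) - (lam - 1)) *s ?J \<alpha> ?v n0 ?x = 0" by (simp only: scaleC_diff_left) simp
   then have e: "- (\<alpha> + of_int (n0 + 1)) - (lam - 1) = 0" using n0(1) by (simp only: cvec.scale_eq_0_iff simp_thms)
   have "\<alpha> + of_int n0 = - (- (\<alpha> + of_int (n0 + 1)) - (lam - 1)) - lam" by simp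
   then show ?thesis unfolding e by simp
  qed
  ultimately obtain a where a: "?J \<alpha> ?v n0 ?x = a *s ?x" and e: "\<alpha> + of_int n0 = - lam" by blast
  have "a \<noteq> 0" using a n0(1) by auto
  then show ?thesis using a e n0(2) by blast
 qed
 show "I w q x = 0" if "\<And>n. q \<noteq> - lam + of_int n"
 proof (rule ccontr)
  assume "I w q x \<noteq> 0"
  then have "?J q w 0 x \<noteq> 0" by (simp add: shift_vop_def)
  then obtain n0 where "q + of_int n0 = - lam" using top by blast
  then have "q = - lam + of_int (- n0)" by (simp add: algebra_simps)
  then show False using that by blast
 qed
 show "\<exists>a. a \<noteq> 0 \<and> I ?v (- lam) (pi_exp (-1)) = a *s pi_exp (-1)" if nt: "nontrivial_vop I"
 proof -
  obtain w q x where "I w q x \<noteq> 0" using nt unfolding nontrivial_vop_def by blast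
  then have "?J q w 0 x \<noteq> 0" by (simp add: shift_vop_def)
  then show ?thesis using top[of q w 0 x] by (auto simp: shift_vop_def)
 qed
 show "I ?v (- lam + of_int n) (pi_exp (-1)) = 0" if n: "n > 0"
 proof (rule ccontr)
  assume "I ?v (- lam + of_int n) (pi_exp (-1)) \<noteq> 0"
  then have z: "?J (- lam) ?v n (pi_exp (-1)) \<noteq> 0" by (simp add: shift_vop_def)
  obtain n0 where n0: "- lam + of_int n0 = - lam" "\<forall>m>n0. ?J (- lam) ?v m (pi_exp (-1)) = 0" using top[OF z] by blast
  then show False using z n by simp
 qed
qed

section \<open>The modules over the tensor product\<close>

lemma tensor_vop_id_right:
 assumes Y: "is_vop Y" and P: "is_vop P" and f: "P f = id_fld"
 shows "tensor_vop Y P (tensor a f) n v = tA (Y a) n v"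
proof (rule tpi_linear_eq[of "tensor_vop Y P (tensor a f) n" "tA (Y a) n"])
 show "clinear (tensor_vop Y P (tensor a f) n)" by (rule tensor_vop_linear2[OF Y P])
 show "clinear (tA (Y a) n)" by (rule is_fld_linear[OF tA_fld[OF is_vop_fld[OF Y]]])
 show "tensor_vop Y P (tensor a f) n (tensor w (single b 1)) = tA (Y a) n (tensor w (single b 1))" for w b
  unfolding tensor_vop_pure[OF Y P] cvl_def f tA_tensor[OF is_vop_fld[OF Y]]
  by (subst SA_single[of n]) (auto simp: id_fld_def tensor_0_right)
qed

lemma tensor_vop_id_left:
 assumes Y: "is_vop Y" and P: "is_vop P" and a: "Y a = id_fld"
 shows "tensor_vop Y P (tensor a f) n v = tU (P f) n v"
proof (rule tpi_linear_eq[of "tensor_vop Y P (tensor a f) n" "tU (P f) n"])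
 show "clinear (tensor_vop Y P (tensor a f) n)" by (rule tensor_vop_linear2[OF Y P])
 show "clinear (tU (P f) n)" by (rule is_fld_linear[OF tU_fld[OF is_vop_fld[OF P]]])
 show "tensor_vop Y P (tensor a f) n (tensor w (single b 1)) = tU (P f) n (tensor w (single b 1))" for w b
  unfolding tensor_vop_pure[OF Y P] cvl_def a tU_tensor[OF is_vop_fld[OF P]]
  by (subst SA_single[of "-1"]) (auto simp: id_fld_def tensor_0_left)
qed

text \<open>The derivative property contributes the sum of the two mode indices. The offsets
  \<open>\<alpha>\<close> and \<open>- \<alpha>\<close> cancel in it, which leaves an
  integer.\<close>

lemma tensor_vop_der:
 assumes J1: "is_vop J1" and J2: "is_vop J2" and T1: "clinear T1" and T2: "clinear T2"
  and d1: "\<And>w n x. J1 (T1 w) n x = - (\<alpha> + of_int n) *s J1 w (n - 1) x"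
  and d2: "\<And>w n x. J2 (T2 w) n x = - (- \<alpha> + of_int n) *s J2 w (n - 1) x"
 shows "tensor_vop J1 J2 (tmap T1 (\<lambda>p. p) u + tmap (\<lambda>w. w) T2 u) n v = - of_int n *s tensor_vop J1 J2 u (n - 1) v"
proof -
 have p: "tensor_vop J1 J2 (tensor (T1 w) f + tensor w (T2 f)) n (tensor y g) = - of_int n *s tensor_vop J1 J2 (tensor w f) (n - 1) (tensor y g)" for w f y g
 proof -
  let ?F = "\<lambda>j. tensor (J1 w j y) (J2 f (n - 1 - 1 - j) g)"
  have 1: "tensor_vop J1 J2 (tensor (T1 w) f) n (tensor y g) = Sum_any (\<lambda>j. - (\<alpha> + of_int (j + 1)) *s ?F j)"
   unfolding tensor_vop_pure[OF J1 J2] cvl_def d1 tensor_scale_left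
   by (subst SA_shift[of _ 1, symmetric]) (simp add: algebra_simps)
  have 2: "tensor_vop J1 J2 (tensor w (T2 f)) n (tensor y g) = Sum_any (\<lambda>j. - (- \<alpha> + of_int (n - 1 - j)) *s ?F j)"
   unfolding tensor_vop_pure[OF J1 J2] cvl_def d2 tensor_scale_right by (simp add: algebra_simps)
  have fs: "fs ?F" by (rule TT_fs[OF J1 J2])
  have "tensor_vop J1 J2 (tensor (T1 w) f + tensor w (T2 f)) n (tensor y g) =
   Sum_any (\<lambda>j. - (\<alpha> + of_int (j + 1)) *s ?F j + - (- \<alpha> + of_int (n - 1 - j)) *s ?F j)"
   unfolding clinear_add[OF tensor_vop_linear1[OF J1 J2]] 1 2 by (intro SA_add[symmetric] fs_scale fs)
  also have "\<dots> = Sum_any (\<lambda>j. - of_int n *s ?F j)"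
   by (simp only: scaleC_add_left[symmetric]) (simp add: algebra_simps)
  finally show ?thesis unfolding SA_scale tensor_vop_pure[OF J1 J2] cvl_def .
 qed
 have q: "tensor_vop J1 J2 (tensor (T1 w) f + tensor w (T2 f)) n v = - of_int n *s tensor_vop J1 J2 (tensor w f) (n - 1) v" for w f
  by (rule tpi_linear_eq[of "tensor_vop J1 J2 (tensor (T1 w) f + tensor w (T2 f)) n" "\<lambda>v. - of_int n *s tensor_vop J1 J2 (tensor w f) (n - 1) v"])
   (auto intro: tensor_vop_linear2[OF J1 J2] clinear_scaleI p simp del: scaleC_minus_left)
 show ?thesis
  by (rule tpi_linear_eq[of "\<lambda>u. tensor_vop J1 J2 (tmap T1 (\<lambda>p. p) u + tmap (\<lambda>w. w) T2 u) n v" "\<lambda>u. - of_int n *s tensor_vop J1 J2 u (n - 1) v"])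
   (use q in \<open>auto intro!: clinear_scaleI clinear_compose[OF tensor_vop_linear1[OF J1 J2]] clinear_plus tmap_linear tensor_vop_linear1[OF J1 J2] clinear_id T1
    simp: tmap_tensor T1 T2 clinear_id simp del: scaleC_minus_left\<close>)
qed

lemma SA_reindex:
 assumes "inj h" "\<And>i. i \<notin> range h \<Longrightarrow> f i = 0"
 shows "Sum_any f = Sum_any (\<lambda>j. f (h j))"
proof -
 have "{i. f i \<noteq> 0} = h ` {j. f (h j) \<noteq> 0}" using assms(2) by fastforce
 then show ?thesis unfolding Sum_any.expand_set by (simp add: sum.reindex[OF inj_on_subset[OF assms(1)]])
qed

text \<open>The sum over complex indices has terms only where \<open>I1\<close> is nonzero, that is
  on the coset of \<open>\<alpha>\<close>; the index of \<open>I2\<close> then lies in the opposite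
  coset.\<close>

lemma tensor_vop_shift:
 assumes "\<And>w q x. (\<And>n. q \<noteq> \<alpha> + of_int n) \<Longrightarrow> I1 w q x = 0"
 shows "tensor_vop I1 I2 w (of_int n) v = tensor_vop (shift_vop \<alpha> I1) (shift_vop (- \<alpha>) I2) w n v"
proof -
 have "Sum_any (\<lambda>i. tensor (I1 a i y) (I2 f (of_int n - 1 - i) g)) =
  Sum_any (\<lambda>i. tensor (shift_vop \<alpha> I1 a i y) (shift_vop (- \<alpha>) I2 f (n - 1 - i) g))" for a y f g
 proof -
  have "I1 a i y = 0" if "i \<notin> range (\<lambda>i::int. \<alpha> + of_int i)" for i using that by (intro assms) auto
  then show ?thesis
   by (subst SA_reindex[of "\<lambda>i::int. \<alpha> + of_int i"]) (auto simp: inj_on_def tensor_0_left shift_vop_def algebra_simps)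
 qed
 then show ?thesis unfolding tensor_vop_def by simp
qed

lemma va_moduleD:
 assumes "va_module UNIV Y vac U"
 shows "is_vop U" "U vac = id_fld" "jac Y U U U a b"
 using assms unfolding va_module_def vertex_operator_UNIV jacobi_iff_jac by (auto simp: id_fld_def fun_eq_iff)

lemma simple_virasoro_vaD:
 assumes "simple_virasoro_va c Y vac conf"
 shows "va_module UNIV Y vac Y" "Y a (-1) vac = a" "n \<ge> 0 \<Longrightarrow> Y a n vac = 0" "Y conf 0 a = Y a (-2) vac"
  "irreducible_highest_weight c 0 (\<lambda>n. Y conf (n + 1)) vac"
 using assms unfolding simple_virasoro_va_def vertex_algebra_def va_module_def by auto

lemma prd_m2_id: "is_fld A \<Longrightarrow> prd A A (-2) id_fld = der A"
proof (intro ext)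
 fix n x
 assume A: "is_fld A"
 have "prd (der A) (der A) (-1) id_fld n x = prd A A (-2) id_fld n x"
  using prd_der_left[OF A is_fld_id, of "-1" n x] by (simp add: scaleC_one)
 then show "prd A A (-2) id_fld n x = der A n x" using prd_id_right[OF is_fld_der[OF A]] by simp
qed

section \<open>Modules and intertwining operators over the tensor product\<close>

context
 fixes k c :: complex and Y :: "('a::complex_vector, int, 'a, 'a) vop" and vac conf :: 'a
 assumes va: "simple_virasoro_va c Y vac conf"
begin

lemmas VD = va_moduleD[OF simple_virasoro_vaD(1)[OF va]] simple_virasoro_vaD[OF va]

text \<open>In the algebra L(-1) a = a_(-2) vac holds by assumption. The Jacobi identity with the
  vacuum turns this into a product of fields, which is the derivative.\<close>

lemma module_translation: "va_module UNIV Y vac YW \<Longrightarrow> YW (Y conf 0 a) n x = - of_int n *s YW a (n - 1) x"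
 for YW :: "('a, int, 'w::complex_vector, 'w) vop"
proof -
 assume m: "va_module UNIV Y vac YW"
 have "YW (Y conf 0 a) = prd (YW a) (YW a) (-2) (YW vac)"
  unfolding VD(7) by (rule jac_prd[OF va_moduleD(3)[OF m]])
 then show ?thesis by (simp add: va_moduleD(2)[OF m] prd_m2_id[OF is_vop_fld[OF va_moduleD(1)[OF m]]] der_def)
qed

context
 fixes YW :: "('a, int, 'w::complex_vector, 'w) vop" and r :: int and lam :: complex
 assumes m: "va_module UNIV Y vac YW"
begin

abbreviation (input) "YT \<equiv> tpi_vop k YW r lam"

lemma tpi_is_vop: "is_vop YT" unfolding tpi_vop_def by (rule tensor_is_vop[OF va_moduleD(1)[OF m] pi_is_vop])

lemma tpi_jac: "jac (tpi_vop k Y 0 0) YT YT YT u v"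
 unfolding tpi_vop_def
 by (rule jac_tensor[OF VD(1) va_moduleD(1)[OF m] va_moduleD(1)[OF m] va_moduleD(1)[OF m] pi_is_vop pi_is_vop pi_is_vop pi_is_vop])
  (rule va_moduleD(3)[OF m], rule pi_jacobi)

lemma tpi_exp_0: "YT (tensor a (pi_exp 0)) n v = tA (YW a) n v"
 unfolding tpi_vop_def by (rule tensor_vop_id_right[OF va_moduleD(1)[OF m] pi_is_vop]) (simp add: YW_pi_exp exp_vop_0)

lemma tpi_vac_left: "YT (tensor vac f) n v = tU (pi_vop k r lam f) n v"
 unfolding tpi_vop_def by (rule tensor_vop_id_left[OF va_moduleD(1)[OF m] pi_is_vop va_moduleD(2)[OF m]])

lemma tpi_vac_id: "YT (tpi_vac vac) = id_fld"
proof (intro ext)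
 fix n and v :: "'w tpi"
 have "tU id_fld n v = id_fld n v"
  by (rule tpi_linear_eq[of "tU id_fld n" "id_fld n"])
   (auto simp: is_fld_linear[OF tU_fld[OF is_fld_id]] is_fld_linear[OF is_fld_id] tU_tensor[OF is_fld_id] id_fld_def tensor_0_right)
 then show "YT (tpi_vac vac) n v = id_fld n v" unfolding tpi_vac_def tpi_vac_left by (simp add: YW_pi_exp exp_vop_0)
qed

lemma tpi_omega_eq: "YT (tpi_omega k vac conf) n v = tA (YW conf) n v + tU (pi_vop k r lam (pi_omega k)) n v"
 unfolding tpi_omega_def vop1_add[OF tpi_is_vop] tpi_exp_0 tpi_vac_left ..

lemma tpi_omega_tensor: "YT (tpi_omega k vac conf) n (tensor w g) = tensor (YW conf n w) g + tensor w (pi_vop k r lam (pi_omega k) n g)"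
 unfolding tpi_omega_eq tA_tensor[OF is_vop_fld[OF va_moduleD(1)[OF m]]] tU_tensor[OF is_vop_fld[OF pi_is_vop]] ..

end

text \<open>L(-1) of the tensor product is the sum of the translations of the factors; this is
  \<open>tensor_vop_der\<close> with offset 0.\<close>

lemma tpi_translation:
 fixes YW :: "('a, int, 'w::complex_vector, 'w) vop"
 assumes m: "va_module UNIV Y vac YW"
 shows "tpi_vop k YW r lam (tpi_vop k Y 0 0 (tpi_omega k vac conf) 0 u) n v = - of_int n *s tpi_vop k YW r lam u (n - 1) v"
proof -
 have "tpi_vop k YW r lam (tmap (Y conf 0) (\<lambda>p. p) u + tmap (\<lambda>w. w) (pi_D k 0 0) u) n v = - of_int n *s tpi_vop k YW r lam u (n - 1) v"
  unfolding tpi_vop_def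
  by (rule tensor_vop_der[OF va_moduleD(1)[OF m] pi_is_vop is_vop_linear[OF VD(1)] pi_D_linear, where \<alpha> = 0])
   (simp_all add: module_translation[OF m] pi_vop_T der_def)
 then show ?thesis unfolding tpi_omega_eq[OF VD(4)] tA_def tU_def pi_D_def .
qed

lemma tpi_L_comm:
 fixes YW :: "('a, int, 'w::complex_vector, 'w) vop"
 assumes m: "va_module UNIV Y vac YW"
 shows "tpi_vop k YW r lam (tpi_omega k vac conf) 0 (tpi_vop k YW r lam a n w) =
  tpi_vop k YW r lam a n (tpi_vop k YW r lam (tpi_omega k vac conf) 0 w) - of_int n *s tpi_vop k YW r lam a (n - 1) w"
proof -
 let ?Y = "tpi_vop k YW r lam" and ?o = "tpi_omega k vac conf"
 have "Sum_any (\<lambda>i::nat. bin 0 i *s ?Y (tpi_vop k Y 0 0 ?o (int i) a) (0 + n - int i) w) = - of_int n *s ?Y a (n - 1) w"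
  using tpi_translation[OF m, of r lam a n w] by (subst SA_single[of 0]) (simp_all add: bin_0_left[of "_ :: nat", simplified] scaleC_one)
 then show ?thesis using jac_comm[OF tpi_jac[OF m, where u = ?o and v = a and r = r and lam = lam], where m = 0 and n = n and x = w] by (simp add: algebra_simps)
qed

lemma tpi_intertwining:
 fixes Y1 :: "('a, int, 'w::complex_vector, 'w) vop" and Y2 :: "('a, int, 'x::complex_vector, 'x) vop" and Y3 :: "('a, int, 'y::complex_vector, 'y) vop" and \<alpha> :: complex
 assumes m1: "va_module UNIV Y vac Y1" and m2: "va_module UNIV Y vac Y2" and m3: "va_module UNIV Y vac Y3"
  and I1: "intertwining_operator conf Y1 Y2 Y3 I1"
  and I2: "intertwining_operator (pi_omega k) (pi_vop k r1 l1) (pi_vop k r2 l2) (pi_vop k r3 l3) I2"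
 defines "J \<equiv> tensor_vop (shift_vop \<alpha> I1) (shift_vop (- \<alpha>) I2)"
 shows tpi_intertwining_is_vop: "is_vop J"
  and tpi_intertwining_jac: "jac (tpi_vop k Y1 r1 l1) (tpi_vop k Y2 r2 l2) (tpi_vop k Y3 r3 l3) J u w"
  and tpi_intertwining_der: "J (tpi_vop k Y1 r1 l1 (tpi_omega k vac conf) 0 w) n x = - of_int n *s J w (n - 1) x"
proof -
 note v = shift_vop_is_vop[OF I1, of \<alpha>] shift_vop_is_vop[OF I2, of "- \<alpha>"]
 show "is_vop J" unfolding J_def by (rule tensor_is_vop[OF v])
 show "jac (tpi_vop k Y1 r1 l1) (tpi_vop k Y2 r2 l2) (tpi_vop k Y3 r3 l3) J u w"
  unfolding J_def tpi_vop_def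
  by (rule jac_tensor[OF va_moduleD(1)[OF m1] va_moduleD(1)[OF m2] va_moduleD(1)[OF m3] v(1) pi_is_vop pi_is_vop pi_is_vop v(2)])
   (rule shift_vop_jac[OF I1], rule shift_vop_jac[OF I2])
 have "J (tmap (Y1 conf 0) (\<lambda>p. p) w + tmap (\<lambda>w. w) (pi_vop k r1 l1 (pi_omega k) 0) w) n x = - of_int n *s J w (n - 1) x"
  unfolding J_def
  by (rule tensor_vop_der[OF v is_vop_linear[OF va_moduleD(1)[OF m1]] is_vop_linear[OF pi_is_vop] shift_vop_der[OF I1] shift_vop_der[OF I2]])
 then show "J (tpi_vop k Y1 r1 l1 (tpi_omega k vac conf) 0 w) n x = - of_int n *s J w (n - 1) x"
  unfolding tpi_omega_eq[OF m1] tA_def tU_def .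
qed

end

section \<open>The screening operator annihilates the affine vertex algebra\<close>

text \<open>For these values of \<open>h\<close> and \<open>c\<close> the difference is annihilated
  by L(1) and L(2), and by the higher modes anyway. It is singular of weight \<open>h + 2\<close>
  and hence zero by irreducibility. With t = p'/p the values are h(2,1) and the central
  charge.\<close>

lemma virasoro_null_vector:
 assumes irr: "irreducible_highest_weight c h L v" and t: "t \<noteq> 0"
  and h: "h = 3 * t / 4 - 1 / 2" and c: "c = 13 - 6 * t - 6 / t"
 shows "L (-1) (L (-1) v) = t *s L (-2) v"
proof -
 note lin = clinear_0[OF vir_linear[OF irr]] clinear_add[OF vir_linear[OF irr]] clinear_scale[OF vir_linear[OF irr]] clinear_diff[OF vir_linear[OF irr]]
 note comm = vir_comm[OF irr] and L0 = hw_L0[OF irr] and pos = hw_pos[OF irr]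
 let ?w = "L (-1) v"
 have w0: "L 0 ?w = (h + 1) *s ?w" using vir_L0_shift[OF irr L0, of "-1"] by simp
 have w1: "L 1 ?w = (2 * h) *s v" using comm[of 1 "-1" v] by (simp add: pos lin L0 scaleC_scaleC)
 have wn: "L n ?w = 0" if "n \<ge> 2" for n using comm[of n "-1" v] that by (simp add: pos lin)
 have ww0: "L 0 (L (-1) ?w) = (h + 2) *s L (-1) ?w" using vir_L0_shift[OF irr w0, of "-1"] by (simp add: add.assoc)
 have u0: "L 0 (L (-2) v) = (h + 2) *s L (-2) v" using vir_L0_shift[OF irr L0, of "-2"] by simp
 have "L (-1) ?w - t *s L (-2) v = 0"
 proof (rule singular_zero[OF irr])
  show "L 0 (L (-1) ?w - t *s L (-2) v) = (h + 2) *s (L (-1) ?w - t *s L (-2) v)"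
   by (simp add: lin ww0 u0 scaleC_diff_right scaleC_scaleC mult.commute)
  show "L n (L (-1) ?w - t *s L (-2) v) = 0" if n: "n > 0" for n
  proof -
   consider "n = 1" | "n = 2" | "n \<ge> 3" using n by linarith
   then show ?thesis
   proof cases
    case 1
    have "L 1 (L (-1) ?w) = (2 * h) *s ?w + (2 * (h + 1)) *s ?w"
     using comm[of 1 "-1" ?w] by (simp add: w1 w0 lin scaleC_scaleC)
    then have "L 1 (L (-1) ?w) = (4 * h + 2) *s ?w" unfolding scaleC_add_left[symmetric] by (simp add: distrib_left)
    moreover have "L 1 (L (-2) v) = 3 *s ?w" using comm[of 1 "-2" v] by (simp add: pos lin)
    ultimately show ?thesis unfolding 1 by (simp add: lin scaleC_scaleC scaleC_diff_left[symmetric] h)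
   next
    case 2
    have "L 2 (L (-1) ?w) = (6 * h) *s v"
     using comm[of 2 "-1" ?w] by (simp add: w1 wn lin scaleC_scaleC)
    moreover have "L 2 (L (-2) v) = (4 * h + c / 2) *s v"
     using comm[of 2 "-2" v] by (simp add: pos lin L0 scaleC_scaleC scaleC_add_left)
    moreover have "6 * h - t * (4 * h + c / 2) = 0" unfolding h c using t by (simp add: field_simps)
    ultimately show ?thesis unfolding 2 by (simp add: lin scaleC_scaleC scaleC_diff_left[symmetric])
   next
    case 3
    have "L n (L (-1) ?w) = 0" using comm[of n "-1" ?w] 3 by (simp add: wn lin)
    moreover have "L n (L (-2) v) = 0" using comm[of n "-2" v] 3 by (simp add: pos lin)
    ultimately show ?thesis by (simp add: lin)
   qed
  qed
 qed simp
 then show ?thesis by simp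
qed

lemma SA_finite: "finite A \<Longrightarrow> (\<And>i. i \<notin> A \<Longrightarrow> f i = 0) \<Longrightarrow> Sum_any f = sum f A"
 by (rule Sum_any.expand_superset) auto

section \<open>Highest modes of normally ordered products on a leading vector\<close>

context
 fixes N B :: "(pi, pi) fld" and y :: pi and \<kappa> :: complex and Q :: int
 assumes N: "is_fld N" and B: "is_fld B" and Ny: "\<And>i. i \<ge> 0 \<Longrightarrow> N i y = (if i = 0 then \<kappa> else 0) *s y" and BQ: "\<And>q. q > Q \<Longrightarrow> B q y = 0"
begin

lemma N0: "N n 0 = 0" using fld_0[OF N] .

text \<open>Among the nonnegative modes of \<open>N\<close> only the zero mode acts on
  \<open>y\<close>, by the scalar \<open>\<kappa>\<close>; the annihilation half of the normal
  ordering is thus a single term.\<close>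

lemma normal_product_m1:
 assumes C: "is_fld C" and CK: "\<And>i. i \<ge> K \<Longrightarrow> C (q + int i) y = 0"
 shows "pr N (-1) C q y = (\<Sum>i<K. N (-1 - int i) (C (q + int i) y)) + \<kappa> *s C (q - 1) y"
proof -
 have "pr N (-1) C q y = Sum_any (\<lambda>i::nat. N (-1 - int i) (C (q + int i) y)) + Sum_any (\<lambda>i::nat. C (q - 1 - int i) (N (int i) y))"
  unfolding prd_m1 by (rule SA_add[OF fld_fs_lin[OF C is_fld_linear[OF N]]])
   (rule fs_nat[of 1], auto simp: Ny fld_0[OF C])
 also have "Sum_any (\<lambda>i::nat. C (q - 1 - int i) (N (int i) y)) = \<kappa> *s C (q - 1) y"
  by (subst SA_single[of 0]) (auto simp: Ny fld_0[OF C] fld_scale[OF C])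
 also have "Sum_any (\<lambda>i::nat. N (-1 - int i) (C (q + int i) y)) = (\<Sum>i<K. N (-1 - int i) (C (q + int i) y))"
  by (rule SA_nat) (simp add: CK N0)
 finally show ?thesis .
qed

lemma normal_product_m2:
 assumes CK: "\<And>i. i \<ge> K \<Longrightarrow> B (q + int i) y = 0"
 shows "pr N (-2) B q y = (\<Sum>i<K. of_nat (Suc i) *s N (-2 - int i) (B (q + int i) y)) - \<kappa> *s B (q - 2) y"
proof -
 have d: "der N (int i) y = (if i = 1 then - \<kappa> else 0) *s y" for i by (cases "i = 0") (auto simp: der_def Ny scaleC_scaleC)
 have "pr N (-2) B q y = pr (der N) (-1) B q y" using prd_der_left[OF N B, of "-1" q y] by (simp add: scaleC_one)
 also have "\<dots> = Sum_any (\<lambda>i::nat. der N (-1 - int i) (B (q + int i) y)) + Sum_any (\<lambda>i::nat. B (q - 1 - int i) (der N (int i) y))"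
  unfolding prd_m1 by (rule SA_add[OF fld_fs_lin[OF B is_fld_linear[OF is_fld_der[OF N]]]])
   (rule fs_nat[of 2], auto simp: d fld_0[OF B])
 also have "Sum_any (\<lambda>i::nat. B (q - 1 - int i) (der N (int i) y)) = - \<kappa> *s B (q - 2) y"
  using d[of 1] by (subst SA_single[of 1]) (auto simp: d fld_0[OF B] fld_scale[OF B] fld_minus[OF B])
 also have "Sum_any (\<lambda>i::nat. der N (-1 - int i) (B (q + int i) y)) = (\<Sum>i<K. of_nat (Suc i) *s N (-2 - int i) (B (q + int i) y))"
 proof -
  have "der N (-1 - int i) u = of_nat (Suc i) *s N (-2 - int i) u" for i u
  proof -
   have "-1 - int i - 1 = -2 - int i" "- of_int (-1 - int i) = (of_nat (Suc i) :: complex)" by simp_all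
   then show ?thesis unfolding der_def by (simp only:)
  qed
  then show ?thesis by (subst SA_nat[of K]) (simp_all add: CK N0 del: of_nat_Suc)
 qed
 finally show ?thesis by simp
qed

lemmas N_lin = fld_add[OF N] fld_scale[OF N]

lemma B1_vals:
 "q > Q + 1 \<Longrightarrow> pr N (-1) B q y = 0"
 "pr N (-1) B (Q + 1) y = \<kappa> *s B Q y"
 "pr N (-1) B Q y = N (-1) (B Q y) + \<kappa> *s B (Q - 1) y"
 "pr N (-1) B (Q - 1) y = N (-1) (B (Q - 1) y) + N (-2) (B Q y) + \<kappa> *s B (Q - 2) y"
proof -
 show "pr N (-1) B q y = 0" if "q > Q + 1" using that BQ by (subst normal_product_m1[OF B, of 0]) auto
 show "pr N (-1) B (Q + 1) y = \<kappa> *s B Q y" using BQ by (subst normal_product_m1[OF B, of 0]) auto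
 show "pr N (-1) B Q y = N (-1) (B Q y) + \<kappa> *s B (Q - 1) y" using BQ by (subst normal_product_m1[OF B, of 1]) auto
 show "pr N (-1) B (Q - 1) y = N (-1) (B (Q - 1) y) + N (-2) (B Q y) + \<kappa> *s B (Q - 2) y"
  using BQ by (subst normal_product_m1[OF B, of 2]) (auto simp: numeral_2_eq_2)
qed

lemma B2_vals:
 "q > Q + 2 \<Longrightarrow> pr N (-1) (pr N (-1) B) q y = 0"
 "pr N (-1) (pr N (-1) B) (Q + 2) y = (\<kappa> * \<kappa>) *s B Q y"
 "pr N (-1) (pr N (-1) B) (Q + 1) y = (2 * \<kappa>) *s N (-1) (B Q y) + (\<kappa> * \<kappa>) *s B (Q - 1) y"
 "pr N (-1) (pr N (-1) B) Q y = N (-1) (N (-1) (B Q y)) + (2 * \<kappa>) *s N (-1) (B (Q - 1) y) + (2 * \<kappa>) *s N (-2) (B Q y) + (\<kappa> * \<kappa>) *s B (Q - 2) y"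
proof -
 note C = prd_fld[OF N N B, of "-1"]
 have dbl: "(2 * \<kappa>) *s X = \<kappa> *s X + \<kappa> *s X" for X :: pi by (simp add: scaleC_add_left[symmetric])
 show "pr N (-1) (pr N (-1) B) q y = 0" if "q > Q + 2" using that B1_vals(1) by (subst normal_product_m1[OF C, of 0]) auto
 show "pr N (-1) (pr N (-1) B) (Q + 2) y = (\<kappa> * \<kappa>) *s B Q y"
  using B1_vals(1,2) by (subst normal_product_m1[OF C, of 0]) (auto simp: scaleC_scaleC add.commute[of 1])
 show "pr N (-1) (pr N (-1) B) (Q + 1) y = (2 * \<kappa>) *s N (-1) (B Q y) + (\<kappa> * \<kappa>) *s B (Q - 1) y"
  using B1_vals by (subst normal_product_m1[OF C, of 1]) (auto simp: scaleC_scaleC N_lin dbl scaleC_add_right add.assoc)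
 show "pr N (-1) (pr N (-1) B) Q y = N (-1) (N (-1) (B Q y)) + (2 * \<kappa>) *s N (-1) (B (Q - 1) y) + (2 * \<kappa>) *s N (-2) (B Q y) + (\<kappa> * \<kappa>) *s B (Q - 2) y"
  using B1_vals by (subst normal_product_m1[OF C, of 2]) (auto simp: numeral_2_eq_2 scaleC_scaleC N_lin dbl scaleC_add_right add_ac)
qed

lemma B3_vals:
 "q > Q + 2 \<Longrightarrow> pr N (-2) B q y = 0"
 "pr N (-2) B (Q + 2) y = - \<kappa> *s B Q y"
 "pr N (-2) B (Q + 1) y = - \<kappa> *s B (Q - 1) y"
 "pr N (-2) B Q y = N (-2) (B Q y) - \<kappa> *s B (Q - 2) y"
proof -
 show "pr N (-2) B q y = 0" if "q > Q + 2" using that BQ by (subst normal_product_m2[of 0]) auto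
 show "pr N (-2) B (Q + 2) y = - \<kappa> *s B Q y" using BQ by (subst normal_product_m2[of 0]) auto
 show "pr N (-2) B (Q + 1) y = - \<kappa> *s B (Q - 1) y" using BQ by (subst normal_product_m2[of 0]) (auto simp: diff_add_eq[symmetric])
 show "pr N (-2) B Q y = N (-2) (B Q y) - \<kappa> *s B (Q - 2) y" using BQ by (subst normal_product_m2[of 1]) (auto simp: scaleC_one)
qed

end

context
 fixes k c t b h21 \<kappa> :: complex and Y :: "('a::complex_vector, int, 'a, 'a) vop" and vac conf :: 'a
  and Y21 :: "('a, int, 'b::complex_vector, 'b) vop" and v21 :: 'b
 assumes va: "simple_virasoro_va c Y vac conf" and m21: "irreducible_virasoro_module Y vac conf c h21 Y21 v21"
  and t: "t \<noteq> 0" "t = k + 2" and b: "b = - k / 2" and h21: "h21 = 3 * t / 4 - 1 / 2" and \<kappa>: "\<kappa> = - k / 2" and c: "c = 13 - 6 * t - 6 / t"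
begin

abbreviation (input) "Ymm \<equiv> tpi_vop k Y21 1 b"
abbreviation (input) "LM \<equiv> tpi_vop k Y21 1 b (tpi_omega k vac conf) 0"
abbreviation (input) "sv \<equiv> tensor v21 (pi_exp 0)"
abbreviation (input) "NN \<equiv> heis_op k 1 b (nu_vec k)"
abbreviation (input) "En n \<equiv> exp_vop k 1 b (-1) n (pi_exp 0)"

lemma m21': "va_module UNIV Y vac Y21" and irr21: "irreducible_highest_weight c h21 (\<lambda>n. Y21 conf (n + 1)) v21"
 using m21 by (simp_all add: irreducible_virasoro_module_def)

lemma nu_top: "top_wt k 1 b 0 = nu_vec k"
 by (simp add: b top_wt_def mu_vec_def nu_vec_def c_vec_def scaleC_prod_def scaleC_complex_def)

text \<open>\<open>\<kappa>\<close> is the norm <nu,nu> = -k/2, by which nu(0) acts on e^nu.\<close>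

lemma NN_0: "i \<ge> 0 \<Longrightarrow> NN i (pi_exp 0) = (if i = 0 then \<kappa> else 0) *s pi_exp 0"
 by (subst heis_pi_exp) (auto simp: nu_top form_def nu_vec_def \<kappa>)

lemma En_pos: "n > 0 \<Longrightarrow> En n = 0" by (simp add: exp_vop_pi_exp Em_neg)

lemma D_En: "pi_D k 1 b (En n) = NN (-1) (En n) + (1 - of_int n) *s En (n - 1)"
proof -
 have "pi_D k 1 b (pi_exp 0) = NN (-1) (pi_exp 0)" using pi_D_exp[of k 1 b 0] unfolding nu_top .
 moreover have "NN (-1) (En n) - exp_vop k 1 b (-1) n (NN (-1) (pi_exp 0)) = - En (n - 1)"
  unfolding exp_vop_comm by (simp add: nu_vec_def scaleC_one)
 ultimately show ?thesis using pi_D_exp_vop[of k 1 b "-1" n "pi_exp 0"] by (simp add: scaleC_diff_left scaleC_one algebra_simps)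
qed

lemma D_NN: "pi_D k 1 b (NN n x) = NN n (pi_D k 1 b x) - of_int n *s NN (n - 1) x"
 by (rule pi_D_heis)

lemma LM_tensor: "LM (tensor w g) = tensor (Y21 conf 0 w) g + tensor w (pi_D k 1 b g)"
 unfolding tpi_omega_tensor[OF va m21'] pi_D_def ..

lemma LM_linear: "clinear LM" by (rule is_vop_linear[OF tpi_is_vop[OF va m21']])

lemmas T_lin = tensor_add_left tensor_add_right tensor_scale_left tensor_scale_right
 tensor_0_left tensor_0_right tensor_diff_right tensor_minus_right

lemma vac_mode: "Ymm (tensor vac f) n (tensor w g) = tensor w (pi_vop k 1 b f n g)"
 unfolding tpi_vac_left[OF va m21'] tU_tensor[OF is_vop_fld[OF pi_is_vop]] ..

abbreviation (input) "ff \<equiv> sl2_f k vac conf"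
abbreviation (input) "Lv n \<equiv> Y21 conf (n + 1) v21"

lemma f_mode: "Ymm ff n sv = (k + 2) *s Sum_any (\<lambda>i. tensor (Y21 conf i v21) (En (n - 1 - i)))
  - tensor v21 (pr NN (-1) (pr NN (-1) (exp_vop k 1 b (-1))) n (pi_exp 0) + (k + 1) *s pr NN (-2) (exp_vop k 1 b (-1)) n (pi_exp 0))"
proof -
 note M = tpi_is_vop[OF va m21', where r = 1 and lam = b]
 have "Ymm (tensor conf (pi_exp (-1))) n sv = Sum_any (\<lambda>i. tensor (Y21 conf i v21) (En (n - 1 - i)))"
  unfolding tpi_vop_def tensor_vop_pure[OF va_moduleD(1)[OF m21'] pi_is_vop] cvl_def YW_pi_exp ..
 then show ?thesis
  unfolding sl2_f_def vop1_diff[OF M] vop1_scale[OF M] vac_mode pi_heis_def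
   vop1_add[OF pi_is_vop] vop1_scale[OF pi_is_vop] YW_heis YW_pi_exp by simp
qed

lemma om_v21: "i \<ge> 2 \<Longrightarrow> Y21 conf i v21 = 0" "Y21 conf 1 v21 = h21 *s v21"
 using hw_pos[OF irr21, of "i - 1"] hw_L0[OF irr21] by simp_all

lemma f_sum: "n \<ge> 0 \<Longrightarrow> Sum_any (\<lambda>i. tensor (Y21 conf i v21) (En (n - 1 - i))) = (\<Sum>i\<in>{n - 1..1}. tensor (Y21 conf i v21) (En (n - 1 - i)))"
 by (rule SA_finite) (auto simp: om_v21(1) En_pos T_lin not_le)

lemmas NN_vals = B2_vals[where Q = 0, OF heis_fld exp_vop_fld NN_0 En_pos, simplified] B3_vals[where Q = 0, OF heis_fld exp_vop_fld NN_0 En_pos, simplified]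

text \<open>Above index 2 the modes of \<open>f\<close> kill s, so the skew-symmetric expression for
  s_0 f has three terms, whose ingredients are listed here.\<close>

lemma f_modes:
 shows "n \<ge> 3 \<Longrightarrow> Ymm ff n sv = 0"
  and "Ymm ff 2 sv = (2 * k + 2) *s tensor v21 (En 0)"
  and "Ymm ff 1 sv = (k + 2) *s tensor (Lv (-1)) (En 0) + k *s tensor v21 (NN (-1) (En 0)) + (2 * k + 2) *s tensor v21 (En (-1))"
  and "Ymm ff 0 sv = (k + 2) *s tensor (Lv (-2)) (En 0) + (k + 2) *s tensor (Lv (-1)) (En (-1)) + (2 * k + 2) *s tensor v21 (En (-2))
   - tensor v21 (NN (-1) (NN (-1) (En 0))) + k *s tensor v21 (NN (-1) (En (-1))) - tensor v21 (NN (-2) (En 0))"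
proof -
 have fz: "\<lbrakk>n > m; m = 1\<rbrakk> \<Longrightarrow> {n..m} = {}" for n m :: int by simp
 have i0: "{-1..1} = {-1, 0, 1 :: int}" "{0..1} = {0, 1 :: int}" by auto
 \<comment> \<open>The weight of \<open>v21\<close> meets the scalars coming from nu: all
   contributions to the coefficient of the top vector are combined here.\<close>
 have e: "((k + 2) * h21) *s X = (2 * k + 2) *s X + (\<kappa> * \<kappa>) *s X - ((k + 1) * \<kappa>) *s X" for X :: "'b tpi"
 proof -
  have "(k + 2) * h21 = (2 * k + 2) + \<kappa> * \<kappa> - (k + 1) * \<kappa>" unfolding h21 \<kappa> t(2) by (simp add: field_simps)
  then show ?thesis by (simp only: scaleC_add_left scaleC_diff_left)
 qed
 have k2: "2 * \<kappa> = - k" by (simp add: \<kappa>)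
 have k1: "(k + 1) *s X = k *s X + X" for X :: "'b tpi" by (simp add: scaleC_add_left scaleC_one)
 note simps = scaleC_scaleC scaleC_add_right scaleC_diff_right T_lin e k2 om_v21(2)
 show "Ymm ff n sv = 0" if "n \<ge> 3"
  using that NN_vals(1)[of n] NN_vals(5)[of n] unfolding f_mode by (simp add: f_sum fz T_lin)
 show "Ymm ff 2 sv = (2 * k + 2) *s tensor v21 (En 0)"
  using NN_vals(2,6) unfolding f_mode f_sum[OF zero_le_numeral] by (simp add: simps)
 show "Ymm ff 1 sv = (k + 2) *s tensor (Lv (-1)) (En 0) + k *s tensor v21 (NN (-1) (En 0)) + (2 * k + 2) *s tensor v21 (En (-1))"
  using NN_vals(3,7) unfolding f_mode f_sum[OF zero_le_one] by (simp add: simps i0)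
 show "Ymm ff 0 sv = (k + 2) *s tensor (Lv (-2)) (En 0) + (k + 2) *s tensor (Lv (-1)) (En (-1)) + (2 * k + 2) *s tensor v21 (En (-2))
   - tensor v21 (NN (-1) (NN (-1) (En 0))) + k *s tensor v21 (NN (-1) (En (-1))) - tensor v21 (NN (-2) (En 0))"
  using NN_vals(4,8) unfolding f_mode f_sum[OF order_refl] by (simp add: simps i0 k1)
qed

text \<open>Coordinates with respect to the eight vectors in which the three terms of s_0 f are
  expressed; applying L(-1) becomes arithmetic with coefficients.\<close>

definition lc8 :: "complex \<Rightarrow> complex \<Rightarrow> complex \<Rightarrow> complex \<Rightarrow> complex \<Rightarrow> complex \<Rightarrow> complex \<Rightarrow> complex \<Rightarrow> 'b tpi" where
 "lc8 a1 a2 a3 a4 a5 a6 a7 a8 = a1 *s tensor (Lv (-2)) (En 0) + a2 *s tensor (Y21 conf 0 (Lv (-1))) (En 0) + a3 *s tensor (Lv (-1)) (NN (-1) (En 0))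
   + a4 *s tensor (Lv (-1)) (En (-1)) + a5 *s tensor v21 (En (-2)) + a6 *s tensor v21 (NN (-1) (NN (-1) (En 0)))
   + a7 *s tensor v21 (NN (-1) (En (-1))) + a8 *s tensor v21 (NN (-2) (En 0))"

lemma lc8_add: "lc8 a1 a2 a3 a4 a5 a6 a7 a8 + lc8 b1 b2 b3 b4 b5 b6 b7 b8 = lc8 (a1 + b1) (a2 + b2) (a3 + b3) (a4 + b4) (a5 + b5) (a6 + b6) (a7 + b7) (a8 + b8)"
 by (simp add: lc8_def scaleC_add_left add_ac)

lemma lc8_scale: "x *s lc8 a1 a2 a3 a4 a5 a6 a7 a8 = lc8 (x * a1) (x * a2) (x * a3) (x * a4) (x * a5) (x * a6) (x * a7) (x * a8)"
 by (simp add: lc8_def scaleC_add_right scaleC_scaleC)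

text \<open>Skew-symmetry gives s_0 f = - f_0 s + L(-1) f_1 s - (1/2) L(-1)^2 f_2 s. All terms with
  a mode of nu or a lower mode of the exponential cancel, and the null vector tensored with the top
  exponential remains.\<close>

lemma screening_f: "skew LM Ymm sv 0 ff = 0"
proof -
 note NL = heis_lin_add heis_lin_scale and LL = clinear_add[OF LM_linear] clinear_scale[OF LM_linear]
 note D = D_En[of 0, simplified] D_En[of "-1", simplified] D_NN[of "-1", simplified]
 have 1: "LM (tensor (Lv (-1)) (En 0)) = lc8 0 1 1 1 0 0 0 0" by (simp add: LM_tensor D T_lin lc8_def scaleC_one)
 have 2: "LM (tensor v21 (NN (-1) (En 0))) = lc8 0 0 1 0 0 1 1 1" by (simp add: LM_tensor D T_lin lc8_def NL scaleC_one)
 have 3: "LM (tensor v21 (En (-1))) = lc8 0 0 0 1 2 0 1 0" by (simp add: LM_tensor D T_lin lc8_def scaleC_one)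
 have 4: "LM (tensor v21 (En 0)) = tensor (Lv (-1)) (En 0) + tensor v21 (NN (-1) (En 0)) + tensor v21 (En (-1))"
  by (simp add: LM_tensor D T_lin)
 have f0: "Ymm ff 0 sv = lc8 (k + 2) 0 0 (k + 2) (2 * k + 2) (-1) k (-1)"
  unfolding f_modes(4) by (simp add: lc8_def scaleC_one)
 have f1: "LM (Ymm ff 1 sv) = lc8 0 (k + 2) (2 * k + 2) (3 * k + 4) (4 * k + 4) k (3 * k + 2) k"
  unfolding f_modes(3) LL 1 2 3 lc8_scale lc8_add by (simp add: algebra_simps)
 have f2: "LM (LM (Ymm ff 2 sv)) = (2 * k + 2) *s lc8 0 1 2 2 2 1 2 1"
  unfolding f_modes(2) LL 4 1 2 3 lc8_add by simp
 have n: "Y21 conf 0 (Lv (-1)) = (k + 2) *s Lv (-2)"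
  using virasoro_null_vector[OF irr21 t(1) h21 c] unfolding t(2) by simp
 have "skew LM Ymm sv 0 ff = (\<Sum>j<3. sg (0 + int j + 1) *s dpow LM j (Ymm ff (0 + int j) sv))"
  unfolding skew_def using f_modes(1) by (intro SA_nat) (simp add: clinear_0[OF dpow_linear[OF LM_linear]])
 also have "\<dots> = (-1) *s Ymm ff 0 sv + LM (Ymm ff 1 sv) + (- 1 / 2) *s LM (LM (Ymm ff 2 sv))"
  by (simp add: numeral_3_eq_3 dpow_def scaleC_one)
 also have "\<dots> = lc8 (- (k + 2)) 1 0 0 0 0 0 0"
  unfolding f0 f1 f2 lc8_scale lc8_add by (simp add: algebra_simps)
 also have "\<dots> = 0" unfolding lc8_def n by (simp add: T_lin scaleC_one scaleC_diff_left scaleC_add_left)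
 finally show ?thesis .
qed

lemma screening_modes_zero: "(\<And>j. j \<ge> 0 \<Longrightarrow> Ymm a j sv = 0) \<Longrightarrow> n \<ge> 0 \<Longrightarrow> skew LM Ymm sv n a = 0"
 unfolding skew_def by (rule SA_zero) (simp add: clinear_0[OF dpow_linear[OF LM_linear]])

lemma screening_e: "skew LM Ymm sv 0 (sl2_e vac) = 0"
 by (rule screening_modes_zero) (simp_all add: sl2_e_def vac_mode YW_pi_exp exp_vop_pi_exp Em_neg T_lin)

lemma screening_h: "skew LM Ymm sv 0 (sl2_h k vac) = 0"
proof (rule screening_modes_zero)
 fix j :: int assume "j \<ge> 0"
 then have "heis_op k 1 b (mu_vec k) j (pi_exp 0) = 0"
  by (simp add: heis_pi_exp nu_top form_def mu_vec_def nu_vec_def)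
 then show "Ymm (sl2_h k vac) j sv = 0"
  using YW_h_vec[of k 1 b "mu_vec k"] unfolding sl2_h_def vac_mode pi_heis_def h_vec_def vop1_scale[OF pi_is_vop] by (simp add: T_lin)
qed simp

text \<open>s_0 is a derivation of all products, by \<open>skew_skew_comm\<close> at index 0, so its
  kernel is closed under modes and it suffices to check the generators.\<close>

lemma screening_affine: "a \<in> affine_sl2 k Y vac conf \<Longrightarrow> skew LM Ymm sv 0 a = 0"
 unfolding affine_sl2_def
proof (induction rule: vertex_subalgebra.induct)
 case vac
 show ?case by (rule screening_modes_zero) (simp_all add: tpi_vac_id[OF va m21'] id_fld_def)
next
 case (gen a)
 then show ?case using screening_e screening_h screening_f by blast
next
 case (mode a d n)
 note M = tpi_is_vop[OF va m21', where r = 1 and lam = b]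
 note V = tpi_is_vop[OF va VD(4)[OF va], where r = 0 and lam = 0]
 note ly = tpi_L_comm[OF va m21', where r = 1 and lam = b]
 note sv = skew_is_vop[OF LM_linear V M ly]
 have "skew LM Ymm sv 0 (tpi_vop k Y 0 0 a n d) = Ymm a n (skew LM Ymm sv 0 d) + Sum_any (\<lambda>j::nat. bin 0 j *s skew LM Ymm (skew LM Ymm sv (int j) a) (0 + n - int j) d)"
  by (rule skew_skew_comm[OF LM_linear V M ly tpi_jac[OF va m21'] tpi_jac[OF va m21']])
 also have "\<dots> = 0"
  using mode(3,4) by (subst SA_single[of 0]) (simp_all add: bin_0_left[of "_ :: nat", simplified] vop_0[OF M] is_vop_0[OF sv])
 finally show ?case .
qed (use skew_is_vop[OF LM_linear tpi_is_vop[OF va VD(4)[OF va], where r = 0 and lam = 0] tpi_is_vop[OF va m21', where r = 1 and lam = b] tpi_L_comm[OF va m21', where r = 1 and lam = b]]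
  in \<open>simp_all add: clinear_add[OF is_vop_linear] clinear_scale[OF is_vop_linear]\<close>)

end

section \<open>The Sugawara vector\<close>

context
 fixes k c :: complex and Y :: "('a::complex_vector, int, 'a, 'a) vop" and vac conf :: 'a
 assumes va: "simple_virasoro_va c Y vac conf" and k2: "k + 2 \<noteq> 0"
begin

abbreviation (input) "Nn m \<equiv> heis_op k 0 0 (nu_vec k) m"
abbreviation (input) "Cc m \<equiv> heis_op k 0 0 c_vec m"
abbreviation (input) "Ep1 \<equiv> exp_vop k 0 0 1"
abbreviation (input) "Em1 \<equiv> exp_vop k 0 0 (-1)"
abbreviation (input) "vc1 \<equiv> pi_exp 0"

lemma V_mod: "va_module UNIV Y vac Y" by (rule VD(4)[OF va])

lemma Em_0: "Em k 0 0 i 0 w = w" by (simp add: Em_def expz_0)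

lemma Em_small: "Em k 0 0 i 1 w = of_int i *s Cc (-1) w"
 "Em k 0 0 i 2 w = (1 / 2) *s of_int i *s (of_int i *s Cc (-1) (Cc (-1) w) + Cc (-2) w)"
proof -
 note E0 = Em_0
 have 1: "Em k 0 0 i 1 w = of_int i *s Sum_any (\<lambda>m::nat. Cc (- 1 - int m) (Em k 0 0 i (1 - 1 - int m) w))"
  using Em_rec[of 1 k 0 0 i w] by (simp only: of_int_1 scaleC_one)
 show e1: "Em k 0 0 i 1 w = of_int i *s Cc (-1) w"
  unfolding 1 by (subst SA_nat[of 1]) (auto simp: Em_neg heis_lin_0 E0)
 have 2: "2 *s Em k 0 0 i 2 w = of_int i *s Sum_any (\<lambda>m::nat. Cc (- 1 - int m) (Em k 0 0 i (2 - 1 - int m) w))"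
  using Em_rec[of 2 k 0 0 i w] by (simp only: of_int_numeral)
 have "2 *s Em k 0 0 i 2 w = of_int i *s (of_int i *s Cc (-1) (Cc (-1) w) + Cc (-2) w)"
  unfolding 2 by (subst SA_nat[of 2]) (auto simp: Em_neg heis_lin_0 E0 e1 numeral_2_eq_2 heis_lin_scale)
 then have "(1 / 2) *s 2 *s Em k 0 0 i 2 w = (1 / 2) *s of_int i *s (of_int i *s Cc (-1) (Cc (-1) w) + Cc (-2) w)" by simp
 then show "Em k 0 0 i 2 w = (1 / 2) *s of_int i *s (of_int i *s Cc (-1) (Cc (-1) w) + Cc (-2) w)" by (simp add: scaleC_scaleC[of _ 2] scaleC_one)
qed

lemma exp_vals:
 "i \<in> {1, -1} \<Longrightarrow> exp_vop k 0 0 i (-1) (pi_exp (- i)) = vc1"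
 "i \<in> {1, -1} \<Longrightarrow> exp_vop k 0 0 i (-2) (pi_exp (- i)) = of_int i *s Cc (-1) vc1"
 "i \<in> {1, -1} \<Longrightarrow> exp_vop k 0 0 i (-3) (pi_exp (- i)) = (1 / 2) *s Cc (-1) (Cc (-1) vc1) + (of_int i / 2) *s Cc (-2) vc1"
 "n \<ge> 0 \<Longrightarrow> exp_vop k 0 0 i n (pi_exp j) = 0"
 by (auto simp: exp_vop_pi_exp Em_small Em_neg scaleC_scaleC scaleC_add_right Em_0)

lemma Ep1_Nn: "Ep1 n (Nn m w) = Nn m (Ep1 n w) - Ep1 (m + n) w"
 using exp_vop_comm[of k 0 0 "nu_vec k" m 1 n w] by (simp add: nu_vec_def scaleC_one algebra_simps)

lemma Nn_ec: "j \<ge> 0 \<Longrightarrow> Nn j (pi_exp 1) = (if j = 0 then 1 else 0) *s pi_exp 1"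
 by (subst heis_pi_exp) (auto simp: form_def nu_vec_def top_wt_0 c_vec_def scaleC_prod_def scaleC_complex_def)

text \<open>Coordinates in terms of nu and c; mu and d are eliminated by mu = nu + (k/2) c and d = 2
  nu + (k/2) c.\<close>

definition lc5 :: "complex \<Rightarrow> complex \<Rightarrow> complex \<Rightarrow> complex \<Rightarrow> complex \<Rightarrow> pi" where
 "lc5 a1 a2 a3 a4 a5 = a1 *s Nn (-1) (Nn (-1) vc1) + a2 *s Nn (-1) (Cc (-1) vc1) + a3 *s Nn (-2) vc1 + a4 *s Cc (-1) (Cc (-1) vc1) + a5 *s Cc (-2) vc1"

lemma lc5_add: "lc5 a1 a2 a3 a4 a5 + lc5 b1 b2 b3 b4 b5 = lc5 (a1 + b1) (a2 + b2) (a3 + b3) (a4 + b4) (a5 + b5)"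
 by (simp add: lc5_def scaleC_add_left add_ac)

lemma lc5_scale: "x *s lc5 a1 a2 a3 a4 a5 = lc5 (x * a1) (x * a2) (x * a3) (x * a4) (x * a5)"
 by (simp add: lc5_def scaleC_add_right scaleC_scaleC)

lemma lc5_cong: "a1 = b1 \<Longrightarrow> a2 = b2 \<Longrightarrow> a3 = b3 \<Longrightarrow> a4 = b4 \<Longrightarrow> a5 = b5 \<Longrightarrow> lc5 a1 a2 a3 a4 a5 = lc5 b1 b2 b3 b4 b5"
 by simp

lemmas H_lin = heis_lin_add heis_lin_scale heis_lin_minus heis_lin_0

abbreviation (input) "gg \<equiv> pi_heis k (nu_vec k) (-1) (pi_heis k (nu_vec k) (-1) (pi_exp (-1))) + (k + 1) *s pi_heis k (nu_vec k) (-2) (pi_exp (-1))"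

lemma Ep1_g: "Ep1 (-1) gg = lc5 1 (-2) (k + 1) (- k / 2) (- k / 2)"
proof -
 note v = exp_vals(1-3)[of 1, simplified]
 have two: "2 *s X = X + X" for X :: pi using scaleC_add_left[of 1 1 X] by (simp add: scaleC_one)
 have "Ep1 (-1) gg = lc5 1 0 0 0 0 - 2 *s Nn (-1) (Ep1 (-2) (pi_exp (-1))) + Ep1 (-3) (pi_exp (-1)) + (k + 1) *s (lc5 0 0 1 0 0 - Ep1 (-3) (pi_exp (-1)))"
  unfolding pi_heis_def clinear_add[OF exp_vop_linear] clinear_scale[OF exp_vop_linear] Ep1_Nn heis_lin_diff
  by (simp add: v(1) two lc5_def scaleC_one)
 also have "Nn (-1) (Ep1 (-2) (pi_exp (-1))) = lc5 0 1 0 0 0" by (simp add: v lc5_def scaleC_one)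
 also have "Ep1 (-3) (pi_exp (-1)) = lc5 0 0 0 (1/2) (1/2)" by (simp add: v lc5_def)
 finally have e: "Ep1 (-1) gg = lc5 1 0 0 0 0 + (-2) *s lc5 0 1 0 0 0 + lc5 0 0 0 (1/2) (1/2) + (k + 1) *s (lc5 0 0 1 0 0 + (-1) *s lc5 0 0 0 (1/2) (1/2))"
  by (simp add: scaleC_one)
 show ?thesis unfolding e lc5_scale lc5_add by (intro lc5_cong) (simp_all add: field_simps)
qed

lemma f_e: "pi_vop k 0 0 gg (-1) (pi_exp 1) = lc5 1 (-2) (k + 3) (- k / 2) (k / 2)"
proof -
 note v = exp_vals(1-3)[of "-1", simplified]
 note vals = B2_vals[where Q = "-1", OF heis_fld exp_vop_fld Nn_ec exp_vals(4)[of _ "-1"], simplified] B3_vals[where Q = "-1", OF heis_fld exp_vop_fld Nn_ec exp_vals(4)[of _ "-1"], simplified]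
 have "pi_vop k 0 0 gg (-1) (pi_exp 1) = pr (heis_op k 0 0 (nu_vec k)) (-1) (pr (heis_op k 0 0 (nu_vec k)) (-1) Em1) (-1) (pi_exp 1)
   + (k + 1) *s pr (heis_op k 0 0 (nu_vec k)) (-2) Em1 (-1) (pi_exp 1)"
  unfolding pi_heis_def vop1_add[OF pi_is_vop] vop1_scale[OF pi_is_vop] YW_heis YW_pi_exp ..
 also have "pr (heis_op k 0 0 (nu_vec k)) (-1) (pr (heis_op k 0 0 (nu_vec k)) (-1) Em1) (-1) (pi_exp 1) = lc5 1 (-2) 2 (1/2) (-1/2)"
  unfolding vals(4) v by (simp add: lc5_def scaleC_one H_lin scaleC_scaleC)
 also have "pr (heis_op k 0 0 (nu_vec k)) (-2) Em1 (-1) (pi_exp 1) = lc5 0 0 1 (-1/2) (1/2)"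
  unfolding vals(8) v by (simp add: lc5_def scaleC_one)
 finally have e: "pi_vop k 0 0 gg (-1) (pi_exp 1) = lc5 1 (-2) 2 (1/2) (-1/2) + (k + 1) *s lc5 0 0 1 (-1/2) (1/2)" .
 show ?thesis unfolding e lc5_scale lc5_add by (intro lc5_cong) (simp_all add: field_simps)
qed

lemma mu_split: "mu_vec k = nu_vec k + (k / 2) *s c_vec" and d_split: "d_vec = 2 *s nu_vec k + (k / 2) *s c_vec"
 by (simp_all add: mu_vec_def nu_vec_def c_vec_def d_vec_def scaleC_prod_def scaleC_complex_def)

lemma c_nu: "Cc (-1) (Nn (-1) w) = Nn (-1) (Cc (-1) w)"
 using heis_comm[of k 0 0 c_vec "-1" "nu_vec k" "-1" w] by simp

lemma h_h: "heis_op k 0 0 (mu_vec k) (-1) (heis_op k 0 0 (mu_vec k) (-1) vc1) = lc5 1 k 0 (k * k / 4) 0"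
proof -
 have e: "heis_op k 0 0 (mu_vec k) (-1) (heis_op k 0 0 (mu_vec k) (-1) vc1) =
  lc5 1 0 0 0 0 + (k / 2) *s lc5 0 1 0 0 0 + (k / 2) *s (lc5 0 1 0 0 0 + (k / 2) *s lc5 0 0 0 1 0)"
  unfolding mu_split heis_add heis_scale by (simp add: H_lin c_nu lc5_def scaleC_one)
 show ?thesis unfolding e lc5_scale lc5_add by (intro lc5_cong) (simp_all add: field_simps)
qed

lemma pi_omega_lc5: "pi_omega k = lc5 0 1 (-1) (k / 4) 0"
 unfolding pi_omega_def pi_heis_def d_split heis_add heis_scale by (simp add: H_lin c_nu lc5_def scaleC_one scaleC_add_right scaleC_scaleC)

text \<open>In the sum of the three products the squares of nu and the terms with c(-2) cancel.
  Every other coefficient carries the factor 2(k + 2), which the normalisation removes.\<close>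

theorem sugawara_eq_omega: "sugawara k Y vac conf = tpi_omega k vac conf"
proof -
 let ?YV = "tpi_vop k Y 0 0"
 note V = va_moduleD(1)[OF V_mod]
 note TV = tpi_is_vop[OF va V_mod, where k = k and r = 0 and lam = 0]
 note T2 = tensor_add_right tensor_scale_right tensor_diff_right
 have vm: "?YV (tensor vac f) n (tensor w g) = tensor w (pi_vop k 0 0 f n g)" for f n w g
  unfolding tpi_vac_left[OF va V_mod] tU_tensor[OF is_vop_fld[OF pi_is_vop]] ..
 have ef: "?YV (sl2_e vac) (-1) (sl2_f k vac conf) = (k + 2) *s tensor conf vc1 - tensor vac (Ep1 (-1) gg)"
  unfolding sl2_e_def sl2_f_def vop_diff[OF TV] vop_scale[OF TV] vm YW_pi_exp using exp_vals(1)[of 1] by simp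
 have "?YV (tensor conf (pi_exp (-1))) (-1) (tensor vac (pi_exp 1)) = Sum_any (\<lambda>i. tensor (Y conf i vac) (Em1 (-1 - 1 - i) (pi_exp 1)))"
  unfolding tpi_vop_def tensor_vop_pure[OF V pi_is_vop] cvl_def YW_pi_exp ..
 also have "\<dots> = tensor (Y conf (-1) vac) (Em1 (-1 - 1 - (-1)) (pi_exp 1))"
 proof (rule SA_single)
  fix i :: int assume "i \<noteq> -1"
  then have "i \<ge> 0 \<or> -1 - 1 - i \<ge> 0" by auto
  then show "tensor (Y conf i vac) (Em1 (-1 - 1 - i) (pi_exp 1)) = 0"
   using exp_vals(4)[of "-1 - 1 - i" "-1" 1] VD(6)[OF va, of i conf] by (auto simp: tensor_0_left tensor_0_right)
 qed
 also have "\<dots> = tensor conf vc1" using exp_vals(1)[of "-1"] VD(5)[OF va, of conf] by simp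
 finally have fe: "?YV (sl2_f k vac conf) (-1) (sl2_e vac) = (k + 2) *s tensor conf vc1 - tensor vac (pi_vop k 0 0 gg (-1) (pi_exp 1))"
  unfolding sl2_e_def sl2_f_def vop1_diff[OF TV] vop1_scale[OF TV] vm by simp
 have hh: "?YV (sl2_h k vac) (-1) (sl2_h k vac) = tensor vac (4 *s heis_op k 0 0 (mu_vec k) (-1) (heis_op k 0 0 (mu_vec k) (-1) vc1))"
  unfolding sl2_h_def vm using YW_h_vec[of k 0 0 "mu_vec k"]
  by (simp add: pi_heis_def h_vec_def vop1_scale[OF pi_is_vop] vop_scale[OF pi_is_vop] scaleC_scaleC)
 have "sugawara k Y vac conf = (1 / (2 * (k + 2))) *s ((k + 2) *s tensor conf vc1 + (k + 2) *s tensor conf vc1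
   + tensor vac ((-1) *s lc5 1 (-2) (k + 1) (- k / 2) (- k / 2) + (-1) *s lc5 1 (-2) (k + 3) (- k / 2) (k / 2) + (1 / 2) *s 4 *s lc5 1 k 0 (k * k / 4) 0))"
  unfolding sugawara_def Let_def ef fe hh Ep1_g f_e h_h T2 by (simp add: scaleC_one)
 also have "(-1) *s lc5 1 (-2) (k + 1) (- k / 2) (- k / 2) + (-1) *s lc5 1 (-2) (k + 3) (- k / 2) (k / 2) + (1 / 2) *s 4 *s lc5 1 k 0 (k * k / 4) 0 = (2 * (k + 2)) *s pi_omega k"
  unfolding pi_omega_lc5 lc5_scale lc5_add by (intro lc5_cong) (simp_all add: field_simps)
 also have "(k + 2) *s tensor conf vc1 + (k + 2) *s tensor conf vc1 = (2 * (k + 2)) *s tensor conf vc1"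
  unfolding scaleC_add_left[symmetric] by simp
 also have "(1 / (2 * (k + 2))) *s ((2 * (k + 2)) *s tensor conf vc1 + tensor vac ((2 * (k + 2)) *s pi_omega k)) = tpi_omega k vac conf"
 proof -
  have "2 * (k + 2) \<noteq> 0" using k2 by (metis mult_eq_0_iff zero_neq_numeral)
  then have "1 / (2 * (k + 2)) * (2 * (k + 2)) = 1" by (simp only: times_divide_eq_left mult_1 divide_self_if if_False)
  then show ?thesis by (simp only: T2 scaleC_add_right scaleC_scaleC tpi_omega_def scaleC_one)
 qed
 finally show ?thesis .
qed

text \<open>The deformed action is compared with its explicit form on the affine subalgebra; this
  makes the comparison available for L(0).\<close>

lemma omega_in_affine: "tpi_omega k vac conf \<in> affine_sl2 k Y vac conf"
 unfolding sugawara_eq_omega[symmetric] sugawara_def Let_def affine_sl2_def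
 by (intro vertex_subalgebra.scale vertex_subalgebra.add vertex_subalgebra.mode vertex_subalgebra.gen) auto

end

section \<open>The deformed module\<close>

context
 fixes X :: "nat \<Rightarrow> 'a::complex_vector \<times> 'b::complex_vector \<Rightarrow> 'a \<times> 'b" and F :: "nat \<Rightarrow> 'a \<Rightarrow> 'b"
 assumes X: "\<And>n v. X n v = (0, F n (fst v))" and F: "\<And>n. F n 0 = 0"
begin

text \<open>Two letters compose to zero, so only the composition with at most one part
  contributes.\<close>

lemma exp_coeff_square_zero: "exp_coeff X N v = (if N = 0 then v else X N v)"
proof -
 have z: "foldr X ns v = 0" if "length ns \<ge> 2" for ns
 proof -
  obtain m n ms where "ns = m # n # ms" using \<open>length ns \<ge> 2\<close> by (cases ns; cases "tl ns") auto
  then show ?thesis by (simp add: X F zero_prod_def)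
 qed
 let ?A = "{ns. 0 \<notin> set ns \<and> sum_list ns = N}" and ?l = "if N = 0 then [] else [N]"
 have l: "ns = ?l" if "ns \<in> ?A" "length ns < 2" for ns using that by (cases ns) auto
 have "exp_coeff X N v = (\<Sum>ns\<in>{?l}. (1 / fact (length ns)) *s foldr X ns v)"
  unfolding exp_coeff_def
 proof (rule sum.mono_neutral_right)
  show "finite ?A" by (rule finite_comps[unfolded comps_def])
  show "\<forall>ns\<in>?A - {?l}. (1 / fact (length ns)) *s foldr X ns v = 0" proof
   fix ns assume ns: "ns \<in> ?A - {?l}"
   have "length ns \<ge> 2"
   proof (rule ccontr)
    assume "\<not> length ns \<ge> 2"
    then have "ns = ?l" by (intro l) (use ns in blast, simp)
    then show False using ns by blast
   qed
   then show "(1 / fact (length ns)) *s foldr X ns v = 0" by (simp add: z)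
  qed
 qed auto
 then show ?thesis by (simp add: scaleC_one)
qed

end

text \<open>An operator of square zero has no eigenvalue but 0, so every admissible decomposition of
  \<open>u\<close> is concentrated at index 0.\<close>

lemma z_power_coeff_square_zero:
 assumes T: "clinear T" and TT: "\<And>x. T (T x) = 0" and u: "T u = 0"
 shows "z_power_coeff T m u = (if m = 0 then u else 0)"
 unfolding z_power_coeff_def
proof (rule the_equality)
 show "\<exists>f :: int \<Rightarrow>\<^sub>0 'a. (\<forall>i. T (lookup f i) = of_int i *s lookup f i) \<and>
   u = (\<Sum>i\<in>keys f. lookup f i) \<and> (if m = 0 then u else 0) = lookup f m"
  by (rule exI[of _ "single 0 u"]) (auto simp: lookup_single when_def u clinear_0[OF T])
next
 fix w
 assume "\<exists>f :: int \<Rightarrow>\<^sub>0 'a. (\<forall>i. T (lookup f i) = of_int i *s lookup f i) \<and>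
   u = (\<Sum>i\<in>keys f. lookup f i) \<and> w = lookup f m"
 then obtain f :: "int \<Rightarrow>\<^sub>0 'a" where f: "\<And>i. T (lookup f i) = of_int i *s lookup f i"
   "u = (\<Sum>i\<in>keys f. lookup f i)" "w = lookup f m" by blast
 have z: "lookup f i = 0" if "i \<noteq> 0" for i
  using TT[of "lookup f i"] that by (simp add: f(1) clinear_scale[OF T] scaleC_scaleC)
 then have "keys f \<subseteq> {0}" by (auto simp: in_keys_iff)
 then have "u = (\<Sum>i\<in>{0}. lookup f i)" unfolding f(2) by (intro sum.mono_neutral_left) (auto simp: in_keys_iff)
 then show "w = (if m = 0 then u else 0)" using z by (simp add: f(3))
qed

text \<open>On the extension a mode of s sends (a, w) to (0, s_n a), so any two of them compose to
  zero and the exponential stops after its linear term. The power z^(s_0) acts trivially, since s_0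
  kills the vectors s_N a and, by assumption, a itself.\<close>

lemma tilde_vop_eq_deform:
 fixes Y21 :: "('a::complex_vector, int, 'b::complex_vector, 'b) vop" and Yrs :: "('a, int, 'c::complex_vector, 'c) vop"
  and Yr1s :: "('a, int, 'd::complex_vector, 'd) vop" and k :: complex and v21 :: 'b
 assumes va: "simple_virasoro_va c0 Y vac conf" and m: "va_module UNIV Y vac Y21"
 defines "L \<equiv> tpi_vop k Y21 1 (- k / 2) (tpi_omega k vac conf) 0" and "YB \<equiv> tpi_vop k Y21 1 (- k / 2)" and "s \<equiv> tensor v21 (pi_exp 0)"
 assumes m2: "va_module UNIV Y vac Yrs" and m3: "va_module UNIV Y vac Yr1s"
  and J: "is_vop J" and JI: "\<And>w n v. tensor_vop I1 I2 w (of_int n) v = J w n v" and s0: "skew L YB s 0 a = 0"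
 shows "M_tilde_vop k Y vac conf Y21 v21 Yrs Yr1s I1 I2 l lam a n v =
  deform L YB (tpi_vop k Yrs l lam) (tpi_vop k Yr1s (l + 1) (- k / 2 + lam)) J s a n v"
proof -
 note M = tpi_is_vop[OF va m, where k = k and r = 1 and lam = "- k / 2", folded YB_def]
 note V = tpi_is_vop[OF va VD(4)[OF va], where k = k and r = 0 and lam = 0]
 note Y2 = tpi_is_vop[OF va m2, where k = k and r = l and lam = lam]
 note Y3 = tpi_is_vop[OF va m3, where k = k and r = "l + 1" and lam = "- k / 2 + lam"]
 have L: "clinear L" unfolding L_def YB_def[symmetric] by (rule is_vop_linear[OF M])
 have sk: "is_vop (skew L YB)"
  unfolding L_def by (rule skew_is_vop[OF L[unfolded L_def] V M]) (unfold YB_def, rule tpi_L_comm[OF va m])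
 let ?E = "ext_vop k Y vac conf Y21" and ?s = "ext_s v21"
 let ?M = "M_vop k Yrs Yr1s I1 I2 l lam"
 have E: "?E ?s n u = (0, skew L YB s n (fst u))" for n u
  by (cases u) (simp add: ext_vop_def ext_s_def Let_def is_vop_0[OF V] is_vop_0[OF M, unfolded YB_def, simplified] skew_def L_def YB_def s_def dpow_def scaleC_scaleC)
 have Mv: "?M (a, 0) n v = (tpi_vop k Yrs l lam a n (fst v), tpi_vop k Yr1s (l + 1) (- k / 2 + lam) a n (snd v))"
  "?M (0, w) n v = (0, J w n (fst v))" for a w n
  by (cases v; simp add: M_vop_def JI is_vop_0[OF J] is_vop_0[OF Y2] is_vop_0[OF Y3, simplified])+
 let ?x = "\<lambda>N. if N = 0 then (a, 0) else (0, log_coeff N *s skew L YB s (int N) a)"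
 have D: "Delta_coeff ?E ?s N m (a, 0) = (if m = 0 then ?x N else 0)" for N m
 proof -
  have X: "((-1) ^ n / (- of_nat n)) *s ?E ?s (int n) u = (0, log_coeff n *s skew L YB s (int n) (fst u))" for n u
   unfolding E log_coeff_def by (simp add: scaleC_prod_def)
  have "exp_coeff (\<lambda>n u. ((-1) ^ n / (- of_nat n)) *s ?E ?s (int n) u) N (a, 0) = ?x N"
   by (subst exp_coeff_square_zero[where F = "\<lambda>n u. log_coeff n *s skew L YB s (int n) u", OF X]) (simp_all only: X fst_conv vop_0[OF sk] scaleC_0)
  moreover have "z_power_coeff (?E ?s 0) m (?x N) = (if m = 0 then ?x N else 0)"
  proof (rule z_power_coeff_square_zero)
   show "clinear (?E ?s 0)" unfolding E[abs_def] by (intro clinear_Pair clinear_zero clinear_compose[OF is_vop_linear[OF sk] clinear_fst])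
  qed (simp_all add: E s0 vop_0[OF sk] zero_prod_def)
  ultimately show ?thesis unfolding Delta_coeff_def by simp
 qed
 let ?T = "\<lambda>N. ?M (?x N) (n - int N) v"
 have M0: "?M 0 n v = 0" for n using Mv(2)[of 0 n] by (simp add: zero_prod_def is_vop_0[OF J])
 obtain K :: nat where K: "\<forall>N\<ge>K. skew L YB s (int N) a = 0" using is_fld_bound[OF is_vop_fld[OF sk], where q = 0 and x = a] by auto
 have T0: "?T N = 0" if "N \<ge> Suc K" for N using that K M0[of "n - int N"] by (auto simp: zero_prod_def)
 have "M_tilde_vop k Y vac conf Y21 v21 Yrs Yr1s I1 I2 l lam a n v = Sum_any (\<lambda>(N, m::int). if m = 0 then ?T N else 0)"
  unfolding M_tilde_vop_def tilde_vop_def D by (rule arg_cong[where f = Sum_any]) (auto simp: M0 fun_eq_iff)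
 also have "\<dots> = (\<Sum>(N, m)\<in>{..<Suc K} \<times> {0 :: int}. if m = 0 then ?T N else 0)"
 proof (rule SA_finite)
  fix i :: "nat \<times> int" assume i: "i \<notin> {..<Suc K} \<times> {0}"
  show "(case i of (N, m) \<Rightarrow> if m = 0 then ?T N else 0) = 0"
   by (cases "snd i = 0") (use i T0[of "fst i"] in \<open>simp_all add: mem_Times_iff case_prod_unfold\<close>)
 qed simp
 also have "\<dots> = (\<Sum>N<Suc K. ?T N)" by (simp add: sum.cartesian_product[symmetric])
 also have "\<dots> = ?T 0 + (\<Sum>N<K. ?T (Suc N))" by (rule sum.lessThan_Suc_shift)
 also have "\<dots> = deform L YB (tpi_vop k Yrs l lam) (tpi_vop k Yr1s (l + 1) (- k / 2 + lam)) J s a n v"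
 proof -
  have "skew_log L YB J s a n (fst v) = (\<Sum>N<Suc K. log_coeff N *s J (skew L YB s (int N) a) (n - int N) (fst v))"
   unfolding skew_log_def by (rule SA_nat) (use K in \<open>simp add: is_vop_0[OF J]\<close>)
  then have "skew_log L YB J s a n (fst v) = (\<Sum>N<K. log_coeff (Suc N) *s J (skew L YB s (int (Suc N)) a) (n - int (Suc N)) (fst v))"
   unfolding sum.lessThan_Suc_shift by (simp add: log_coeff_0)
  then show ?thesis
   by (simp add: deform_def Mv vop1_scale[OF J] prod_eq_iff clinear_sum[OF clinear_fst] clinear_sum[OF clinear_snd])
 qed
 finally show ?thesis .
qed

section \<open>Semisimplicity of the weight modules\<close>

lemma span_linear_image:
 assumes f: "clinear f" and E: "\<And>v. v \<in> E \<Longrightarrow> f v \<in> cvec.span E'" and x: "x \<in> cvec.span E"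
 shows "f x \<in> cvec.span E'"
 using x
proof (induction rule: cvec.span_induct_alt)
 case (step c x y)
 then show ?case using E by (simp add: clinear_add[OF f] clinear_scale[OF f] cvec.span_add cvec.span_scale)
qed (simp add: clinear_0[OF f] cvec.span_zero)

text \<open>The monomials on the lattice side are eigenvectors of all operators in question, so a
  spanning set of eigenvectors is needed for the first factor only.\<close>

lemma semisimple_tensor:
 assumes E: "cvec.span E = UNIV" and T: "\<And>w b. w \<in> E \<Longrightarrow> \<exists>c. T (tensor w (single b 1)) = c *s tensor w (single b 1)"
 shows "semisimple T"
proof -
 have "x \<in> cvec.span {v. \<exists>c. T v = c *s v}" for x
 proof (induction x rule: pm_induct)
  case (single b w)
  have "tensor w (single b 1) \<in> cvec.span {v. \<exists>c. T v = c *s v}"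
   by (rule span_linear_image[OF tensor_linear1, of E], rule cvec.span_base) (use T in blast, simp add: E)
  then show ?case unfolding tensor_single .
 qed (rule cvec.span_add)
 then show ?thesis unfolding semisimple_def by blast
qed

lemma semisimple_pair:
 assumes A: "semisimple A" "clinear A" and B: "semisimple B" "clinear B"
 shows "semisimple (\<lambda>v. (A (fst v), B (snd v)))"
proof -
 let ?E = "{v. \<exists>c. (A (fst v), B (snd v)) = c *s v}"
 have "v \<in> cvec.span ?E" for v
 proof -
  have "(fst v, 0) \<in> cvec.span ?E"
   by (rule span_linear_image[of "\<lambda>x. (x, 0)" "{v. \<exists>c. A v = c *s v}"])
    (use A(1) in \<open>auto simp: semisimple_def scaleC_prod_def clinear_0[OF B(2)] intro!: cvec.span_base clinear_Pair clinear_id clinear_zero\<close>)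
  moreover have "(0, snd v) \<in> cvec.span ?E"
   by (rule span_linear_image[of "\<lambda>x. (0, x)" "{v. \<exists>c. B v = c *s v}"])
    (use B(1) in \<open>auto simp: semisimple_def scaleC_prod_def clinear_0[OF A(2)] intro!: cvec.span_base clinear_Pair clinear_id clinear_zero\<close>)
  ultimately have "(fst v, 0) + (0, snd v) \<in> cvec.span ?E" by (rule cvec.span_add)
  then show ?thesis by simp
 qed
 then show ?thesis unfolding semisimple_def by blast
qed

lemma pi_L0_basis: "\<exists>c. pi_vop k r lam (pi_omega k) 1 (single b 1) = c *s single b 1"
proof -
 have step: "\<exists>c. pi_vop k r lam (pi_omega k) 1 (heis_op k r lam a n x) = c *s heis_op k r lam a n x"
  if "\<exists>c. pi_vop k r lam (pi_omega k) 1 x = c *s x" for a n x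
  using that by (auto simp: pi_L0_heis heis_lin_scale scaleC_diff_left[symmetric])
 have B: "\<exists>c. pi_vop k r lam (pi_omega k) 1 (single ({#}, B, j) 1) = c *s single ({#}, B, j) 1" for B j
 proof (induction B)
  case empty then show ?case using pi_L0_exp by (simp add: pi_exp_def)
 next
  case (add m B) then show ?case using step[of "single ({#}, B, j) 1" d_vec "- int m - 1"] by (simp add: heis_d_neg)
 qed
 have "\<exists>c. pi_vop k r lam (pi_omega k) 1 (single (A, B, j) 1) = c *s single (A, B, j) 1" for A B j
 proof (induction A)
  case (add m A) then show ?case using step[of "single (A, B, j) 1" c_vec "- int m - 1"] by (simp add: heis_c_neg)
 qed (rule B)
 then show ?thesis by (cases b) blast
qed

lemma vacuum_affine: "tpi_vac vac \<in> affine_sl2 k Y vac conf"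
 unfolding affine_sl2_def by (rule vertex_subalgebra.vac)

lemma affine_module_weight:
 fixes YW :: "('a::complex_vector, int, 'w::complex_vector, 'w) vop"
 assumes va: "simple_virasoro_va c Y vac conf" and m: "irreducible_virasoro_module Y vac conf c h YW v" and k: "k + 2 \<noteq> 0"
 shows "weight_module k Y vac conf (tpi_vop k YW r lam)" and "semisimple (tpi_vop k YW r lam (tpi_omega k vac conf) 1)"
proof -
 have m': "va_module UNIV Y vac YW" and irr: "irreducible_highest_weight c h (\<lambda>n. YW conf (n + 1)) v"
  using m by (simp_all add: irreducible_virasoro_module_def)
 note M = tpi_is_vop[OF va m']
 show L0: "semisimple (tpi_vop k YW r lam (tpi_omega k vac conf) 1)"
 proof (rule semisimple_tensor)
  show "cvec.span {v. \<exists>c. YW conf 1 v = c *s v} = UNIV" using vir_L0_semisimple[OF irr] by (simp add: semisimple_def)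
  fix w :: 'w and b :: pi_basis assume "w \<in> {v. \<exists>c. YW conf 1 v = c *s v}"
  then obtain c d where "YW conf 1 w = c *s w" "pi_vop k r lam (pi_omega k) 1 (single b 1) = d *s single b 1"
   using pi_L0_basis by blast
  then have "tpi_vop k YW r lam (tpi_omega k vac conf) 1 (tensor w (single b 1)) = (c + d) *s tensor w (single b 1)"
   by (simp add: tpi_omega_tensor[OF va m'] tensor_scale_left tensor_scale_right scaleC_add_left)
  then show "\<exists>c. tpi_vop k YW r lam (tpi_omega k vac conf) 1 (tensor w (single b 1)) = c *s tensor w (single b 1)" by blast
 qed
 have h: "semisimple (tpi_vop k YW r lam (sl2_h k vac) 0)"
 proof (rule semisimple_tensor)
  fix w :: 'w and b :: pi_basis
  obtain A B j where b: "b = (A, B, j)" by (cases b)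
  have "tpi_vop k YW r lam (sl2_h k vac) 0 (tensor w (single b 1)) = tensor w (2 *s heis_op k r lam (mu_vec k) 0 (single b 1))"
   unfolding sl2_h_def tpi_vac_left[OF va m'] tU_tensor[OF is_vop_fld[OF pi_is_vop]] pi_heis_def vop1_scale[OF pi_is_vop]
   using YW_h_vec[of k r lam "mu_vec k"] by (simp add: h_vec_def)
  also have "\<dots> = (2 * form (mu_vec k) (top_wt k r lam j)) *s tensor w (single b 1)"
   unfolding b heis_zero' by (simp add: tensor_scale_right scaleC_scaleC)
  finally show "\<exists>c. tpi_vop k YW r lam (sl2_h k vac) 0 (tensor w (single b 1)) = c *s tensor w (single b 1)" by blast
 qed (rule cvec.span_UNIV)
 have "affine_module k Y vac conf (tpi_vop k YW r lam)"
  unfolding affine_module_def va_module_def jacobi_iff_jac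
  using is_vop_subset[OF M] tpi_vac_id[OF va m'] tpi_jac[OF va m'] by (auto simp: id_fld_def)
 then show "weight_module k Y vac conf (tpi_vop k YW r lam)"
  unfolding weight_module_def sugawara_L0_def sugawara_eq_omega[OF va k] using L0 h by blast
qed

theorem corollary9p7:
  fixes p p' r s :: nat and l :: int and k lam :: complex
    and Y :: "('a::complex_vector, int, 'a, 'a) vop" and vac om :: 'a
    and Y21 :: "('a, int, 'b::complex_vector, 'b) vop" and v21 :: 'b
    and Yrs :: "('a, int, 'c::complex_vector, 'c) vop" and vrs :: 'c
    and Yr1s :: "('a, int, 'd::complex_vector, 'd) vop" and vr1s :: 'd
    and I1 :: "('b, complex, 'c, 'd) vop"
    and I2 :: "(pi, complex, pi, pi) vop"
  assumes "p \<ge> 2" and "p' \<ge> 2" and "coprime p p'"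
    and "k + 2 = of_nat p' / of_nat p"
    and "1 \<le> s" and "s \<le> p' - 1" and "2 \<le> r" and "r \<le> p - 1"
    and "lam = - (1 / 2) * (of_nat s + 1 - (k + 2) * (of_nat r + 1))"
    and "simple_virasoro_va (virasoro_c p p') Y vac om"
    and "irreducible_virasoro_module Y vac om (virasoro_c p p') (virasoro_h p p' 2 1) Y21 v21"
    and "irreducible_virasoro_module Y vac om (virasoro_c p p') (virasoro_h p p' r s) Yrs vrs"
    and "irreducible_virasoro_module Y vac om (virasoro_c p p') (virasoro_h p p' (r - 1) s) Yr1s vr1s"
    and "intertwining_operator om Y21 Yrs Yr1s I1" and "nontrivial_vop I1"
    and "intertwining_operator (pi_omega k)
           (pi_vop k 1 (- k / 2)) (pi_vop k l lam) (pi_vop k (l + 1) (- k / 2 + lam)) I2"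
    and "nontrivial_vop I2"
  defines "YM \<equiv> M_tilde_vop k Y vac om Y21 v21 Yrs Yr1s I1 I2 l lam"
    and "Ysub \<equiv> tpi_vop k Yr1s (l + 1) (- k / 2 + lam)"
    and "Yquot \<equiv> tpi_vop k Yrs l lam"
  shows "(affine_module k Y vac om YM
          \<and> logarithmic (sugawara_L0 k Y vac om YM)
          \<and> has_nilpotent_rank (sugawara_L0 k Y vac om YM) 2)
       \<and> (weight_module k Y vac om Ysub
          \<and> weight_module k Y vac om Yquot
          \<and> short_exact (affine_sl2 k Y vac om) Ysub YM Yquot (\<lambda>y. (0, y)) fst
          \<and> \<not> splits (affine_sl2 k Y vac om) YM Yquot fst)"
proof -
 note va = assms(10) and M21 = assms(11) and Mrs = assms(12) and Mr1s = assms(13) and I1 = assms(14) and I2 = assms(16)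
 define t where "t = k + 2"
 have pp: "(of_nat p :: complex) \<noteq> 0" "(of_nat p' :: complex) \<noteq> 0" using assms(1,2) by auto
 have t: "t = of_nat p' / of_nat p" using assms(4) by (simp add: t_def)
 have t0: "t \<noteq> 0" "k + 2 \<noteq> 0" using pp by (simp_all add: t t_def[symmetric])
 have c: "virasoro_c p p' = 13 - 6 * t - 6 / t"
  unfolding virasoro_c_def t using pp by (simp add: field_simps power2_eq_square)
 have h21: "virasoro_h p p' 2 1 = 3 * t / 4 - 1 / 2"
  unfolding virasoro_h_def t using pp by (simp add: field_simps power2_eq_square)
 \<comment> \<open>The hypothesis on \<open>lam\<close> enters here, as a difference of conformal
   weights.\<close>
 have \<delta>: "virasoro_h p p' 2 1 + virasoro_h p p' r s - virasoro_h p p' (r - 1) s - 1 = lam - 1"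
 proof -
  have r1: "(of_nat (r - 1) :: complex) = of_nat r - 1" using assms(7) by (simp add: of_nat_diff)
  have "virasoro_h p p' r s - virasoro_h p p' (r - 1) s = - (of_nat s - of_nat r * t) / 2 - t / 4"
   unfolding virasoro_h_def r1 t using pp by (simp add: field_simps power2_eq_square)
  then show ?thesis unfolding h21 assms(9) t_def[symmetric] by (simp add: field_simps)
 qed
 have m: "va_module UNIV Y vac Y21" "va_module UNIV Y vac Yrs" "va_module UNIV Y vac Yr1s"
  and irr: "irreducible_highest_weight (virasoro_c p p') (virasoro_h p p' 2 1) (\<lambda>n. Y21 om (n + 1)) v21"
   "irreducible_highest_weight (virasoro_c p p') (virasoro_h p p' r s) (\<lambda>n. Yrs om (n + 1)) vrs"
   "irreducible_highest_weight (virasoro_c p p') (virasoro_h p p' (r - 1) s) (\<lambda>n. Yr1s om (n + 1)) vr1s"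
  using M21 Mrs Mr1s by (simp_all add: irreducible_virasoro_module_def)
 note lead1 = virasoro_intertwining_leading_term[OF I1 irr va_moduleD(1)[OF m(3)], unfolded \<delta>]
 note lead2 = pi_intertwining_leading_term[OF I2]

 define b where "b = - k / 2"
 let ?A = "affine_sl2 k Y vac om" and ?o = "tpi_omega k vac om" and ?s = "tensor v21 (pi_exp 0)"
 let ?YV = "tpi_vop k Y 0 0" and ?YB = "tpi_vop k Y21 1 b"
 let ?L = "?YB ?o 0"
 define J where "J = tensor_vop (shift_vop lam I1) (shift_vop (- lam) I2)"
 note V = tpi_is_vop[OF va VD(4)[OF va], where k = k and r = 0 and lam = 0]
 note B = tpi_is_vop[OF va m(1), where k = k and r = 1 and lam = b]
 note Y2 = tpi_is_vop[OF va m(2), where k = k and r = l and lam = lam, folded Yquot_def]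
 note Y3 = tpi_is_vop[OF va m(3), where k = k and r = "l + 1" and lam = "- k / 2 + lam", folded Ysub_def]
 note L = is_vop_linear[OF B, where a = ?o and n = 0]
 have LB: "?L (?YB a n w) = ?YB a n (?L w) - of_int n *s ?YB a (n - 1) w" for a n w by (rule tpi_L_comm[OF va m(1)])
 have J: "is_vop J" unfolding J_def by (rule tpi_intertwining_is_vop[OF va m I1 I2])
 have Jjac: "jac ?YB Yquot Ysub J a w" for a w
  unfolding J_def Yquot_def Ysub_def b_def by (rule tpi_intertwining_jac[OF va m I1 I2])
 have Jder: "J (?L w) n x = - of_int n *s J w (n - 1) x" for w n x
  unfolding J_def b_def by (rule tpi_intertwining_der[OF va m I1 I2])
 \<comment> \<open>\<open>lam - 1\<close> and \<open>lam\<close> lie in the same coset, so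
   \<open>lam\<close> can serve as the offset of \<open>I1\<close>; the opposite offset is then the
   coset of \<open>I2\<close>.\<close>
 have JI: "tensor_vop I1 I2 w (of_int n) v = J w n v" for w n v
  unfolding J_def
 proof (rule tensor_vop_shift)
  fix w q x assume q: "\<And>n. q \<noteq> lam + of_int n"
  have "q \<noteq> lam - 1 + of_int n" for n using q[of "n - 1"] by (simp add: algebra_simps)
  then show "I1 w q x = 0" by (rule lead1(1))
 qed
 have s0: "skew ?L ?YB ?s 0 a = 0" if "a \<in> ?A" for a
  by (rule screening_affine[OF va M21 t0(1) t_def b_def h21 refl c that])
 define D where "D = deform ?L ?YB Yquot Ysub J ?s"
 \<comment> \<open>\<open>D\<close> is given on all vectors of the tensor product and is linear
   there; on those killed by s_0, in particular on the affine algebra, it is the twisted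
   action.\<close>
 have YM: "YM a = D a" if "a \<in> ?A" for a
  using tilde_vop_eq_deform[OF va m J JI s0[OF that, unfolded b_def]] unfolding YM_def D_def Yquot_def Ysub_def b_def by blast
 have D: "is_vop D" unfolding D_def by (rule deform_vop[OF L V B Y2 Y3 J], rule LB, rule Jder, rule tpi_jac[OF va m(1)], rule Jjac)
 have Djac: "jac ?YV D D D a d" if "a \<in> ?A" for a d
  unfolding D_def
  by (rule deform_jac[OF L V B Y2 Y3 J], rule LB, rule Jder, rule tpi_jac[OF va m(1)], rule Jjac, rule s0[OF that],
    unfold Yquot_def Ysub_def, rule tpi_jac[OF va m(2)], rule tpi_jac[OF va m(3)])
 have Dvac: "D (tpi_vac vac) n v = (if n = -1 then v else 0)" for n v
 proof -
  have "skew ?L ?YB ?s (int N) (tpi_vac vac) = 0" for N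
   unfolding skew_def by (rule SA_zero) (simp add: tpi_vac_id[OF va m(1)] id_fld_def clinear_0[OF dpow_linear[OF L]])
  then have "skew_log ?L ?YB J ?s (tpi_vac vac) n (fst v) = 0"
   unfolding skew_log_def by (intro SA_zero) (simp add: is_vop_0[OF J])
  then show ?thesis unfolding D_def deform_def Yquot_def Ysub_def by (simp add: tpi_vac_id[OF va m(2)] tpi_vac_id[OF va m(3)] id_fld_def zero_prod_def)
 qed
 have mode: "?YV a n d \<in> ?A" if "a \<in> ?A" "d \<in> ?A" for a n d using that unfolding affine_sl2_def by (rule vertex_subalgebra.mode)
 have affine: "affine_module k Y vac om YM"
  unfolding affine_module_def va_module_def jacobi_iff_jac
 proof (intro conjI ballI allI)
  show "vertex_operator ?A YM"
  proof -
   have "a + d \<in> ?A" if "a \<in> ?A" "d \<in> ?A" for a d using that unfolding affine_sl2_def by (rule vertex_subalgebra.add)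
   moreover have "x *s a \<in> ?A" if "a \<in> ?A" for a x using that unfolding affine_sl2_def by (rule vertex_subalgebra.scale)
   ultimately show ?thesis using is_vop_subset[OF D, of ?A] unfolding vertex_operator_def by (simp add: YM)
  qed
  show "YM (tpi_vac vac) n x = (if n = - 1 then x else 0)" for n x unfolding YM[OF vacuum_affine] by (rule Dvac)
  show "jac ?YV YM YM YM a d" if "a \<in> ?A" "d \<in> ?A" for a d
   using Djac[OF that(1), of d] unfolding jac_def YM[OF that(1)] YM[OF that(2)] YM[OF mode[OF that]] .
 qed

 note oA = omega_in_affine[OF va t0(2)]
 define S where "S = J ?s 0"
 have S: "clinear S" unfolding S_def by (rule is_vop_linear[OF J])
 \<comment> \<open>s is primary of conformal weight 1: \<open>v21\<close> has weight 3(k + 2)/4 -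
   1/2 and e^nu has weight -3k/4. A residue of a primary field of weight 1 commutes with L(0), which
   is \<open>SL\<close> below.\<close>
 have om_s: "?YB ?o n ?s = (if n = 1 then ?s else 0)" if "n \<ge> 1" for n
 proof -
  have hz: "heis_op k 1 b a j (pi_exp 0) = (if j = 0 then form a (nu_vec k) else 0) *s pi_exp 0" if "j \<ge> 0" for a j
   using heis_pi_exp[OF that, of k 1 b a 0] nu_top[OF va M21 t0(1) t_def b_def h21 refl c] by simp
  have "Sum_any (\<lambda>i::nat. heis_op k 1 b c_vec (- 1 - int i) (heis_op k 1 b d_vec (n + int i) (pi_exp 0)) + heis_op k 1 b d_vec (n - 1 - int i) (heis_op k 1 b c_vec (int i) (pi_exp 0)))
    = heis_op k 1 b d_vec (n - 1) (pi_exp 0)"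
   using that by (subst SA_single[of 0]) (auto simp: hz heis_lin_0 heis_lin_scale nu_vec_def scaleC_one)
  note sum = this
  \<comment> \<open>Half of <d,nu> gives -k/4, and the linear term of the conformal vector adds
    <nu,nu> = -k/2.\<close>
  have "pi_vop k 1 b (pi_omega k) n (pi_exp 0) = (if n = 1 then - 3 * k / 4 else 0) *s pi_exp 0"
  proof (cases "n = 1")
   case True
   have "pi_vop k 1 b (pi_omega k) n (pi_exp 0) = (1 / 2 * form d_vec (nu_vec k) + form (nu_vec k) (nu_vec k)) *s pi_exp 0"
    unfolding yW_omega sum using True by (simp add: hz scaleC_scaleC scaleC_add_left scaleC_one)
   then show ?thesis using True by (simp add: form_def nu_vec_def d_vec_def field_simps)
  next
   case False
   then show ?thesis unfolding yW_omega sum using that by (simp add: hz)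
  qed
  moreover have "Y21 om n v21 = (if n = 1 then 3 * t / 4 - 1 / 2 else 0) *s v21"
   using om_v21(1)[OF va M21 t0(1) t_def b_def h21 refl c, of n] om_v21(2)[OF va M21 t0(1) t_def b_def h21 refl c] that h21 by (cases "n = 1") auto
  ultimately show ?thesis unfolding tpi_omega_tensor[OF va m(1)]
   by (simp add: tensor_scale_left tensor_scale_right tensor_0_left scaleC_add_left[symmetric] t_def)
    (simp add: field_simps scaleC_one)
 qed
 \<comment> \<open>The vectors s_N omega vanish for \<open>N \<ge> 2\<close>, and s_1 omega = s with
   \<open>log_coeff 1 = 1\<close>. Hence the correction of L(0) is exactly the zero mode of
   s.\<close>
 have Ko: "skew_log ?L ?YB J ?s ?o 1 x = S x" for x
 proof -
  have n2: "skew ?L ?YB ?s (int N) ?o = 0" if "N \<ge> 2" for N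
   unfolding skew_def by (rule SA_zero) (use that in \<open>simp add: om_s clinear_0[OF dpow_linear[OF L]]\<close>)
  have n1: "skew ?L ?YB ?s 1 ?o = ?s"
   unfolding skew_def by (subst SA_single[of 0]) (simp_all add: om_s clinear_0[OF dpow_linear[OF L]] dpow_0 scaleC_one)
  show ?thesis
   unfolding skew_log_def
  proof (subst SA_single[of 1])
   show "log_coeff N *s J (skew ?L ?YB ?s (int N) ?o) (1 - int N) x = 0" if "N \<noteq> 1" for N
    using n2[of N] that by (cases "N = 0") (auto simp: log_coeff_0 is_vop_0[OF J])
  qed (simp add: n1 S_def log_coeff_def scaleC_one)
 qed
 let ?T = "sugawara_L0 k Y vac om YM"
 let ?D = "\<lambda>v. (Yquot ?o 1 (fst v), Ysub ?o 1 (snd v))" and ?N = "\<lambda>v. (0, S (fst v))"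
 have T: "?T v = ?D v + ?N v" for v
  unfolding sugawara_L0_def sugawara_eq_omega[OF va t0(2)] YM[OF oA] D_def deform_def Ko by simp
 \<comment> \<open>The commutator formula yields L(-1) s in mode 1 plus s in mode 0, and by the
   derivative property these cancel.\<close>
 have SL: "Ysub ?o 1 (S x) = S (Yquot ?o 1 x)" for x
 proof -
  have "Sum_any (\<lambda>i::nat. bin 1 i *s J (?YB ?o (int i) ?s) (1 + 0 - int i) x) = (\<Sum>i<2. bin 1 i *s J (?YB ?o (int i) ?s) (1 + 0 - int i) x)"
   by (rule SA_nat) (simp add: om_s is_vop_0[OF J])
  also have "\<dots> = 0" by (simp add: numeral_2_eq_2 om_s Jder scaleC_one)
  finally show ?thesis using jac_comm[OF Jjac[of ?o ?s], where m = 1 and n = 0 and x = x] unfolding S_def by simp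
 qed
 have wm: "weight_module k Y vac om Ysub" "semisimple (Ysub ?o 1)" "weight_module k Y vac om Yquot" "semisimple (Yquot ?o 1)"
  unfolding Ysub_def Yquot_def using affine_module_weight[OF va Mr1s t0(2)] affine_module_weight[OF va Mrs t0(2)] by blast+
 have lD: "clinear ?D" by (intro clinear_Pair clinear_compose[OF is_vop_linear[OF Y2] clinear_fst] clinear_compose[OF is_vop_linear[OF Y3] clinear_snd])
 have ssD: "semisimple ?D" by (rule semisimple_pair[OF wm(4) is_vop_linear[OF Y2] wm(2) is_vop_linear[OF Y3]])
 have lN: "clinear ?N" by (intro clinear_Pair clinear_zero clinear_compose[OF S clinear_fst])
 have NN: "?N (?N v) = 0" for v by (simp add: clinear_0[OF S] zero_prod_def)
 have DN: "?D (?N v) = ?N (?D v)" for v by (simp add: SL vop_0[OF Y2])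
 obtain x0 where x0: "S x0 \<noteq> 0"
 proof -
  obtain a1 a2 where a1: "a1 \<noteq> 0" "I1 v21 (lam - 1) vrs = a1 *s vr1s" and a2: "a2 \<noteq> 0" "I2 (pi_exp 0) (- lam) (pi_exp (-1)) = a2 *s pi_exp (-1)"
   using lead1(2)[OF assms(15)] lead2(2)[OF assms(17)] by blast
  let ?F = "\<lambda>j. tensor (I1 v21 (lam + of_int j) vrs) (I2 (pi_exp 0) (- lam + of_int (0 - 1 - j)) (pi_exp (-1)))"
  have "S (tensor vrs (pi_exp (-1))) = Sum_any ?F"
   unfolding S_def J_def tensor_vop_pure[OF shift_vop_is_vop[OF I1] shift_vop_is_vop[OF I2]] cvl_def shift_vop_def ..
  also have "\<dots> = ?F (-1)"
  \<comment> \<open>For every other \<open>j\<close> one of the two mode indices lies beyond the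
    leading index of its factor.\<close>
  proof (rule SA_single)
   fix j :: int assume "j \<noteq> -1"
   then consider "j + 1 > 0" | "- 1 - j > 0" by linarith
   then show "?F j = 0"
   proof cases
    case 1
    have "I1 v21 (lam - 1 + of_int (j + 1)) vrs = 0" by (rule lead1(3)[OF 1])
    then show ?thesis by (simp add: tensor_0_left)
   next
    case 2
    then show ?thesis using lead2(3)[OF 2] by (simp add: tensor_0_right)
   qed
  qed
  also have "\<dots> = tensor (a1 *s vr1s) (a2 *s pi_exp (-1))" using a1(2) a2(2) by simp
  finally have e: "S (tensor vrs (pi_exp (-1))) = tensor (a1 *s vr1s) (a2 *s pi_exp (-1))" .
  have "lookup (S (tensor vrs (pi_exp (-1)))) ({#}, {#}, -1) = (a2 * a1) *s vr1s"
   unfolding e lookup_tensor by (simp add: lookup_scaleC pi_exp_def scaleC_complex_def scaleC_scaleC)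
  then have "S (tensor vrs (pi_exp (-1))) \<noteq> 0" using a1(1) a2(1) hw_nonzero[OF irr(3)] by auto
  then show ?thesis by (rule that)
 qed
 have N0: "?N (x0, 0) \<noteq> 0" using x0 by (simp add: zero_prod_def)
 have log: "logarithmic ?T" by (rule logarithmic_jordan[OF lD ssD lN NN DN T])
 have rank: "has_nilpotent_rank ?T 2" by (rule has_nilpotent_rank_jordan[OF lD ssD lN NN DN T N0])

 have K0: "skew_log ?L ?YB J ?s a n 0 = 0" for a n unfolding skew_log_def by (rule SA_zero) (simp add: vop_0[OF J])
 have exact: "short_exact ?A Ysub YM Yquot (\<lambda>y. (0, y)) fst"
  unfolding short_exact_def va_hom_def
 proof (intro conjI ballI allI)
  show "(0, Ysub a n y) = YM a n (0, y)" if "a \<in> ?A" for a n y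
   unfolding YM[OF that] D_def deform_def by (simp add: K0 vop_0[OF Y2])
  show "fst (YM a n v) = Yquot a n (fst v)" if "a \<in> ?A" for a n v unfolding YM[OF that] D_def deform_def by simp
  show "clinear (\<lambda>y. (0, y))" by (intro clinear_Pair clinear_zero clinear_id)
  show "range (\<lambda>y. (0, y)) = {y. fst y = 0}" by (auto simp: image_iff prod_eq_iff)
 qed (auto simp: clinear_fst inj_on_def surj_def)
 have nonsplit: "\<not> splits ?A YM Yquot fst"
 proof
  assume "splits ?A YM Yquot fst"
  then obtain g where g: "clinear g" "\<And>a n z. a \<in> ?A \<Longrightarrow> g (Yquot a n z) = YM a n (g z)" "\<And>z. fst (g z) = z"
   unfolding splits_def va_hom_def by blast
  let ?E = "{v. \<exists>c. ?T v = c *s v}"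
  have To: "?T v = YM ?o 1 v" for v by (simp add: sugawara_L0_def sugawara_eq_omega[OF va t0(2)])
  \<comment> \<open>Given a section, every vector is the sum of one from its image and one from the
    submodule, and L(0) is semisimple on both.\<close>
  have "v \<in> cvec.span ?E" for v
  proof -
   have "g (fst v) \<in> cvec.span ?E"
    by (rule span_linear_image[OF g(1), of "{z. \<exists>c. Yquot ?o 1 z = c *s z}"])
     (use wm(4) in \<open>auto simp: semisimple_def To g(2)[OF oA, symmetric] clinear_scale[OF g(1)] intro!: cvec.span_base\<close>)
   moreover have "(0, snd v - snd (g (fst v))) \<in> cvec.span ?E"
    by (rule span_linear_image[of "\<lambda>x. (0, x)" "{z. \<exists>c. Ysub ?o 1 z = c *s z}"])
     (use wm(2) in \<open>auto simp: semisimple_def T scaleC_prod_def clinear_0[OF S] vop_0[OF Y2] intro!: cvec.span_base clinear_Pair clinear_id clinear_zero\<close>)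
   ultimately have "g (fst v) + (0, snd v - snd (g (fst v))) \<in> cvec.span ?E" by (rule cvec.span_add)
   moreover have "g (fst v) + (0, snd v - snd (g (fst v))) = v" by (simp add: prod_eq_iff g(3))
   ultimately show ?thesis by simp
  qed
  then have ss: "semisimple ?T" unfolding semisimple_def by blast
  have lT: "clinear ?T" unfolding T[abs_def] by (intro clinear_plus lD lN)
  \<comment> \<open>The semisimple part is computed twice, from \<open>?T\<close> with zero
    nilpotent part and from \<open>?D\<close> with nilpotent part \<open>?N\<close>; uniqueness
    forces \<open>S x0 = 0\<close>.\<close>
  have "semisimple_part ?T (x0, 0) = ?T (x0, 0)"
   by (rule semisimple_part_jordan[OF lT ss clinear_zero]) (simp_all add: clinear_0[OF lT])
  moreover have "semisimple_part ?T (x0, 0) = ?D (x0, 0)" by (rule semisimple_part_jordan[OF lD ssD lN NN DN T])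
  ultimately have "?T (x0, 0) = ?D (x0, 0)" by (rule trans[OF sym])
  then have "S x0 = 0" unfolding T by simp
  then show False using x0 by blast
 qed
 show ?thesis using affine log rank wm(1,3) exact nonsplit by blast
qed

end
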